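(* Let $\ell>0$ and $B(x)=\operatorname{diag}(\beta_1(x),\dots,\beta_n(x))$ with real-valued $\beta_k$ satisfying: $\beta_k,1/\beta_k\in L^\infty[0,\ell]$, each of constant nonzero sign; for some $n_-\in\{0,\dots,n\}$, $\beta_1\le\dots\le\beta_{n_-}<0<\beta_{n_-+1}\le\dots\le\beta_n$ on $[0,\ell]$; there is $\theta>0$ such that for each $k\le n-1$ either $\beta_k\equiv\beta_{k+1}$ or $\beta_k(x)+\theta<\beta_{k+1}(x)$ on $[0,\ell]$. Let $Q\in L^1([0,\ell];\mathbb C^{n\times n})$ and let the boundary value problem $-iB^{-1}(y'+Qy)=\lambda y$, $Cy(0)+Dy(\ell)=0$ be strictly regular. Then any system of root vectors of $L_U(Q)$ is uniformly minimal in $\mathfrak H$.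
   Context: $\rho_k(x)=\int_0^x\beta_k$, $b_k=\rho_k(\ell)$, $\Phi_0(x,\lambda)=\operatorname{diag}(e^{i\lambda\rho_k(x)})$. $\mathfrak H=\bigoplus_kL^2_{|\beta_k|}[0,\ell]$; $L_U(Q)y=-iB^{-1}(y'+Qy)$ on $\{y\in AC([0,\ell];\mathbb C^n):-iB^{-1}(y'+Qy)\in\mathfrak H,\ Cy(0)+Dy(\ell)=0\}$ with $C,D\in\mathbb C^{n\times n}$, $\operatorname{rank}(C\ D)=n$. $Q_{\rm diag}$ has entries $Q_{jk}$ if $\beta_j\equiv\beta_k$ and $0$ otherwise; $W$ solves $W'+Q_{\rm diag}W=0$, $W(0)=I_n$. With $P_+=\operatorname{diag}(p_k^+)$, $p_k^+=1$ iff $b_k>0$, $P_-=I-P_+$: the problem is strictly regular if $\det(CP_-+DW(\ell)P_+)\ne0\ne\det(CP_++DW(\ell)P_-)$ and the zeros (counting multiplicity) of $\widetilde\Delta_0(\lambda)=\det(C+DW(\ell)\Phi_0(\ell,\lambda))$ are asymptotically separated (for some $m_0,\delta>0$, $|\mu_j-\mu_k|>2\delta$ for $j\ne k$, $|j|,|k|>m_0$). A system of root vectors is the union over eigenvalues of bases of the root subspaces. A sequence $\{\phi_m\}$ in a Banach space is uniformly minimal if $\inf_m\operatorname{dist}(\phi_m/\|\phi_m\|,\overline{\operatorname{span}}\{\phi_k:k\ne m\})>0$. *)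

theory Defs
  imports "HOL-Complex_Analysis.Complex_Analysis"
begin

text \<open>Indices 1..n are modelled by a finite linearly ordered type 'n.
  Functions on [0,l] with values in C^n are maps real => complex^'n;
  n x n matrices are complex^'n^'n.\<close>

definition idx_succ :: "'n::linorder \<Rightarrow> 'n \<Rightarrow> bool" where
  "idx_succ j k \<longleftrightarrow> j < k \<and> \<not> (\<exists>i. j < i \<and> i < k)"

abbreviation ae_on :: "real \<Rightarrow> (real \<Rightarrow> bool) \<Rightarrow> bool" where
  "ae_on l P \<equiv> (AE x in lebesgue_on {0..l}. P x)"

definition Linf_on :: "real \<Rightarrow> (real \<Rightarrow> real) \<Rightarrow> bool" where
  "Linf_on l f \<longleftrightarrow> f \<in> borel_measurable (lebesgue_on {0..l})
      \<and> (\<exists>M. ae_on l (\<lambda>x. \<bar>f x\<bar> \<le> M))"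

definition beta_eq :: "real \<Rightarrow> ('n \<Rightarrow> real \<Rightarrow> real) \<Rightarrow> 'n \<Rightarrow> 'n \<Rightarrow> bool" where
  "beta_eq l \<beta> j k \<longleftrightarrow> ae_on l (\<lambda>x. \<beta> j x = \<beta> k x)"

definition admissible_B :: "real \<Rightarrow> ('n::{finite,linorder} \<Rightarrow> real \<Rightarrow> real) \<Rightarrow> bool" where
  "admissible_B l \<beta> \<longleftrightarrow>
     (\<forall>k. Linf_on l (\<beta> k) \<and> Linf_on l (\<lambda>x. 1 / \<beta> k x))
   \<and> (\<forall>k. ae_on l (\<lambda>x. \<beta> k x < 0) \<or> ae_on l (\<lambda>x. 0 < \<beta> k x))
   \<and> (\<exists>nm::nat. nm \<le> CARD('n) \<and>
        (\<forall>k. card {i. i \<le> k} \<le> nm \<longleftrightarrow> ae_on l (\<lambda>x. \<beta> k x < 0)))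
   \<and> (\<forall>j k. j \<le> k \<longrightarrow> ae_on l (\<lambda>x. \<beta> j x \<le> \<beta> k x))
   \<and> (\<exists>\<theta>>0. \<forall>j k. idx_succ j k \<longrightarrow>
        beta_eq l \<beta> j k \<or> ae_on l (\<lambda>x. \<beta> j x + \<theta> < \<beta> k x))"

definition rho :: "('n \<Rightarrow> real \<Rightarrow> real) \<Rightarrow> 'n \<Rightarrow> real \<Rightarrow> real" where
  "rho \<beta> k x = integral {0..x} (\<beta> k)"

definition bvec :: "real \<Rightarrow> ('n \<Rightarrow> real \<Rightarrow> real) \<Rightarrow> 'n \<Rightarrow> real" where
  "bvec l \<beta> k = rho \<beta> k l"

definition diag_mat :: "('n::finite \<Rightarrow> complex) \<Rightarrow> complex^'n^'n" where
  "diag_mat d = (\<chi> j k. if j = k then d j else 0)"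

definition Phi0 :: "('n::finite \<Rightarrow> real \<Rightarrow> real) \<Rightarrow> real \<Rightarrow> complex \<Rightarrow> complex^'n^'n" where
  "Phi0 \<beta> x lam = diag_mat (\<lambda>k. exp (\<i> * lam * complex_of_real (rho \<beta> k x)))"

definition Pplus :: "real \<Rightarrow> ('n::finite \<Rightarrow> real \<Rightarrow> real) \<Rightarrow> complex^'n^'n" where
  "Pplus l \<beta> = diag_mat (\<lambda>k. if bvec l \<beta> k > 0 then 1 else 0)"

definition Pminus :: "real \<Rightarrow> ('n::finite \<Rightarrow> real \<Rightarrow> real) \<Rightarrow> complex^'n^'n" where
  "Pminus l \<beta> = mat 1 - Pplus l \<beta>"

definition Qdiag :: "real \<Rightarrow> ('n::finite \<Rightarrow> real \<Rightarrow> real) \<Rightarrow> (real \<Rightarrow> complex^'n^'n)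
                     \<Rightarrow> real \<Rightarrow> complex^'n^'n" where
  "Qdiag l \<beta> Q x = (\<chi> j k. if beta_eq l \<beta> j k then Q x $ j $ k else 0)"

definition AC_with_deriv :: "real \<Rightarrow> (real \<Rightarrow> 'a::euclidean_space) \<Rightarrow> (real \<Rightarrow> 'a) \<Rightarrow> bool" where
  "AC_with_deriv l y g \<longleftrightarrow> g absolutely_integrable_on {0..l}
      \<and> (\<forall>x\<in>{0..l}. y x = y 0 + integral {0..x} g)"

definition is_W :: "real \<Rightarrow> ('n::finite \<Rightarrow> real \<Rightarrow> real) \<Rightarrow> (real \<Rightarrow> complex^'n^'n)
                   \<Rightarrow> (real \<Rightarrow> complex^'n^'n) \<Rightarrow> bool" where
  "is_W l \<beta> Q W \<longleftrightarrow> W 0 = mat 1 \<and>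
     AC_with_deriv l W (\<lambda>x. - (Qdiag l \<beta> Q x ** W x))"

definition Delta0 :: "real \<Rightarrow> ('n::finite \<Rightarrow> real \<Rightarrow> real) \<Rightarrow> complex^'n^'n \<Rightarrow> complex^'n^'n
                     \<Rightarrow> complex^'n^'n \<Rightarrow> complex \<Rightarrow> complex" where
  "Delta0 l \<beta> C D Wl lam = det (C + D ** Wl ** Phi0 \<beta> l lam)"

definition zeros_asympt_separated :: "(complex \<Rightarrow> complex) \<Rightarrow> bool" where
  "zeros_asympt_separated f \<longleftrightarrow>
     (\<exists>\<mu>::int \<Rightarrow> complex.
        (\<forall>j. f (\<mu> j) = 0) \<and>
        (\<forall>z. f z = 0 \<longrightarrow> card {j. \<mu> j = z} = nat (zorder f z)) \<and>
        (\<exists>m0 \<delta>. \<delta> > 0 \<and> (\<forall>j k. j \<noteq> k \<and> \<bar>j\<bar> > m0 \<and> \<bar>k\<bar> > m0 \<longrightarrow>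
                     cmod (\<mu> j - \<mu> k) > 2 * \<delta>)))"

definition strictly_regular ::
  "real \<Rightarrow> ('n::finite \<Rightarrow> real \<Rightarrow> real) \<Rightarrow> (real \<Rightarrow> complex^'n^'n)
   \<Rightarrow> complex^'n^'n \<Rightarrow> complex^'n^'n \<Rightarrow> bool" where
  "strictly_regular l \<beta> Q C D \<longleftrightarrow>
     (\<exists>W. is_W l \<beta> Q W \<and>
        det (C ** Pminus l \<beta> + D ** W l ** Pplus l \<beta>) \<noteq> 0 \<and>
        det (C ** Pplus l \<beta> + D ** W l ** Pminus l \<beta>) \<noteq> 0 \<and>
        zeros_asympt_separated (Delta0 l \<beta> C D (W l)))"

definition block_CD :: "complex^'n^'m \<Rightarrow> complex^'n^'m \<Rightarrow> complex^('n + 'n)^'m" where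
  "block_CD C D = (\<chi> i j. case j of Inl a \<Rightarrow> C $ i $ a | Inr b \<Rightarrow> D $ i $ b)"

definition H_mem :: "real \<Rightarrow> ('n::finite \<Rightarrow> real \<Rightarrow> real) \<Rightarrow> (real \<Rightarrow> complex^'n) \<Rightarrow> bool" where
  "H_mem l \<beta> f \<longleftrightarrow> (\<forall>k. (\<lambda>x. f x $ k) \<in> borel_measurable (lebesgue_on {0..l})
      \<and> integrable (lebesgue_on {0..l}) (\<lambda>x. \<bar>\<beta> k x\<bar> * (cmod (f x $ k))\<^sup>2))"

definition H_norm :: "real \<Rightarrow> ('n::finite \<Rightarrow> real \<Rightarrow> real) \<Rightarrow> (real \<Rightarrow> complex^'n) \<Rightarrow> real" where
  "H_norm l \<beta> f = sqrt (\<Sum>k\<in>UNIV. LINT x|lebesgue_on {0..l}. \<bar>\<beta> k x\<bar> * (cmod (f x $ k))\<^sup>2)"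

definition H_zero :: "real \<Rightarrow> (real \<Rightarrow> complex^'n) \<Rightarrow> bool" where
  "H_zero l f \<longleftrightarrow> ae_on l (\<lambda>x. f x = 0)"

text \<open>Graph of L_U(Q): y in dom(L_U(Q)) and L_U(Q) y = f, as elements of H.
  y has an absolutely continuous representative yt with derivative g.\<close>
definition LU :: "real \<Rightarrow> ('n::finite \<Rightarrow> real \<Rightarrow> real) \<Rightarrow> (real \<Rightarrow> complex^'n^'n)
                  \<Rightarrow> complex^'n^'n \<Rightarrow> complex^'n^'n
                  \<Rightarrow> (real \<Rightarrow> complex^'n) \<Rightarrow> (real \<Rightarrow> complex^'n) \<Rightarrow> bool" where
  "LU l \<beta> Q C D y f \<longleftrightarrow>
     (\<exists>yt g. AC_with_deriv l yt g \<and> ae_on l (\<lambda>x. y x = yt x)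
        \<and> C *v yt 0 + D *v yt l = 0
        \<and> H_mem l \<beta> f
        \<and> ae_on l (\<lambda>x. f x = (\<chi> k. - \<i> * ((g x + Q x *v yt x) $ k) / complex_of_real (\<beta> k x))))"

fun ker_pow :: "real \<Rightarrow> ('n::finite \<Rightarrow> real \<Rightarrow> real) \<Rightarrow> (real \<Rightarrow> complex^'n^'n)
                  \<Rightarrow> complex^'n^'n \<Rightarrow> complex^'n^'n \<Rightarrow> complex \<Rightarrow> nat
                  \<Rightarrow> (real \<Rightarrow> complex^'n) \<Rightarrow> bool" where
  "ker_pow l \<beta> Q C D lam 0 y \<longleftrightarrow> H_mem l \<beta> y \<and> H_zero l y"
| "ker_pow l \<beta> Q C D lam (Suc k) y \<longleftrightarrow>
     (\<exists>f. LU l \<beta> Q C D y f \<and> ker_pow l \<beta> Q C D lam k (\<lambda>x. f x - lam *s y x))"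

definition is_eigenvalue :: "real \<Rightarrow> ('n::finite \<Rightarrow> real \<Rightarrow> real) \<Rightarrow> (real \<Rightarrow> complex^'n^'n)
                  \<Rightarrow> complex^'n^'n \<Rightarrow> complex^'n^'n \<Rightarrow> complex \<Rightarrow> bool" where
  "is_eigenvalue l \<beta> Q C D lam \<longleftrightarrow>
     (\<exists>y. \<not> H_zero l y \<and> LU l \<beta> Q C D y (\<lambda>x. lam *s y x))"

definition root_space :: "real \<Rightarrow> ('n::finite \<Rightarrow> real \<Rightarrow> real) \<Rightarrow> (real \<Rightarrow> complex^'n^'n)
                  \<Rightarrow> complex^'n^'n \<Rightarrow> complex^'n^'n \<Rightarrow> complex \<Rightarrow> (real \<Rightarrow> complex^'n) set" where
  "root_space l \<beta> Q C D lam = {y. \<exists>k. ker_pow l \<beta> Q C D lam k y}"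

definition root_vector_system :: "real \<Rightarrow> ('n::finite \<Rightarrow> real \<Rightarrow> real) \<Rightarrow> (real \<Rightarrow> complex^'n^'n)
                  \<Rightarrow> complex^'n^'n \<Rightarrow> complex^'n^'n
                  \<Rightarrow> ('i \<Rightarrow> complex) \<Rightarrow> ('i \<Rightarrow> real \<Rightarrow> complex^'n) \<Rightarrow> bool" where
  "root_vector_system l \<beta> Q C D ev \<phi> \<longleftrightarrow>
     (\<forall>i. is_eigenvalue l \<beta> Q C D (ev i) \<and> \<phi> i \<in> root_space l \<beta> Q C D (ev i))
   \<and> (\<forall>lam. is_eigenvalue l \<beta> Q C D lam \<longrightarrow>
        (\<forall>F c. finite F \<and> F \<subseteq> {i. ev i = lam} \<and>
               H_zero l (\<lambda>x. \<Sum>i\<in>F. c i *s \<phi> i x) \<longrightarrow> (\<forall>i\<in>F. c i = 0))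
      \<and> (\<forall>y\<in>root_space l \<beta> Q C D lam. \<exists>F c. finite F \<and> F \<subseteq> {i. ev i = lam} \<and>
               H_zero l (\<lambda>x. y x - (\<Sum>i\<in>F. c i *s \<phi> i x))))"

text \<open>Uniform minimality in H: the distance from phi_m / ||phi_m|| to the closed linear span of
  the phi_k, k /= m, is bounded below by a positive constant (this distance equals the infimum
  over finite linear combinations).\<close>
definition uniformly_minimal :: "real \<Rightarrow> ('n::finite \<Rightarrow> real \<Rightarrow> real)
                  \<Rightarrow> ('i \<Rightarrow> real \<Rightarrow> complex^'n) \<Rightarrow> bool" where
  "uniformly_minimal l \<beta> \<phi> \<longleftrightarrow>
     (\<exists>\<delta>>0. \<forall>m F c. finite F \<and> m \<notin> F \<longrightarrow>
        H_norm l \<beta> (\<lambda>x. complex_of_real (1 / H_norm l \<beta> (\<phi> m)) *s \<phi> m x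
                       - (\<Sum>k\<in>F. c k *s \<phi> k x)) \<ge> \<delta>)"

end

theory Submission imports Defs begin

text \<open>Write a finite combination of root functions as a sum of contour integrals of its resolvent: the part
  belonging to the eigenvalues inside a contour is the Riesz projection of the whole, so a bound for
  the resolvent on the contour bounds that part by the norm of the whole combination.

  The resolvent is never constructed. A solution of the resolvent equation with root functions on
  the right-hand side is an explicit rational function of the spectral parameter, and all bounds
  are a priori estimates for solutions. Away from the real axis they come from the growth or decay
  of each component. In a horizontal strip the oscillation of the entries of Q that couple different
  weights shows that, for large real parts, solutions are close to those of the problem
  with Q replaced by its block diagonal part, which have denominator \<open>\<Delta>\<^sub>0\<close>. By almost periodicity
  \<open>\<Delta>\<^sub>0\<close> is bounded below off small discs around its zeros, uniformly along the strip. Asymptotic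
  separation makes the distant zeros simple and the discs disjoint, and since the principal part
  of the leading term at a simple zero has rank one, each distant disc contains at most one root
  vector. The remaining ones lie inside one rectangle; they are finitely many because a space of
  functions on which the sup norm is controlled by the Hilbert norm is finite-dimensional.\<close>

section \<open>Absolutely continuous functions\<close>

text \<open>Uniform minimality is a statement about finite combinations, so the argument runs on
  upper bounds alone: eigenvalues are located only up to the set where an a priori estimate fails.
  The obstacle is that Q is merely integrable. After removal of the block diagonal part the coupling
  matrix is not small for large spectral parameter; only its primitive is, and without a rate.
  Comparison with the block diagonal problem therefore leaves an error \<eta> times the norm of the
  right-hand side, with \<eta> fixed in advance. This suffices because every use is an absorption.
  In particular, two root vectors in one disc span a plane containing a nonzero h annihilated by the
  functional through which the principal part acts; the contour integral of the approximate
  resolvent of h is then zero, and h is bounded by a factor below one times itself. All estimates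
  pass from the L1 norm of the right-hand side to the sup norm of the solution. Up to constants the
  Hilbert norm lies between the two, so one estimate serves the projections, the finiteness of the
  central part and the absorption.\<close>

lemma AC_with_derivD:
  assumes "AC_with_deriv l y g"
  shows "g absolutely_integrable_on {0..l}" "g integrable_on {0..l}"
    "x \<in> {0..l} \<Longrightarrow> y x = y 0 + integral {0..x} g"
  using assms unfolding AC_with_deriv_def absolutely_integrable_on_def by blast+

lemma AC_with_derivI:
  assumes "g absolutely_integrable_on {0..l}" "\<And>x. x \<in> {0..l} \<Longrightarrow> y x = y 0 + integral {0..x} g"
  shows "AC_with_deriv l y g"
  using assms unfolding AC_with_deriv_def by blast

lemma AC_with_deriv_diff:
  assumes "AC_with_deriv l y g" "0 \<le> s" "s \<le> t" "t \<le> l"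
  shows "y t - y s = integral {s..t} g"
proof -
  have "g integrable_on {0..t}"
    using AC_with_derivD(2)[OF assms(1)] assms by (auto intro: integrable_on_subinterval)
  then have "integral {0..s} g + integral {s..t} g = integral {0..t} g"
    using assms by (intro Henstock_Kurzweil_Integration.integral_combine) auto
  moreover have "y t = y 0 + integral {0..t} g" "y s = y 0 + integral {0..s} g"
    using AC_with_derivD(3)[OF assms(1), of t] AC_with_derivD(3)[OF assms(1), of s] assms by auto
  ultimately show ?thesis by (simp add: algebra_simps)
qed

lemma AC_with_deriv_continuous:
  assumes "AC_with_deriv l y g"
  shows "continuous_on {0..l} y"
proof -
  have "continuous_on {0..l} (\<lambda>x. y 0 + integral {0..x} g)"
    by (intro continuous_intros indefinite_integral_continuous_1 AC_with_derivD(2)[OF assms])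
  then show ?thesis
    by (rule continuous_on_eq) (rule AC_with_derivD(3)[OF assms, symmetric])
qed

lemma AC_with_deriv_cong:
  assumes "AC_with_deriv l y g" "0 \<le> l" "\<And>x. x \<in> {0..l} \<Longrightarrow> y x = y' x"
    "\<And>x. x \<in> {0..l} \<Longrightarrow> g x = g' x"
  shows "AC_with_deriv l y' g'"
proof (rule AC_with_derivI)
  show "g' absolutely_integrable_on {0..l}"
    using AC_with_derivD(1)[OF assms(1)] assms(4)
    by (subst set_integrable_cong[OF refl refl, of _ _ g]) auto
  fix x assume x: "x \<in> {0..l}"
  have "integral {0..x} g' = integral {0..x} g"
    using x assms(4) by (intro Henstock_Kurzweil_Integration.integral_cong) auto
  then show "y' x = y' 0 + integral {0..x} g'"
    using AC_with_derivD(3)[OF assms(1) x] assms(2,3) x by simp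
qed

lemma AC_with_deriv_spike:
  assumes "AC_with_deriv l y g" "negligible N" "\<And>x. x \<in> {0..l} - N \<Longrightarrow> g' x = g x"
  shows "AC_with_deriv l y g'"
proof (rule AC_with_derivI)
  show "g' absolutely_integrable_on {0..l}"
    using AC_with_derivD(1)[OF assms(1)] assms(2,3) by (rule absolutely_integrable_spike)
  fix x assume x: "x \<in> {0..l}"
  have "integral {0..x} g' = integral {0..x} g"
    using x assms(3) by (intro integral_spike[OF assms(2)]) auto
  then show "y x = y 0 + integral {0..x} g'"
    using AC_with_derivD(3)[OF assms(1) x] by simp
qed

lemma AC_with_deriv_integral:
  assumes "g absolutely_integrable_on {0..l}"
  shows "AC_with_deriv l (\<lambda>x. c + integral {0..x} g) g"
  by (intro AC_with_derivI assms) simp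

lemma AC_with_deriv_const: "AC_with_deriv l (\<lambda>x. c) (\<lambda>x. 0)"
  by (auto simp: AC_with_deriv_def)

lemma AC_with_deriv_add:
  assumes "AC_with_deriv l y g" "AC_with_deriv l z h"
  shows "AC_with_deriv l (\<lambda>x. y x + z x) (\<lambda>x. g x + h x)"
proof (rule AC_with_derivI)
  show "(\<lambda>x. g x + h x) absolutely_integrable_on {0..l}"
    by (intro set_integral_add AC_with_derivD(1)[OF assms(1)] AC_with_derivD(1)[OF assms(2)])
  fix x assume x: "x \<in> {0..l}"
  have "integral {0..x} (\<lambda>x. g x + h x) = integral {0..x} g + integral {0..x} h"
    using x AC_with_derivD(2)[OF assms(1)] AC_with_derivD(2)[OF assms(2)]
    by (intro Henstock_Kurzweil_Integration.integral_add) (auto intro: integrable_on_subinterval)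
  then show "y x + z x = y 0 + z 0 + integral {0..x} (\<lambda>x. g x + h x)"
    using AC_with_derivD(3)[OF assms(1) x] AC_with_derivD(3)[OF assms(2) x] by simp
qed

lemma AC_with_deriv_linear:
  assumes "AC_with_deriv l y g" "bounded_linear p"
  shows "AC_with_deriv l (\<lambda>x. p (y x)) (\<lambda>x. p (g x))"
proof (rule AC_with_derivI)
  show "(\<lambda>x. p (g x)) absolutely_integrable_on {0..l}"
    using absolutely_integrable_linear[OF AC_with_derivD(1)[OF assms(1)] assms(2)] by (simp add: o_def)
  fix x assume x: "x \<in> {0..l}"
  have "integral {0..x} (\<lambda>x. p (g x)) = p (integral {0..x} g)"
    using integral_linear[OF integrable_on_subinterval[OF AC_with_derivD(2)[OF assms(1)], of 0 x] assms(2)] x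
    by (auto simp: o_def)
  then show "p (y x) = p (y 0) + integral {0..x} (\<lambda>x. p (g x))"
    unfolding AC_with_derivD(3)[OF assms(1) x] by (simp add: linear_simps(1)[OF assms(2)])
qed

lemma AC_with_deriv_minus:
  assumes "AC_with_deriv l y g"
  shows "AC_with_deriv l (\<lambda>x. - y x) (\<lambda>x. - g x)"
  by (rule AC_with_deriv_linear[OF assms bounded_linear_minus[OF bounded_linear_ident]])

lemma AC_with_deriv_sub:
  assumes "AC_with_deriv l y g" "AC_with_deriv l z h"
  shows "AC_with_deriv l (\<lambda>x. y x - z x) (\<lambda>x. g x - h x)"
  using AC_with_deriv_add[OF assms(1) AC_with_deriv_minus[OF assms(2)]] by simp

lemma AC_with_deriv_sum:
  assumes "\<And>i. i \<in> I \<Longrightarrow> AC_with_deriv l (y i) (g i)"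
  shows "AC_with_deriv l (\<lambda>x. \<Sum>i\<in>I. y i x) (\<lambda>x. \<Sum>i\<in>I. g i x)"
  using assms
proof (induction I rule: infinite_finite_induct)
  case (insert i I)
  then show ?case
    using AC_with_deriv_add[of l "y i" "g i" "\<lambda>x. \<Sum>i\<in>I. y i x" "\<lambda>x. \<Sum>i\<in>I. g i x"] by simp
qed (simp_all add: AC_with_deriv_const)

lemma AC_with_deriv_decreasing:
  fixes H :: "real \<Rightarrow> real"
  assumes "AC_with_deriv l H h" "\<And>t. t \<in> {0..l} \<Longrightarrow> h t \<le> 0" "x \<in> {0..l}"
  shows "H x \<le> H 0"
proof -
  have "integral {0..x} h \<le> integral {0..x} (\<lambda>_. 0)"
    using AC_with_derivD(2)[OF assms(1)] assms(2,3)
    by (intro integral_le) (auto intro: integrable_on_subinterval)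
  then show ?thesis using AC_with_derivD(3)[OF assms(1,3)] by simp
qed

text \<open>Chain and product rules in the class of absolutely continuous functions follow from this
  criterion, which needs no almost everywhere differentiability: the error terms add up over a
  fine equidistant partition.\<close>
lemma AC_with_deriv_local:
  fixes H :: "real \<Rightarrow> 'a::euclidean_space"
  assumes l: "0 \<le> l" and h: "h absolutely_integrable_on {0..l}"
    and w: "w integrable_on {0..l}" "\<And>x. x \<in> {0..l} \<Longrightarrow> 0 \<le> w x"
    and loc: "\<And>e. e > 0 \<Longrightarrow> \<exists>d>0. \<forall>x y. 0 \<le> x \<and> x \<le> y \<and> y \<le> l \<and> y - x < d \<longrightarrow>
      norm (H y - H x - integral {x..y} h) \<le> e * integral {x..y} w"
  shows "AC_with_deriv l H h"
proof -
  have hi: "h integrable_on {0..l}" using h by (auto simp: absolutely_integrable_on_def)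
  have "H x = H 0 + integral {0..x} h" if x: "x \<in> {0..l}" for x
  proof -
    have est: "norm (H x - H 0 - integral {0..x} h) \<le> e * integral {0..x} w" if e: "e > 0" for e
    proof -
      obtain d where d: "d > 0" and loc': "\<And>x y. \<lbrakk>0 \<le> x; x \<le> y; y \<le> l; y - x < d\<rbrakk> \<Longrightarrow>
          norm (H y - H x - integral {x..y} h) \<le> e * integral {x..y} w"
        using loc[OF e] by blast
      obtain N :: nat where N: "x / d < real N" using reals_Archimedean2 by blast
      have "0 \<le> x / d" using x d by simp
      with N have N0: "real N > 0" by linarith
      define s where "s = x / real N"
      have s: "0 \<le> s" "s < d" "real N * s = x"
        using x N0 N d by (auto simp: s_def field_simps)
      have "norm (H (real k * s) - H 0 - integral {0..real k * s} h) \<le> e * integral {0..real k * s} w"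
        if "k \<le> N" for k
        using that
      proof (induction k)
        case 0
        then show ?case by simp
      next
        case (Suc k)
        have le: "real k * s \<le> real (Suc k) * s" "0 \<le> real k * s" using s by (auto intro: mult_right_mono)
        have "real (Suc k) * s \<le> real N * s" using Suc.prems s(1) by (intro mult_right_mono) auto
        then have le2: "real (Suc k) * s \<le> l" using s x by auto
        have st: "norm (H (real (Suc k) * s) - H (real k * s) - integral {real k * s..real (Suc k) * s} h)
            \<le> e * integral {real k * s..real (Suc k) * s} w"
          using le le2 s by (intro loc') (auto simp: algebra_simps)
        have c1: "integral {0..real k * s} h + integral {real k * s..real (Suc k) * s} h = integral {0..real (Suc k) * s} h"
          using le le2 by (intro Henstock_Kurzweil_Integration.integral_combine integrable_on_subinterval[OF hi]) auto
        have c2: "integral {0..real k * s} w + integral {real k * s..real (Suc k) * s} w = integral {0..real (Suc k) * s} w"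
          using le le2 by (intro Henstock_Kurzweil_Integration.integral_combine integrable_on_subinterval[OF w(1)]) auto
        have "H (real (Suc k) * s) - H 0 - integral {0..real (Suc k) * s} h
            = (H (real k * s) - H 0 - integral {0..real k * s} h) + 
              (H (real (Suc k) * s) - H (real k * s) - integral {real k * s..real (Suc k) * s} h)"
          unfolding c1[symmetric] by simp
        also have "norm \<dots> \<le> e * integral {0..real k * s} w + e * integral {real k * s..real (Suc k) * s} w"
          using st Suc by (intro norm_triangle_le add_mono) auto
        also have "\<dots> = e * integral {0..real (Suc k) * s} w"
          unfolding c2[symmetric] by (simp add: algebra_simps)
        finally show ?case .
      qed
      from this[of N] show ?thesis using s by simp
    qed
    have "norm (H x - H 0 - integral {0..x} h) \<le> 0 + e" if e: "e > 0" for e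
    proof -
      \<comment> \<open>The weight may integrate to zero, hence the division by
        \<open>I + 1\<close>.\<close>
      define I where "I = integral {0..x} w"
      have I: "I \<ge> 0" unfolding I_def using x w
        by (intro Henstock_Kurzweil_Integration.integral_nonneg integrable_on_subinterval[OF w(1)]) auto
      have "norm (H x - H 0 - integral {0..x} h) \<le> e / (I + 1) * I"
        using est[of "e / (I+1)"] e I by (simp add: I_def)
      also have "\<dots> \<le> e" using e I by (simp add: field_simps)
      finally show ?thesis by simp
    qed
    then have "norm (H x - H 0 - integral {0..x} h) \<le> 0" by (rule field_le_epsilon)
    then show ?thesis by (simp add: algebra_simps)
  qed
  then show ?thesis using h by (intro AC_with_derivI)
qed

section \<open>Product rule, exponentials and Gronwall's inequality\<close>

lemma absolutely_integrable_bilinear_continuous: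
  fixes p :: "'a::euclidean_space \<Rightarrow> 'b::euclidean_space \<Rightarrow> 'c::euclidean_space"
  assumes "bounded_bilinear p" "f absolutely_integrable_on {a..b::real}" "continuous_on {a..b} G"
  shows "(\<lambda>x. p (f x) (G x)) absolutely_integrable_on {a..b}"
proof -
  have "bounded (G ` {a..b})"
    by (intro compact_imp_bounded compact_continuous_image assms) auto
  then show ?thesis
    using assms absolutely_integrable_bounded_measurable_product[of "\<lambda>x y. p y x" G "{a..b}" f]
      bilinear_conv_bounded_bilinear[of "\<lambda>x y. p y x"] bounded_bilinear.flip
    by (auto simp: continuous_imp_measurable_on_sets_lebesgue)
qed

lemma bounded_continuous_Icc:
  assumes "continuous_on {a..b::real} G"
  obtains K :: real where "K > 0" "\<And>x. x \<in> {a..b} \<Longrightarrow> norm (G x) \<le> K"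
proof -
  have "bounded (G ` {a..b})"
    by (intro compact_imp_bounded compact_continuous_image assms) auto
  then show ?thesis using that unfolding bounded_pos by auto
qed

lemma uniformly_continuous_Icc:
  assumes "continuous_on {a..b::real} G" "e > 0"
  obtains d where "d > 0" "\<And>x y. \<lbrakk>x \<in> {a..b}; y \<in> {a..b}; \<bar>x - y\<bar> < d\<rbrakk> \<Longrightarrow> norm (G x - G y) < e"
  using compact_uniformly_continuous[OF assms(1)] assms(2)
  unfolding uniformly_continuous_on_def dist_norm real_norm_def by (metis compact_Icc)

lemma AC_with_deriv_bilinear:
  fixes p :: "'a::euclidean_space \<Rightarrow> 'b::euclidean_space \<Rightarrow> 'c::euclidean_space"
  assumes l: "0 \<le> l" and p: "bounded_bilinear p" and F: "AC_with_deriv l F f" and G: "AC_with_deriv l G g"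
  shows "AC_with_deriv l (\<lambda>x. p (F x) (G x)) (\<lambda>x. p (f x) (G x) + p (F x) (g x))"
proof (rule AC_with_deriv_local[OF l])
  interpret p: bounded_bilinear p by fact
  note cF = AC_with_deriv_continuous[OF F] and cG = AC_with_deriv_continuous[OF G]
  note aF = AC_with_derivD(1)[OF F] and aG = AC_with_derivD(1)[OF G]
  have a1: "(\<lambda>x. p (f x) (G x)) absolutely_integrable_on {0..l}"
    by (rule absolutely_integrable_bilinear_continuous[OF p aF cG])
  have a2: "(\<lambda>x. p (F x) (g x)) absolutely_integrable_on {0..l}"
    by (rule absolutely_integrable_bilinear_continuous[OF p.flip aG cF])
  show "(\<lambda>x. p (f x) (G x) + p (F x) (g x)) absolutely_integrable_on {0..l}"
    by (rule set_integral_add(1)[OF a1 a2])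
  let ?w = "\<lambda>x. norm (f x) + norm (g x)"
  have nf: "(\<lambda>x. norm (f x)) integrable_on {0..l}" "(\<lambda>x. norm (g x)) integrable_on {0..l}"
    using aF aG by (auto simp: absolutely_integrable_on_def)
  show w: "?w integrable_on {0..l}" by (intro integrable_add nf)
  show "\<And>x. x \<in> {0..l} \<Longrightarrow> 0 \<le> ?w x" by auto
  fix e :: real assume e: "e > 0"
  obtain K where K: "K > 0" "\<And>a b. norm (p a b) \<le> norm a * norm b * K" using p.pos_bounded by blast
  have eK: "e / K > 0" using e K by simp
  obtain d1 where d1: "d1 > 0" "\<And>x y. \<lbrakk>x \<in> {0..l}; y \<in> {0..l}; \<bar>x - y\<bar> < d1\<rbrakk> \<Longrightarrow> norm (F x - F y) < e / K"
    using uniformly_continuous_Icc[OF cF eK] by blast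
  obtain d2 where d2: "d2 > 0" "\<And>x y. \<lbrakk>x \<in> {0..l}; y \<in> {0..l}; \<bar>x - y\<bar> < d2\<rbrakk> \<Longrightarrow> norm (G x - G y) < e / K"
    using uniformly_continuous_Icc[OF cG eK] by blast
  have "norm (p (F y) (G y) - p (F x) (G x) - integral {x..y} (\<lambda>x. p (f x) (G x) + p (F x) (g x)))
      \<le> e * integral {x..y} ?w"
    if xy: "0 \<le> x" "x \<le> y" "y \<le> l" "y - x < min d1 d2" for x y
  proof -
    have sub: "{x..y} \<subseteq> {0..l}" using xy by auto
    have fi: "f integrable_on {x..y}" "g integrable_on {x..y}"
      using AC_with_derivD(2)[OF F] AC_with_derivD(2)[OF G] sub by (auto intro: integrable_on_subinterval)
    have i1: "(\<lambda>x. p (f x) (G x) + p (F x) (g x)) integrable_on {x..y}"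
      using set_integral_add(1)[OF a1 a2] sub
      by (auto simp: absolutely_integrable_on_def intro: integrable_on_subinterval)
    have i2: "((\<lambda>t. p (f t) (G y)) has_integral p (integral {x..y} f) (G y)) {x..y}"
      using has_integral_linear[OF integrable_integral[OF fi(1)] p.bounded_linear_left[of "G y"]]
      by (simp add: o_def)
    have i3: "((\<lambda>t. p (F x) (g t)) has_integral p (F x) (integral {x..y} g)) {x..y}"
      using has_integral_linear[OF integrable_integral[OF fi(2)] p.bounded_linear_right[of "F x"]]
      by (simp add: o_def)
    have "p (F y) (G y) - p (F x) (G x) = p (F y - F x) (G y) + p (F x) (G y - G x)"
      by (simp add: p.diff_left p.diff_right)
    also have "\<dots> = p (integral {x..y} f) (G y) + p (F x) (integral {x..y} g)"
      using AC_with_deriv_diff[OF F xy(1-3)] AC_with_deriv_diff[OF G xy(1-3)] by simp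
    finally have eq: "p (F y) (G y) - p (F x) (G x) = p (integral {x..y} f) (G y) + p (F x) (integral {x..y} g)" .
    have hi: "((\<lambda>t. (p (f t) (G y) + p (F x) (g t)) - (p (f t) (G t) + p (F t) (g t))) has_integral
        p (F y) (G y) - p (F x) (G x) - integral {x..y} (\<lambda>x. p (f x) (G x) + p (F x) (g x))) {x..y}"
      unfolding eq by (intro has_integral_diff has_integral_add i2 i3 integrable_integral[OF i1])
    have int: "(\<lambda>t. (p (f t) (G y) + p (F x) (g t)) - (p (f t) (G t) + p (F t) (g t))) integrable_on {x..y}"
      using hi by blast
    have "p (F y) (G y) - p (F x) (G x) - integral {x..y} (\<lambda>x. p (f x) (G x) + p (F x) (g x))
       = integral {x..y} (\<lambda>t. (p (f t) (G y) + p (F x) (g t)) - (p (f t) (G t) + p (F t) (g t)))"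
      by (rule integral_unique[OF hi, symmetric])
    also have "norm (integral {x..y} (\<lambda>t. (p (f t) (G y) + p (F x) (g t)) - (p (f t) (G t) + p (F t) (g t))))
       \<le> integral {x..y} (\<lambda>t. e * ?w t)"
    proof (rule integral_norm_bound_integral[OF int])
      show "(\<lambda>t. e * ?w t) integrable_on {x..y}"
        using integrable_on_subinterval[OF w sub] by (rule integrable_on_mult_right)
      fix t assume t: "t \<in> {x..y}"
      have "(p (f t) (G y) + p (F x) (g t)) - (p (f t) (G t) + p (F t) (g t)) = p (f t) (G y - G t) + p (F x - F t) (g t)"
        by (simp add: p.diff_left p.diff_right)
      also have "norm \<dots> \<le> norm (f t) * (e / K) * K + (e / K) * norm (g t) * K"
      proof (intro norm_triangle_le add_mono)
        have "norm (G y - G t) \<le> e / K" using d2(2)[of y t] xy t by (auto intro!: less_imp_le)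
        then show "norm (p (f t) (G y - G t)) \<le> norm (f t) * (e / K) * K"
          by (intro order_trans[OF K(2)] mult_right_mono mult_left_mono) (use K in auto)
        have "norm (F x - F t) \<le> e / K" using d1(2)[of x t] xy t by (auto intro!: less_imp_le)
        then show "norm (p (F x - F t) (g t)) \<le> (e / K) * norm (g t) * K"
          by (intro order_trans[OF K(2)] mult_right_mono mult_left_mono) (use K in auto)
      qed
      also have "\<dots> = e * ?w t" using K by (simp add: field_simps)
      finally show "norm ((p (f t) (G y) + p (F x) (g t)) - (p (f t) (G t) + p (F t) (g t))) \<le> e * ?w t" .
    qed
    finally show ?thesis by simp
  qed
  then show "\<exists>d>0. \<forall>x y. 0 \<le> x \<and> x \<le> y \<and> y \<le> l \<and> y - x < d \<longrightarrow>
      norm (p (F y) (G y) - p (F x) (G x) - integral {x..y} (\<lambda>x. p (f x) (G x) + p (F x) (g x))) \<le> e * integral {x..y} ?w"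
    using d1(1) d2(1) by (intro exI[of _ "min d1 d2"]) auto
qed

text \<open>Stated over a general field because it is applied to real integrating factors as well as
  to complex phases. The local error splits at the tangent \<open>(a y - a x) * exp (a x)\<close>: a
  mean value estimate on one side, replacing \<open>exp (a x)\<close> by \<open>exp (a t)\<close>
  under the integral on the other. Each takes half of e.\<close>

lemma AC_with_deriv_exp:
  fixes a :: "real \<Rightarrow> 'a::{real_normed_field, banach, euclidean_space}"
  assumes l: "0 \<le> l" and a: "AC_with_deriv l a a'"
  shows "AC_with_deriv l (\<lambda>x. exp (a x)) (\<lambda>x. a' x * exp (a x))"
proof (rule AC_with_deriv_local[OF l])
  note ca = AC_with_deriv_continuous[OF a] and aa = AC_with_derivD(1)[OF a]
  have cE: "continuous_on {0..l} (\<lambda>x. exp (a x))" by (intro continuous_intros ca)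
  show ai: "(\<lambda>x. a' x * exp (a x)) absolutely_integrable_on {0..l}"
    by (rule absolutely_integrable_bilinear_continuous[OF bounded_bilinear_mult aa cE])
  show w: "(\<lambda>x. norm (a' x)) integrable_on {0..l}"
    using aa by (auto simp: absolutely_integrable_on_def)
  show "\<And>x. x \<in> {0..l} \<Longrightarrow> 0 \<le> norm (a' x)" by auto
  fix e :: real assume e: "e > 0"
  obtain K where K: "K > 0" "\<And>x. x \<in> {0..l} \<Longrightarrow> norm (a x) \<le> K"
    using bounded_continuous_Icc[OF ca] by blast
  have "uniformly_continuous_on (cball 0 K) (exp :: 'a \<Rightarrow> 'a)"
    by (intro compact_uniformly_continuous continuous_intros compact_cball)
  then obtain d0 where d0: "d0 > 0" "\<And>u v::'a. \<lbrakk>u \<in> cball 0 K; v \<in> cball 0 K; dist u v < d0\<rbrakk> \<Longrightarrow> dist (exp u) (exp v) < e/2"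
    unfolding uniformly_continuous_on_def using e by (metis half_gt_zero)
  obtain d where d: "d > 0" "\<And>x y. \<lbrakk>x \<in> {0..l}; y \<in> {0..l}; \<bar>x - y\<bar> < d\<rbrakk> \<Longrightarrow> norm (a x - a y) < d0"
    using uniformly_continuous_Icc[OF ca d0(1)] by blast
  have "norm (exp (a y) - exp (a x) - integral {x..y} (\<lambda>x. a' x * exp (a x))) \<le> e * integral {x..y} (\<lambda>x. norm (a' x))"
    if xy: "0 \<le> x" "x \<le> y" "y \<le> l" "y - x < d" for x y
  proof -
    have sub: "{x..y} \<subseteq> {0..l}" using xy by auto
    have ia: "a' integrable_on {x..y}"
      using AC_with_derivD(2)[OF a] sub by (auto intro: integrable_on_subinterval)
    have iw: "(\<lambda>x. norm (a' x)) integrable_on {x..y}" by (rule integrable_on_subinterval[OF w sub])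
    have i1: "(\<lambda>x. a' x * exp (a x)) integrable_on {x..y}"
      using ai sub by (auto simp: absolutely_integrable_on_def intro: integrable_on_subinterval)
    have dif: "a y - a x = integral {x..y} a'" by (rule AC_with_deriv_diff[OF a xy(1-3)])
    have nd: "norm (a y - a x) \<le> integral {x..y} (\<lambda>x. norm (a' x))"
      unfolding dif by (rule integral_norm_bound_integral[OF ia iw]) auto
    have ax: "a x \<in> cball 0 K" "a y \<in> cball 0 K" using K xy by auto
    have seg: "closed_segment (a x) (a y) \<subseteq> cball 0 K \<inter> ball (a x) d0"
      using ax d(2)[of x y] xy d0(1)
      by (intro closed_segment_subset convex_Int convex_cball convex_ball) (auto simp: dist_norm)
    \<comment> \<open>Mean value inequality for \<open>exp z - z * exp (a x)\<close>, whose
      derivative \<open>exp z - exp (a x)\<close> is small along the segment.\<close>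
    have "norm ((exp (a y) - a y * exp (a x)) - (exp (a x) - a x * exp (a x))) \<le> e/2 * norm (a y - a x)"
    proof (rule field_differentiable_bound[of "closed_segment (a x) (a y)" _ "\<lambda>z. exp z - exp (a x)"])
      fix z assume "z \<in> closed_segment (a x) (a y)"
      then have z: "z \<in> cball 0 K" "dist z (a x) < d0" using seg by (auto simp: dist_commute)
      show "norm (exp z - exp (a x)) \<le> e / 2"
        using d0(2)[OF z(1) ax(1) z(2)] by (simp add: dist_norm)
      show "((\<lambda>z. exp z - z * exp (a x)) has_field_derivative exp z - exp (a x)) (at z within closed_segment (a x) (a y))"
        by (rule derivative_eq_intros refl | simp)+
    qed simp_all
    moreover have "(exp (a y) - a y * exp (a x)) - (exp (a x) - a x * exp (a x)) = exp (a y) - exp (a x) - (a y - a x) * exp (a x)"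
      by (simp add: algebra_simps)
    moreover have "e/2 * norm (a y - a x) \<le> e/2 * integral {x..y} (\<lambda>x. norm (a' x))"
      using nd e by (intro mult_left_mono) auto
    ultimately have p1: "norm (exp (a y) - exp (a x) - (a y - a x) * exp (a x)) \<le> e/2 * integral {x..y} (\<lambda>x. norm (a' x))"
      by simp
    have i2: "((\<lambda>t. a' t * exp (a x)) has_integral (a y - a x) * exp (a x)) {x..y}"
      unfolding dif by (intro has_integral_mult_left integrable_integral ia)
    have p2: "norm ((a y - a x) * exp (a x) - integral {x..y} (\<lambda>x. a' x * exp (a x))) \<le> integral {x..y} (\<lambda>t. e/2 * norm (a' t))"
    proof -
      have hi: "((\<lambda>t. a' t * exp (a x) - a' t * exp (a t)) has_integral (a y - a x) * exp (a x) - integral {x..y} (\<lambda>x. a' x * exp (a x))) {x..y}"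
        by (intro has_integral_diff i2 integrable_integral i1)
      show ?thesis
        unfolding integral_unique[OF hi, symmetric]
      proof (rule integral_norm_bound_integral)
        show "(\<lambda>t. a' t * exp (a x) - a' t * exp (a t)) integrable_on {x..y}" using hi by blast
        show "(\<lambda>t. e/2 * norm (a' t)) integrable_on {x..y}" by (intro integrable_on_mult_right iw)
        fix t assume t: "t \<in> {x..y}"
        have "norm (exp (a x) - exp (a t)) \<le> e/2"
        proof -
          have "norm (a x - a t) < d0" using xy t by (intro d(2)) auto
          moreover have "a t \<in> cball 0 K" using K(2)[of t] xy t by simp
          ultimately show ?thesis using d0(2)[OF ax(1), of "a t"] by (simp add: dist_norm)
        qed
        then show "norm (a' t * exp (a x) - a' t * exp (a t)) \<le> e/2 * norm (a' t)"
          using mult_left_mono[of _ "e/2" "norm (a' t)"]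
          by (simp only: right_diff_distrib[symmetric] norm_mult mult.commute[of "e/2"] norm_ge_zero)
      qed
    qed
    have p2': "norm ((a y - a x) * exp (a x) - integral {x..y} (\<lambda>x. a' x * exp (a x))) \<le> e/2 * integral {x..y} (\<lambda>t. norm (a' t))"
      using p2 by simp
    have "exp (a y) - exp (a x) - integral {x..y} (\<lambda>x. a' x * exp (a x))
      = (exp (a y) - exp (a x) - (a y - a x) * exp (a x))
        + ((a y - a x) * exp (a x) - integral {x..y} (\<lambda>x. a' x * exp (a x)))"
      by simp
    also have "norm \<dots> \<le> e/2 * integral {x..y} (\<lambda>t. norm (a' t)) + e/2 * integral {x..y} (\<lambda>t. norm (a' t))"
      by (rule norm_triangle_le[OF add_mono[OF p1 p2']])
    finally show ?thesis by simp
  qed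
  then show "\<exists>d>0. \<forall>x y. 0 \<le> x \<and> x \<le> y \<and> y \<le> l \<and> y - x < d \<longrightarrow>
      norm (exp (a y) - exp (a x) - integral {x..y} (\<lambda>x. a' x * exp (a x))) \<le> e * integral {x..y} (\<lambda>x. norm (a' x))"
    using d by (intro exI[of _ d]) auto
qed

text \<open>Integrating factor: with P the integral on the right-hand side,
  \<open>(P + a) * exp (- integral w)\<close> is nonincreasing, since its derivative carries the
  nonpositive factor \<open>u - P - a\<close>.\<close>

lemma gronwall_integral:
  fixes u w :: "real \<Rightarrow> real"
  assumes l: "0 \<le> l" and u: "continuous_on {0..l} u" and w: "w absolutely_integrable_on {0..l}"
    and w0: "\<And>t. t \<in> {0..l} \<Longrightarrow> 0 \<le> w t"
    and le: "\<And>x. x \<in> {0..l} \<Longrightarrow> u x \<le> a + integral {0..x} (\<lambda>t. w t * u t)"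
    and x: "x \<in> {0..l}"
  shows "u x \<le> a * exp (integral {0..x} w)"
proof -
  define P where "P = (\<lambda>x. 0 + integral {0..x} (\<lambda>t. w t * u t))"
  define E where "E = (\<lambda>x. exp (- (0 + integral {0..x} w)))"
  have P: "AC_with_deriv l P (\<lambda>t. w t * u t)"
    unfolding P_def by (intro AC_with_deriv_integral absolutely_integrable_bilinear_continuous[OF bounded_bilinear_mult w u])
  have E: "AC_with_deriv l E (\<lambda>t. - w t * E t)"
    unfolding E_def by (intro AC_with_deriv_exp l AC_with_deriv_minus AC_with_deriv_integral w)
  have PE: "AC_with_deriv l (\<lambda>x. P x * E x + a * E x) (\<lambda>t. (w t * u t * E t + P t * (- w t * E t)) + a * (- w t * E t))"
    by (intro AC_with_deriv_add AC_with_deriv_bilinear[OF l bounded_bilinear_mult P E] AC_with_deriv_linear[OF E] bounded_linear_mult_right)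
  have "P x * E x + a * E x \<le> P 0 * E 0 + a * E 0"
  proof (rule AC_with_deriv_decreasing[OF PE _ x])
    fix t assume t: "t \<in> {0..l}"
    have "u t - P t - a \<le> 0" using le[OF t] by (simp add: P_def)
    moreover have "0 \<le> w t * E t" using w0[OF t] by (simp add: E_def)
    ultimately have "w t * E t * (u t - P t - a) \<le> 0" by (simp add: mult_nonneg_nonpos)
    then show "(w t * u t * E t + P t * (- w t * E t)) + a * (- w t * E t) \<le> 0"
      by (simp add: algebra_simps)
  qed
  then have le': "(P x + a) * E x \<le> a" by (simp add: P_def E_def algebra_simps)
  have "u x \<le> P x + a" using le[OF x] by (simp add: P_def)
  moreover have E0: "E x > 0" by (simp add: E_def)
  ultimately have "u x * E x \<le> (P x + a) * E x" by (simp only: mult_le_cancel_right_pos)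
  with le' have "u x * E x \<le> a" by (rule order_trans[rotated])
  then have "u x \<le> a * inverse (E x)" using E0 by (simp only: pos_le_divide_eq[symmetric] divide_inverse)
  moreover have "inverse (E x) = exp (integral {0..x} w)" by (simp only: E_def exp_minus inverse_inverse_eq add_0)
  ultimately show ?thesis by simp
qed

section \<open>Lebesgue integrals on an interval\<close>

lemma absolutely_integrable_Icc_iff_integrable:
  fixes f :: "real \<Rightarrow> 'a::euclidean_space"
  shows "f absolutely_integrable_on {a..b} \<longleftrightarrow> integrable (lebesgue_on {a..b}) f"
  by (simp add: set_integrable_def integrable_restrict_space)

lemma AC_with_deriv_has_integral:
  assumes "AC_with_deriv l y g" "0 \<le> s" "s \<le> t" "t \<le> l"
  shows "(g has_integral y t - y s) {s..t}"
proof -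
  have "g integrable_on {s..t}"
    using AC_with_derivD(2)[OF assms(1)] assms(2-4) by (auto intro: integrable_on_subinterval)
  then show ?thesis
    unfolding AC_with_deriv_diff[OF assms] by (rule integrable_integral)
qed

lemma AE_lebesgue_on_iff_negligible:
  assumes "S \<in> sets lebesgue"
  shows "(AE x in lebesgue_on S. P x) \<longleftrightarrow> (\<exists>Z. negligible Z \<and> (\<forall>x\<in>S - Z. P x))"
proof -
  have "(AE x in lebesgue_on S. P x) \<longleftrightarrow> (AE x in lebesgue. x \<in> S \<longrightarrow> P x)"
    using assms by (subst AE_restrict_space_iff) auto
  also have "\<dots> \<longleftrightarrow> (\<exists>Z. negligible Z \<and> (\<forall>x\<in>S - Z. P x))"
    unfolding eventually_ae_filter negligible_iff_null_sets
    by (auto simp: subset_iff)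
  finally show ?thesis .
qed

lemma integral_continuous_clamp_approx:
  fixes q :: "real \<Rightarrow> 'a::euclidean_space"
  assumes q: "q absolutely_integrable_on {a..b}" and e: "e > 0"
  obtains g where "continuous_on UNIV g" "integral {a..b} (\<lambda>x. norm (q x - g x)) < e"
proof -
  let ?M = "lebesgue_on {a..b}"
  define cl :: "real \<Rightarrow> 'a \<Rightarrow> 'a" where "cl N v = (N / max N (norm v)) *\<^sub>R v" for N v
  have cl_cont: "continuous_on UNIV (cl N)" if "N > 0" for N
    unfolding cl_def using that by (intro continuous_intros) auto
  have cl_norm: "norm (cl N v) \<le> N" "norm (cl N v) \<le> norm v" if "N > 0" for N v
    using that by (auto simp: cl_def field_simps max_def)
  have cl_id: "cl N v = v" if "N > 0" "norm v \<le> N" for N v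
    using that by (auto simp: cl_def max_def)
  have qi: "integrable ?M q" using q by (simp add: absolutely_integrable_Icc_iff_integrable)
  then have qm[measurable]: "q \<in> borel_measurable ?M" by auto
  have clm: "(\<lambda>x. cl N (f x)) \<in> borel_measurable ?M" if "N > 0" "f \<in> borel_measurable ?M" for N f
    using borel_measurable_continuous_onI[OF cl_cont[OF that(1)]] that(2) by (rule measurable_compose[rotated])
  have ieq: "integral\<^sup>L ?M (\<lambda>x. norm (f x)) = integral {a..b} (\<lambda>x. norm (f x))" if "integrable ?M f" for f :: "real \<Rightarrow> 'a"
    using that by (intro lebesgue_integral_eq_integral) auto
  have "(\<lambda>n. integral\<^sup>L ?M (\<lambda>x. norm (q x - cl (real (Suc n)) (q x)))) \<longlonglongrightarrow> integral\<^sup>L ?M (\<lambda>x. 0)"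
  proof (rule integral_dominated_convergence[where w="\<lambda>x. 2 * norm (q x)"])
    show "integrable ?M (\<lambda>x. 2 * norm (q x))" using qi by auto
    have [measurable]: "(\<lambda>x. cl (real (Suc i)) (q x)) \<in> borel_measurable ?M" for i
      by (rule clm[OF _ qm]) simp
    show "\<And>i. (\<lambda>x. norm (q x - cl (real (Suc i)) (q x))) \<in> borel_measurable ?M"
      by measurable
    show "AE x in ?M. (\<lambda>i. norm (q x - cl (real (Suc i)) (q x))) \<longlonglongrightarrow> 0"
    proof (rule AE_I2)
      fix x
      obtain n0 :: nat where n0: "norm (q x) \<le> real n0" using real_arch_simple by blast
      have "eventually (\<lambda>i. norm (q x - cl (real (Suc i)) (q x)) = 0) sequentially"
        using eventually_ge_at_top[of n0] by eventually_elim (use n0 in \<open>auto intro!: cl_id[symmetric]\<close>)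
      then show "(\<lambda>i. norm (q x - cl (real (Suc i)) (q x))) \<longlonglongrightarrow> 0" by (rule tendsto_eventually)
    qed
    show "\<And>i. AE x in ?M. norm (norm (q x - cl (real (Suc i)) (q x))) \<le> 2 * norm (q x)"
    proof (rule AE_I2)
      fix i x show "norm (norm (q x - cl (real (Suc i)) (q x))) \<le> 2 * norm (q x)"
        using norm_triangle_ineq4[of "q x" "cl (real (Suc i)) (q x)"] cl_norm(2)[of "real (Suc i)" "q x"] by simp
    qed
  qed simp
  then have "eventually (\<lambda>n. integral\<^sup>L ?M (\<lambda>x. norm (q x - cl (real (Suc n)) (q x))) < e/2) sequentially"
    using e by (intro order_tendstoD) auto
  then obtain n where n: "integral\<^sup>L ?M (\<lambda>x. norm (q x - cl (real (Suc n)) (q x))) < e/2"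
    by (auto simp: eventually_sequentially)
  define N where "N = real (Suc n)"
  have N: "N > 0" "integral\<^sup>L ?M (\<lambda>x. norm (q x - cl N (q x))) < e/2" using n by (auto simp: N_def)
  have "q measurable_on {a..b}" by (subst measurable_on_iff_borel_measurable) auto
  then obtain Z g where Z: "negligible Z" and g: "\<And>n. continuous_on UNIV (g n)"
    and lim: "\<And>x. x \<notin> Z \<Longrightarrow> (\<lambda>n. g n x) \<longlonglongrightarrow> (if x \<in> {a..b} then q x else 0)"
    unfolding measurable_on_def by metis
  have gm: "g i \<in> borel_measurable ?M" for i :: nat
    using continuous_imp_measurable_on_sets_lebesgue[OF continuous_on_subset[OF g[of i]], of "{a..b}"] by auto
  have "(\<lambda>n. integral\<^sup>L ?M (\<lambda>x. norm (cl N (q x) - cl N (g n x)))) \<longlonglongrightarrow> integral\<^sup>L ?M (\<lambda>x. 0)"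
  proof (rule integral_dominated_convergence[where w="\<lambda>x. 2 * N"])
    show "integrable ?M (\<lambda>x. 2 * N)" by (auto simp: absolutely_integrable_Icc_iff_integrable[symmetric])
    show "\<And>i. (\<lambda>x. norm (cl N (q x) - cl N (g i x))) \<in> borel_measurable ?M"
      using clm[OF N(1) qm] clm[OF N(1) gm] by measurable
    have "AE x in ?M. x \<notin> Z"
      using Z by (subst AE_lebesgue_on_iff_negligible) auto
    moreover have "AE x in ?M. x \<in> {a..b}" by (rule AE_I2) simp
    ultimately show "AE x in ?M. (\<lambda>i. norm (cl N (q x) - cl N (g i x))) \<longlonglongrightarrow> 0"
    proof eventually_elim
      fix x assume "x \<notin> Z" "x \<in> {a..b}"
      then have "(\<lambda>n. g n x) \<longlonglongrightarrow> q x" using lim[of x] by simp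
      then have "(\<lambda>n. cl N (g n x)) \<longlonglongrightarrow> cl N (q x)"
        using cl_cont[OF N(1)] by (intro continuous_on_tendsto_compose[of UNIV "cl N"]) auto
      then show "(\<lambda>i. norm (cl N (q x) - cl N (g i x))) \<longlonglongrightarrow> 0"
        using tendsto_norm_zero[OF LIM_zero] by (subst norm_minus_commute) auto
    qed
    show "\<And>i. AE x in ?M. norm (norm (cl N (q x) - cl N (g i x))) \<le> 2 * N"
    proof (rule AE_I2)
      fix i x show "norm (norm (cl N (q x) - cl N (g i x))) \<le> 2 * N"
        using norm_triangle_ineq4[of "cl N (q x)" "cl N (g i x)"] cl_norm(1)[OF N(1), of "q x"] cl_norm(1)[OF N(1), of "g i x"] by simp
    qed
  qed simp
  then have "eventually (\<lambda>n. integral\<^sup>L ?M (\<lambda>x. norm (cl N (q x) - cl N (g n x))) < e/2) sequentially"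
    using e by (intro order_tendstoD) auto
  then obtain k where k: "integral\<^sup>L ?M (\<lambda>x. norm (cl N (q x) - cl N (g k x))) < e/2"
    by (auto simp: eventually_sequentially)
  have "continuous_on UNIV (\<lambda>x. cl N (g k x))"
    using continuous_on_compose2[OF cl_cont[OF N(1)] g[of k]] by simp
  then have cg: "(\<lambda>x. cl N (g k x)) absolutely_integrable_on {a..b}"
    by (meson absolutely_integrable_continuous_real continuous_on_subset subset_UNIV)
  have cq: "integrable ?M (\<lambda>x. cl N (q x))"
    by (rule Bochner_Integration.integrable_bound[OF qi clm[OF N(1) qm]]) (auto intro!: AE_I2 cl_norm(2)[OF N(1)])
  have cg': "integrable ?M (\<lambda>x. cl N (g k x))" using cg by (simp add: absolutely_integrable_Icc_iff_integrable)
  have "integral {a..b} (\<lambda>x. norm (q x - cl N (g k x))) = integral\<^sup>L ?M (\<lambda>x. norm (q x - cl N (g k x)))"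
    by (rule ieq[symmetric]) (intro Bochner_Integration.integrable_diff qi cg')
  also have "\<dots> \<le> integral\<^sup>L ?M (\<lambda>x. norm (q x - cl N (q x)) + norm (cl N (q x) - cl N (g k x)))"
  proof (rule integral_mono)
    fix x show "norm (q x - cl N (g k x)) \<le> norm (q x - cl N (q x)) + norm (cl N (q x) - cl N (g k x))"
      using norm_triangle_ineq[of "q x - cl N (q x)" "cl N (q x) - cl N (g k x)"] by simp
  qed (intro Bochner_Integration.integrable_add integrable_norm Bochner_Integration.integrable_diff qi cg' cq)+
  also have "\<dots> = integral\<^sup>L ?M (\<lambda>x. norm (q x - cl N (q x))) + integral\<^sup>L ?M (\<lambda>x. norm (cl N (q x) - cl N (g k x)))"
    by (intro Bochner_Integration.integral_add integrable_norm Bochner_Integration.integrable_diff qi cg' cq)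
  also have "\<dots> < e" using N(2) k by simp
  finally show ?thesis using that \<open>continuous_on UNIV (\<lambda>x. cl N (g k x))\<close> by blast
qed

text \<open>The Riemann-Lebesgue argument integrates by parts, so the approximant must have an
  integrable derivative; a polynomial close to a continuous approximant does. The tolerance is
  divided by \<open>l + 1\<close> because l may be zero here.\<close>

lemma L1_approx_AC:
  fixes q :: "real \<Rightarrow> 'a::euclidean_space"
  assumes l: "0 \<le> l" and q: "q absolutely_integrable_on {0..l}" and e: "e > 0"
  obtains p p' where "AC_with_deriv l p p'" "integral {0..l} (\<lambda>x. norm (q x - p x)) < e"
proof -
  obtain g where g: "continuous_on UNIV g" "integral {0..l} (\<lambda>x. norm (q x - g x)) < e/2"
    using integral_continuous_clamp_approx[OF q, of "e/2"] e by auto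
  have gl: "continuous_on {0..l} g" using g(1) continuous_on_subset by blast
  define d where "d = e / 2 / (l + 1)"
  have d: "d > 0" using e l by (simp add: d_def)
  obtain p where p: "polynomial_function p" "\<And>x. x \<in> {0..l} \<Longrightarrow> norm (g x - p x) < d"
    using Stone_Weierstrass_polynomial_function[OF compact_Icc gl d] by blast
  obtain p' where p': "polynomial_function p'" "\<And>x. (p has_vector_derivative (p' x)) (at x)"
    using has_vector_derivative_polynomial_function[OF p(1)] by blast
  have cp: "continuous_on {0..l} p" and cp': "continuous_on {0..l} p'"
    using p(1) p'(1) by (auto intro: continuous_on_polymonial_function)
  have AC: "AC_with_deriv l p p'"
  proof (rule AC_with_derivI)
    show "p' absolutely_integrable_on {0..l}" by (rule absolutely_integrable_continuous_real[OF cp'])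
    fix x assume x: "x \<in> {0..l}"
    have "(p' has_integral p x - p 0) {0..x}"
      using x p'(2) by (intro fundamental_theorem_of_calculus) (auto intro: has_vector_derivative_at_within)
    then show "p x = p 0 + integral {0..x} p'" by (simp add: integral_unique)
  qed
  have ag: "g absolutely_integrable_on {0..l}" and ap: "p absolutely_integrable_on {0..l}"
    by (auto intro: absolutely_integrable_continuous_real gl cp)
  have i1: "(\<lambda>x. norm (q x - g x)) integrable_on {0..l}" and i2: "(\<lambda>x. norm (q x - p x)) integrable_on {0..l}"
    using set_integral_diff(1)[OF q ag] set_integral_diff(1)[OF q ap] by (auto simp: absolutely_integrable_on_def)
  have "integral {0..l} (\<lambda>x. norm (q x - p x)) \<le> integral {0..l} (\<lambda>x. norm (q x - g x) + d)"
  proof (rule integral_le[OF i2])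
    show "(\<lambda>x. norm (q x - g x) + d) integrable_on {0..l}" by (intro integrable_add i1) auto
    fix x assume "x \<in> {0..l}"
    have "norm (q x - p x) \<le> norm (q x - g x) + norm (g x - p x)" using norm_triangle_ineq[of "q x - g x" "g x - p x"] by simp
    then show "norm (q x - p x) \<le> norm (q x - g x) + d" using p(2)[OF \<open>x \<in> {0..l}\<close>] by simp
  qed
  also have "\<dots> = integral {0..l} (\<lambda>x. norm (q x - g x)) + d * l"
    using l by (subst Henstock_Kurzweil_Integration.integral_add[OF i1]) auto
  also have "d * l \<le> e / 2" using l e by (auto simp: d_def field_simps)
  finally show ?thesis using that[OF AC] g(2) by linarith
qed

text \<open>The derivative of the phase is bounded and bounded away from zero, with no further
  smoothness. Writing m as \<open>r' * q\<close> and replacing q in L1 by an absolutely continuous p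
  allows an integration by parts that gains a factor \<open>1 / lam\<close>. One threshold R serves
  the whole strip and all upper limits x.\<close>

lemma riemann_lebesgue_phase:
  fixes r r' :: "real \<Rightarrow> real" and m :: "real \<Rightarrow> complex"
  assumes l: "0 \<le> l" and r: "AC_with_deriv l r r'" and m: "m absolutely_integrable_on {0..l}"
    and r'm: "r' \<in> borel_measurable (lebesgue_on {0..l})"
    and lo: "0 < \<theta>" "\<And>x. x \<in> {0..l} \<Longrightarrow> \<theta> \<le> \<bar>r' x\<bar>"
    and hi: "\<And>x. x \<in> {0..l} \<Longrightarrow> \<bar>r' x\<bar> \<le> B"
    and e: "e > 0"
  obtains R where "\<And>lam x. \<lbrakk>\<bar>Im lam\<bar> \<le> h; R \<le> cmod lam; x \<in> {0..l}\<rbrakk> \<Longrightarrow>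
     cmod (integral {0..x} (\<lambda>t. exp (- (\<i> * lam * of_real (r t))) * m t)) \<le> e"
proof -
  have B: "B > 0" using lo hi[of 0] lo(2)[of 0] l by fastforce
  define q where "q = (\<lambda>x. of_real (1 / r' x) * m x)"
  have q: "q absolutely_integrable_on {0..l}"
    unfolding q_def
  proof (rule absolutely_integrable_bounded_measurable_product[where h="(*)", OF _ _ _ _ m])
    show "bilinear ((*) :: complex \<Rightarrow> complex \<Rightarrow> complex)" by (simp add: bilinear_times)
    show "(\<lambda>x. complex_of_real (1 / r' x)) \<in> borel_measurable (lebesgue_on {0..l})"
      using r'm by measurable
    show "bounded ((\<lambda>x. complex_of_real (1 / r' x)) ` {0..l})"
      unfolding bounded_iff
    proof (intro exI[of _ "1/\<theta>"] ballI)
      fix y assume "y \<in> (\<lambda>x. complex_of_real (1 / r' x)) ` {0..l}"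
      then obtain x where "x \<in> {0..l}" "y = complex_of_real (1 / r' x)" by blast
      then show "norm y \<le> 1/\<theta>" using lo(2)[of x] lo(1) by (simp add: norm_divide frac_le)
    qed
  qed auto
  obtain K where K: "K > 0" "\<And>x. x \<in> {0..l} \<Longrightarrow> norm (r x) \<le> K"
    using bounded_continuous_Icc[OF AC_with_deriv_continuous[OF r]] by blast
  define E where "E = exp (\<bar>h\<bar> * K)"
  have E: "E \<ge> 1" unfolding E_def using K by simp
  define e1 where "e1 = e / 2 / (E * B)"
  have e1: "e1 > 0" using e E B by (simp add: e1_def)
  obtain p p' where p: "AC_with_deriv l p p'" and pq: "integral {0..l} (\<lambda>x. norm (q x - p x)) < e1"
    using L1_approx_AC[OF l q e1] by blast
  obtain Kp where Kp: "Kp > 0" "\<And>x. x \<in> {0..l} \<Longrightarrow> norm (p x) \<le> Kp"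
    using bounded_continuous_Icc[OF AC_with_deriv_continuous[OF p]] by blast
  have ip': "(\<lambda>t. norm (p' t)) integrable_on {0..l}"
    using AC_with_derivD(1)[OF p] by (auto simp: absolutely_integrable_on_def)
  define T where "T = integral {0..l} (\<lambda>t. norm (p' t))"
  have T: "T \<ge> 0" unfolding T_def by (intro Henstock_Kurzweil_Integration.integral_nonneg ip') auto
  \<comment> \<open>Makes the boundary terms and the integral of \<open>p'\<close>, together at most
    \<open>E * (T + 2 * Kp)\<close>, at most \<open>e / 2 * cmod lam\<close>; the added 1 keeps R
    positive.\<close>
  define R where "R = 2 * E * (T + 2 * Kp) / e + 1"
  have R: "R > 0" unfolding R_def using E T Kp e by (intro add_nonneg_pos divide_nonneg_pos mult_nonneg_nonneg) auto
  show ?thesis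
  proof (rule that)
    fix lam x assume im: "\<bar>Im lam\<bar> \<le> h" and lam: "R \<le> cmod lam" and x: "x \<in> {0..l}"
    define f where "f = (\<lambda>t. exp (- (\<i> * lam * complex_of_real (r t))))"
    have fE: "cmod (f t) \<le> E" if "t \<in> {0..l}" for t
    proof -
      have "Im lam * r t \<le> \<bar>Im lam\<bar> * \<bar>r t\<bar>" by (metis abs_ge_self abs_mult)
      also have "\<dots> \<le> \<bar>h\<bar> * K" using im K(2)[OF that] by (intro mult_mono) auto
      finally show ?thesis by (simp add: f_def E_def)
    qed
    have f: "AC_with_deriv l f (\<lambda>t. - (\<i> * lam * complex_of_real (r' t)) * f t)"
      unfolding f_def
      by (intro AC_with_deriv_exp[OF l] AC_with_deriv_minus AC_with_deriv_linear[OF r]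
        bounded_linear_compose[OF bounded_linear_mult_right bounded_linear_of_real])
    note cf = AC_with_deriv_continuous[OF f]
    have fp: "AC_with_deriv l (\<lambda>t. f t * p t) (\<lambda>t. (- (\<i> * lam * complex_of_real (r' t)) * f t) * p t + f t * p' t)"
      by (rule AC_with_deriv_bilinear[OF l bounded_bilinear_mult f p])
    have sub: "{0..x} \<subseteq> {0..l}" using x by auto
    have afp': "(\<lambda>t. p' t * f t) absolutely_integrable_on {0..l}"
      by (rule absolutely_integrable_bilinear_continuous[OF bounded_bilinear_mult AC_with_derivD(1)[OF p] cf])
    then have ifp': "(\<lambda>t. f t * p' t) integrable_on {0..x}"
      using sub by (auto simp: absolutely_integrable_on_def mult.commute intro: integrable_on_subinterval)
    have "((\<lambda>t. (- (\<i> * lam * complex_of_real (r' t)) * f t) * p t + f t * p' t - f t * p' t) has_integral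
         (f x * p x - f 0 * p 0 - integral {0..x} (\<lambda>t. f t * p' t))) {0..x}"
      using AC_with_deriv_has_integral[OF fp, of 0 x] x
      by (intro has_integral_diff integrable_integral ifp') auto
    then have hi1: "((\<lambda>t. - (\<i> * lam) * (complex_of_real (r' t) * f t * p t)) has_integral
         (f x * p x - f 0 * p 0 - integral {0..x} (\<lambda>t. f t * p' t))) {0..x}" by (simp add: mult_ac)
    have lam0: "lam \<noteq> 0" using lam R by auto
    \<comment> \<open>I1 is the integral of \<open>r' * f * p\<close>, computed by parts; the
      remainder \<open>r' * f * (q - p)\<close> is small in L1.\<close>
    define I1 where "I1 = (f x * p x - f 0 * p 0 - integral {0..x} (\<lambda>t. f t * p' t)) / (- (\<i> * lam))"
    have hi2: "((\<lambda>t. complex_of_real (r' t) * f t * p t) has_integral I1) {0..x}"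
      using has_integral_mult_right[OF hi1, of "inverse (- (\<i> * lam))"] lam0
      by (simp add: I1_def field_simps)
    have am: "(\<lambda>t. m t * f t) absolutely_integrable_on {0..l}"
      by (rule absolutely_integrable_bilinear_continuous[OF bounded_bilinear_mult m cf])
    have hi3: "((\<lambda>t. f t * m t) has_integral integral {0..x} (\<lambda>t. f t * m t)) {0..x}"
      using am sub by (intro integrable_integral) (auto simp: absolutely_integrable_on_def mult.commute intro: integrable_on_subinterval)
    have eq: "f t * m t - complex_of_real (r' t) * f t * p t = complex_of_real (r' t) * f t * (q t - p t)" if "t \<in> {0..l}" for t
      using lo(1) lo(2)[OF that] by (auto simp: q_def field_simps)
    have hi4: "((\<lambda>t. complex_of_real (r' t) * f t * (q t - p t)) has_integral integral {0..x} (\<lambda>t. f t * m t) - I1) {0..x}"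
      using has_integral_diff[OF hi3 hi2] by (rule has_integral_eq[rotated]) (use eq sub in auto)
    have "(\<lambda>x. q x - p x) absolutely_integrable_on {0..l}"
      by (intro set_integral_diff q absolutely_integrable_continuous_real AC_with_deriv_continuous[OF p])
    then have iqp: "(\<lambda>x. norm (q x - p x)) integrable_on {0..l}" by (auto simp: absolutely_integrable_on_def)
    have "cmod (integral {0..x} (\<lambda>t. f t * m t) - I1) \<le> integral {0..x} (\<lambda>t. B * E * norm (q t - p t))"
      unfolding integral_unique[OF hi4, symmetric]
    proof (rule integral_norm_bound_integral)
      show "(\<lambda>t. complex_of_real (r' t) * f t * (q t - p t)) integrable_on {0..x}" using hi4 by blast
      show "(\<lambda>t. B * E * norm (q t - p t)) integrable_on {0..x}"
        by (intro integrable_on_mult_right integrable_on_subinterval[OF iqp sub])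
      fix t assume "t \<in> {0..x}"
      then have t: "t \<in> {0..l}" using sub by auto
      show "cmod (complex_of_real (r' t) * f t * (q t - p t)) \<le> B * E * norm (q t - p t)"
        using hi[OF t] fE[OF t] E B by (auto simp: norm_mult intro!: mult_right_mono mult_mono)
    qed
    also have "\<dots> = B * E * integral {0..x} (\<lambda>t. norm (q t - p t))" by simp
    also have "\<dots> \<le> B * E * integral {0..l} (\<lambda>t. norm (q t - p t))"
      using B E by (intro mult_left_mono integral_subset_le sub iqp integrable_on_subinterval[OF iqp sub]) auto
    also have "\<dots> \<le> B * E * e1" using pq B E by (intro mult_left_mono) auto
    also have "\<dots> = e / 2" using B E by (simp add: e1_def)
    finally have b1: "cmod (integral {0..x} (\<lambda>t. f t * m t) - I1) \<le> e / 2" .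
    have b2: "cmod (integral {0..x} (\<lambda>t. f t * p' t)) \<le> E * T"
    proof -
      have "cmod (integral {0..x} (\<lambda>t. f t * p' t)) \<le> integral {0..x} (\<lambda>t. E * norm (p' t))"
      proof (rule integral_norm_bound_integral[OF ifp'])
        show "(\<lambda>t. E * norm (p' t)) integrable_on {0..x}"
          by (intro integrable_on_mult_right integrable_on_subinterval[OF ip' sub])
        fix t assume "t \<in> {0..x}"
        then have t: "t \<in> {0..l}" using sub by auto
        show "cmod (f t * p' t) \<le> E * norm (p' t)" using fE[OF t] by (simp add: norm_mult mult_right_mono)
      qed
      also have "\<dots> = E * integral {0..x} (\<lambda>t. norm (p' t))" by simp
      also have "\<dots> \<le> E * T" unfolding T_def
        using E by (intro mult_left_mono integral_subset_le sub ip' integrable_on_subinterval[OF ip' sub]) auto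
      finally show ?thesis .
    qed
    have x0: "0 \<in> {0..l}" using l by simp
    have b3: "cmod (f y * p y) \<le> E * Kp" if "y \<in> {0..l}" for y
      using fE[OF that] Kp(2)[OF that] E by (simp add: norm_mult mult_mono)
    have "cmod (f x * p x - f 0 * p 0 - integral {0..x} (\<lambda>t. f t * p' t)) \<le> E * Kp + E * Kp + E * T"
      by (intro order_trans[OF norm_triangle_ineq4] add_mono b2 b3 x x0)
    also have "\<dots> = E * (T + 2 * Kp)" by (simp add: algebra_simps)
    also have "\<dots> \<le> e / 2 * R" using e by (simp add: R_def field_simps)
    also have "\<dots> \<le> e / 2 * cmod lam" using e lam by (intro mult_left_mono) auto
    finally have "cmod I1 \<le> e / 2" using lam0 by (simp add: I1_def norm_divide norm_mult divide_le_eq)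
    with b1 have "cmod (integral {0..x} (\<lambda>t. f t * m t)) \<le> e / 2 + e / 2"
      using norm_triangle_ineq[of "integral {0..x} (\<lambda>t. f t * m t) - I1" I1] by simp
    then show "cmod (integral {0..x} (\<lambda>t. exp (- (\<i> * lam * complex_of_real (r t))) * m t)) \<le> e"
      by (simp add: f_def)
  qed
qed

section \<open>Vector- and matrix-valued functions\<close>

no_notation fps_nth (infixl \<open>$\<close> 75)

lemma AC_with_deriv_nth:
  assumes "AC_with_deriv l y g"
  shows "AC_with_deriv l (\<lambda>x. y x $ k) (\<lambda>x. g x $ k)"
  by (rule AC_with_deriv_linear[OF assms bounded_linear_vec_nth])

lemma bounded_linear_axis: "bounded_linear (axis k :: 'a::euclidean_space \<Rightarrow> 'a^'n)"
  unfolding linear_conv_bounded_linear[symmetric] by (auto intro!: linearI simp: vec_eq_iff axis_def)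

lemma AC_with_deriv_vec:
  fixes y :: "real \<Rightarrow> 'a::euclidean_space^'n"
  assumes "\<And>k. AC_with_deriv l (\<lambda>x. y x $ k) (\<lambda>x. g x $ k)"
  shows "AC_with_deriv l y g"
proof -
  have "v = (\<Sum>k\<in>UNIV. axis k (v $ k))" for v :: "'a^'n"
    by (simp add: vec_eq_iff axis_def if_distrib cong: if_cong)
  then have eq: "(\<lambda>x. \<Sum>k\<in>UNIV. axis k (v x $ k)) = v" for v :: "real \<Rightarrow> 'a^'n" by (simp add: fun_eq_iff)
  have "AC_with_deriv l (\<lambda>x. \<Sum>k\<in>UNIV. axis k (y x $ k)) (\<lambda>x. \<Sum>k\<in>UNIV. axis k (g x $ k))"
    by (intro AC_with_deriv_sum AC_with_deriv_linear[OF assms] bounded_linear_axis)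
  then show ?thesis unfolding eq .
qed

lemma norm_matrix_vector_mult_le:
  fixes A :: "complex^'n^'m"
  shows "norm (A *v x) \<le> norm A * norm x"
proof -
  have "cmod ((A *v x) $ i) \<le> norm (A $ i) * norm x" for i
  proof -
    have "cmod ((A *v x) $ i) \<le> (\<Sum>j\<in>UNIV. \<bar>cmod (A $ i $ j)\<bar> * \<bar>cmod (x $ j)\<bar>)"
      unfolding matrix_vector_mult_def by (auto intro!: order_trans[OF norm_sum] simp: norm_mult)
    also have "\<dots> \<le> norm (A $ i) * norm x"
      unfolding norm_vec_def by (rule L2_set_mult_ineq)
    finally show ?thesis .
  qed
  then have "norm (A *v x) \<le> L2_set (\<lambda>i. norm (A $ i) * norm x) UNIV"
    unfolding norm_vec_def[of "A *v x"] by (intro L2_set_mono) auto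
  also have "\<dots> = norm A * norm x"
    unfolding norm_vec_def[of A] by (rule L2_set_left_distrib[symmetric]) simp
  finally show ?thesis .
qed

lemma bounded_bilinear_matrix_vector: "bounded_bilinear (\<lambda>(A::complex^'n^'m) x. A *v x)"
  by (rule bounded_bilinear.intro)
    (auto simp: vec_eq_iff matrix_vector_mult_def ring_distribs sum.distrib
      scaleR_sum_right intro!: exI[of _ 1] norm_matrix_vector_mult_le[unfolded matrix_vector_mult_def])

lemma bounded_bilinear_matrix_matrix: "bounded_bilinear (\<lambda>(A::complex^'n^'m) (B::complex^'p^'n). A ** B)"
  unfolding bilinear_conv_bounded_bilinear[symmetric] bilinear_def
  by (auto intro!: linearI simp: vec_eq_iff matrix_matrix_mult_def ring_distribs sum.distrib scaleR_sum_right)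

lemma norm_vec_le_const:
  fixes v :: "'a::real_normed_vector^'n"
  assumes "\<And>k. norm (v $ k) \<le> K"
  shows "norm v \<le> real CARD('n) * K"
proof -
  have "norm v \<le> (\<Sum>k\<in>UNIV. norm (v $ k))" unfolding norm_vec_def by (rule L2_set_le_sum) auto
  also have "\<dots> \<le> of_nat (card (UNIV :: 'n set)) * K" by (rule sum_bounded_above) (use assms in auto)
  finally show ?thesis by simp
qed

lemma norm_matrix_le_const:
  fixes A :: "complex^'n^'m"
  assumes "\<And>j k. norm (A $ j $ k) \<le> K"
  shows "norm A \<le> real CARD('m) * (real CARD('n) * K)"
  by (intro norm_vec_le_const assms)

section \<open>Bounds and inverses for linear matrix equations\<close>

lemma AC_with_deriv_gronwall:
  fixes y :: "real \<Rightarrow> 'a::euclidean_space"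
  assumes l: "0 \<le> l" and y: "AC_with_deriv l y g"
    and a: "a absolutely_integrable_on {0..l}" "\<And>x. x \<in> {0..l} \<Longrightarrow> 0 \<le> a x"
    and b: "b integrable_on {0..l}" "\<And>x. x \<in> {0..l} \<Longrightarrow> 0 \<le> b x"
    and g: "\<And>x. x \<in> {0..l} \<Longrightarrow> norm (g x) \<le> a x * norm (y x) + b x"
    and x: "x \<in> {0..l}"
  shows "norm (y x) \<le> (norm (y 0) + integral {0..l} b) * exp (integral {0..l} a)"
proof -
  have cn: "continuous_on {0..l} (\<lambda>x. norm (y x))" by (intro continuous_intros AC_with_deriv_continuous[OF y])
  have ai: "a integrable_on {0..l}" using a(1) by (auto simp: absolutely_integrable_on_def)
  have ay: "(\<lambda>t. a t * norm (y t)) integrable_on {0..l}"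
    using absolutely_integrable_bilinear_continuous[OF bounded_bilinear_mult a(1) cn] by (auto simp: absolutely_integrable_on_def)
  have "norm (y x) \<le> (norm (y 0) + integral {0..l} b) * exp (integral {0..x} a)"
  proof (rule gronwall_integral[OF l cn a _ x])
    fix x assume x: "x \<in> {0..l}"
    then have sub: "{0..x} \<subseteq> {0..l}" by auto
    have "y x = y 0 + integral {0..x} g" by (rule AC_with_derivD(3)[OF y x])
    then have "norm (y x) \<le> norm (y 0) + norm (integral {0..x} g)" by (simp add: norm_triangle_ineq)
    also have "norm (integral {0..x} g) \<le> integral {0..x} (\<lambda>t. a t * norm (y t) + b t)"
      using sub g by (intro integral_norm_bound_integral integrable_add integrable_on_subinterval[OF ay]
        integrable_on_subinterval[OF b(1)] integrable_on_subinterval[OF AC_with_derivD(2)[OF y]]) auto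
    also have "\<dots> = integral {0..x} (\<lambda>t. a t * norm (y t)) + integral {0..x} b"
      using sub by (intro Henstock_Kurzweil_Integration.integral_add integrable_on_subinterval[OF ay] integrable_on_subinterval[OF b(1)])
    also have "integral {0..x} b \<le> integral {0..l} b"
      using sub b by (intro integral_subset_le integrable_on_subinterval[OF b(1)]) auto
    finally show "norm (y x) \<le> norm (y 0) + integral {0..l} b + integral {0..x} (\<lambda>t. a t * norm (y t))" by simp
  qed auto
  also have "\<dots> \<le> (norm (y 0) + integral {0..l} b) * exp (integral {0..l} a)"
  proof (intro mult_left_mono)
    show "exp (integral {0..x} a) \<le> exp (integral {0..l} a)"
      using x a by (auto intro!: integral_subset_le integrable_on_subinterval[OF ai])
    show "0 \<le> norm (y 0) + integral {0..l} b"
      using b by (intro add_nonneg_nonneg Henstock_Kurzweil_Integration.integral_nonneg) auto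
  qed
  finally show ?thesis .
qed

text \<open>Backward Gronwall: the square of \<open>norm y\<close> times
  \<open>exp (2 * integral a)\<close> is nondecreasing, and squaring avoids differentiating the
  norm. It yields injectivity of a fundamental matrix together with a bound for the inverse.\<close>

lemma AC_with_deriv_lower_bound:
  fixes y :: "real \<Rightarrow> 'a::euclidean_space"
  assumes l: "0 \<le> l" and y: "AC_with_deriv l y g"
    and a: "a absolutely_integrable_on {0..l}"
    and g: "\<And>x. x \<in> {0..l} \<Longrightarrow> norm (g x) \<le> a x * norm (y x)"
    and x: "x \<in> {0..l}"
  shows "norm (y 0) \<le> norm (y x) * exp (integral {0..x} a)"
proof -
  have 1: "AC_with_deriv l (\<lambda>x. exp (2 * (0 + integral {0..x} a))) (\<lambda>x. 2 * a x * exp (2 * (0 + integral {0..x} a)))"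
    by (intro AC_with_deriv_exp l AC_with_deriv_linear[OF AC_with_deriv_integral[OF a]] bounded_linear_mult_right)
  have 2: "AC_with_deriv l (\<lambda>x. y x \<bullet> y x) (\<lambda>x. g x \<bullet> y x + y x \<bullet> g x)"
    by (rule AC_with_deriv_bilinear[OF l bounded_bilinear_inner y y])
  have "- ((y x \<bullet> y x) * exp (2 * (0 + integral {0..x} a))) \<le> - ((y 0 \<bullet> y 0) * exp (2 * (0 + integral {0..0} a)))"
  proof (rule AC_with_deriv_decreasing[OF AC_with_deriv_minus[OF AC_with_deriv_bilinear[OF l bounded_bilinear_mult 2 1]] _ x])
    fix t assume t: "t \<in> {0..l}"
    have "- (g t \<bullet> y t) \<le> norm (g t) * norm (y t)" using Cauchy_Schwarz_ineq2[of "g t" "y t"] by linarith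
    also have "\<dots> \<le> a t * norm (y t) * norm (y t)" using g[OF t] by (intro mult_right_mono) auto
    also have "\<dots> = a t * (y t \<bullet> y t)" by (simp add: power2_norm_eq_inner[symmetric] power2_eq_square)
    finally have "0 \<le> (g t \<bullet> y t) + a t * (y t \<bullet> y t)" by linarith
    then have "0 \<le> 2 * exp (2 * (0 + integral {0..t} a)) * ((g t \<bullet> y t) + a t * (y t \<bullet> y t))" by simp
    then show "- ((g t \<bullet> y t + y t \<bullet> g t) * exp (2 * (0 + integral {0..t} a)) + (y t \<bullet> y t) * (2 * a t * exp (2 * (0 + integral {0..t} a)))) \<le> 0"
      by (simp add: algebra_simps inner_commute)
  qed
  then have "(norm (y 0))\<^sup>2 \<le> (norm (y x))\<^sup>2 * exp (2 * integral {0..x} a)"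
    by (simp add: power2_norm_eq_inner)
  also have "\<dots> = (norm (y x) * exp (integral {0..x} a))\<^sup>2"
    by (simp add: power_mult_distrib power2_eq_square exp_add[symmetric])
  finally show ?thesis by (rule power2_le_imp_le) auto
qed

lemma matrix_left_inverse_bounded:
  fixes W :: "real \<Rightarrow> complex^'n^'n"
  assumes low: "\<And>x v. x \<in> S \<Longrightarrow> norm v \<le> K * norm (W x *v v)"
  shows "x \<in> S \<Longrightarrow> matrix_inv (W x) ** W x = mat 1" "x \<in> S \<Longrightarrow> W x ** matrix_inv (W x) = mat 1"
    "x \<in> S \<Longrightarrow> norm (matrix_inv (W x)) \<le> real CARD('n) * (real CARD('n) * \<bar>K\<bar>)"
proof -
  show 1: "matrix_inv (W x) ** W x = mat 1" and 2: "W x ** matrix_inv (W x) = mat 1" if x: "x \<in> S" for x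
  proof -
    have "W x *v v = 0 \<Longrightarrow> v = 0" for v using low[OF x, of v] by simp
    then have "invertible (W x)"
      unfolding invertible_left_inverse matrix_left_invertible_ker by blast
    then show "matrix_inv (W x) ** W x = mat 1" "W x ** matrix_inv (W x) = mat 1"
      using someI_ex[of "\<lambda>A'. W x ** A' = mat 1 \<and> A' ** W x = mat 1"]
      by (auto simp: invertible_def matrix_inv_def)
  qed
  show "norm (matrix_inv (W x)) \<le> real CARD('n) * (real CARD('n) * \<bar>K\<bar>)" if x: "x \<in> S"
  proof (rule norm_matrix_le_const)
    fix j k
    let ?v = "matrix_inv (W x) *v axis k 1"
    have "matrix_inv (W x) $ j $ k = ?v $ j"
      by (simp add: matrix_vector_mult_def axis_def if_distrib cong: if_cong)
    also have "norm \<dots> \<le> norm ?v" by (rule Finite_Cartesian_Product.norm_nth_le)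
    also have "\<dots> \<le> K * norm (W x *v ?v)" by (rule low[OF x])
    also have "W x *v ?v = axis k 1" by (simp add: matrix_vector_mul_assoc 2[OF x])
    also have "K * norm (axis k 1 :: complex^'n) \<le> \<bar>K\<bar> * 1"
    proof (rule mult_mono)
    show "norm (axis k 1 :: complex^'n) \<le> 1"
      by (simp add: norm_vec_def L2_set_def axis_def if_distrib[of "\<lambda>z. (cmod z)\<^sup>2"] cong: if_cong)
    qed auto
    finally show "norm (matrix_inv (W x) $ j $ k) \<le> \<bar>K\<bar>" by simp
  qed
qed

text \<open>Continuity of the inverse V comes from
  \<open>V t - V x = V t ** (W x - W t) ** V x\<close>. Then the primitive V1 of
  \<open>V ** A\<close> starting at the identity is compared with V:
  \<open>E = V1 ** W - mat 1\<close> satisfies a homogeneous linear equation with zero initial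
  value, so it vanishes by Gronwall's inequality.\<close>

lemma AC_with_deriv_matrix_inverse:
  fixes W A :: "real \<Rightarrow> complex^'n^'n"
  assumes l: "0 \<le> l" and W0: "W 0 = mat 1" and A: "A absolutely_integrable_on {0..l}"
    and W: "AC_with_deriv l W (\<lambda>x. - (A x ** W x))"
  shows "\<And>x. x \<in> {0..l} \<Longrightarrow> matrix_inv (W x) ** W x = mat 1"
    and "\<And>x. x \<in> {0..l} \<Longrightarrow> W x ** matrix_inv (W x) = mat 1"
    and "AC_with_deriv l (\<lambda>x. matrix_inv (W x)) (\<lambda>x. matrix_inv (W x) ** A x)"
proof -
  interpret mv: bounded_bilinear "\<lambda>(A::complex^'n^'n) x. A *v x" by (rule bounded_bilinear_matrix_vector)
  interpret mm: bounded_bilinear "\<lambda>(A::complex^'n^'n) (B::complex^'n^'n). A ** B" by (rule bounded_bilinear_matrix_matrix)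
  have nA: "(\<lambda>x. norm (A x)) absolutely_integrable_on {0..l}" by (rule absolutely_integrable_norm[OF A, unfolded o_def])
  then have nAi: "(\<lambda>x. norm (A x)) integrable_on {0..l}" by (auto simp: absolutely_integrable_on_def)
  define K where "K = exp (integral {0..l} (\<lambda>x. norm (A x)))"
  have K: "K > 0" by (simp add: K_def)
  have low: "norm v \<le> K * norm (W x *v v)" if x: "x \<in> {0..l}" for x v
  proof -
    have "AC_with_deriv l (\<lambda>x. W x *v v) (\<lambda>x. - (A x ** W x) *v v)"
      by (rule AC_with_deriv_linear[OF W mv.bounded_linear_left])
    then have "norm (W 0 *v v) \<le> norm (W x *v v) * exp (integral {0..x} (\<lambda>x. norm (A x)))"
      by (rule AC_with_deriv_lower_bound[OF l _ nA _ x])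
        (simp add: mv.minus_left matrix_vector_mul_assoc[symmetric] norm_matrix_vector_mult_le)
    also have "\<dots> \<le> norm (W x *v v) * K"
      unfolding K_def using x by (intro mult_left_mono) (auto intro!: integral_subset_le integrable_on_subinterval[OF nAi] nAi)
    finally show ?thesis by (simp add: W0 mult.commute)
  qed
  define V where "V = (\<lambda>x. matrix_inv (W x))"
  have VW: "V x ** W x = mat 1" and WV: "W x ** V x = mat 1" if "x \<in> {0..l}" for x
    using matrix_left_inverse_bounded(1,2)[of "{0..l}" K W, OF low that] by (auto simp: V_def)
  then show "\<And>x. x \<in> {0..l} \<Longrightarrow> matrix_inv (W x) ** W x = mat 1"
    and "\<And>x. x \<in> {0..l} \<Longrightarrow> W x ** matrix_inv (W x) = mat 1" by (auto simp: V_def)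
  obtain KV where KV: "KV > 0" "\<And>x. x \<in> {0..l} \<Longrightarrow> norm (V x) \<le> KV"
    using matrix_left_inverse_bounded(3)[of "{0..l}" K W, OF low] K
    by (metis V_def abs_of_pos mult_pos_pos of_nat_0_less_iff zero_less_card_finite)
  obtain KW where KW: "KW > 0" "\<And>x. x \<in> {0..l} \<Longrightarrow> norm (W x) \<le> KW"
    using bounded_continuous_Icc[OF AC_with_deriv_continuous[OF W]] by blast
  obtain Km where Km: "Km > 0" "\<And>(A :: complex^'n^'n) (B :: complex^'n^'n). norm (A ** B) \<le> norm A * norm B * Km" using mm.pos_bounded by blast
  have Km2: "norm (A ** B) \<le> a * b * Km" if "norm A \<le> a" "norm B \<le> b" for a b and A B :: "complex^'n^'n"
  proof -
    have "0 \<le> a" using that(1) norm_ge_zero[of A] by linarith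
    then have "norm A * norm B * Km \<le> a * b * Km"
      using that Km(1) by (intro mult_right_mono mult_mono) auto
    then show ?thesis using Km(2)[of A B] by linarith
  qed
  have cV: "continuous_on {0..l} V"
    unfolding continuous_on_iff
  proof (intro ballI allI impI)
    fix x and e :: real assume x: "x \<in> {0..l}" and e: "e > 0"
    define K2 where "K2 = KV * Km * KV * Km"
    have K2: "K2 > 0" using KV Km by (simp add: K2_def)
    then have "e / K2 > 0" using e by simp
    then obtain d where d: "d > 0" "\<And>t. t \<in> {0..l} \<Longrightarrow> dist t x < d \<Longrightarrow> dist (W t) (W x) < e / K2"
      using AC_with_deriv_continuous[OF W] x unfolding continuous_on_iff by blast
    have "dist (V t) (V x) < e" if t: "t \<in> {0..l}" "dist t x < d" for t
    proof -
      have "V t ** (W x - W t) ** V x = V t ** (W x ** V x) - (V t ** W t) ** V x"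
        by (simp add: mm.diff_left mm.diff_right matrix_mul_assoc)
      also have "\<dots> = V t - V x" using VW[OF t(1)] WV[OF x] by simp
      finally have "norm (V t - V x) = norm (V t ** (W x - W t) ** V x)" by simp
      also have "\<dots> \<le> (KV * norm (W x - W t) * Km) * KV * Km"
        by (intro Km2 KV t x) auto
      also have "\<dots> = K2 * norm (W x - W t)" by (simp add: K2_def)
      also have "\<dots> < K2 * (e / K2)" using d(2)[OF t] K2
        by (intro mult_strict_left_mono) (auto simp: dist_norm norm_minus_commute)
      finally show ?thesis using K2 by (simp add: dist_norm)
    qed
    then show "\<exists>d>0. \<forall>t\<in>{0..l}. dist t x < d \<longrightarrow> dist (V t) (V x) < e" using d(1) by blast
  qed
  have aVA: "(\<lambda>x. V x ** A x) absolutely_integrable_on {0..l}"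
    using absolutely_integrable_bilinear_continuous[OF mm.flip A cV] by simp
  define V1 where "V1 = (\<lambda>x. mat 1 + integral {0..x} (\<lambda>x. V x ** A x))"
  have V1: "AC_with_deriv l V1 (\<lambda>x. V x ** A x)"
    unfolding V1_def by (rule AC_with_deriv_integral[OF aVA])
  define E where "E = (\<lambda>x. V1 x ** W x - mat 1)"
  have E: "AC_with_deriv l E (\<lambda>x. ((V x ** A x) ** W x + V1 x ** - (A x ** W x)) - 0)"
    unfolding E_def by (intro AC_with_deriv_sub AC_with_deriv_const AC_with_deriv_bilinear[OF l bounded_bilinear_matrix_matrix V1 W])
  define K3 where "K3 = KV * Km * KW * Km * Km"
  have K3: "K3 > 0" using KV KW Km by (simp add: K3_def)
  have E0: "norm (E x) \<le> (norm (E 0) + integral {0..l} (\<lambda>x. 0)) * exp (integral {0..l} (\<lambda>x. K3 * norm (A x)))" if "x \<in> {0..l}" for x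
  proof (rule AC_with_deriv_gronwall[OF l E _ _ _ _ _ that])
    show "(\<lambda>x. K3 * norm (A x)) absolutely_integrable_on {0..l}"
      using absolutely_integrable_scaleR_left[OF nA, of K3] by simp
    fix x assume x: "x \<in> {0..l}"
    have "E x ** V x = V1 x ** (W x ** V x) - V x" by (simp add: E_def mm.diff_left matrix_mul_assoc)
    then have EV: "E x ** V x = V1 x - V x" using WV[OF x] by simp
    have "((V x ** A x) ** W x + V1 x ** - (A x ** W x)) - 0 = - ((E x ** V x) ** (A x ** W x))"
      unfolding EV by (simp add: mm.diff_left mm.minus_right matrix_mul_assoc)
    also have "norm \<dots> \<le> (norm (E x) * KV * Km) * (norm (A x) * KW * Km) * Km"
      unfolding norm_minus_cancel by (intro Km2 KV KW x) auto
    also have "\<dots> = K3 * norm (A x) * norm (E x) + 0" by (simp add: K3_def)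
    finally show "norm (((V x ** A x) ** W x + V1 x ** - (A x ** W x)) - 0) \<le> K3 * norm (A x) * norm (E x) + 0" .
  qed (use K3 in auto)
  have "E 0 = 0" by (simp add: E_def V1_def W0)
  then have "V1 x ** W x = mat 1" if "x \<in> {0..l}" for x using E0[OF that] by (simp add: E_def)
  then have "V1 x = V x" if "x \<in> {0..l}" for x
    using WV[OF that] that by (metis matrix_mul_assoc matrix_mul_lid matrix_mul_rid)
  then have "AC_with_deriv l V (\<lambda>x. V x ** A x)"
    by (intro AC_with_deriv_cong[OF V1 l]) auto
  then show "AC_with_deriv l (\<lambda>x. matrix_inv (W x)) (\<lambda>x. matrix_inv (W x) ** A x)" by (simp add: V_def)
qed

section \<open>Asymptotics of solutions in a horizontal strip\<close>

lemma integral_vec_nth: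
  fixes f :: "real \<Rightarrow> 'a::euclidean_space^'n"
  assumes "f integrable_on S"
  shows "integral S f $ k = integral S (\<lambda>x. f x $ k)"
  using integral_linear[OF assms bounded_linear_vec_nth[of k]] by (simp add: o_def)

text \<open>The conditions on the weights, imposed in \<open>admissible_B\<close> almost everywhere, hold everywhere here:
  changing each weight on a null set does not affect the problem.\<close>
locale bvp =
  fixes l :: real and \<beta> :: "'n::finite \<Rightarrow> real \<Rightarrow> real" and Q :: "real \<Rightarrow> complex^'n^'n"
    and C D :: "complex^'n^'n" and W :: "real \<Rightarrow> complex^'n^'n" and b0 B \<theta> :: real
  assumes l: "0 < l"
    and beta_measurable: "\<And>k. \<beta> k \<in> borel_measurable (lebesgue_on {0..l})"
    and b0: "0 < b0" and beta_lo: "\<And>k x. x \<in> {0..l} \<Longrightarrow> b0 \<le> \<bar>\<beta> k x\<bar>"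
    and beta_hi: "\<And>k x. x \<in> {0..l} \<Longrightarrow> \<bar>\<beta> k x\<bar> \<le> B"
    and beta_sgn: "\<And>k. (\<forall>x\<in>{0..l}. 0 < \<beta> k x) \<or> (\<forall>x\<in>{0..l}. \<beta> k x < 0)"
    and theta: "0 < \<theta>"
    and gap: "\<And>j k. (\<forall>x\<in>{0..l}. \<beta> j x = \<beta> k x) \<or> (\<forall>x\<in>{0..l}. \<theta> \<le> \<bar>\<beta> j x - \<beta> k x\<bar>)"
    and Q: "Q absolutely_integrable_on {0..l}"
    and W0: "W 0 = mat 1"
    and W: "AC_with_deriv l W
      (\<lambda>x. - ((\<chi> j k. if \<forall>x\<in>{0..l}. \<beta> j x = \<beta> k x then Q x $ j $ k else 0) ** W x))"
begin

lemma l0: "0 \<le> l" using l by simp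

definition eqv :: "'n \<Rightarrow> 'n \<Rightarrow> bool" where "eqv j k \<longleftrightarrow> (\<forall>x\<in>{0..l}. \<beta> j x = \<beta> k x)"

definition Q_block :: "real \<Rightarrow> complex^'n^'n" where "Q_block x = (\<chi> j k. if eqv j k then Q x $ j $ k else 0)"

definition V :: "real \<Rightarrow> complex^'n^'n" where "V x = matrix_inv (W x)"

text \<open>Reciprocal of the k-th diagonal entry of \<open>Phi0\<close>: the integrating factor
  that removes the spectral parameter from the k-th equation.\<close>

definition osc_exp :: "complex \<Rightarrow> 'n \<Rightarrow> real \<Rightarrow> complex" where
  "osc_exp lam k x = exp (- (\<i> * lam * of_real (rho \<beta> k x)))"

text \<open>The equation \<open>(L\<^sub>U(Q) - \<lambda>) y = g\<close>, solved for \<open>y'\<close>.\<close>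
definition solves :: "complex \<Rightarrow> (real \<Rightarrow> complex^'n) \<Rightarrow> (real \<Rightarrow> complex^'n) \<Rightarrow> bool" where
  "solves lam y g \<longleftrightarrow>
     AC_with_deriv l y (\<lambda>x. (\<chi> k. \<i> * of_real (\<beta> k x) * (lam * y x $ k + g x $ k)) - Q x *v y x)
     \<and> C *v y 0 + D *v y l = 0"

definition L1 :: "(real \<Rightarrow> complex^'n) \<Rightarrow> real" where "L1 g = integral {0..l} (\<lambda>t. norm (g t))"

section \<open>Primitives of the weights and the fundamental matrix of the block diagonal
  problem\<close>

lemma beta_ai: "\<beta> k absolutely_integrable_on {0..l}"
proof -
  have "(\<lambda>x. \<beta> k x * 1) absolutely_integrable_on {0..l}"
    using beta_hi[of _ k]
    by (intro absolutely_integrable_bounded_measurable_product_real beta_measurable) (auto simp: bounded_iff intro!: exI[of _ B])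
  then show ?thesis by simp
qed

lemma rho_AC: "AC_with_deriv l (rho \<beta> k) (\<beta> k)"
  using AC_with_deriv_integral[OF beta_ai, of 0 k] by (simp add: rho_def[abs_def])

lemma rho_0: "rho \<beta> k 0 = 0" by (simp add: rho_def)

lemma B0: "0 < B" using b0 beta_lo[of 0 undefined] beta_hi[of 0 undefined] l by simp

lemma rho_diff_bound:
  assumes "0 \<le> s" "s \<le> t" "t \<le> l"
  shows "\<bar>rho \<beta> k t - rho \<beta> k s\<bar> \<le> B * (t - s)"
proof -
  have h: "(\<beta> k has_integral rho \<beta> k t - rho \<beta> k s) {s..t}"
    by (rule AC_with_deriv_has_integral[OF rho_AC assms])
  have "norm (integral {s..t} (\<beta> k)) \<le> integral {s..t} (\<lambda>_. B)"
    using h assms by (intro integral_norm_bound_integral) (auto intro!: beta_hi)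
  then show ?thesis using integral_unique[OF h] assms by (simp add: mult.commute)
qed

lemma rho_bound: "x \<in> {0..l} \<Longrightarrow> \<bar>rho \<beta> k x\<bar> \<le> B * l"
  using rho_diff_bound[of 0 x k] B0 by (auto simp: rho_0 intro: order_trans mult_left_mono)

lemma rho_eqv: "eqv j k \<Longrightarrow> x \<in> {0..l} \<Longrightarrow> rho \<beta> j x = rho \<beta> k x"
  unfolding rho_def eqv_def by (intro Henstock_Kurzweil_Integration.integral_cong) auto

lemma eqv_refl: "eqv k k" by (simp add: eqv_def)
lemma eqv_sym: "eqv j k \<Longrightarrow> eqv k j" by (simp add: eqv_def)
lemma eqv_trans: "eqv i j \<Longrightarrow> eqv j k \<Longrightarrow> eqv i k" by (simp add: eqv_def)

lemma Q_block_ai: "Q_block absolutely_integrable_on {0..l}"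
proof -
  define P :: "complex^'n^'n \<Rightarrow> complex^'n^'n" where "P A = (\<chi> j k. if eqv j k then A $ j $ k else 0)" for A
  have "linear P" by (auto intro!: linearI simp: P_def vec_eq_iff)
  then have "(P \<circ> Q) absolutely_integrable_on {0..l}"
    by (intro absolutely_integrable_linear[OF Q] linear_conv_bounded_linear[THEN iffD1])
  then show ?thesis by (simp add: Q_block_def[abs_def] P_def o_def)
qed

lemma W_AC: "AC_with_deriv l W (\<lambda>x. - (Q_block x ** W x))"
  using W by (simp add: Q_block_def eqv_def)

lemmas V_inverse = AC_with_deriv_matrix_inverse[OF l0 W0 Q_block_ai W_AC, folded V_def]
lemmas VW = V_inverse(1) and WV = V_inverse(2) and V_AC = V_inverse(3)

text \<open>The entries of W outside the blocks satisfy the same linear equation, because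
  \<open>Q_block\<close> respects the blocks, and they start at zero; Gronwall's inequality keeps
  them there.\<close>

lemma W_block:
  assumes x: "x \<in> {0..l}" and jk: "\<not> eqv j k"
  shows "W x $ j $ k = 0"
proof -
  define P :: "complex^'n^'n \<Rightarrow> complex^'n^'n" where "P A = (\<chi> j k. if eqv j k then 0 else A $ j $ k)" for A
  have "linear P" by (auto intro!: linearI simp: P_def vec_eq_iff)
  then have P: "bounded_linear P" by (rule linear_conv_bounded_linear[THEN iffD1])
  interpret mm: bounded_bilinear "\<lambda>(A::complex^'n^'n) (B::complex^'n^'n). A ** B" by (rule bounded_bilinear_matrix_matrix)
  have PQ: "P (- (Q_block x ** A)) = - (Q_block x ** P A)" for x A
  proof -
    have "P (- (Q_block x ** A)) $ i $ j = (- (Q_block x ** P A)) $ i $ j" for i j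
    proof (cases "eqv i j")
      case True
      then have "(if eqv i k then Q x $ i $ k else 0) * (if eqv k j then 0 else A $ k $ j) = 0" for k
        using eqv_sym[of i k] eqv_trans[of k i j] by auto
      then have "(\<Sum>k\<in>UNIV. (if eqv i k then Q x $ i $ k else 0) * (if eqv k j then 0 else A $ k $ j)) = 0"
        by (rule sum.neutral[OF ballI])
      then show ?thesis using True by (simp add: P_def Q_block_def matrix_matrix_mult_def)
    next
      case False
      then have "(if eqv i k then Q x $ i $ k else 0) * (if eqv k j then 0 else A $ k $ j)
          = (if eqv i k then Q x $ i $ k else 0) * A $ k $ j" for k
        using eqv_trans[of i k j] by auto
      then have "(\<Sum>k\<in>UNIV. (if eqv i k then Q x $ i $ k else 0) * (if eqv k j then 0 else A $ k $ j))
          = (\<Sum>k\<in>UNIV. (if eqv i k then Q x $ i $ k else 0) * A $ k $ j)"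
        by (intro sum.cong refl)
      then show ?thesis using False by (simp add: P_def Q_block_def matrix_matrix_mult_def)
    qed
    then show ?thesis by (simp only: vec_eq_iff) simp
  qed
  have A: "AC_with_deriv l (\<lambda>x. P (W x)) (\<lambda>x. - (Q_block x ** P (W x)))"
    using AC_with_deriv_linear[OF W_AC P] by (simp add: PQ)
  obtain Km where Km: "Km > 0" "\<And>(A :: complex^'n^'n) (B :: complex^'n^'n). norm (A ** B) \<le> norm A * norm B * Km"
    using mm.pos_bounded by blast
  have nQ: "(\<lambda>x. Km * norm (Q_block x)) absolutely_integrable_on {0..l}"
    using absolutely_integrable_scaleR_left[OF absolutely_integrable_norm[OF Q_block_ai], of Km] by (simp add: o_def)
  have "norm (P (W x)) \<le> (norm (P (W 0)) + integral {0..l} (\<lambda>x. 0)) * exp (integral {0..l} (\<lambda>x. Km * norm (Q_block x)))"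
  proof (rule AC_with_deriv_gronwall[OF l0 A nQ _ _ _ _ x])
    fix x show "norm (- (Q_block x ** P (W x))) \<le> Km * norm (Q_block x) * norm (P (W x)) + 0"
      using Km(2)[of "Q_block x" "P (W x)"] by (simp add: mult_ac)
  qed (use Km in auto)
  moreover have "P (W 0) = 0" by (auto simp: W0 P_def mat_def vec_eq_iff eqv_refl)
  ultimately have "P (W x) = 0" by simp
  then have "P (W x) $ j $ k = 0" by simp
  then show ?thesis using jk by (simp add: P_def)
qed

lemma osc_exp_AC: "AC_with_deriv l (osc_exp lam k) (\<lambda>x. - (\<i> * lam * of_real (\<beta> k x)) * osc_exp lam k x)"
  unfolding osc_exp_def[abs_def]
  by (intro AC_with_deriv_exp[OF l0] AC_with_deriv_minus AC_with_deriv_linear[OF rho_AC]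
        bounded_linear_compose[OF bounded_linear_mult_right bounded_linear_of_real])

lemma osc_exp_inverse: "osc_exp lam k x * exp (\<i> * lam * of_real (rho \<beta> k x)) = 1"
  by (simp add: osc_exp_def exp_add[symmetric])

lemma Phi0_mult: "(Phi0 \<beta> x lam *v v) $ k = exp (\<i> * lam * of_real (rho \<beta> k x)) * v $ k"
  by (simp add: Phi0_def diag_mat_def matrix_vector_mult_def if_distrib if_distribR cong: if_cong)

lemma Phi0_osc_exp: "Phi0 \<beta> x lam *v (\<chi> k. osc_exp lam k x * v $ k) = v"
proof -
  have "exp (\<i> * lam * of_real (rho \<beta> k x)) * (osc_exp lam k x * v $ k) = v $ k" for k
    using osc_exp_inverse[of lam k x] by (metis mult.assoc mult.commute mult_1)
  then show ?thesis by (simp add: vec_eq_iff Phi0_mult)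
qed

text \<open>\<open>rho\<close> is constant on each block, and W has no entries between different
  blocks.\<close>

lemma Phi0_W_commute: "x \<in> {0..l} \<Longrightarrow> Phi0 \<beta> x lam ** W x = W x ** Phi0 \<beta> x lam"
proof -
  assume x: "x \<in> {0..l}"
  have "exp (\<i> * lam * of_real (rho \<beta> j x)) * W x $ j $ k = W x $ j $ k * exp (\<i> * lam * of_real (rho \<beta> k x))" for j k
    using W_block[OF x, of j k] rho_eqv[OF _ x, of j k] by (cases "eqv j k") auto
  then show ?thesis
    by (simp add: Phi0_def diag_mat_def matrix_matrix_mult_def vec_eq_iff if_distrib if_distribR cong: if_cong)
qed

definition strip_const :: "real \<Rightarrow> real" where "strip_const H = exp (H * (B * l))"

lemma exp_strip:
  assumes "\<bar>Im lam\<bar> \<le> H" "\<bar>r\<bar> \<le> B * l"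
  shows "cmod (exp (\<i> * lam * of_real r)) \<le> strip_const H" "cmod (exp (- (\<i> * lam * of_real r))) \<le> strip_const H"
proof -
  have "\<bar>Im lam * r\<bar> \<le> H * (B * l)"
    unfolding abs_mult using assms by (intro mult_mono) auto
  then show "cmod (exp (\<i> * lam * of_real r)) \<le> strip_const H" "cmod (exp (- (\<i> * lam * of_real r))) \<le> strip_const H"
    by (auto simp: strip_const_def)
qed

lemma strip_const_pos: "strip_const H > 0" and strip_const_nonneg: "0 \<le> strip_const H" by (simp_all add: strip_const_def)

definition forcing :: "complex \<Rightarrow> (real \<Rightarrow> complex^'n) \<Rightarrow> real \<Rightarrow> complex^'n" where
  "forcing lam g x = V x *v (\<chi> k. osc_exp lam k x * (\<i> * of_real (\<beta> k x) * g x $ k))"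

definition F :: "complex \<Rightarrow> (real \<Rightarrow> complex^'n) \<Rightarrow> real \<Rightarrow> complex^'n" where
  "F lam g x = integral {0..x} (forcing lam g)"

text \<open>The part of Q outside the blocks, conjugated by \<open>Phi0\<close>. The entry (j, k)
  oscillates with the phase \<open>rho j - rho k\<close>, whose derivative is at least \<theta> in
  modulus.\<close>

definition osc_part :: "complex \<Rightarrow> real \<Rightarrow> complex^'n^'n" where
  "osc_part lam x = (\<chi> j k. if eqv j k then 0 else exp (- (\<i> * lam * of_real (rho \<beta> j x - rho \<beta> k x))) * Q x $ j $ k)"

definition N' :: "complex \<Rightarrow> real \<Rightarrow> complex^'n^'n" where
  "N' lam x = V x ** osc_part lam x ** W x"

text \<open>Coordinates with respect to the fundamental matrix \<open>\<Phi>\<^sub>0 W\<close> of the problem with block diagonal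
  potential: in them the equation keeps only the oscillating entries of Q.\<close>
definition amplitude :: "complex \<Rightarrow> (real \<Rightarrow> complex^'n) \<Rightarrow> real \<Rightarrow> complex^'n" where
  "amplitude lam y x = V x *v (\<chi> k. osc_exp lam k x * y x $ k)"

lemma y_eq_amplitude:
  assumes "x \<in> {0..l}"
  shows "y x = Phi0 \<beta> x lam *v (W x *v amplitude lam y x)"
proof -
  have "W x *v amplitude lam y x = (\<chi> k. osc_exp lam k x * y x $ k)"
    by (simp add: amplitude_def matrix_vector_mul_assoc WV[OF assms])
  then show ?thesis by (simp add: Phi0_osc_exp)
qed

text \<open>\<open>osc_exp\<close> cancels the term with the spectral parameter, and V, whose
  derivative is \<open>V ** Q_block\<close>, cancels the block diagonal part of Q. What remains is
  the forcing and the oscillating matrix \<open>N' lam\<close>.\<close>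

lemma amplitude_AC:
  assumes "solves lam y g"
  shows "AC_with_deriv l (amplitude lam y) (\<lambda>x. forcing lam g x - N' lam x *v amplitude lam y x)"
proof -
  interpret mv: bounded_bilinear "\<lambda>(A::complex^'n^'n) x. A *v x" by (rule bounded_bilinear_matrix_vector)
  define y' where "y' = (\<lambda>x. (\<chi> k. \<i> * of_real (\<beta> k x) * (lam * y x $ k + g x $ k)) - Q x *v y x)"
  have y: "AC_with_deriv l y y'" using assms by (simp add: solves_def y'_def)
  define w where "w = (\<lambda>x. \<chi> k. osc_exp lam k x * y x $ k)"
  define w' where "w' = (\<lambda>x. \<chi> k. (- (\<i> * lam * of_real (\<beta> k x)) * osc_exp lam k x) * y x $ k + osc_exp lam k x * y' x $ k)"
  have w: "AC_with_deriv l w w'"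
    by (rule AC_with_deriv_vec) (simp add: w_def w'_def, rule AC_with_deriv_bilinear[OF l0 bounded_bilinear_mult osc_exp_AC AC_with_deriv_nth[OF y], simplified])
  have u: "AC_with_deriv l (\<lambda>x. V x *v w x) (\<lambda>x. (V x ** Q_block x) *v w x + V x *v w' x)"
    by (rule AC_with_deriv_bilinear[OF l0 bounded_bilinear_matrix_vector V_AC w])
  have w'_eq: "w' x = (\<chi> k. osc_exp lam k x * (\<i> * of_real (\<beta> k x) * g x $ k)) - Q_block x *v w x - osc_part lam x *v w x"
    if x: "x \<in> {0..l}" for x
  proof -
    \<comment> \<open>Within a block the two phases coincide; between blocks the phase difference
      turns \<open>osc_exp lam j\<close> into \<open>osc_exp lam k\<close>.\<close>
    have term_eq: "(if eqv k j then Q x $ k $ j else 0) * (osc_exp lam j x * y x $ j)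
        + (if eqv k j then 0 else exp (- (\<i> * lam * of_real (rho \<beta> k x - rho \<beta> j x))) * Q x $ k $ j) * (osc_exp lam j x * y x $ j)
       = osc_exp lam k x * (Q x $ k $ j * y x $ j)" for k j
    proof (cases "eqv k j")
      case True
      then show ?thesis using rho_eqv[OF True x] by (simp add: osc_exp_def)
    next
      case False
      have "exp (- (\<i> * lam * of_real (rho \<beta> k x - rho \<beta> j x))) * osc_exp lam j x = osc_exp lam k x"
        by (simp add: osc_exp_def exp_add[symmetric] algebra_simps)
      then show ?thesis using False by (simp add: mult.assoc[symmetric])
    qed
    have "(Q_block x *v w x) $ k + (osc_part lam x *v w x) $ k = osc_exp lam k x * (Q x *v y x) $ k" for k
      unfolding Q_block_def osc_part_def w_def matrix_vector_mult_def
      by (simp add: sum.distrib[symmetric] term_eq sum_distrib_left)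
    then show ?thesis
      by (simp add: vec_eq_iff w'_def y'_def algebra_simps)
  qed
  show ?thesis
  proof (rule AC_with_deriv_cong[OF u l0])
    fix x assume x: "x \<in> {0..l}"
    show "V x *v w x = amplitude lam y x" by (simp add: amplitude_def w_def)
    then have "w x = W x *v amplitude lam y x"
      by (metis WV[OF x] matrix_vector_mul_assoc matrix_vector_mul_lid)
    then have "N' lam x *v amplitude lam y x = V x *v (osc_part lam x *v w x)"
      by (simp add: N'_def matrix_vector_mul_assoc[symmetric])
    then show "(V x ** Q_block x) *v w x + V x *v w' x = forcing lam g x - N' lam x *v amplitude lam y x"
      unfolding w'_eq[OF x] forcing_def mv.diff_right by (simp add: matrix_vector_mul_assoc[symmetric])
  qed
qed

end

lemma norm_vec_le_scaled:
  fixes v :: "'a::real_normed_vector^'m" and w :: "'b::real_normed_vector^'m"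
  assumes "\<And>k. norm (v $ k) \<le> c * norm (w $ k)" "0 \<le> c"
  shows "norm v \<le> c * norm w"
  unfolding norm_vec_def L2_set_right_distrib[OF assms(2)] using assms(1) by (intro L2_set_mono) auto

lemma absolutely_integrable_vec:
  fixes f :: "real \<Rightarrow> 'a::euclidean_space^'m"
  assumes "\<And>k. (\<lambda>x. f x $ k) absolutely_integrable_on S"
  shows "f absolutely_integrable_on S"
proof -
  have "v = (\<Sum>k\<in>UNIV. axis k (v $ k))" for v :: "'a^'m"
    by (simp add: vec_eq_iff axis_def if_distrib cong: if_cong)
  then have eq: "(\<lambda>x. \<Sum>k\<in>UNIV. axis k (f x $ k)) = f" by (simp add: fun_eq_iff)
  have "(\<lambda>x. \<Sum>k\<in>UNIV. axis k (f x $ k)) absolutely_integrable_on S"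
    using absolutely_integrable_linear[OF assms bounded_linear_axis]
    by (intro absolutely_integrable_sum) (auto simp: o_def)
  then show ?thesis unfolding eq .
qed

lemma absolutely_integrable_imp_integrable_sub:
  fixes f :: "real \<Rightarrow> 'a::euclidean_space"
  assumes "f absolutely_integrable_on S" "{a..b} \<subseteq> S"
  shows "f integrable_on {a..b}"
  using absolutely_integrable_on_subinterval[OF assms] by (auto simp: absolutely_integrable_on_def)

lemma absolutely_integrable_nth:
  fixes f :: "real \<Rightarrow> 'a::euclidean_space^'m"
  assumes "f absolutely_integrable_on S"
  shows "(\<lambda>x. f x $ k) absolutely_integrable_on S"
  using absolutely_integrable_linear[OF assms bounded_linear_vec_nth[of k]] by (simp add: o_def)

section \<open>Oscillation of the coupling entries and its effect on solutions\<close>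

context bvp begin

lemma osc_exp_continuous: "continuous_on {0..l} (osc_exp lam k)"
  by (rule AC_with_deriv_continuous[OF osc_exp_AC])

lemma rho_continuous: "continuous_on {0..l} (rho \<beta> k)"
  by (rule AC_with_deriv_continuous[OF rho_AC])

lemma V_continuous: "continuous_on {0..l} V"
  by (rule AC_with_deriv_continuous[OF V_AC])

lemma W_continuous: "continuous_on {0..l} W"
  by (rule AC_with_deriv_continuous[OF W_AC])

lemma beta_times_continuous_ai:
  assumes "continuous_on {0..l} f"
  shows "(\<lambda>x. of_real (\<beta> k x) * (f x :: complex)) absolutely_integrable_on {0..l}"
  using absolutely_integrable_bilinear_continuous[OF bounded_bilinear_mult _ assms,
      of "\<lambda>x. complex_of_real (\<beta> k x)"] absolutely_integrable_linear[OF beta_ai bounded_linear_of_real, of k]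
  by (simp add: o_def)

lemma forcing_ai:
  assumes g: "continuous_on {0..l} g"
  shows "forcing lam g absolutely_integrable_on {0..l}"
proof -
  have "(\<lambda>x. of_real (\<beta> k x) * (osc_exp lam k x * \<i> * g x $ k)) absolutely_integrable_on {0..l}" for k
    by (intro beta_times_continuous_ai continuous_intros osc_exp_continuous g)
  then have "(\<lambda>x. \<chi> k. osc_exp lam k x * (\<i> * of_real (\<beta> k x) * g x $ k)) absolutely_integrable_on {0..l}"
    by (intro absolutely_integrable_vec) (simp add: mult_ac)
  then show ?thesis
    unfolding forcing_def[abs_def]
    by (rule absolutely_integrable_bilinear_continuous[OF bounded_bilinear.flip[OF bounded_bilinear_matrix_vector] _ V_continuous])
qed

lemma forcing_bound:
  obtains K where "K > 0"
    "\<And>lam g x. \<bar>Im lam\<bar> \<le> H \<Longrightarrow> x \<in> {0..l} \<Longrightarrow> norm (forcing lam g x) \<le> K * norm (g x)"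
proof -
  obtain KV where KV: "KV > 0" "\<And>x. x \<in> {0..l} \<Longrightarrow> norm (V x) \<le> KV"
    using bounded_continuous_Icc[OF V_continuous] by blast
  show ?thesis
  proof (rule that)
    show "KV * (strip_const H * B) > 0" using KV strip_const_pos B0 by simp
    fix lam x and g :: "real \<Rightarrow> complex^'n" assume lam: "\<bar>Im lam\<bar> \<le> H" and x: "x \<in> {0..l}"
    have chi: "norm (\<chi> k. osc_exp lam k x * (\<i> * of_real (\<beta> k x) * g x $ k)) \<le> (strip_const H * B) * norm (g x)"
    proof (rule norm_vec_le_scaled)
      fix k
      have "cmod (osc_exp lam k x) * \<bar>\<beta> k x\<bar> \<le> strip_const H * B"
        unfolding osc_exp_def using exp_strip(2)[OF lam rho_bound[OF x, of k]] beta_hi[OF x, of k] strip_const_nonneg[of H]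
        by (intro mult_mono) auto
      then show "norm ((\<chi> k. osc_exp lam k x * (\<i> * of_real (\<beta> k x) * g x $ k)) $ k) \<le> strip_const H * B * norm (g x $ k)"
        by (simp add: norm_mult mult.assoc[symmetric] mult_right_mono)
    qed (use strip_const_nonneg[of H] B0 in auto)
    have "norm (forcing lam g x) \<le> KV * (strip_const H * B * norm (g x))"
      unfolding forcing_def using KV(1) by (intro order_trans[OF norm_matrix_vector_mult_le] mult_mono KV(2) chi x) auto
    then show "norm (forcing lam g x) \<le> KV * (strip_const H * B) * norm (g x)" by (simp add: mult.assoc)
  qed
qed

lemma cnorm_integrable:
  assumes g: "continuous_on {0..l} g"
  shows "(\<lambda>x. norm (g x)) integrable_on {0..l}"
  by (intro integrable_continuous_real continuous_intros g)

lemma L1_nonneg: "continuous_on {0..l} g \<Longrightarrow> 0 \<le> L1 g"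
  unfolding L1_def by (intro Henstock_Kurzweil_Integration.integral_nonneg cnorm_integrable) auto

lemma F_AC: "continuous_on {0..l} g \<Longrightarrow> AC_with_deriv l (F lam g) (forcing lam g)"
  using AC_with_deriv_integral[OF forcing_ai, of g 0 lam] by (simp add: F_def[abs_def])

lemma F_bound:
  obtains K where "K > 0" "\<And>lam g x. \<lbrakk>\<bar>Im lam\<bar> \<le> H; continuous_on {0..l} g; x \<in> {0..l}\<rbrakk> \<Longrightarrow> norm (F lam g x) \<le> K * L1 g"
proof -
  obtain K where K: "K > 0" "\<And>lam g x. \<bar>Im lam\<bar> \<le> H \<Longrightarrow> x \<in> {0..l} \<Longrightarrow> norm (forcing lam g x) \<le> K * norm (g x)"
    using forcing_bound by blast
  show ?thesis
  proof (rule that[OF K(1)])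
    fix lam x and g :: "real \<Rightarrow> complex^'n" assume lam: "\<bar>Im lam\<bar> \<le> H" and g: "continuous_on {0..l} g" and x: "x \<in> {0..l}"
    then have sub: "{0..x} \<subseteq> {0..l}" by auto
    have "norm (F lam g x) \<le> integral {0..x} (\<lambda>t. K * norm (g t))"
      unfolding F_def using sub K(2)[OF lam]
      by (intro integral_norm_bound_integral integrable_on_mult_right integrable_on_subinterval[OF cnorm_integrable[OF g] sub]
         integrable_on_subinterval[OF AC_with_derivD(2)[OF F_AC[OF g]] sub]) auto
    also have "\<dots> \<le> K * L1 g"
      unfolding L1_def using K(1) sub
      by (simp, intro integral_subset_le integrable_on_subinterval[OF cnorm_integrable[OF g] sub] cnorm_integrable g) auto
    finally show "norm (F lam g x) \<le> K * L1 g" .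
  qed
qed

lemma osc_part_ai: "osc_part lam absolutely_integrable_on {0..l}"
proof (intro absolutely_integrable_vec)
  fix j k
  have "(\<lambda>x. Q x $ j $ k * exp (- (\<i> * lam * of_real (rho \<beta> j x - rho \<beta> k x)))) absolutely_integrable_on {0..l}"
    by (intro absolutely_integrable_bilinear_continuous[OF bounded_bilinear_mult] absolutely_integrable_nth Q
        continuous_intros rho_continuous)
  then show "(\<lambda>x. osc_part lam x $ j $ k) absolutely_integrable_on {0..l}"
    by (cases "eqv j k") (simp_all add: osc_part_def mult.commute)
qed

lemma N'_ai: "N' lam absolutely_integrable_on {0..l}"
  unfolding N'_def[abs_def]
  by (intro absolutely_integrable_bilinear_continuous[OF bounded_bilinear_matrix_matrix _ W_continuous]
    absolutely_integrable_bilinear_continuous[OF bounded_bilinear.flip[OF bounded_bilinear_matrix_matrix] _ V_continuous] osc_part_ai)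

lemma N'_bound:
  obtains K where "K > 0" "\<And>lam x. \<lbrakk>\<bar>Im lam\<bar> \<le> H; x \<in> {0..l}\<rbrakk> \<Longrightarrow> norm (N' lam x) \<le> K * norm (Q x)"
proof -
  interpret mm: bounded_bilinear "\<lambda>(A::complex^'n^'n) (B::complex^'n^'n). A ** B" by (rule bounded_bilinear_matrix_matrix)
  obtain KV where KV: "KV > 0" "\<And>x. x \<in> {0..l} \<Longrightarrow> norm (V x) \<le> KV"
    using bounded_continuous_Icc[OF V_continuous] by blast
  obtain KW where KW: "KW > 0" "\<And>x. x \<in> {0..l} \<Longrightarrow> norm (W x) \<le> KW"
    using bounded_continuous_Icc[OF W_continuous] by blast
  obtain Km where Km: "Km > 0" "\<And>(A :: complex^'n^'n) (B :: complex^'n^'n). norm (A ** B) \<le> norm A * norm B * Km"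
    using mm.pos_bounded by blast
  define E where "E = strip_const H * strip_const H"
  have E: "E > 0" using strip_const_pos by (simp add: E_def)
  show ?thesis
  proof (rule that)
    show "KV * E * Km * KW * Km > 0" using KV KW Km E by simp
    fix lam x assume lam: "\<bar>Im lam\<bar> \<le> H" and x: "x \<in> {0..l}"
    have "norm (osc_part lam x) \<le> E * norm (Q x)"
    proof (intro norm_vec_le_scaled)
      fix j k
      have "exp (- (\<i> * lam * of_real (rho \<beta> j x - rho \<beta> k x)))
          = exp (- (\<i> * lam * of_real (rho \<beta> j x))) * exp (\<i> * lam * of_real (rho \<beta> k x))"
        by (simp add: exp_add[symmetric] algebra_simps)
      also have "cmod \<dots> \<le> E"
        unfolding norm_mult E_def by (intro mult_mono exp_strip[OF lam rho_bound[OF x]] strip_const_nonneg norm_ge_zero)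
      finally show "norm (osc_part lam x $ j $ k) \<le> E * norm (Q x $ j $ k)"
        using E by (auto simp: osc_part_def norm_mult intro!: mult_right_mono)
    qed (use E in auto)
    then have 1: "norm (V x ** osc_part lam x) \<le> KV * (E * norm (Q x)) * Km"
      using KV(1) KV(2)[OF x] Km(1) by (intro order_trans[OF Km(2)] mult_right_mono mult_mono) auto
    have "norm (N' lam x) \<le> (KV * (E * norm (Q x)) * Km) * KW * Km"
      unfolding N'_def using KV(1) KW(1) KW(2)[OF x] Km(1) E by (intro order_trans[OF Km(2)] mult_right_mono mult_mono 1) auto
    then show "norm (N' lam x) \<le> KV * E * Km * KW * Km * norm (Q x)" by (simp add: mult_ac)
  qed
qed

text \<open>Riemann-Lebesgue with the phase \<open>rho j - rho k\<close>: V and W are continuous, so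
  together with the entry of Q they form an integrable amplitude independent of lam.\<close>

lemma N'_entry_small:
  assumes e: "e > 0" and jk: "\<not> eqv j k"
  obtains R where "\<And>lam x. \<lbrakk>\<bar>Im lam\<bar> \<le> H; R \<le> cmod lam; x \<in> {0..l}\<rbrakk> \<Longrightarrow>
     cmod (integral {0..x} (\<lambda>t. V t $ a $ j * osc_part lam t $ j $ k * W t $ k $ b)) \<le> e"
proof -
  let ?m = "\<lambda>t. Q t $ j $ k * (V t $ a $ j * W t $ k $ b)"
  have r: "AC_with_deriv l (\<lambda>x. rho \<beta> j x - rho \<beta> k x) (\<lambda>x. \<beta> j x - \<beta> k x)"
    by (intro AC_with_deriv_sub rho_AC)
  have m: "?m absolutely_integrable_on {0..l}"
    by (intro absolutely_integrable_bilinear_continuous[OF bounded_bilinear_mult] absolutely_integrable_nth Q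
        continuous_intros V_continuous W_continuous)
  have meas: "(\<lambda>x. \<beta> j x - \<beta> k x) \<in> borel_measurable (lebesgue_on {0..l})"
    by (intro borel_measurable_diff beta_measurable)
  have lo: "\<theta> \<le> \<bar>\<beta> j x - \<beta> k x\<bar>" if "x \<in> {0..l}" for x
    using gap[of j k] jk that by (auto simp: eqv_def)
  have hi: "\<bar>\<beta> j x - \<beta> k x\<bar> \<le> 2 * B" if "x \<in> {0..l}" for x
    using beta_hi[OF that, of j] beta_hi[OF that, of k] by linarith
  obtain R where R: "\<And>lam x. \<lbrakk>\<bar>Im lam\<bar> \<le> H; R \<le> cmod lam; x \<in> {0..l}\<rbrakk> \<Longrightarrow>
     cmod (integral {0..x} (\<lambda>t. exp (- (\<i> * lam * of_real (rho \<beta> j t - rho \<beta> k t))) * ?m t)) \<le> e"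
    using riemann_lebesgue_phase[OF l0 r m meas theta lo hi e] by blast
  have eq: "(\<lambda>t. V t $ a $ j * osc_part lam t $ j $ k * W t $ k $ b) =
      (\<lambda>t. exp (- (\<i> * lam * of_real (rho \<beta> j t - rho \<beta> k t))) * ?m t)" for lam
    using jk by (auto simp: osc_part_def fun_eq_iff mult_ac)
  show ?thesis by (rule that) (unfold eq, rule R)
qed

lemma N_small:
  assumes e: "e > 0"
  obtains R where "\<And>lam x. \<lbrakk>\<bar>Im lam\<bar> \<le> H; R \<le> cmod lam; x \<in> {0..l}\<rbrakk> \<Longrightarrow>
     norm (integral {0..x} (N' lam)) \<le> e"
proof -
  define c where "c = real CARD('n)"
  have c: "c > 0" by (simp add: c_def)
  \<comment> \<open>Two factors c pass from entries to the norm of a matrix, two more count the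
    pairs of inner summation indices.\<close>
  define e1 where "e1 = e / (c * c * c * c)"
  have e1: "e1 > 0" using e c by (simp add: e1_def)
  have "\<forall>p::'n\<times>'n\<times>'n\<times>'n. \<exists>R. \<forall>lam x. \<bar>Im lam\<bar> \<le> H \<and> R \<le> cmod lam \<and> x \<in> {0..l} \<longrightarrow>
     cmod (integral {0..x} (\<lambda>t. V t $ fst p $ fst (snd p) * osc_part lam t $ fst (snd p) $ fst (snd (snd p)) * W t $ fst (snd (snd p)) $ snd (snd (snd p)))) \<le> e1"
  proof (intro allI)
    fix p :: "'n\<times>'n\<times>'n\<times>'n"
    obtain a j k b where p: "p = (a, j, k, b)" by (cases p) auto
    show "\<exists>R. \<forall>lam x. \<bar>Im lam\<bar> \<le> H \<and> R \<le> cmod lam \<and> x \<in> {0..l} \<longrightarrow>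
     cmod (integral {0..x} (\<lambda>t. V t $ fst p $ fst (snd p) * osc_part lam t $ fst (snd p) $ fst (snd (snd p)) * W t $ fst (snd (snd p)) $ snd (snd (snd p)))) \<le> e1"
    proof (cases "eqv j k")
      case True
      then show ?thesis using e1 by (simp add: p osc_part_def)
    next
      case False
      obtain R where "\<And>lam x. \<lbrakk>\<bar>Im lam\<bar> \<le> H; R \<le> cmod lam; x \<in> {0..l}\<rbrakk> \<Longrightarrow>
          cmod (integral {0..x} (\<lambda>t. V t $ a $ j * osc_part lam t $ j $ k * W t $ k $ b)) \<le> e1"
        using N'_entry_small[OF e1 False] by blast
      then show ?thesis unfolding p by auto
    qed
  qed
  from choice[OF this] obtain Rf where Rf': "\<forall>p lam x. \<bar>Im lam\<bar> \<le> H \<and> Rf p \<le> cmod lam \<and> x \<in> {0..l} \<longrightarrow>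
     cmod (integral {0..x} (\<lambda>t. V t $ fst p $ fst (snd p) * osc_part lam t $ fst (snd p) $ fst (snd (snd p)) * W t $ fst (snd (snd p)) $ snd (snd (snd p)))) \<le> e1"
    by (rule exE)
  have Rf: "cmod (integral {0..x} (\<lambda>t. V t $ a $ j * osc_part lam t $ j $ k * W t $ k $ b)) \<le> e1"
    if "\<bar>Im lam\<bar> \<le> H" "Rf (a,j,k,b) \<le> cmod lam" "x \<in> {0..l}" for a j k b lam x
    using Rf'[rule_format, of lam "(a,j,k,b)" x] that by simp
  show ?thesis
  proof (rule that)
    fix lam x assume lam: "\<bar>Im lam\<bar> \<le> H" "Max (range Rf) \<le> cmod lam" and x: "x \<in> {0..l}"
    then have sub: "{0..x} \<subseteq> {0..l}" by auto
    have R: "Rf p \<le> cmod lam" for p 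
    proof -
      have "Rf p \<le> Max (range Rf)" by (rule Max_ge) auto
      then show ?thesis using lam(2) by linarith
    qed
    have iN: "N' lam integrable_on {0..x}"
      by (rule absolutely_integrable_imp_integrable_sub[OF N'_ai sub])
    have "norm (integral {0..x} (N' lam)) \<le> c * (c * (c * (c * e1)))"
      unfolding c_def
    proof (intro norm_matrix_le_const)
      fix a b
      have iRow: "(\<lambda>t. N' lam t $ a) integrable_on {0..x}"
        using integrable_linear[OF iN bounded_linear_vec_nth[of a]] by (simp add: o_def)
      have "integral {0..x} (N' lam) $ a $ b = integral {0..x} (\<lambda>t. N' lam t $ a $ b)"
        by (simp add: integral_vec_nth[OF iN] integral_vec_nth[OF iRow])
      also have "\<dots> = integral {0..x} (\<lambda>t. \<Sum>k\<in>UNIV. \<Sum>j\<in>UNIV. V t $ a $ j * osc_part lam t $ j $ k * W t $ k $ b)"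
        by (simp add: N'_def matrix_matrix_mult_def sum_distrib_right)
      also have "\<dots> = (\<Sum>k\<in>UNIV. \<Sum>j\<in>UNIV. integral {0..x} (\<lambda>t. V t $ a $ j * osc_part lam t $ j $ k * W t $ k $ b))"
      proof -
        have "(\<lambda>t. osc_part lam t $ j $ k * (V t $ a $ j * W t $ k $ b)) absolutely_integrable_on {0..l}" for j k
          by (intro absolutely_integrable_bilinear_continuous[OF bounded_bilinear_mult] absolutely_integrable_nth osc_part_ai
            continuous_intros V_continuous W_continuous)
        then have "(\<lambda>t. osc_part lam t $ j $ k * (V t $ a $ j * W t $ k $ b)) integrable_on {0..x}" for j k
          by (rule absolutely_integrable_imp_integrable_sub[OF _ sub])
        then have "(\<lambda>t. V t $ a $ j * osc_part lam t $ j $ k * W t $ k $ b) integrable_on {0..x}" for j k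
          by (simp add: mult_ac)
        then show ?thesis
          by (simp add: Henstock_Kurzweil_Integration.integral_sum integrable_sum)
      qed
      also have "cmod \<dots> \<le> (\<Sum>k\<in>(UNIV::'n set). \<Sum>j\<in>(UNIV::'n set). e1)"
        using Rf[OF lam(1) R x] by (intro order_trans[OF norm_sum] sum_mono) auto
      also have "\<dots> = real CARD('n) * (real CARD('n) * e1)" by simp
      finally show "cmod (integral {0..x} (N' lam) $ a $ b) \<le> real CARD('n) * (real CARD('n) * e1)" .
    qed
    also have "\<dots> = e" using c by (simp add: e1_def)
    finally show "norm (integral {0..x} (N' lam)) \<le> e" .
  qed
qed

text \<open>Only the primitive N of \<open>N' lam\<close> is small for large lam. Hence u is first
  bounded by Gronwall's inequality, uniformly in lam; then the integral of \<open>N' u\<close> is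
  rewritten by parts as \<open>N u\<close> minus the integral of \<open>N u'\<close>, where every
  term contains N.\<close>

lemma strip_asymptotics:
  assumes e: "e > 0"
  obtains R where "\<And>lam y g x. \<lbrakk>\<bar>Im lam\<bar> \<le> H; R \<le> cmod lam; continuous_on {0..l} g; solves lam y g; x \<in> {0..l}\<rbrakk>
     \<Longrightarrow> norm (amplitude lam y x - amplitude lam y 0 - F lam g x) \<le> e * (norm (amplitude lam y 0) + L1 g)"
proof -
  interpret mv: bounded_bilinear "\<lambda>(A::complex^'n^'n) x. A *v x" by (rule bounded_bilinear_matrix_vector)
  obtain KN where KN: "KN > 0" "\<And>lam x. \<lbrakk>\<bar>Im lam\<bar> \<le> H; x \<in> {0..l}\<rbrakk> \<Longrightarrow> norm (N' lam x) \<le> KN * norm (Q x)"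
    using N'_bound by blast
  obtain Kf where Kf: "Kf > 0" "\<And>lam g x. \<bar>Im lam\<bar> \<le> H \<Longrightarrow> x \<in> {0..l} \<Longrightarrow> norm (forcing lam g x) \<le> Kf * norm (g x)"
    using forcing_bound by blast
  have aQ: "(\<lambda>x. KN * norm (Q x)) absolutely_integrable_on {0..l}"
    using absolutely_integrable_scaleR_left[OF absolutely_integrable_norm[OF Q], of KN] by (simp add: o_def)
  then have iQ: "(\<lambda>x. KN * norm (Q x)) integrable_on {0..l}" by (auto simp: absolutely_integrable_on_def)
  define q where "q = integral {0..l} (\<lambda>x. KN * norm (Q x))"
  have q: "q \<ge> 0" unfolding q_def using KN by (intro Henstock_Kurzweil_Integration.integral_nonneg iQ) auto
  \<comment> \<open>K2 bounds u by Gronwall's inequality; K4 below adds up the contributions of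
    \<open>N u\<close> and of the two terms in the bound for \<open>u'\<close>, so that N of size
    \<open>e / K4\<close> suffices.\<close>
  define K2 where "K2 = (1 + Kf) * exp q"
  have K2: "K2 > 0" using Kf by (simp add: K2_def add_pos_pos)
  define K4 where "K4 = K2 + (q * K2 + Kf)"
  have K4: "K4 > 0" using K2 q Kf by (auto simp: K4_def intro!: add_pos_nonneg)
  obtain R where R: "\<And>lam x. \<lbrakk>\<bar>Im lam\<bar> \<le> H; R \<le> cmod lam; x \<in> {0..l}\<rbrakk> \<Longrightarrow>
     norm (integral {0..x} (N' lam)) \<le> e / K4"
    using N_small[of "e / K4" H] e K4 by auto
  show ?thesis
  proof (rule that)
    fix lam x and y g :: "real \<Rightarrow> complex^'n"
    assume lam: "\<bar>Im lam\<bar> \<le> H" "R \<le> cmod lam" and g: "continuous_on {0..l} g" and sol: "solves lam y g"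
      and x: "x \<in> {0..l}"
    define u where "u = amplitude lam y"
    define u' where "u' = (\<lambda>x. forcing lam g x - N' lam x *v u x)"
    define S where "S = norm (u 0) + L1 g"
    have S: "0 \<le> S" using L1_nonneg[OF g] by (simp add: S_def)
    have u: "AC_with_deriv l u u'" unfolding u_def u'_def by (rule amplitude_AC[OF sol])
    have ig: "(\<lambda>x. Kf * norm (g x)) integrable_on {0..l}" by (intro integrable_on_mult_right cnorm_integrable g)
    have Nu: "norm (N' lam t *v u t) \<le> KN * norm (Q t) * norm (u t)" if "t \<in> {0..l}" for t
      using KN(2)[OF lam(1) that] by (intro order_trans[OF norm_matrix_vector_mult_le] mult_right_mono) auto
    have u'b: "norm (u' t) \<le> KN * norm (Q t) * norm (u t) + Kf * norm (g t)" if "t \<in> {0..l}" for t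
      unfolding u'_def using Nu[OF that] Kf(2)[OF lam(1) that, of g]
      by (intro order_trans[OF norm_triangle_ineq4]) linarith
    have ub: "norm (u t) \<le> K2 * S" if t: "t \<in> {0..l}" for t
    proof -
      have "norm (u t) \<le> (norm (u 0) + integral {0..l} (\<lambda>x. Kf * norm (g x))) * exp q"
        unfolding q_def by (rule AC_with_deriv_gronwall[OF l0 u aQ _ ig _ u'b t]) (use KN Kf in auto)
      also have "\<dots> \<le> ((1 + Kf) * S) * exp q"
        using Kf L1_nonneg[OF g] by (intro mult_right_mono) (auto simp: S_def L1_def algebra_simps)
      finally show ?thesis by (simp add: K2_def mult_ac)
    qed
    have u'b2: "norm (u' t) \<le> KN * norm (Q t) * (K2 * S) + Kf * norm (g t)" if "t \<in> {0..l}" for t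
    proof -
      have "KN * norm (Q t) * norm (u t) \<le> KN * norm (Q t) * (K2 * S)"
        using KN(1) by (intro mult_left_mono ub that) auto
      then show ?thesis using u'b[OF that] by linarith
    qed
    have sub: "{0..x} \<subseteq> {0..l}" using x by auto
    define N where "N = (\<lambda>x. 0 + integral {0..x} (N' lam))"
    have N: "AC_with_deriv l N (N' lam)" unfolding N_def by (rule AC_with_deriv_integral[OF N'_ai])
    have Nb: "norm (N t) \<le> e / K4" if "t \<in> {0..l}" for t using R[OF lam that] by (simp add: N_def)
    have "AC_with_deriv l (\<lambda>x. N x *v u x) (\<lambda>x. N' lam x *v u x + N x *v u' x)"
      by (rule AC_with_deriv_bilinear[OF l0 bounded_bilinear_matrix_vector N u])
    then have h1: "((\<lambda>x. N' lam x *v u x + N x *v u' x) has_integral N x *v u x) {0..x}"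
      using AC_with_deriv_has_integral[of l "\<lambda>x. N x *v u x" _ 0 x] x by (simp add: N_def)
    have "(\<lambda>t. N t *v u' t) absolutely_integrable_on {0..l}"
      by (rule absolutely_integrable_bilinear_continuous[OF mv.flip AC_with_derivD(1)[OF u] AC_with_deriv_continuous[OF N]])
    then have i2: "(\<lambda>t. N t *v u' t) integrable_on {0..x}"
      using sub by (auto simp: absolutely_integrable_on_def intro: integrable_on_subinterval)
    have h2: "((\<lambda>t. N' lam t *v u t) has_integral N x *v u x - integral {0..x} (\<lambda>t. N t *v u' t)) {0..x}"
      using has_integral_diff[OF h1 integrable_integral[OF i2]] by simp
    have "(u' has_integral u x - u 0) {0..x}"
      using AC_with_deriv_has_integral[OF u, of 0 x] x by simp
    from has_integral_add[OF this h2]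
    have "(forcing lam g has_integral u x - u 0 + (N x *v u x - integral {0..x} (\<lambda>t. N t *v u' t))) {0..x}"
      by (simp add: u'_def)
    then have "F lam g x = u x - u 0 + (N x *v u x - integral {0..x} (\<lambda>t. N t *v u' t))"
      unfolding F_def by (rule integral_unique)
    then have "u x - u 0 - F lam g x = integral {0..x} (\<lambda>t. N t *v u' t) - N x *v u x" by simp
    also have "norm \<dots> \<le> norm (integral {0..x} (\<lambda>t. N t *v u' t)) + norm (N x *v u x)" by (rule norm_triangle_ineq4)
    also have "norm (N x *v u x) \<le> e / K4 * (K2 * S)"
      using Nb[OF x] ub[OF x] e K4 K2 S by (intro order_trans[OF norm_matrix_vector_mult_le] mult_mono) auto
    also have "norm (integral {0..x} (\<lambda>t. N t *v u' t)) \<le> integral {0..x} (\<lambda>t. e / K4 * ((K2 * S) * (KN * norm (Q t)) + Kf * norm (g t)))"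
    proof (rule integral_norm_bound_integral[OF i2])
      show "(\<lambda>t. e / K4 * ((K2 * S) * (KN * norm (Q t)) + Kf * norm (g t))) integrable_on {0..x}"
        by (intro integrable_on_mult_right[of _ _ "e / K4"] integrable_add integrable_on_mult_right[of _ _ "K2 * S"] 
            integrable_on_subinterval[OF iQ sub] integrable_on_subinterval[OF ig sub])
      fix t assume "t \<in> {0..x}"
      then have t: "t \<in> {0..l}" using sub by auto
      show "norm (N t *v u' t) \<le> e / K4 * ((K2 * S) * (KN * norm (Q t)) + Kf * norm (g t))"
        using Nb[OF t] u'b2[OF t] e K4 by (intro order_trans[OF norm_matrix_vector_mult_le] mult_mono) (auto simp: mult_ac)
    qed
    also have "\<dots> = e / K4 * ((K2 * S) * integral {0..x} (\<lambda>t. KN * norm (Q t)) + integral {0..x} (\<lambda>t. Kf * norm (g t)))"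
      by (rule integral_unique[OF has_integral_mult_right[OF has_integral_add[OF has_integral_mult_right]]])
        (intro integrable_integral integrable_on_subinterval[OF iQ sub] integrable_on_subinterval[OF ig sub])+
    also have "\<dots> \<le> e / K4 * ((K2 * S) * q + Kf * S)"
    proof (intro mult_left_mono add_mono)
      show "integral {0..x} (\<lambda>t. KN * norm (Q t)) \<le> q"
        unfolding q_def using KN by (intro integral_subset_le sub iQ integrable_on_subinterval[OF iQ sub]) auto
      have "integral {0..x} (\<lambda>t. Kf * norm (g t)) \<le> integral {0..l} (\<lambda>t. Kf * norm (g t))"
        using Kf by (intro integral_subset_le sub ig integrable_on_subinterval[OF ig sub]) auto
      also have "\<dots> \<le> Kf * S" using Kf by (simp add: S_def L1_def)
      finally show "integral {0..x} (\<lambda>t. Kf * norm (g t)) \<le> Kf * S" .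
    qed (use e K4 K2 S in auto)
    finally have "norm (u x - u 0 - F lam g x) \<le> e / K4 * ((K2 * S) * q + Kf * S) + e / K4 * (K2 * S)" by linarith
    also have "\<dots> = e / K4 * (K4 * S)" by (simp add: K4_def algebra_simps)
    also have "\<dots> = e * S" using K4 by simp
    finally show "norm (amplitude lam y x - amplitude lam y 0 - F lam g x) \<le> e * (norm (amplitude lam y 0) + L1 g)"
      by (simp add: u_def S_def)
  qed
qed

end

section \<open>The leading part of the resolvent\<close>

text \<open>The adjugate of A applied to b. Leaving out the division by the determinant keeps it
  defined, and polynomial in the entries, where the determinant vanishes.\<close>

definition cramer_vec :: "complex^'n^'n \<Rightarrow> complex^'n \<Rightarrow> complex^'n::finite" where
  "cramer_vec A b = (\<chi> k. det (\<chi> i j. if j = k then b $ i else A $ i $ j))"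

lemma norm_vector_smult: "norm (c *s v) = cmod c * norm (v :: complex^'n)"
  by (simp add: norm_vec_def norm_mult L2_set_right_distrib[symmetric])

lemma cramer_vec_mult: "cramer_vec A (A *v x) = det A *s x"
  by (simp add: cramer_vec_def cramer_lemma vec_eq_iff mult.commute)

lemma mult_cramer_vec:
  assumes "det A \<noteq> 0"
  shows "A *v (inverse (det A) *s cramer_vec A b) = b"
  unfolding cramer[OF assms] by (simp add: cramer_vec_def vec_eq_iff divide_inverse mult.commute)

text \<open>Every permutation meets column k exactly once, so each product contains a single entry
  of b and the bound is linear in b. With \<open>1 \<le> K\<close> the remaining
  \<open>CARD('n) - 1\<close> factors are bounded by the full power.\<close>

lemma cramer_vec_bound:
  fixes A :: "complex^'n^'n"
  assumes K: "1 \<le> K" "\<And>i j. cmod (A $ i $ j) \<le> K"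
  shows "norm (cramer_vec A b) \<le> real CARD('n) * (fact CARD('n) * K ^ CARD('n)) * norm b"
proof -
  have "cmod (cramer_vec A b $ k) \<le> (fact CARD('n) * K ^ CARD('n)) * norm b" for k
  proof -
    let ?M = "(\<chi> i j. if j = k then b $ i else A $ i $ j) :: complex^'n^'n"
    have "cmod (of_int (sign p) * (\<Prod>i\<in>UNIV. ?M $ i $ p i)) \<le> norm b * K ^ CARD('n)" if p: "p permutes UNIV" for p
    proof -
      define i0 where "i0 = inv p k"
      have pi0: "p i0 = k" using permutes_inverses(1)[OF p] by (simp add: i0_def)
      have pk: "p i \<noteq> k" if "i \<noteq> i0" for i using that pi0 permutes_inj[OF p] by (metis injD)
      have "cmod (\<Prod>i\<in>UNIV. ?M $ i $ p i) = cmod (?M $ i0 $ p i0) * (\<Prod>i\<in>UNIV - {i0}. cmod (?M $ i $ p i))"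
        by (subst prod_norm[symmetric], rule prod.remove) auto
      also have "\<dots> \<le> norm b * (\<Prod>i\<in>UNIV - {i0}. K)"
        using K pk by (intro mult_mono prod_mono) (auto simp: pi0 Finite_Cartesian_Product.norm_nth_le intro: prod_nonneg)
      also have "(\<Prod>i\<in>UNIV - {i0}. K) = K ^ (CARD('n) - 1)" by simp
      also have "norm b * K ^ (CARD('n) - 1) \<le> norm b * K ^ CARD('n)"
        using K by (intro mult_left_mono power_increasing) auto
      finally show ?thesis by (simp add: norm_mult sign_def)
    qed
    then have "cmod (det ?M) \<le> (\<Sum>p\<in>{p. p permutes (UNIV::'n set)}. norm b * K ^ CARD('n))"
      unfolding det_def by (intro order_trans[OF norm_sum] sum_mono) auto
    also have "\<dots> = (fact CARD('n) * K ^ CARD('n)) * norm b"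
      by (simp add: card_permutations[OF refl])
    finally show ?thesis by (simp add: cramer_vec_def)
  qed
  then show ?thesis using norm_vec_le_const[of "cramer_vec A b"] by (simp add: mult.assoc)
qed

lemma det_eq_0_iff_kernel:
  fixes A :: "complex^'n^'n"
  shows "det A = 0 \<longleftrightarrow> (\<exists>p. p \<noteq> 0 \<and> A *v p = 0)"
  using matrix_left_invertible_ker[of A] invertible_left_inverse[of A] invertible_det_nz[of A] by blast

text \<open>At a zero of the determinant the Cramer vector depends on its right-hand side through one
  linear functional only.\<close>
lemma cramer_vec_eq_0:
  assumes p: "p \<noteq> 0" "transpose A *v p = 0" and b: "(\<Sum>i\<in>UNIV. b $ i * p $ i) = 0"
  shows "cramer_vec A b = 0"
proof -
  have "det (\<chi> i j. if j = k then b $ i else A $ i $ j) = 0" for k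
  proof -
    let ?M = "(\<chi> i j. if j = k then b $ i else A $ i $ j)"
    have "(\<Sum>i\<in>UNIV. A $ i $ j * p $ i) = 0" for j
      using p(2) by (simp add: vec_eq_iff matrix_vector_mult_def transpose_def)
    \<comment> \<open>p annihilates the columns of A from the left by choice, and the replaced
      column by the hypothesis on b.\<close>
    then have "(transpose ?M *v p) $ j = 0" for j
      using b by (cases "j = k") (simp_all add: matrix_vector_mult_def transpose_def)
    then have "transpose ?M *v p = 0" by (simp add: vec_eq_iff)
    then have "det (transpose ?M) = 0" using p(1) det_eq_0_iff_kernel by blast
    then show ?thesis by simp
  qed
  then show ?thesis by (simp add: cramer_vec_def vec_eq_iff)
qed

text \<open>Near x the integral of q is small by uniform continuity of its primitive; at distance at
  least \<open>d'\<close> the exponential is small. This makes an integrable potential a small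
  perturbation far from the real axis, uniformly in x.\<close>

lemma exp_kernel_small:
  fixes q :: "real \<Rightarrow> real"
  assumes l: "0 \<le> l" and q: "q integrable_on {0..l}" "\<And>t. t \<in> {0..l} \<Longrightarrow> 0 \<le> q t" and e: "0 < e"
  obtains T where "T > 0" "\<And>\<tau> x. \<lbrakk>T \<le> \<tau>; x \<in> {0..l}\<rbrakk> \<Longrightarrow>
     (\<lambda>t. exp (- (\<tau> * \<bar>x - t\<bar>)) * q t) integrable_on {0..l} \<and> integral {0..l} (\<lambda>t. exp (- (\<tau> * \<bar>x - t\<bar>)) * q t) \<le> e"
proof -
  have qa: "q absolutely_integrable_on {0..l}" using q by (intro nonnegative_absolutely_integrable_1)
  define P where "P = (\<lambda>x. 0 + integral {0..x} q)"
  have P: "AC_with_deriv l P q" unfolding P_def by (rule AC_with_deriv_integral[OF qa])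
  obtain d where d: "d > 0" "\<And>x y. \<lbrakk>x \<in> {0..l}; y \<in> {0..l}; \<bar>x - y\<bar> < d\<rbrakk> \<Longrightarrow> norm (P x - P y) < e / 2"
    using uniformly_continuous_Icc[OF AC_with_deriv_continuous[OF P], of "e/2"] e by auto
  define d' where "d' = d / 3"
  have d': "d' > 0" "2 * d' < d" using d by (auto simp: d'_def)
  define J where "J = integral {0..l} q"
  have J: "J \<ge> 0" unfolding J_def by (intro Henstock_Kurzweil_Integration.integral_nonneg q)
  \<comment> \<open>From \<open>exp (- s) \<le> 1 / s\<close> with s at least \<open>T * d'\<close>;
    \<open>J + 1\<close> stands in for J, which may be zero.\<close>
  define T where "T = 2 * (J + 1) / (e * d')"
  have T: "T > 0" using J e d' by (simp add: T_def)
  show ?thesis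
  proof (rule that[OF T])
    fix \<tau> x assume tau: "T \<le> \<tau>" and x: "x \<in> {0..l}"
    have ci: "continuous_on {0..l} (\<lambda>t. exp (- (\<tau> * \<bar>x - t\<bar>)))" by (intro continuous_intros)
    have int: "(\<lambda>t. exp (- (\<tau> * \<bar>x - t\<bar>)) * q t) integrable_on {0..l}"
      using absolutely_integrable_bilinear_continuous[OF bounded_bilinear_mult qa ci]
      by (auto simp: absolutely_integrable_on_def mult.commute)
    define a where "a = max 0 (x - d')"
    define b where "b = min l (x + d')"
    have ab: "0 \<le> a" "a \<le> b" "b \<le> l" "b - a < d" using x d' by (auto simp: a_def b_def)
    have "\<tau> * d' > 0" using T tau d' by simp
    have small: "exp (- (\<tau> * d')) * J \<le> e / 2"
    proof -
      have "\<tau> * d' \<le> exp (\<tau> * d')" using exp_ge_add_one_self[of "\<tau> * d'"] by linarith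
      then have "exp (- (\<tau> * d')) \<le> 1 / (\<tau> * d')"
        using \<open>\<tau> * d' > 0\<close> by (simp add: exp_minus field_simps)
      also have "\<dots> \<le> 1 / (T * d')" using T tau d' by (intro divide_left_mono) auto
      also have "\<dots> = e / (2 * (J + 1))" using e d' J by (simp add: T_def)
      finally have "exp (- (\<tau> * d')) * J \<le> e / (2 * (J + 1)) * J" using J by (intro mult_right_mono)
      also have "\<dots> \<le> e / 2" using J e by (simp add: field_simps)
      finally show ?thesis .
    qed
    have i1: "(\<lambda>t. if t \<in> {a..b} then q t else 0) integrable_on {0..l}"
      using ab q(1) by (subst integrable_restrict_Int) (auto intro!: integrable_on_subinterval[OF q(1)] simp: Int_absorb2)
    have I1: "integral {0..l} (\<lambda>t. if t \<in> {a..b} then q t else 0) = integral {a..b} q"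
      using ab by (subst integral_restrict_Int) (auto intro!: arg_cong[where f="\<lambda>S. integral S q"])
    have "integral {a..b} q = P b - P a" using AC_with_deriv_diff[OF P ab(1-3)] by simp
    also have "\<dots> \<le> e / 2" using d(2)[of b a] ab abs_ge_self[of "P b - P a"] by auto
    finally have I1': "integral {a..b} q \<le> e / 2" .
    have "integral {0..l} (\<lambda>t. exp (- (\<tau> * \<bar>x - t\<bar>)) * q t) \<le>
        integral {0..l} (\<lambda>t. (if t \<in> {a..b} then q t else 0) + exp (- (\<tau> * d')) * q t)"
    proof (rule integral_le[OF int])
      show "(\<lambda>t. (if t \<in> {a..b} then q t else 0) + exp (- (\<tau> * d')) * q t) integrable_on {0..l}"
        by (intro integrable_add i1 integrable_on_mult_right q)
      fix t assume t: "t \<in> {0..l}"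
      have tau0: "\<tau> > 0" using T tau by simp
      show "exp (- (\<tau> * \<bar>x - t\<bar>)) * q t \<le> (if t \<in> {a..b} then q t else 0) + exp (- (\<tau> * d')) * q t"
      proof (cases "t \<in> {a..b}")
        case True
        have "exp (- (\<tau> * \<bar>x - t\<bar>)) * q t \<le> 1 * q t" using q(2)[OF t] tau0 by (intro mult_right_mono) auto
        moreover have "0 \<le> exp (- (\<tau> * d')) * q t" using q(2)[OF t] by simp
        ultimately show ?thesis using True by simp
      next
        case False
        then have "d' \<le> \<bar>x - t\<bar>" using t by (auto simp: a_def b_def)
        then show ?thesis using False q(2)[OF t] tau0 by (auto intro!: mult_right_mono)
      qed
    qed
    also have "\<dots> = integral {a..b} q + exp (- (\<tau> * d')) * J"
      unfolding I1[symmetric] J_def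
      by (intro integral_unique has_integral_add has_integral_mult_right integrable_integral i1 q)
    also have "\<dots> \<le> e" using I1' small by linarith
    finally show "(\<lambda>t. exp (- (\<tau> * \<bar>x - t\<bar>)) * q t) integrable_on {0..l} \<and>
        integral {0..l} (\<lambda>t. exp (- (\<tau> * \<bar>x - t\<bar>)) * q t) \<le> e" using int by blast
  qed
qed

section \<open>The approximate resolvent and its distance from solutions\<close>

context bvp begin

definition A0 :: "complex \<Rightarrow> complex^'n^'n" where "A0 lam = C + D ** W l ** Phi0 \<beta> l lam"

abbreviation D0 :: "complex \<Rightarrow> complex" where "D0 \<equiv> Delta0 l \<beta> C D (W l)"

lemma D0_eq: "D0 lam = det (A0 lam)" by (simp add: Delta0_def A0_def)

definition boundary_rhs :: "complex \<Rightarrow> (real \<Rightarrow> complex^'n) \<Rightarrow> complex^'n" where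
  "boundary_rhs lam g = - ((D ** W l ** Phi0 \<beta> l lam) *v F lam g l)"

definition cramer_coeff :: "complex \<Rightarrow> (real \<Rightarrow> complex^'n) \<Rightarrow> complex^'n" where
  "cramer_coeff lam g = inverse (D0 lam) *s cramer_vec (A0 lam) (boundary_rhs lam g)"

text \<open>The solution of the problem with block diagonal potential, continued meromorphically in the
  spectral parameter by Cramer's rule.\<close>
definition model :: "complex \<Rightarrow> (real \<Rightarrow> complex^'n) \<Rightarrow> real \<Rightarrow> complex^'n" where
  "model lam g x = Phi0 \<beta> x lam *v (W x *v (cramer_coeff lam g + F lam g x))"

lemma Phi0_bound:
  assumes "\<bar>Im lam\<bar> \<le> H" "x \<in> {0..l}"
  shows "norm (Phi0 \<beta> x lam *v v) \<le> strip_const H * norm v"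
proof (rule norm_vec_le_scaled)
  fix k show "cmod ((Phi0 \<beta> x lam *v v) $ k) \<le> strip_const H * cmod (v $ k)"
    using exp_strip(1)[OF assms(1) rho_bound[OF assms(2)], of k] by (simp add: Phi0_mult norm_mult mult_right_mono)
qed (rule strip_const_nonneg)

text \<open>The boundary condition in amplitude coordinates, without error. At 0 the fundamental
  matrix is the identity; at l its two factors commute, which makes \<open>A0\<close> the
  coefficient of the initial amplitude. The last bracket is the deviation estimated by
  \<open>strip_asymptotics\<close>.\<close>

lemma boundary_amplitude:
  assumes "solves lam y g"
  shows "A0 lam *v amplitude lam y 0 = boundary_rhs lam g - (D ** W l ** Phi0 \<beta> l lam) *v (amplitude lam y l - amplitude lam y 0 - F lam g l)"
proof -
  interpret mv: bounded_bilinear "\<lambda>(A::complex^'n^'n) x. A *v x" by (rule bounded_bilinear_matrix_vector)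
  have "Phi0 \<beta> 0 lam = mat 1" by (simp add: Phi0_def diag_mat_def mat_def rho_0)
  then have y0: "y 0 = amplitude lam y 0" using y_eq_amplitude[of 0 y lam] l by (simp add: W0)
  have "y l = (Phi0 \<beta> l lam ** W l) *v amplitude lam y l" using y_eq_amplitude[of l y lam] l by (simp add: matrix_vector_mul_assoc)
  then have yl: "D *v y l = (D ** W l ** Phi0 \<beta> l lam) *v amplitude lam y l"
    using l by (simp add: Phi0_W_commute matrix_vector_mul_assoc matrix_mul_assoc)
  have "C *v amplitude lam y 0 + (D ** W l ** Phi0 \<beta> l lam) *v amplitude lam y l = 0"
    using assms unfolding solves_def yl y0[symmetric] by blast
  then show ?thesis by (simp add: A0_def boundary_rhs_def mv.add_left mv.diff_right algebra_simps)
qed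

lemma strip_constants:
  obtains KJ KD KF KW where "KJ > 0" "KD > 0" "KF > 0" "KW > 0"
    "\<And>lam b. \<bar>Im lam\<bar> \<le> H \<Longrightarrow> norm (cramer_vec (A0 lam) b) \<le> KJ * norm b"
    "\<And>lam v. \<bar>Im lam\<bar> \<le> H \<Longrightarrow> norm ((D ** W l ** Phi0 \<beta> l lam) *v v) \<le> KD * norm v"
    "\<And>lam g x. \<lbrakk>\<bar>Im lam\<bar> \<le> H; continuous_on {0..l} g; x \<in> {0..l}\<rbrakk> \<Longrightarrow> norm (F lam g x) \<le> KF * L1 g"
    "\<And>x v. x \<in> {0..l} \<Longrightarrow> norm (W x *v v) \<le> KW * norm v"
proof -
  interpret mv: bounded_bilinear "\<lambda>(A::complex^'n^'n) x. A *v x" by (rule bounded_bilinear_matrix_vector)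
  obtain KF where KF: "KF > 0" "\<And>lam g x. \<lbrakk>\<bar>Im lam\<bar> \<le> H; continuous_on {0..l} g; x \<in> {0..l}\<rbrakk> \<Longrightarrow> norm (F lam g x) \<le> KF * L1 g"
    using F_bound by blast
  obtain KW where KW: "KW > 0" "\<And>x. x \<in> {0..l} \<Longrightarrow> norm (W x) \<le> KW"
    using bounded_continuous_Icc[OF W_continuous] by blast
  define KD where "KD = norm (D ** W l) * strip_const H + 1"
  have KD: "KD > 0" using strip_const_nonneg[of H] by (simp add: KD_def add_nonneg_pos)
  have KD2: "norm ((D ** W l ** Phi0 \<beta> l lam) *v v) \<le> KD * norm v" if lam: "\<bar>Im lam\<bar> \<le> H" for lam v
  proof -
    have "norm ((D ** W l ** Phi0 \<beta> l lam) *v v) = norm ((D ** W l) *v (Phi0 \<beta> l lam *v v))"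
      by (simp add: matrix_vector_mul_assoc)
    also have "\<dots> \<le> norm (D ** W l) * (strip_const H * norm v)"
      using l by (intro order_trans[OF norm_matrix_vector_mult_le mult_left_mono[OF Phi0_bound[OF lam]]]) auto
    also have "\<dots> \<le> KD * norm v" by (simp add: KD_def algebra_simps)
    finally show ?thesis .
  qed
  \<comment> \<open>The summand 1 meets the hypothesis \<open>1 \<le> K\<close> of
    \<open>cramer_vec_bound\<close>.\<close>
  define K1 where "K1 = 1 + norm C + KD"
  define KJ where "KJ = real CARD('n) * (fact CARD('n) * K1 ^ CARD('n))"
  have K1: "1 \<le> K1" using KD by (simp add: K1_def)
  have KJ: "KJ > 0" using K1 by (simp add: KJ_def)
  show ?thesis
  proof (rule that[OF KJ KD KF(1) KW(1) _ KD2 KF(2)])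
    show "norm (W x *v v) \<le> KW * norm v" if "x \<in> {0..l}" for x v
      using KW(2)[OF that] by (intro order_trans[OF norm_matrix_vector_mult_le] mult_right_mono) auto
    fix lam b assume lam: "\<bar>Im lam\<bar> \<le> H"
    have "cmod (A0 lam $ i $ j) \<le> K1" for i j
    proof -
      have "A0 lam $ i $ j = (A0 lam *v axis j 1) $ i"
        by (simp add: matrix_vector_mult_def axis_def if_distrib cong: if_cong)
      also have "cmod \<dots> \<le> norm (A0 lam *v axis j 1)" by (rule Finite_Cartesian_Product.norm_nth_le)
      also have "\<dots> \<le> norm C * norm (axis j 1 :: complex^'n) + KD * norm (axis j 1 :: complex^'n)"
        unfolding A0_def mv.add_left
        by (intro order_trans[OF norm_triangle_ineq] add_mono norm_matrix_vector_mult_le KD2 lam)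
      also have "norm (axis j 1 :: complex^'n) = 1"
        by (simp add: norm_vec_def L2_set_def axis_def if_distrib[of "\<lambda>z. (cmod z)\<^sup>2"] cong: if_cong)
      finally show ?thesis by (simp add: K1_def)
    qed
    then show "norm (cramer_vec (A0 lam) b) \<le> KJ * norm b"
      unfolding KJ_def by (rule cramer_vec_bound[OF K1])
  qed auto
qed

lemma cramer_coeff_bound:
  assumes c: "0 < c"
  obtains K where "K > 0" "\<And>lam g. \<lbrakk>\<bar>Im lam\<bar> \<le> H; continuous_on {0..l} g; c \<le> cmod (D0 lam)\<rbrakk> \<Longrightarrow> norm (cramer_coeff lam g) \<le> K * L1 g"
proof -
  obtain KJ KD KF KW where K: "KJ > 0" "KD > 0" "KF > 0" "KW > 0"
    "\<And>lam b. \<bar>Im lam\<bar> \<le> H \<Longrightarrow> norm (cramer_vec (A0 lam) b) \<le> KJ * norm b"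
    "\<And>lam v. \<bar>Im lam\<bar> \<le> H \<Longrightarrow> norm ((D ** W l ** Phi0 \<beta> l lam) *v v) \<le> KD * norm v"
    "\<And>lam g x. \<lbrakk>\<bar>Im lam\<bar> \<le> H; continuous_on {0..l} g; x \<in> {0..l}\<rbrakk> \<Longrightarrow> norm (F lam g x) \<le> KF * L1 g"
    "\<And>x v. x \<in> {0..l} \<Longrightarrow> norm (W x *v v) \<le> KW * norm v"
    using strip_constants[of H] by blast
  show ?thesis
  proof (rule that)
    show "KJ * KD * KF / c > 0" using K c by simp
    fix lam and g :: "real \<Rightarrow> complex^'n"
    assume lam: "\<bar>Im lam\<bar> \<le> H" and g: "continuous_on {0..l} g" and D: "c \<le> cmod (D0 lam)"
    have "norm (cramer_coeff lam g) = norm (cramer_vec (A0 lam) (boundary_rhs lam g)) / cmod (D0 lam)"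
      by (simp add: cramer_coeff_def norm_vector_smult norm_inverse divide_inverse mult.commute)
    also have "\<dots> \<le> norm (cramer_vec (A0 lam) (boundary_rhs lam g)) / c"
      using D c by (intro divide_left_mono) (auto intro!: mult_pos_pos)
    also have "norm (cramer_vec (A0 lam) (boundary_rhs lam g)) \<le> KJ * (KD * (KF * L1 g))"
    proof -
      have "norm (boundary_rhs lam g) \<le> KD * norm (F lam g l)" unfolding boundary_rhs_def norm_minus_cancel by (rule K(6)[OF lam])
      also have "\<dots> \<le> KD * (KF * L1 g)" using K(7)[OF lam g, of l] K(2) l by (intro mult_left_mono) auto
      finally show ?thesis using K(5)[OF lam, of "boundary_rhs lam g"] K(1) by (meson mult_left_mono order_trans less_imp_le)
    qed
    finally show "norm (cramer_coeff lam g) \<le> KJ * KD * KF / c * L1 g" using c by (simp add: divide_right_mono mult.assoc)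
  qed
qed

text \<open>Subtracting the boundary equation of the model leaves \<open>A0\<close> applied to the
  difference of the initial amplitudes, equal to a small term whose size still involves the unknown
  \<open>u 0\<close>. Cramer's rule with the lower bound c for the determinant, followed by
  absorption of \<open>u 0\<close>, gives the estimate.\<close>

lemma strip_good_set:
  assumes c: "0 < c" and e: "0 < e"
  obtains R where "\<And>lam y g x. \<lbrakk>\<bar>Im lam\<bar> \<le> H; R \<le> cmod lam; continuous_on {0..l} g; solves lam y g;
      c \<le> cmod (D0 lam); x \<in> {0..l}\<rbrakk> \<Longrightarrow> norm (y x - model lam g x) \<le> e * L1 g"
proof -
  interpret mv: bounded_bilinear "\<lambda>(A::complex^'n^'n) x. A *v x" by (rule bounded_bilinear_matrix_vector)
  obtain KJ KD KF KW where K: "KJ > 0" "KD > 0" "KF > 0" "KW > 0"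
    "\<And>lam b. \<bar>Im lam\<bar> \<le> H \<Longrightarrow> norm (cramer_vec (A0 lam) b) \<le> KJ * norm b"
    "\<And>lam v. \<bar>Im lam\<bar> \<le> H \<Longrightarrow> norm ((D ** W l ** Phi0 \<beta> l lam) *v v) \<le> KD * norm v"
    "\<And>lam g x. \<lbrakk>\<bar>Im lam\<bar> \<le> H; continuous_on {0..l} g; x \<in> {0..l}\<rbrakk> \<Longrightarrow> norm (F lam g x) \<le> KF * L1 g"
    "\<And>x v. x \<in> {0..l} \<Longrightarrow> norm (W x *v v) \<le> KW * norm v"
    using strip_constants[of H] by blast
  obtain Kv where Kv: "Kv > 0" "\<And>lam g. \<lbrakk>\<bar>Im lam\<bar> \<le> H; continuous_on {0..l} g; c \<le> cmod (D0 lam)\<rbrakk> \<Longrightarrow> norm (cramer_coeff lam g) \<le> Kv * L1 g"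
    using cramer_coeff_bound[OF c, of H] by blast
  define q where "q = KJ * KD / c"
  have q: "q > 0" using K c by (simp add: q_def)
  define K6 where "K6 = strip_const H * KW * ((q + 1) * (2 * Kv + 2))"
  have K6: "K6 > 0" using K q Kv strip_const_pos[of H] by (simp add: K6_def)
  \<comment> \<open>The second entry makes \<open>q * n\<close> at most 1/2, for absorbing
    \<open>u 0\<close>; the first turns the accumulated constant K6 into e.\<close>
  define n where "n = min (e / K6) (1 / (2 * q))"
  have n: "n > 0" "n \<le> e / K6" "n \<le> 1 / (2 * q)" using e K6 q by (auto simp: n_def)
  obtain R where R: "\<And>lam y g x. \<lbrakk>\<bar>Im lam\<bar> \<le> H; R \<le> cmod lam; continuous_on {0..l} g; solves lam y g; x \<in> {0..l}\<rbrakk>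
     \<Longrightarrow> norm (amplitude lam y x - amplitude lam y 0 - F lam g x) \<le> n * (norm (amplitude lam y 0) + L1 g)"
    using strip_asymptotics[OF n(1), of H] by blast
  show ?thesis
  proof (rule that)
    fix lam x and y g :: "real \<Rightarrow> complex^'n"
    assume lam: "\<bar>Im lam\<bar> \<le> H" "R \<le> cmod lam" and g: "continuous_on {0..l} g" and sol: "solves lam y g"
      and D: "c \<le> cmod (D0 lam)" and x: "x \<in> {0..l}"
    define u where "u = amplitude lam y"
    define v where "v = cramer_coeff lam g"
    define ex where "ex = u l - u 0 - F lam g l"
    define L where "L = L1 g"
    have L: "L \<ge> 0" unfolding L_def by (rule L1_nonneg[OF g])
    have ex: "norm ex \<le> n * (norm (u 0) + L)"
      unfolding ex_def u_def L_def using R[OF lam g sol, of l] l by simp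
    have v: "norm v \<le> Kv * L" unfolding v_def L_def by (rule Kv(2)[OF lam(1) g D])
    have D0: "det (A0 lam) \<noteq> 0" using D c by (auto simp: D0_eq)
    have "A0 lam *v v = boundary_rhs lam g" unfolding v_def cramer_coeff_def D0_eq by (rule mult_cramer_vec[OF D0])
    then have "A0 lam *v (u 0 - v) = - ((D ** W l ** Phi0 \<beta> l lam) *v ex)"
      using boundary_amplitude[OF sol] by (simp add: mv.diff_right u_def ex_def)
    then have "det (A0 lam) *s (u 0 - v) = cramer_vec (A0 lam) (- ((D ** W l ** Phi0 \<beta> l lam) *v ex))"
      by (metis cramer_vec_mult)
    moreover have "norm (det (A0 lam) *s (u 0 - v)) = cmod (D0 lam) * norm (u 0 - v)"
      by (simp only: norm_vector_smult D0_eq)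
    ultimately have "cmod (D0 lam) * norm (u 0 - v) \<le> KJ * norm (- ((D ** W l ** Phi0 \<beta> l lam) *v ex))"
      using K(5)[OF lam(1)] by metis
    also have "\<dots> \<le> KJ * (KD * norm ex)" unfolding norm_minus_cancel using K(1) by (intro mult_left_mono K(6) lam) auto
    finally have "c * norm (u 0 - v) \<le> KJ * (KD * norm ex)" using D by (meson mult_right_mono norm_ge_zero order_trans)
    then have uv: "norm (u 0 - v) \<le> q * norm ex" using c by (simp add: q_def field_simps)
    have "q * norm ex \<le> q * (n * (norm (u 0) + L))" using q ex by (intro mult_left_mono) auto
    also have "\<dots> \<le> (1/2) * (norm (u 0) + L)" 
    proof -
      have "q * n \<le> 1/2" using n(3) q by (simp add: field_simps)
      then have "(q * n) * (norm (u 0) + L) \<le> (1/2) * (norm (u 0) + L)" using L by (intro mult_right_mono) auto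
      then show ?thesis by (simp only: mult.assoc)
    qed
    finally have "norm (u 0) \<le> Kv * L + (1/2) * (norm (u 0) + L)"
      using uv v norm_triangle_ineq[of "u 0 - v" v, unfolded diff_add_cancel] by linarith
    then have u0: "norm (u 0) + L \<le> (2 * Kv + 2) * L" by (simp add: field_simps)
    have "norm (u x - (v + F lam g x)) \<le> norm (u x - u 0 - F lam g x) + norm (u 0 - v)"
      using norm_triangle_ineq[of "u x - u 0 - F lam g x" "u 0 - v"] by (simp add: algebra_simps)
    also have "\<dots> \<le> n * (norm (u 0) + L) + q * (n * (norm (u 0) + L))"
    proof (rule add_mono)
      show "norm (u x - u 0 - F lam g x) \<le> n * (norm (u 0) + L)"
        unfolding u_def L_def by (rule R[OF lam g sol x])
      show "norm (u 0 - v) \<le> q * (n * (norm (u 0) + L))"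
        using uv mult_left_mono[OF ex, of q] q by linarith
    qed
    also have "\<dots> = n * ((q + 1) * (norm (u 0) + L))" by (simp add: algebra_simps)
    also have "\<dots> \<le> n * ((q + 1) * ((2 * Kv + 2) * L))"
      using u0 n q by (intro mult_left_mono) auto
    finally have main: "norm (u x - (v + F lam g x)) \<le> n * ((q + 1) * ((2 * Kv + 2) * L))" .
    have "y x - model lam g x = Phi0 \<beta> x lam *v (W x *v (u x - (v + F lam g x)))"
      unfolding model_def mv.diff_right v_def u_def y_eq_amplitude[OF x, of y lam, symmetric] by simp
    also have "norm \<dots> \<le> strip_const H * (KW * norm (u x - (v + F lam g x)))"
      by (intro order_trans[OF Phi0_bound[OF lam(1) x]] mult_left_mono K(8) x strip_const_nonneg)
    also have "\<dots> \<le> strip_const H * (KW * (n * ((q + 1) * ((2 * Kv + 2) * L))))"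
      using main K(4) strip_const_nonneg[of H] by (intro mult_left_mono) auto
    also have "\<dots> = n * K6 * L" by (simp add: K6_def)
    also have "\<dots> \<le> e * L" using n(2) K6 L by (intro mult_right_mono) (simp_all add: field_simps)
    finally show "norm (y x - model lam g x) \<le> e * L1 g" by (simp add: L_def)
  qed
qed

lemma model_bound:
  assumes c: "0 < c"
  obtains K where "K > 0" "\<And>lam g x. \<lbrakk>\<bar>Im lam\<bar> \<le> H; continuous_on {0..l} g; c \<le> cmod (D0 lam); x \<in> {0..l}\<rbrakk>
     \<Longrightarrow> norm (model lam g x) \<le> K * L1 g"
proof -
  obtain KJ KD KF KW where K: "KJ > 0" "KD > 0" "KF > 0" "KW > 0"
    "\<And>lam b. \<bar>Im lam\<bar> \<le> H \<Longrightarrow> norm (cramer_vec (A0 lam) b) \<le> KJ * norm b"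
    "\<And>lam v. \<bar>Im lam\<bar> \<le> H \<Longrightarrow> norm ((D ** W l ** Phi0 \<beta> l lam) *v v) \<le> KD * norm v"
    "\<And>lam g x. \<lbrakk>\<bar>Im lam\<bar> \<le> H; continuous_on {0..l} g; x \<in> {0..l}\<rbrakk> \<Longrightarrow> norm (F lam g x) \<le> KF * L1 g"
    "\<And>x v. x \<in> {0..l} \<Longrightarrow> norm (W x *v v) \<le> KW * norm v"
    using strip_constants[of H] by blast
  obtain Kv where Kv: "Kv > 0" "\<And>lam g. \<lbrakk>\<bar>Im lam\<bar> \<le> H; continuous_on {0..l} g; c \<le> cmod (D0 lam)\<rbrakk> \<Longrightarrow> norm (cramer_coeff lam g) \<le> Kv * L1 g"
    using cramer_coeff_bound[OF c, of H] by blast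
  show ?thesis
  proof (rule that)
    show "strip_const H * (KW * (Kv + KF)) > 0" using strip_const_pos[of H] K(3,4) Kv(1) by (simp add: add_pos_pos)
    fix lam x and g :: "real \<Rightarrow> complex^'n"
    assume lam: "\<bar>Im lam\<bar> \<le> H" and g: "continuous_on {0..l} g" and D: "c \<le> cmod (D0 lam)" and x: "x \<in> {0..l}"
    have "norm (cramer_coeff lam g + F lam g x) \<le> Kv * L1 g + KF * L1 g"
      by (intro norm_triangle_le add_mono Kv K(7) lam g D x)
    then have "norm (model lam g x) \<le> strip_const H * (KW * (Kv * L1 g + KF * L1 g))"
      unfolding model_def using K(4)
      by (intro order_trans[OF Phi0_bound[OF lam x]] mult_left_mono order_trans[OF K(8)[OF x]] strip_const_nonneg) auto
    then show "norm (model lam g x) \<le> strip_const H * (KW * (Kv + KF)) * L1 g" by (simp add: algebra_simps)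
  qed
qed

end

section \<open>Solutions far from the real axis\<close>

lemma diag_mat_mult: "(diag_mat d *v v) $ k = d k * v $ k"
  by (simp add: diag_mat_def matrix_vector_mult_def if_distrib if_distribR cong: if_cong)

context bvp begin

definition proj_on :: "'n set \<Rightarrow> complex^'n^'n" where "proj_on S = diag_mat (\<lambda>k. if k \<in> S then 1 else 0)"

lemma proj_on_mult: "(proj_on S *v v) $ k = (if k \<in> S then v $ k else 0)"
  by (simp add: proj_on_def diag_mat_mult)

text \<open>W leaves the range of \<open>proj_on (- S)\<close> invariant, so the matrix containing W
  factors through \<open>proj_on S + W l ** proj_on (- S)\<close>. The purpose: far from the real
  axis the whole of Q is treated as a perturbation, and the boundary determinant met there contains
  no W.\<close>

lemma det_without_W:
  assumes S: "\<And>j k. eqv j k \<Longrightarrow> j \<in> S \<longleftrightarrow> k \<in> S"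
    and det: "det (C ** proj_on S + D ** W l ** proj_on (- S)) \<noteq> 0"
  shows "det (C ** proj_on S + D ** proj_on (- S)) \<noteq> 0"
proof
  assume "det (C ** proj_on S + D ** proj_on (- S)) = 0"
  interpret mv: bounded_bilinear "\<lambda>(A::complex^'n^'n) x. A *v x" by (rule bounded_bilinear_matrix_vector)
  have ll: "l \<in> {0..l}" using l by simp
  have PW: "proj_on (- S) *v (W l *v (proj_on (- S) *v v)) = W l *v (proj_on (- S) *v v)"
    and PSW: "proj_on S *v (W l *v (proj_on (- S) *v v)) = 0" for v
  proof -
    have "(W l *v (proj_on (- S) *v v)) $ j = 0" if "j \<in> S" for j
    proof -
      have "W l $ j $ k * (proj_on (- S) *v v) $ k = 0" for k
        using W_block[OF ll, of j k] S[of j k] that by (auto simp: proj_on_mult)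
      then have "(\<Sum>k\<in>UNIV. W l $ j $ k * (proj_on (- S) *v v) $ k) = 0" by (intro sum.neutral) blast
      then show ?thesis by (simp add: matrix_vector_mult_def[of "W l"])
    qed
    then show "proj_on (- S) *v (W l *v (proj_on (- S) *v v)) = W l *v (proj_on (- S) *v v)"
      "proj_on S *v (W l *v (proj_on (- S) *v v)) = 0" by (auto simp: vec_eq_iff proj_on_mult)
  qed
  have P1: "proj_on S *v (proj_on S *v v) = proj_on S *v v" "proj_on (- S) *v (proj_on S *v v) = 0" for v
    by (auto simp: vec_eq_iff proj_on_mult)
  have "(C ** proj_on S + D ** W l ** proj_on (- S)) *v v = ((C ** proj_on S + D ** proj_on (- S)) ** (proj_on S + W l ** proj_on (- S))) *v v" for v
    by (simp add: mv.add_left mv.add_right matrix_vector_mul_assoc[symmetric] P1 PW PSW)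
  then have "C ** proj_on S + D ** W l ** proj_on (- S) = (C ** proj_on S + D ** proj_on (- S)) ** (proj_on S + W l ** proj_on (- S))"
    by (simp add: matrix_eq)
  with det \<open>det (C ** proj_on S + D ** proj_on (- S)) = 0\<close> show False by (simp add: det_mul)
qed

section \<open>Propagation of single components with exponential decay\<close>

lemma solves_continuous: "solves lam y g \<Longrightarrow> continuous_on {0..l} y"
  unfolding solves_def by (elim conjE) (erule AC_with_deriv_continuous)

lemma variation_of_constants:
  fixes y g :: "real \<Rightarrow> complex^'n"
  assumes sol: "solves lam y g" and st: "0 \<le> s" "s \<le> t" "t \<le> l"
  defines "r \<equiv> \<lambda>x k. \<i> * of_real (\<beta> k x) * g x $ k - (Q x *v y x) $ k"
  shows "((\<lambda>x. osc_exp lam k x * r x k) has_integral osc_exp lam k t * y t $ k - osc_exp lam k s * y s $ k) {s..t}"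
proof -
  define y' where "y' = (\<lambda>x. (\<chi> k. \<i> * of_real (\<beta> k x) * (lam * y x $ k + g x $ k)) - Q x *v y x)"
  have y: "AC_with_deriv l y y'" using sol by (simp add: solves_def y'_def)
  have "AC_with_deriv l (\<lambda>x. osc_exp lam k x * y x $ k)
      (\<lambda>x. (- (\<i> * lam * of_real (\<beta> k x)) * osc_exp lam k x) * y x $ k + osc_exp lam k x * y' x $ k)"
    by (rule AC_with_deriv_bilinear[OF l0 bounded_bilinear_mult osc_exp_AC AC_with_deriv_nth[OF y]])
  moreover have "(\<lambda>x. (- (\<i> * lam * of_real (\<beta> k x)) * osc_exp lam k x) * y x $ k + osc_exp lam k x * y' x $ k)
      = (\<lambda>x. osc_exp lam k x * r x k)"
    by (simp add: y'_def r_def algebra_simps fun_eq_iff)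
  ultimately have "AC_with_deriv l (\<lambda>x. osc_exp lam k x * y x $ k) (\<lambda>x. osc_exp lam k x * r x k)" by simp
  from AC_with_deriv_has_integral[OF this st] show ?thesis .
qed

lemma osc_exp_decay:
  assumes st: "s \<in> {0..l}" "t \<in> {0..l}"
    and sgn: "s \<le> t \<and> (\<forall>x\<in>{0..l}. 0 < Im lam * \<beta> k x) \<or> t \<le> s \<and> (\<forall>x\<in>{0..l}. Im lam * \<beta> k x < 0)"
  shows "cmod (exp (\<i> * lam * of_real (rho \<beta> k t)) * osc_exp lam k s) \<le> exp (- (\<bar>Im lam\<bar> * b0 * \<bar>t - s\<bar>))"
proof -
  \<comment> \<open>The sign \<sigma> lets one monotonicity estimate serve both directions of
    propagation.\<close>
  have bd: "b0 * (t' - s') * \<bar>Im lam\<bar> \<le> \<sigma> * (Im lam * (rho \<beta> k t' - rho \<beta> k s'))"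
    if "0 \<le> s'" "s' \<le> t'" "t' \<le> l" "\<And>x. x \<in> {0..l} \<Longrightarrow> 0 < \<sigma> * (Im lam * \<beta> k x)" "\<bar>\<sigma>\<bar> = 1" for s' t' \<sigma>
  proof -
    have h: "((\<lambda>x. \<sigma> * (Im lam * \<beta> k x)) has_integral \<sigma> * (Im lam * (rho \<beta> k t' - rho \<beta> k s'))) {s'..t'}"
      by (intro has_integral_mult_right AC_with_deriv_has_integral[OF rho_AC that(1-3)])
    have c: "((\<lambda>x. b0 * \<bar>Im lam\<bar>) has_integral (b0 * \<bar>Im lam\<bar>) * (t' - s')) {s'..t'}"
      using has_integral_const_real[of "b0 * \<bar>Im lam\<bar>" s' t'] that(2) by (simp add: mult.commute)
    have "(b0 * \<bar>Im lam\<bar>) * (t' - s') \<le> \<sigma> * (Im lam * (rho \<beta> k t' - rho \<beta> k s'))"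
    proof (rule has_integral_le[OF c h])
      fix x assume "x \<in> {s'..t'}"
      then have x: "x \<in> {0..l}" using that by auto
      have "b0 * \<bar>Im lam\<bar> \<le> \<bar>\<beta> k x\<bar> * \<bar>Im lam\<bar>" using beta_lo[OF x] by (intro mult_right_mono) auto
      also have "\<dots> = \<bar>\<sigma> * (Im lam * \<beta> k x)\<bar>" using that(5) by (simp add: abs_mult)
      also have "\<dots> = \<sigma> * (Im lam * \<beta> k x)" using that(4)[OF x] by simp
      finally show "b0 * \<bar>Im lam\<bar> \<le> \<sigma> * (Im lam * \<beta> k x)" .
    qed
    then show ?thesis by (simp add: mult_ac)
  qed
  have "\<bar>Im lam\<bar> * b0 * \<bar>t - s\<bar> \<le> Im lam * (rho \<beta> k t - rho \<beta> k s)"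
    using sgn
  proof
    assume "s \<le> t \<and> (\<forall>x\<in>{0..l}. 0 < Im lam * \<beta> k x)"
    then show ?thesis using bd[of s t 1] st by (simp add: mult_ac)
  next
    assume "t \<le> s \<and> (\<forall>x\<in>{0..l}. Im lam * \<beta> k x < 0)"
    then show ?thesis using bd[of t s "-1"] st by (simp add: algebra_simps)
  qed
  moreover have "cmod (exp (\<i> * lam * of_real (rho \<beta> k t)) * osc_exp lam k s) = exp (- (Im lam * (rho \<beta> k t - rho \<beta> k s)))"
    by (simp add: osc_exp_def norm_mult exp_add[symmetric] algebra_simps)
  ultimately show ?thesis by simp
qed

text \<open>The component is followed from s to t in the direction in which its exponential decays,
  so the potential enters only through the exponentially localised integral bounded by \<kappa>.
  Allowing s on either side of t covers both signs of \<open>Im lam * \<beta> k x\<close>.\<close>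

lemma large_Im_componentwise:
  fixes y g :: "real \<Rightarrow> complex^'n"
  assumes sol: "solves lam y g" and g: "continuous_on {0..l} g" and st: "s \<in> {0..l}" "t \<in> {0..l}"
    and sgn: "s \<le> t \<and> (\<forall>x\<in>{0..l}. 0 < Im lam * \<beta> k x) \<or> t \<le> s \<and> (\<forall>x\<in>{0..l}. Im lam * \<beta> k x < 0)"
    and Y: "\<And>x. x \<in> {0..l} \<Longrightarrow> norm (y x) \<le> Y"
    and int: "(\<lambda>x. exp (- (\<bar>Im lam\<bar> * b0 * \<bar>t - x\<bar>)) * norm (Q x)) integrable_on {0..l}"
      "integral {0..l} (\<lambda>x. exp (- (\<bar>Im lam\<bar> * b0 * \<bar>t - x\<bar>)) * norm (Q x)) \<le> \<kappa>"
  shows "cmod (y t $ k) \<le> exp (- (\<bar>Im lam\<bar> * b0 * \<bar>t - s\<bar>)) * cmod (y s $ k) + (\<kappa> * Y + B * L1 g)"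
proof -
  define a where "a = min s t"
  define b where "b = max s t"
  have ab: "0 \<le> a" "a \<le> b" "b \<le> l" "{a..b} \<subseteq> {0..l}" using st by (auto simp: a_def b_def)
  have Y0: "0 \<le> Y" using Y[OF st(1)] norm_ge_zero order_trans by blast
  define E where "E = exp (\<i> * lam * of_real (rho \<beta> k t))"
  define r where "r = (\<lambda>x. \<i> * of_real (\<beta> k x) * g x $ k - (Q x *v y x) $ k)"
  have hi: "((\<lambda>x. E * (osc_exp lam k x * r x)) has_integral E * (osc_exp lam k b * y b $ k - osc_exp lam k a * y a $ k)) {a..b}"
    unfolding r_def by (intro has_integral_mult_right variation_of_constants[OF sol ab(1-3)])
  have E1: "E * osc_exp lam k t = 1" using osc_exp_inverse[of lam k t] by (simp add: E_def mult.commute)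
  have "cmod (y t $ k - E * osc_exp lam k s * y s $ k) = cmod (E * (osc_exp lam k b * y b $ k - osc_exp lam k a * y a $ k))"
  proof (cases "s \<le> t")
    case True
    then have "a = s" "b = t" by (auto simp: a_def b_def)
    then show ?thesis using E1 by (simp add: right_diff_distrib mult.assoc[symmetric])
  next
    case False
    then have "a = t" "b = s" by (auto simp: a_def b_def)
    then show ?thesis using E1 by (simp add: right_diff_distrib mult.assoc[symmetric] norm_minus_commute)
  qed
  also have "\<dots> \<le> integral {a..b} (\<lambda>x. Y * (exp (- (\<bar>Im lam\<bar> * b0 * \<bar>t - x\<bar>)) * norm (Q x)) + B * norm (g x))"
    unfolding integral_unique[OF hi, symmetric]
  proof (rule integral_norm_bound_integral)
    show "(\<lambda>x. E * (osc_exp lam k x * r x)) integrable_on {a..b}" using hi by blast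
    show "(\<lambda>x. Y * (exp (- (\<bar>Im lam\<bar> * b0 * \<bar>t - x\<bar>)) * norm (Q x)) + B * norm (g x)) integrable_on {a..b}"
      by (intro integrable_add integrable_on_mult_right integrable_on_subinterval[OF int(1) ab(4)]
          integrable_on_subinterval[OF cnorm_integrable[OF g] ab(4)])
    fix x assume x: "x \<in> {a..b}"
    then have xl: "x \<in> {0..l}" using ab by auto
    have dec: "cmod (E * osc_exp lam k x) \<le> exp (- (\<bar>Im lam\<bar> * b0 * \<bar>t - x\<bar>))"
      unfolding E_def using x sgn by (intro osc_exp_decay[OF xl st(2)]) (auto simp: a_def b_def)
    also have "\<dots> \<le> 1" using b0 by simp
    finally have dec1: "cmod (E * osc_exp lam k x) \<le> 1" .
    have "cmod (E * (osc_exp lam k x * r x)) = cmod (E * osc_exp lam k x) * cmod (r x)" by (simp add: norm_mult)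
    also have "\<dots> \<le> cmod (E * osc_exp lam k x) * (B * norm (g x) + norm (Q x) * Y)"
    proof (rule mult_left_mono)
      have "cmod (r x) \<le> cmod (\<i> * of_real (\<beta> k x) * g x $ k) + cmod ((Q x *v y x) $ k)"
        unfolding r_def by (rule norm_triangle_ineq4)
      also have "\<dots> \<le> B * norm (g x) + norm (Q x) * Y"
      proof (rule add_mono)
        show "cmod (\<i> * of_real (\<beta> k x) * g x $ k) \<le> B * norm (g x)"
          using beta_hi[OF xl, of k] B0 Finite_Cartesian_Product.norm_nth_le[of "g x" k] by (simp add: norm_mult mult_mono)
        have "cmod ((Q x *v y x) $ k) \<le> norm (Q x *v y x)" by (rule Finite_Cartesian_Product.norm_nth_le)
        also have "\<dots> \<le> norm (Q x) * Y"
          using Y[OF xl] by (intro order_trans[OF norm_matrix_vector_mult_le] mult_left_mono) auto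
        finally show "cmod ((Q x *v y x) $ k) \<le> norm (Q x) * Y" .
      qed
      finally show "cmod (r x) \<le> B * norm (g x) + norm (Q x) * Y" .
    qed simp
    also have "\<dots> \<le> 1 * (B * norm (g x)) + exp (- (\<bar>Im lam\<bar> * b0 * \<bar>t - x\<bar>)) * (norm (Q x) * Y)"
      unfolding distrib_left using dec dec1 B0 Y0 by (intro add_mono mult_right_mono) auto
    finally show "cmod (E * (osc_exp lam k x * r x)) \<le> Y * (exp (- (\<bar>Im lam\<bar> * b0 * \<bar>t - x\<bar>)) * norm (Q x)) + B * norm (g x)"
      by (simp add: mult_ac)
  qed
  also have "\<dots> \<le> integral {0..l} (\<lambda>x. Y * (exp (- (\<bar>Im lam\<bar> * b0 * \<bar>t - x\<bar>)) * norm (Q x)) + B * norm (g x))"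
    using ab(4) Y0 B0
    by (intro integral_subset_le integrable_add integrable_on_mult_right integrable_on_subinterval[OF int(1) ab(4)]
          integrable_on_subinterval[OF cnorm_integrable[OF g] ab(4)] int(1) cnorm_integrable g) auto
  also have "\<dots> = Y * integral {0..l} (\<lambda>x. exp (- (\<bar>Im lam\<bar> * b0 * \<bar>t - x\<bar>)) * norm (Q x)) + B * L1 g"
    unfolding L1_def
    by (intro integral_unique has_integral_add has_integral_mult_right integrable_integral int(1) cnorm_integrable g)
  also have "\<dots> \<le> \<kappa> * Y + B * L1 g" using mult_left_mono[OF int(2) Y0] by (simp add: mult.commute)
  finally have main: "cmod (y t $ k - E * osc_exp lam k s * y s $ k) \<le> \<kappa> * Y + B * L1 g" .
  have "cmod (E * osc_exp lam k s * y s $ k) \<le> exp (- (\<bar>Im lam\<bar> * b0 * \<bar>t - s\<bar>)) * cmod (y s $ k)"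
    unfolding norm_mult[of _ "y s $ k"] E_def by (intro mult_right_mono osc_exp_decay[OF st sgn]) auto
  then show ?thesis using main norm_triangle_ineq[of "y t $ k - E * osc_exp lam k s * y s $ k" "E * osc_exp lam k s * y s $ k"]
    by simp
qed

text \<open>The vector v collects the incoming data: components in S at 0, the others at l. It
  controls the solution everywhere, while it contributes to the outgoing boundary values a and b
  only with a small factor. The boundary condition reads \<open>E *v v = - (C *v a + D *v b)\<close>
  with E invertible, so v can be absorbed.\<close>

lemma large_Im_S:
  assumes det: "det (C ** proj_on S + D ** proj_on (- S)) \<noteq> 0"
  obtains T K where "T > 0" "K > 0"
    "\<And>lam y g x. \<lbrakk>T \<le> \<bar>Im lam\<bar>; \<And>k x. k \<in> S \<Longrightarrow> x \<in> {0..l} \<Longrightarrow> 0 < Im lam * \<beta> k x;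
        \<And>k x. k \<notin> S \<Longrightarrow> x \<in> {0..l} \<Longrightarrow> Im lam * \<beta> k x < 0;
        continuous_on {0..l} g; solves lam y g; x \<in> {0..l}\<rbrakk> \<Longrightarrow> norm (y x) \<le> K * L1 g"
proof -
  interpret mv: bounded_bilinear "\<lambda>(A::complex^'n^'n) x. A *v x" by (rule bounded_bilinear_matrix_vector)
  define E where "E = C ** proj_on S + D ** proj_on (- S)"
  have "invertible E" using det unfolding E_def invertible_det_nz .
  then obtain E' where E': "E' ** E = mat 1" unfolding invertible_def by blast
  define K5 where "K5 = norm E' * (norm C + norm D) + 1"
  have K5: "K5 \<ge> 1" by (simp add: K5_def)
  define n where "n = real CARD('n)"
  have n: "n \<ge> 1" unfolding n_def by (simp add: Suc_leI)
  \<comment> \<open>Chosen so that \<open>K5 * n * n * \<epsilon>\<close> is 1/6; the terms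
    collected at the end then multiply \<open>norm v\<close> by at most 1/6 + 1/3.\<close>
  define \<epsilon> where "\<epsilon> = 1 / (6 * K5 * n * n)"
  have eps: "\<epsilon> > 0" using K5 n by (simp add: \<epsilon>_def)
  have iQ: "(\<lambda>x. norm (Q x)) integrable_on {0..l}" using Q by (auto simp: absolutely_integrable_on_def)
  obtain T0 where T0: "T0 > 0" "\<And>\<tau> x. \<lbrakk>T0 \<le> \<tau>; x \<in> {0..l}\<rbrakk> \<Longrightarrow>
     (\<lambda>t. exp (- (\<tau> * \<bar>x - t\<bar>)) * norm (Q t)) integrable_on {0..l} \<and> integral {0..l} (\<lambda>t. exp (- (\<tau> * \<bar>x - t\<bar>)) * norm (Q t)) \<le> \<epsilon>"
    using exp_kernel_small[OF l0 iQ norm_ge_zero eps] by blast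
  \<comment> \<open>The first entry makes the kernel integral at rate
    \<open>\<bar>Im lam\<bar> * b0\<close> at most \<epsilon>, the second makes the decay over the
    whole interval, \<open>exp (- (\<bar>Im lam\<bar> * b0 * l))\<close>, at most
    \<epsilon>.\<close>
  define T where "T = max (T0 / b0) (1 / (\<epsilon> * b0 * l))"
  have T: "T > 0" using T0(1) b0 by (simp add: T_def less_max_iff_disj)
  have Tt: "T0 \<le> \<tau> * b0" "1 / \<epsilon> \<le> \<tau> * b0 * l" if "T \<le> \<tau>" for \<tau>
  proof -
    have "T0 / b0 \<le> \<tau>" "1 / (\<epsilon> * b0 * l) \<le> \<tau>" using that by (auto simp: T_def)
    moreover have "\<epsilon> * b0 * l > 0" using eps b0 l by simp
    ultimately show "T0 \<le> \<tau> * b0" "1 / \<epsilon> \<le> \<tau> * b0 * l"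
      using b0 eps by (simp_all only: pos_divide_le_eq) (simp_all only: mult_ac)
  qed
  define K where "K = 2 * n * (4 * K5 * n * B + B)"
  have "4 * K5 * n * B > 0" using n K5 B0 by (intro mult_pos_pos) auto
  then have K: "K > 0" unfolding K_def using n K5 B0 by (intro mult_pos_pos add_pos_pos) auto
  show ?thesis
  proof (rule that[OF T K])
    fix lam x and y g :: "real \<Rightarrow> complex^'n"
    assume tau: "T \<le> \<bar>Im lam\<bar>" and sgn1: "\<And>k x. k \<in> S \<Longrightarrow> x \<in> {0..l} \<Longrightarrow> 0 < Im lam * \<beta> k x"
      and sgn2: "\<And>k x. k \<notin> S \<Longrightarrow> x \<in> {0..l} \<Longrightarrow> Im lam * \<beta> k x < 0"
      and g: "continuous_on {0..l} g" and sol: "solves lam y g" and x: "x \<in> {0..l}"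
    have cy: "continuous_on {0..l} (\<lambda>x. norm (y x))"
      by (intro continuous_on_norm solves_continuous[OF sol])
    \<comment> \<open>The supremum of \<open>norm (y x)\<close> is attained and finite, so it can be
      estimated at x0 and absorbed.\<close>
    obtain x0 where x0: "x0 \<in> {0..l}" "\<And>x. x \<in> {0..l} \<Longrightarrow> norm (y x) \<le> norm (y x0)"
      using continuous_attains_sup[OF compact_Icc _ cy] l by auto
    define Y where "Y = norm (y x0)"
    have Y: "0 \<le> Y" "\<And>x. x \<in> {0..l} \<Longrightarrow> norm (y x) \<le> Y" using x0 by (auto simp: Y_def)
    define L where "L = B * L1 g"
    have L: "0 \<le> L" using B0 L1_nonneg[OF g] by (simp add: L_def)
    note int = T0(2)[OF Tt(1)[OF tau]]
    define v :: "complex^'n" where "v = (\<chi> k. if k \<in> S then y 0 $ k else y l $ k)"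
    have zl: "0 \<in> {0..l}" "l \<in> {0..l}" using l by auto
    have est: "cmod (y t $ k) \<le> exp (- (\<bar>Im lam\<bar> * b0 * \<bar>t - s\<bar>)) * norm v + (\<epsilon> * Y + L)"
      if t: "t \<in> {0..l}" and s: "s = (if k \<in> S then 0 else l)" for t s k
    proof -
      have sl: "s \<in> {0..l}" using s zl by auto
      have "cmod (y t $ k) \<le> exp (- (\<bar>Im lam\<bar> * b0 * \<bar>t - s\<bar>)) * cmod (y s $ k) + (\<epsilon> * Y + B * L1 g)"
        using t s sgn1[of k] sgn2[of k] int[OF t] by (intro large_Im_componentwise[OF sol g sl t _ Y(2)]) auto
      also have "cmod (y s $ k) \<le> norm v"
        using Finite_Cartesian_Product.norm_nth_le[of v k] s by (simp add: v_def split: if_splits)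
      finally show ?thesis by (simp add: L_def mult_left_mono)
    qed
    have "cmod (y t $ k) \<le> norm v + (\<epsilon> * Y + L)" if "t \<in> {0..l}" for t k
    proof -
      define s where "s = (if k \<in> S then 0 else l)"
      have "exp (- (\<bar>Im lam\<bar> * b0 * \<bar>t - s\<bar>)) * norm v \<le> 1 * norm v"
        using b0 by (intro mult_right_mono) auto
      then show ?thesis using est[OF that s_def] by linarith
    qed
    then have Yb: "norm (y t) \<le> n * (norm v + (\<epsilon> * Y + L))" if "t \<in> {0..l}" for t
      unfolding n_def using that by (intro norm_vec_le_const)
    have neps: "n * \<epsilon> \<le> 1/2"
    proof -
      have "n * \<epsilon> = 1 / (6 * K5 * n)" using n by (simp add: \<epsilon>_def)
      also have "\<dots> \<le> 1 / 6" using mult_mono[of 1 K5 1 n] K5 n by (intro divide_left_mono) auto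
      finally show ?thesis by simp
    qed
    have "Y \<le> n * (norm v + L) + (n * \<epsilon>) * Y" using Yb[OF x0(1)] by (simp add: Y_def algebra_simps)
    also have "(n * \<epsilon>) * Y \<le> (1/2) * Y" using neps Y(1) by (intro mult_right_mono)
    finally have "Y \<le> 2 * (n * (norm v + L))" by linarith
    then have Yv: "Y \<le> 2 * n * (norm v + L)" by (simp only: mult.assoc)
    define a where "a = proj_on (- S) *v y 0"
    define b where "b = proj_on S *v y l"
    have far: "cmod (y t $ k) \<le> \<epsilon> * norm v + (\<epsilon> * Y + L)"
      if "t = (if k \<in> S then l else 0)" for t k
    proof -
      define z where "z = \<bar>Im lam\<bar> * b0 * l"
      have "1 / \<epsilon> \<le> z" using Tt(2)[OF tau] by (simp only: z_def)
      moreover have "0 < 1 / \<epsilon>" using eps by simp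
      ultimately have z: "0 < z" "1 \<le> z * \<epsilon>" using eps by (linarith, simp only: pos_divide_le_eq)
      have "z \<le> exp z" using exp_ge_add_one_self[of z] by linarith
      then have "exp (- z) \<le> 1 / z" using z(1) by (simp add: exp_minus field_simps)
      also have "1 / z \<le> \<epsilon>" using z by (simp only: pos_divide_le_eq mult.commute[of \<epsilon>])
      finally have "exp (- z) \<le> \<epsilon>" .
      then have ex: "exp (- (\<bar>Im lam\<bar> * b0 * l)) \<le> \<epsilon>" by (simp only: z_def)
      have "t \<in> {0..l}" using that zl by auto
      have "cmod (y t $ k) \<le> exp (- (\<bar>Im lam\<bar> * b0 * l)) * norm v + (\<epsilon> * Y + L)"
      proof (cases "k \<in> S")
        case True
        then show ?thesis using est[OF \<open>t \<in> {0..l}\<close> refl, of k] that l by simp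
      next
        case False
        then show ?thesis using est[OF \<open>t \<in> {0..l}\<close> refl, of k] that l by simp
      qed
      then show ?thesis using mult_right_mono[OF ex norm_ge_zero, of v] by linarith
    qed
    have pos: "0 \<le> \<epsilon> * norm v + (\<epsilon> * Y + L)" using eps Y L by (intro add_nonneg_nonneg) auto
    have ab: "norm a \<le> n * (\<epsilon> * norm v + (\<epsilon> * Y + L))" "norm b \<le> n * (\<epsilon> * norm v + (\<epsilon> * Y + L))"
      unfolding n_def
    proof (rule_tac[!] norm_vec_le_const)
      fix k
      show "cmod (a $ k) \<le> \<epsilon> * norm v + (\<epsilon> * Y + L)"
        using far[of 0 k] pos unfolding a_def proj_on_mult by auto
      show "cmod (b $ k) \<le> \<epsilon> * norm v + (\<epsilon> * Y + L)"
        using far[of l k] pos unfolding b_def proj_on_mult by auto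
    qed
    have "proj_on S *v v = y 0 - a" "proj_on (- S) *v v = y l - b"
      by (auto simp: vec_eq_iff proj_on_mult v_def a_def b_def)
    then have "E *v v = C *v y 0 + D *v y l - (C *v a + D *v b)"
      by (simp add: E_def mv.add_left mv.diff_right matrix_vector_mul_assoc[symmetric])
    moreover have "C *v y 0 + D *v y l = 0" using sol unfolding solves_def by blast
    ultimately have Ev: "E *v v = - (C *v a + D *v b)" by simp
    have "v = E' *v (E *v v)" unfolding matrix_vector_mul_assoc E' by simp
    then have "v = E' *v (- (C *v a + D *v b))" unfolding Ev .
    then have "norm v \<le> norm E' * norm (C *v a + D *v b)"
      by (metis norm_matrix_vector_mult_le norm_minus_cancel)
    also have "\<dots> \<le> norm E' * (norm C * (n * (\<epsilon> * norm v + (\<epsilon> * Y + L))) + norm D * (n * (\<epsilon> * norm v + (\<epsilon> * Y + L))))"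
      by (intro mult_left_mono norm_triangle_le add_mono order_trans[OF norm_matrix_vector_mult_le] ab) auto
    also have "\<dots> = (norm E' * (norm C + norm D)) * (n * (\<epsilon> * norm v + (\<epsilon> * Y + L)))"
      by (simp add: algebra_simps)
    also have "\<dots> \<le> K5 * (n * (\<epsilon> * norm v + (\<epsilon> * Y + L)))"
      using pos n by (intro mult_right_mono) (auto simp: K5_def)
    also have "\<dots> \<le> K5 * (n * (\<epsilon> * norm v + (\<epsilon> * (2 * n * (norm v + L)) + L)))"
      using Yv eps K5 n by (intro mult_left_mono add_mono order_refl) auto
    also have "\<dots> = (K5 * n * \<epsilon> + 2 * K5 * n * n * \<epsilon>) * norm v + (K5 * n + 2 * K5 * n * n * \<epsilon>) * L"
      by (simp add: algebra_simps)
    also have "\<dots> \<le> (1/2) * norm v + (2 * K5 * n) * L"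
    proof (intro add_mono mult_right_mono)
      have "K5 \<noteq> 0" "n \<noteq> 0" using K5 n by auto
      then have e1: "K5 * n * n * \<epsilon> = 1 / 6" unfolding \<epsilon>_def by (simp add: field_simps)
      have "K5 * n * \<epsilon> * 1 \<le> K5 * n * \<epsilon> * n" using K5 n eps by (intro mult_left_mono) auto
      moreover have "K5 * n * \<epsilon> * n = K5 * n * n * \<epsilon>" by (simp only: mult_ac)
      ultimately have e2: "K5 * n * \<epsilon> \<le> 1 / 6" using e1 by linarith
      show "K5 * n * \<epsilon> + 2 * K5 * n * n * \<epsilon> \<le> 1 / 2" using e1 e2 by linarith
      have "1 \<le> K5 * n" using mult_mono[of 1 K5 1 n] K5 n by simp
      then show "K5 * n + 2 * K5 * n * n * \<epsilon> \<le> 2 * K5 * n" using e1 by linarith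
    qed (use L in auto)
    finally have v: "norm v \<le> 4 * K5 * n * L" by linarith
    have "norm (y x) \<le> 2 * n * (norm v + L)" using Y(2)[OF x] Yv by linarith
    also have "\<dots> \<le> 2 * n * (4 * K5 * n * L + L)" using v n by (intro mult_left_mono) auto
    also have "\<dots> = K * L1 g" by (simp add: K_def L_def algebra_simps)
    finally show "norm (y x) \<le> K * L1 g" .
  qed
qed

definition pos_idx :: "'n set" where "pos_idx = {k. \<forall>x\<in>{0..l}. 0 < \<beta> k x}"

lemma pos_idx_sgn: "k \<in> pos_idx \<Longrightarrow> x \<in> {0..l} \<Longrightarrow> 0 < \<beta> k x" "k \<notin> pos_idx \<Longrightarrow> x \<in> {0..l} \<Longrightarrow> \<beta> k x < 0"
  unfolding pos_idx_def mem_Collect_eq using beta_sgn[of k] by blast+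

lemma pos_idx_eqv: "eqv j k \<Longrightarrow> j \<in> pos_idx \<longleftrightarrow> k \<in> pos_idx"
  by (simp add: pos_idx_def eqv_def)

text \<open>In the upper half plane components with positive weight are propagated from 0 and the
  others from l; in the lower half plane it is the other way round. After removal of W, each
  regularity determinant is the boundary determinant of one half plane.\<close>

lemma large_Im:
  assumes det: "det (C ** proj_on pos_idx + D ** W l ** proj_on (- pos_idx)) \<noteq> 0" "det (C ** proj_on (- pos_idx) + D ** W l ** proj_on pos_idx) \<noteq> 0"
  obtains T K where "T > 0" "K > 0"
    "\<And>lam y g x. \<lbrakk>T \<le> \<bar>Im lam\<bar>; continuous_on {0..l} g; solves lam y g; x \<in> {0..l}\<rbrakk> \<Longrightarrow> norm (y x) \<le> K * L1 g"
proof -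
  have d1: "det (C ** proj_on pos_idx + D ** proj_on (- pos_idx)) \<noteq> 0"
    by (rule det_without_W[OF pos_idx_eqv det(1)])
  have d2: "det (C ** proj_on (- pos_idx) + D ** proj_on (- (- pos_idx))) \<noteq> 0"
    by (rule det_without_W) (use pos_idx_eqv det(2) in auto)
  obtain T1 K1 where 1: "T1 > 0" "K1 > 0"
    "\<And>lam y g x. \<lbrakk>T1 \<le> \<bar>Im lam\<bar>; \<And>k x. k \<in> pos_idx \<Longrightarrow> x \<in> {0..l} \<Longrightarrow> 0 < Im lam * \<beta> k x;
        \<And>k x. k \<notin> pos_idx \<Longrightarrow> x \<in> {0..l} \<Longrightarrow> Im lam * \<beta> k x < 0;
        continuous_on {0..l} g; solves lam y g; x \<in> {0..l}\<rbrakk> \<Longrightarrow> norm (y x) \<le> K1 * L1 g"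
    using large_Im_S[OF d1] by blast
  obtain T2 K2 where 2: "T2 > 0" "K2 > 0"
    "\<And>lam y g x. \<lbrakk>T2 \<le> \<bar>Im lam\<bar>; \<And>k x. k \<in> - pos_idx \<Longrightarrow> x \<in> {0..l} \<Longrightarrow> 0 < Im lam * \<beta> k x;
        \<And>k x. k \<notin> - pos_idx \<Longrightarrow> x \<in> {0..l} \<Longrightarrow> Im lam * \<beta> k x < 0;
        continuous_on {0..l} g; solves lam y g; x \<in> {0..l}\<rbrakk> \<Longrightarrow> norm (y x) \<le> K2 * L1 g"
    using large_Im_S[OF d2] by blast
  show ?thesis
  proof (rule that)
    show "max T1 T2 > 0" "K1 + K2 > 0" using 1 2 by auto
    fix lam x and y g :: "real \<Rightarrow> complex^'n"
    assume t: "max T1 T2 \<le> \<bar>Im lam\<bar>" and a: "continuous_on {0..l} g" "solves lam y g" "x \<in> {0..l}"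
    have L: "0 \<le> L1 g" by (rule L1_nonneg[OF a(1)])
    show "norm (y x) \<le> (K1 + K2) * L1 g"
    proof (cases "Im lam > 0")
      case True
      have "norm (y x) \<le> K1 * L1 g"
        using t True pos_idx_sgn by (intro 1(3)[OF _ _ _ a]) (auto simp: mult_pos_neg)
      also have "\<dots> \<le> (K1 + K2) * L1 g" using L 2 by (intro mult_right_mono) auto
      finally show ?thesis .
    next
      case False
      then have neg: "Im lam < 0" using t 1(1) by (cases "Im lam = 0") auto
      have "norm (y x) \<le> K2 * L1 g"
        using t neg pos_idx_sgn by (intro 2(3)[OF _ _ _ a]) (auto simp: mult_neg_neg mult_neg_pos)
      also have "\<dots> \<le> (K1 + K2) * L1 g" using L 1 by (intro mult_right_mono) auto
      finally show ?thesis .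
    qed
  qed
qed

end

section \<open>Zeros of the characteristic determinant\<close>

lemma exp_decay_at_top:
  fixes b :: real
  assumes "0 < b"
  shows "((\<lambda>t. exp (- (t * b))) \<longlongrightarrow> 0) at_top"
proof -
  have "filterlim (\<lambda>t::real. t * b) at_top at_top"
    by (rule filterlim_at_top_mult_tendsto_pos[OF tendsto_const assms filterlim_ident])
  then have "filterlim (\<lambda>t::real. - (t * b)) at_bot at_top" by (simp add: filterlim_uminus_at_bot)
  then show ?thesis by (rule filterlim_compose[OF exp_at_bot])
qed

context bvp begin

definition bb :: "'n \<Rightarrow> real" where "bb k = rho \<beta> k l"

text \<open>The characteristic determinant with free phases: its real translates are again of this form,
  and the phases range over a compact torus.\<close>
definition torus_det :: "complex^'n \<Rightarrow> complex \<Rightarrow> complex" where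
  "torus_det om z = det (\<chi> i j. C $ i $ j + (D ** W l) $ i $ j * (om $ j * exp (\<i> * z * of_real (bb j))))"

definition phase :: "real \<Rightarrow> complex^'n" where "phase s = (\<chi> k. exp (\<i> * of_real s * of_real (bb k)))"

definition torus :: "(complex^'n) set" where "torus = {om. \<forall>k. cmod (om $ k) = 1}"

lemma phase_torus: "phase s \<in> torus" by (simp add: phase_def torus_def)

lemma A0_entry: "A0 lam $ i $ j = C $ i $ j + (D ** W l) $ i $ j * exp (\<i> * lam * of_real (bb j))"
proof -
  have "(D ** W l ** Phi0 \<beta> l lam) $ i $ j = (\<Sum>k\<in>UNIV. (D ** W l) $ i $ k * (if k = j then exp (\<i> * lam * of_real (bb k)) else 0))"
    unfolding matrix_matrix_mult_def[of "D ** W l"] Phi0_def diag_mat_def bb_def by simp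
  also have "\<dots> = (D ** W l) $ i $ j * exp (\<i> * lam * of_real (bb j))"
    by (subst sum.remove[of UNIV j]) (auto intro!: sum.neutral)
  finally show ?thesis by (simp add: A0_def)
qed

lemma A0_eq: "A0 lam = (\<chi> i j. C $ i $ j + (D ** W l) $ i $ j * exp (\<i> * lam * of_real (bb j)))"
  by (simp add: vec_eq_iff A0_entry)

lemma D0_translate: "D0 (z + of_real s) = torus_det (phase s) z"
proof -
  have "exp (\<i> * (z + of_real s) * of_real (bb j)) = phase s $ j * exp (\<i> * z * of_real (bb j))" for j
    by (simp add: phase_def exp_add[symmetric] algebra_simps)
  then show ?thesis by (simp add: D0_eq torus_det_def A0_eq)
qed

lemma torus_det_continuous: "continuous_on S (\<lambda>p. torus_det (fst p) (snd p))"
  unfolding torus_det_def det_def by (simp, intro continuous_intros)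

lemma torus_det_holomorphic: "torus_det om holomorphic_on S"
  unfolding torus_det_def det_def by (simp, intro holomorphic_intros)

lemma D0_holomorphic: "D0 holomorphic_on S"
  unfolding D0_eq[abs_def] A0_eq det_def by (simp, intro holomorphic_intros)

section \<open>Lower bounds for the determinant from compactness of the phases\<close>

lemma torus_compact: "compact torus"
proof -
  have "closed torus" unfolding torus_def
    by (intro closed_Collect_all closed_Collect_eq continuous_intros)
  moreover have "bounded torus"
    unfolding bounded_iff
  proof (intro exI ballI)
    fix x assume "x \<in> torus"
    then show "norm x \<le> real CARD('n) * 1" by (intro norm_vec_le_const) (simp add: torus_def)
  qed
  ultimately show ?thesis using compact_eq_bounded_closed by blast
qed

lemma bb_sgn: "k \<in> pos_idx \<Longrightarrow> 0 < bb k" "k \<notin> pos_idx \<Longrightarrow> bb k < 0"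
proof -
  have h: "(\<beta> k has_integral bb k) {0..l}"
    using AC_with_deriv_has_integral[OF rho_AC[of k], of 0 l] l by (simp add: bb_def rho_0)
  show "0 < bb k" if k: "k \<in> pos_idx"
  proof -
    have "((\<lambda>x. b0) has_integral l * b0) {0..l}" using has_integral_const_real[of b0 0 l] l by simp
    then have "l * b0 \<le> bb k"
    proof (rule has_integral_le[OF _ h])
      fix x assume x: "x \<in> {0..l}"
      show "b0 \<le> \<beta> k x" using beta_lo[OF x, of k] pos_idx_sgn(1)[OF k x] by simp
    qed
    then show ?thesis using mult_pos_pos[OF l b0] by linarith
  qed
  show "bb k < 0" if k: "k \<notin> pos_idx"
  proof -
    have "((\<lambda>x. - b0) has_integral l * - b0) {0..l}" using has_integral_const_real[of "-b0" 0 l] l by simp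
    then have "bb k \<le> l * - b0"
    proof (rule has_integral_le[OF h])
      fix x assume x: "x \<in> {0..l}"
      show "\<beta> k x \<le> - b0" using beta_lo[OF x, of k] pos_idx_sgn(2)[OF k x] by simp
    qed
    then show ?thesis using mult_pos_pos[OF l b0] by simp
  qed
qed

text \<open>Along \<open>\<i> * \<tau>\<close> with \<tau> going to infinity, the columns with index
  in \<open>pos_idx\<close> lose their exponential and tend to those of C; the others, rescaled,
  tend to those of \<open>D ** W l\<close>. The limit determinant is a regularity determinant
  whatever the phases, so all limit functions are covered at once.\<close>

lemma torus_det_nontrivial:
  assumes det: "det (C ** proj_on pos_idx + D ** W l ** proj_on (- pos_idx)) \<noteq> 0" and om: "om \<in> torus"
  shows "\<exists>z. torus_det om z \<noteq> 0"
proof (rule ccontr)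
  assume "\<not> (\<exists>z. torus_det om z \<noteq> 0)"
  then have zero: "torus_det om z = 0" for z by blast
  define M where "M = (\<lambda>z. \<chi> i j. C $ i $ j + (D ** W l) $ i $ j * (om $ j * exp (\<i> * z * of_real (bb j))))"
  \<comment> \<open>Column scaling that removes the exponential and the phase from the columns
    outside \<open>pos_idx\<close>.\<close>
  define d where "d = (\<lambda>(\<tau>::real) j. if j \<in> pos_idx then 1 else complex_of_real (exp (\<tau> * bb j)) / om $ j)"
  define N where "N = (\<lambda>\<tau>. \<chi> i j. M (\<i> * of_real \<tau>) $ i $ j * d \<tau> j)"
  have "N \<tau> = M (\<i> * of_real \<tau>) ** diag_mat (d \<tau>)" for \<tau>
  proof -
    have "(M (\<i> * of_real \<tau>) ** diag_mat (d \<tau>)) $ i $ j = M (\<i> * of_real \<tau>) $ i $ j * d \<tau> j" for i j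
      unfolding matrix_matrix_mult_def diag_mat_def
      by (simp, subst sum.remove[of UNIV j]) (auto intro!: sum.neutral)
    then show ?thesis by (simp add: N_def vec_eq_iff)
  qed
  then have N0: "det (N \<tau>) = 0" for \<tau>
    using zero[of "\<i> * of_real \<tau>"] by (simp add: det_mul torus_det_def M_def)
  define E where "E = C ** proj_on pos_idx + D ** W l ** proj_on (- pos_idx)"
  have E_entry: "E $ i $ j = (if j \<in> pos_idx then C $ i $ j else (D ** W l) $ i $ j)" for i j
  proof -
    have "(A ** proj_on S) $ i $ j = (if j \<in> S then A $ i $ j else 0)" for A S
      unfolding matrix_matrix_mult_def proj_on_def diag_mat_def
      by (simp, subst sum.remove[of UNIV j]) (auto intro!: sum.neutral)
    then show ?thesis by (simp add: E_def)
  qed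
  have omj: "om $ j \<noteq> 0" for j
    using om unfolding torus_def mem_Collect_eq by (metis norm_zero zero_neq_one)
  have lim: "((\<lambda>\<tau>. N \<tau> $ i $ j) \<longlongrightarrow> E $ i $ j) at_top" for i j
  proof (cases "j \<in> pos_idx")
    case True
    have "((\<lambda>\<tau>. exp (- (\<tau> * bb j))) \<longlongrightarrow> 0) at_top"
      by (rule exp_decay_at_top[OF bb_sgn(1)[OF True]])
    then have "((\<lambda>\<tau>. C $ i $ j + (D ** W l) $ i $ j * (om $ j * complex_of_real (exp (- (\<tau> * bb j))))) \<longlongrightarrow>
        C $ i $ j + (D ** W l) $ i $ j * (om $ j * of_real 0)) at_top"
      by (intro tendsto_intros)
    moreover have "N \<tau> $ i $ j = C $ i $ j + (D ** W l) $ i $ j * (om $ j * complex_of_real (exp (- (\<tau> * bb j))))" for \<tau>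
      using True by (simp add: N_def M_def d_def exp_of_real[symmetric] mult.assoc[symmetric])
    ultimately show ?thesis using True by (simp add: E_entry)
  next
    case False
    have "((\<lambda>\<tau>. exp (\<tau> * bb j)) \<longlongrightarrow> 0) at_top"
      using exp_decay_at_top[of "- bb j"] bb_sgn(2)[OF False] by simp
    then have "((\<lambda>\<tau>. C $ i $ j * (complex_of_real (exp (\<tau> * bb j)) / om $ j) + (D ** W l) $ i $ j) \<longlongrightarrow>
        C $ i $ j * (of_real 0 / om $ j) + (D ** W l) $ i $ j) at_top"
      by (intro tendsto_intros omj)
    moreover have "N \<tau> $ i $ j = C $ i $ j * (complex_of_real (exp (\<tau> * bb j)) / om $ j) + (D ** W l) $ i $ j" for \<tau>
    proof -
      have "exp (\<i> * (\<i> * complex_of_real \<tau>) * of_real (bb j)) * complex_of_real (exp (\<tau> * bb j)) = 1"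
        by (simp add: exp_of_real[symmetric] exp_add[symmetric] mult.assoc[symmetric])
      then show ?thesis using False omj by (simp add: N_def M_def d_def field_simps)
    qed
    ultimately show ?thesis using False by (simp add: E_entry)
  qed
  have "((\<lambda>\<tau>. det (N \<tau>)) \<longlongrightarrow> det E) at_top"
    unfolding det_def by (intro tendsto_intros lim)
  then have "((\<lambda>\<tau>::real. 0 :: complex) \<longlongrightarrow> det E) at_top" by (simp add: N0)
  then have "det E = 0" using tendsto_unique[OF trivial_limit_at_top_linorder _ tendsto_const] by blast
  then show False using det by (simp add: E_def)
qed

lemma torus_det_uniform_limit:
  assumes om: "\<And>n. om n \<in> torus" "om \<longlonglongrightarrow> om'" and K: "compact K"
  shows "uniform_limit K (\<lambda>n. torus_det (om n)) (torus_det om') sequentially"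
proof (rule uniform_limitI)
  fix e :: real assume e: "e > 0"
  have om': "om' \<in> torus"
    by (rule closed_sequentially[OF compact_imp_closed[OF torus_compact] om])
  have uc: "uniformly_continuous_on (torus \<times> K) (\<lambda>p. torus_det (fst p) (snd p))"
    by (intro compact_uniformly_continuous torus_det_continuous compact_Times torus_compact K)
  from uc[unfolded uniformly_continuous_on_def, THEN spec, THEN mp, OF e]
  obtain d where d: "d > 0" "\<forall>p\<in>torus \<times> K. \<forall>q\<in>torus \<times> K. dist q p < d \<longrightarrow>
      dist (torus_det (fst q) (snd q)) (torus_det (fst p) (snd p)) < e"
    by (elim exE conjE)
  have "eventually (\<lambda>n. dist (om n) om' < d) sequentially" using om(2) d(1) by (rule tendstoD)
  then show "\<forall>\<^sub>F n in sequentially. \<forall>x\<in>K. dist (torus_det (om n) x) (torus_det om' x) < e"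
  proof eventually_elim
    case (elim n)
    show ?case
    proof
      fix x assume x: "x \<in> K"
      have "dist (om n, x) (om', x) < d" using elim by (simp add: dist_Pair_Pair)
      with d(2)[THEN bspec, of "(om', x)", THEN bspec, of "(om n, x)"] x om(1)[of n] om'
      show "dist (torus_det (om n) x) (torus_det om' x) < e" by simp
    qed
  qed
qed

text \<open>Otherwise points with ever smaller \<open>D0\<close>, at distance at least r from all
  zeros, can be translated to the imaginary axis with convergent phases and positions. The limit
  function vanishes at the limit point, while its approximants eventually have no zeros in a disc of
  radius r/2 about it. Since the limit is not constant, this contradicts Hurwitz's theorem.\<close>

lemma D0_lower_bound_off_zeros:
  assumes det: "det (C ** proj_on pos_idx + D ** W l ** proj_on (- pos_idx)) \<noteq> 0" and r: "0 < r"
  obtains c where "c > 0" "\<And>lam. \<lbrakk>\<bar>Im lam\<bar> \<le> H; \<And>z. D0 z = 0 \<Longrightarrow> r \<le> cmod (lam - z)\<rbrakk> \<Longrightarrow> c \<le> cmod (D0 lam)"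
proof (rule ccontr)
  assume neg: "\<not> thesis"
  have "\<exists>lam. \<bar>Im lam\<bar> \<le> H \<and> (\<forall>z. D0 z = 0 \<longrightarrow> r \<le> cmod (lam - z)) \<and> cmod (D0 lam) < 1 / real (Suc n)" for n
    using neg that[of "1 / real (Suc n)"] by (meson not_le of_nat_0_less_iff zero_less_Suc zero_less_divide_1_iff)
  then obtain lam where lam: "\<And>n. \<bar>Im (lam n)\<bar> \<le> H" "\<And>n z. D0 z = 0 \<Longrightarrow> r \<le> cmod (lam n - z)"
    "\<And>n. cmod (D0 (lam n)) < 1 / real (Suc n)"
    by metis
  define p where "p = (\<lambda>n. (phase (Re (lam n)), \<i> * complex_of_real (Im (lam n))))"
  have "compact (torus \<times> cball (0::complex) H)" by (intro compact_Times torus_compact compact_cball)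
  moreover have "\<forall>n. p n \<in> torus \<times> cball (0::complex) H"
    using lam(1) phase_torus by (simp add: p_def norm_mult)
  ultimately obtain q s where q: "q \<in> torus \<times> cball (0::complex) H" "strict_mono s" "(p \<circ> s) \<longlonglongrightarrow> q"
    unfolding compact_def by metis
  have l1: "(\<lambda>n. fst (p (s n))) \<longlonglongrightarrow> fst q" and l2: "(\<lambda>n. snd (p (s n))) \<longlonglongrightarrow> snd q"
    using q(3) by (auto simp: o_def intro: tendsto_fst tendsto_snd)
  have val: "torus_det (fst (p n)) (snd (p n)) = D0 (lam n)" for n
    unfolding p_def fst_conv snd_conv D0_translate[symmetric]
    by (rule arg_cong[where f=D0]) (simp add: complex_eq_iff)
  have "(\<lambda>n. torus_det (fst (p (s n))) (snd (p (s n)))) \<longlonglongrightarrow> torus_det (fst q) (snd q)"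
    using continuous_on_tendsto_compose[OF torus_det_continuous[of UNIV] q(3)] by (simp add: o_def)
  moreover have "(\<lambda>n. D0 (lam (s n))) \<longlonglongrightarrow> 0"
  proof (rule Lim_null_comparison)
    have "(\<lambda>n. 1 / real (Suc n)) \<longlonglongrightarrow> 0" by (rule LIMSEQ_Suc) (rule lim_1_over_n)
    then show "((\<lambda>n. 1 / real (Suc n)) \<circ> s) \<longlonglongrightarrow> 0" using q(2) by (rule LIMSEQ_subseq_LIMSEQ)
    show "\<forall>\<^sub>F n in sequentially. cmod (D0 (lam (s n))) \<le> ((\<lambda>n. 1 / real (Suc n)) \<circ> s) n"
      using lam(3) by (intro always_eventually) (simp add: less_imp_le)
  qed
  ultimately have q0: "torus_det (fst q) (snd q) = 0" unfolding val by (rule LIMSEQ_unique)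
  have "eventually (\<lambda>n. dist (snd (p (s n))) (snd q) < r / 2) sequentially"
    using l2 r by (intro tendstoD) auto
  then obtain n0 where n0: "\<And>n. n \<ge> n0 \<Longrightarrow> dist (snd (p (s n))) (snd q) < r / 2"
    by (auto simp: eventually_sequentially)
  have om_torus: "fst (p n) \<in> torus" for n by (simp add: p_def phase_torus)
  have "torus_det (fst q) (snd q) \<noteq> 0"
  \<comment> \<open>Indices are shifted by n0 because every member of the sequence must be zero-free
    in the disc.\<close>
  proof (rule Hurwitz_no_zeros[of "ball (snd q) (r / 2)" "\<lambda>n. torus_det (fst (p (s (n + n0))))" "torus_det (fst q)" "snd q"])
    show "torus_det (fst q) holomorphic_on ball (snd q) (r / 2)" "\<And>n. torus_det (fst (p (s (n + n0)))) holomorphic_on ball (snd q) (r / 2)"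
      by (rule torus_det_holomorphic)+
    fix K :: "complex set" assume "compact K"
    then show "uniform_limit K (\<lambda>n. torus_det (fst (p (s (n + n0))))) (torus_det (fst q)) sequentially"
      by (intro torus_det_uniform_limit om_torus LIMSEQ_ignore_initial_segment[OF l1])
  next
    show "\<not> torus_det (fst q) constant_on ball (snd q) (r / 2)"
    proof
      assume "torus_det (fst q) constant_on ball (snd q) (r / 2)"
      then have z: "\<And>z. z \<in> ball (snd q) (r / 2) \<Longrightarrow> torus_det (fst q) z = 0"
        using q0 r unfolding constant_on_def by (metis centre_in_ball half_gt_zero)
      have "torus_det (fst q) w = 0" for w
        by (rule analytic_continuation_open[of "ball (snd q) (r / 2)" UNIV _ "\<lambda>_. 0", OF _ _ _ _ _ torus_det_holomorphic _ z])
          (use r in auto)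
      then show False using torus_det_nontrivial[OF det, of "fst q"] q(1) by (auto simp: mem_Times_iff)
    qed
  next
    fix n z assume z: "z \<in> ball (snd q) (r / 2)"
    show "torus_det (fst (p (s (n + n0)))) z \<noteq> 0"
    proof
      assume "torus_det (fst (p (s (n + n0)))) z = 0"
      then have "D0 (z + of_real (Re (lam (s (n + n0))))) = 0" unfolding D0_translate by (simp add: p_def)
      then have "r \<le> cmod (lam (s (n + n0)) - (z + of_real (Re (lam (s (n + n0))))))" by (rule lam(2))
      also have "lam (s (n + n0)) - (z + of_real (Re (lam (s (n + n0))))) = snd (p (s (n + n0))) - z"
        by (simp add: p_def complex_eq_iff)
      also have "cmod \<dots> = dist (snd (p (s (n + n0)))) z" by (simp add: dist_norm)
      also have "\<dots> \<le> dist (snd (p (s (n + n0)))) (snd q) + dist (snd q) z" by (rule dist_triangle)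
      also have "\<dots> < r / 2 + r / 2" using n0[of "n + n0"] z by (intro add_strict_mono) auto
      finally show False by simp
    qed
  qed (use r in auto)
  then show False using q0 by blast
qed

text \<open>Supplies the vertical sides of a contour, with a constant independent of R.
  Counterexamples, translated, have a limit function with finitely many zeros in a rectangle of unit
  width; an abscissa x that misses these zeros contradicts the smallness of the approximants
  somewhere above x.\<close>

lemma D0_lower_bound_segments:
  assumes det: "det (C ** proj_on pos_idx + D ** W l ** proj_on (- pos_idx)) \<noteq> 0" and H: "0 \<le> H"
  obtains c where "c > 0" "\<And>R. \<exists>x\<in>{R..R+1}. \<forall>\<tau>. \<bar>\<tau>\<bar> \<le> H \<longrightarrow> c \<le> cmod (D0 (Complex x \<tau>))"
proof (rule ccontr)
  assume neg: "\<not> thesis"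
  have "\<exists>R. \<forall>x\<in>{R..R+1}. \<exists>\<tau>. \<bar>\<tau>\<bar> \<le> H \<and> cmod (D0 (Complex x \<tau>)) < 1 / real (Suc n)" for n
    using neg that[of "1 / real (Suc n)"] by (meson not_le of_nat_0_less_iff zero_less_Suc zero_less_divide_1_iff)
  then obtain R where R: "\<And>n x. x \<in> {R n..R n+1} \<Longrightarrow> \<exists>\<tau>. \<bar>\<tau>\<bar> \<le> H \<and> cmod (D0 (Complex x \<tau>)) < 1 / real (Suc n)"
    by metis
  obtain om s where om: "om \<in> torus" "strict_mono s" "((\<lambda>n. phase (R n)) \<circ> s) \<longlonglongrightarrow> om"
    using torus_compact phase_torus unfolding compact_def by metis
  have nz: "\<exists>z. torus_det om z \<noteq> 0" by (rule torus_det_nontrivial[OF det om(1)])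
  have fin: "finite {z \<in> cbox (Complex 0 (-H)) (Complex 1 H). torus_det om z = 0}"
  proof (cases "torus_det om constant_on UNIV")
    case True
    then have "torus_det om z \<noteq> 0" for z using nz unfolding constant_on_def by (metis UNIV_I)
    then show ?thesis by simp
  next
    case False
    then show ?thesis
      by (rule holomorphic_compact_finite_zeros[OF torus_det_holomorphic open_UNIV connected_UNIV compact_cbox subset_UNIV])
  qed
  then have finRe: "finite (Re ` {z \<in> cbox (Complex 0 (-H)) (Complex 1 H). torus_det om z = 0})" by (rule finite_imageI)
  have "\<not> {0..1} \<subseteq> Re ` {z \<in> cbox (Complex 0 (-H)) (Complex 1 H). torus_det om z = 0}"
    using finite_subset[OF _ finRe, of "{0..1}"] infinite_Icc[of "0::real" 1] by (metis zero_less_one)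
  then obtain x where x: "x \<in> {0..1}" "x \<notin> Re ` {z \<in> cbox (Complex 0 (-H)) (Complex 1 H). torus_det om z = 0}"
    unfolding subset_eq Ball_def not_all not_imp by (elim exE conjE)
  have "\<exists>\<tau>. \<bar>\<tau>\<bar> \<le> H \<and> cmod (torus_det (phase (R n)) (Complex x \<tau>)) < 1 / real (Suc n)" for n
  proof -
    have "Complex (R n + x) \<tau> = Complex x \<tau> + of_real (R n)" for \<tau> by (simp add: complex_eq_iff)
    then show ?thesis using R[of "R n + x" n] x(1) D0_translate by auto
  qed
  then obtain \<tau> where tau: "\<And>n. \<bar>\<tau> n\<bar> \<le> H" "\<And>n. cmod (torus_det (phase (R n)) (Complex x (\<tau> n))) < 1 / real (Suc n)"
    by metis
  have "\<forall>n. (\<tau> \<circ> s) n \<in> {-H..H}" using tau(1) by (auto simp: abs_le_iff minus_le_iff)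
  then obtain t s' where t: "t \<in> {-H..H}" "strict_mono s'" "((\<tau> \<circ> s) \<circ> s') \<longlonglongrightarrow> t"
    using compact_Icc[of "-H" H] unfolding compact_def by metis
  have "(\<lambda>n. (phase (R (s (s' n))), Complex x (\<tau> (s (s' n))))) \<longlonglongrightarrow> (om, Complex x t)"
  proof (intro tendsto_Pair)
    show "(\<lambda>n. phase (R (s (s' n)))) \<longlonglongrightarrow> om"
      using LIMSEQ_subseq_LIMSEQ[OF om(3) t(2)] by (simp add: o_def)
    show "(\<lambda>n. Complex x (\<tau> (s (s' n)))) \<longlonglongrightarrow> Complex x t"
      using t(3) by (intro tendsto_Complex tendsto_const) (simp add: o_def)
  qed
  from continuous_on_tendsto_compose[OF torus_det_continuous[of UNIV] this]
  have "(\<lambda>n. torus_det (phase (R (s (s' n)))) (Complex x (\<tau> (s (s' n))))) \<longlonglongrightarrow> torus_det om (Complex x t)" by simp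
  moreover have "(\<lambda>n. torus_det (phase (R (s (s' n)))) (Complex x (\<tau> (s (s' n))))) \<longlonglongrightarrow> 0"
  proof (rule Lim_null_comparison)
    have "(\<lambda>n. 1 / real (Suc n)) \<longlonglongrightarrow> 0" by (rule LIMSEQ_Suc) (rule lim_1_over_n)
    then show "((\<lambda>n. 1 / real (Suc n)) \<circ> (s \<circ> s')) \<longlonglongrightarrow> 0"
      by (rule LIMSEQ_subseq_LIMSEQ) (rule strict_mono_o[OF om(2) t(2)])
    show "\<forall>\<^sub>F n in sequentially. cmod (torus_det (phase (R (s (s' n)))) (Complex x (\<tau> (s (s' n))))) \<le> ((\<lambda>n. 1 / real (Suc n)) \<circ> (s \<circ> s')) n"
      using tau(2) by (intro always_eventually) (simp add: less_imp_le)
  qed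
  ultimately have "torus_det om (Complex x t) = 0" by (rule LIMSEQ_unique)
  then have "x \<in> Re ` {z \<in> cbox (Complex 0 (-H)) (Complex 1 H). torus_det om z = 0}"
    using x(1) t(1) by (intro image_eqI[of _ _ "Complex x t"]) (auto simp: in_cbox_complex_iff)
  then show False using x(2) by blast
qed

text \<open>Separation is assumed for the indices of an enumeration with multiplicities and is
  turned here into conditions on real parts. A zero with large real part is enumerated by large
  indices only, hence exactly once, and the multiplicity count makes it simple.\<close>

lemma D0_zeros_separated:
  assumes det: "det (C ** proj_on pos_idx + D ** W l ** proj_on (- pos_idx)) \<noteq> 0" and sep: "zeros_asympt_separated D0"
  obtains R \<delta> where "\<delta> > 0"
    "\<And>z w. \<lbrakk>D0 z = 0; D0 w = 0; z \<noteq> w; R \<le> \<bar>Re z\<bar>\<rbrakk> \<Longrightarrow> 2 * \<delta> \<le> cmod (z - w)"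
    "\<And>z. \<lbrakk>D0 z = 0; R \<le> \<bar>Re z\<bar>\<rbrakk> \<Longrightarrow> deriv D0 z \<noteq> 0"
proof -
  obtain \<mu> :: "int \<Rightarrow> complex" and m0 :: int and \<delta> where mu: "\<And>j. D0 (\<mu> j) = 0"
    "\<And>z. D0 z = 0 \<Longrightarrow> card {j. \<mu> j = z} = nat (zorder D0 z)" and delta: "\<delta> > 0"
    and sep': "\<And>j k. \<lbrakk>j \<noteq> k; \<bar>j\<bar> > m0; \<bar>k\<bar> > m0\<rbrakk> \<Longrightarrow> cmod (\<mu> j - \<mu> k) > 2 * \<delta>"
    using sep unfolding zeros_asympt_separated_def by metis
  have "\<exists>z. D0 z \<noteq> 0"
    using torus_det_nontrivial[OF det phase_torus[of 0]] D0_translate[of _ 0] by auto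
  then obtain w0 where w0: "D0 w0 \<noteq> 0" by blast
  have zo: "zorder D0 z > 0" if "D0 z = 0" for z
    using zorder_exist_zero[of D0 UNIV z] D0_holomorphic w0 that by auto
  \<comment> \<open>Exceeds the real parts of the finitely many zeros of small index by more than
    \<open>2 * \<delta>\<close>, so that a zero with large real part is separated from these as
    well.\<close>
  define R where "R = Max ((\<lambda>j. \<bar>Re (\<mu> j)\<bar>) ` {-\<bar>m0\<bar>..\<bar>m0\<bar>}) + 2 * \<delta> + 1"
  have small: "\<bar>Re (\<mu> j)\<bar> + 2 * \<delta> < R" if "\<not> \<bar>j\<bar> > m0" for j
  proof -
    have "j \<in> {-\<bar>m0\<bar>..\<bar>m0\<bar>}" using that by auto
    then have "\<bar>Re (\<mu> j)\<bar> \<le> Max ((\<lambda>j. \<bar>Re (\<mu> j)\<bar>) ` {-\<bar>m0\<bar>..\<bar>m0\<bar>})" by (intro Max_ge) auto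
    then show ?thesis by (simp add: R_def)
  qed
  have ex: "\<exists>j. \<mu> j = z" if "D0 z = 0" for z
  proof (rule ccontr)
    assume "\<nexists>j. \<mu> j = z"
    then have "{j. \<mu> j = z} = {}" by blast
    then show False using mu(2)[OF that] zo[OF that] by simp
  qed
  have large: "\<bar>j\<bar> > m0" if "R \<le> \<bar>Re (\<mu> j)\<bar>" for j using small[of j] that delta by linarith
  show ?thesis
  proof (rule that[OF delta])
    fix z w assume zw: "D0 z = 0" "D0 w = 0" "z \<noteq> w" and R: "R \<le> \<bar>Re z\<bar>"
    obtain j k where jk: "\<mu> j = z" "\<mu> k = w" using ex zw by blast
    show "2 * \<delta> \<le> cmod (z - w)"
    proof (cases "\<bar>k\<bar> > m0")
      case True
      then show ?thesis using sep'[of j k] large[of j] R jk zw(3) by (metis less_imp_le)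
    next
      case False
      then have "2 * \<delta> \<le> \<bar>Re z\<bar> - \<bar>Re w\<bar>" using small[OF False] R jk by simp
      also have "\<dots> \<le> \<bar>Re (z - w)\<bar>" by simp
      also have "\<dots> \<le> cmod (z - w)" by (rule abs_Re_le_cmod)
      finally show ?thesis .
    qed
  next
    fix z assume z: "D0 z = 0" and R: "R \<le> \<bar>Re z\<bar>"
    obtain j where j: "\<mu> j = z" using ex z by blast
    have "{j. \<mu> j = z} = {j}"
    proof -
      have "k = j" if "\<mu> k = z" for k
      proof (rule ccontr)
        assume "k \<noteq> j"
        then have "cmod (\<mu> k - \<mu> j) > 2 * \<delta>" using sep'[of k j] large[of k] large[of j] R that j by simp
        then show False using that j delta by simp
      qed
      then show ?thesis using j by blast
    qed
    then have n1: "nat (zorder D0 z) = 1" using mu(2)[OF z] by simp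
    have "\<exists>w\<in>UNIV. D0 w \<noteq> 0" using w0 by blast
    \<comment> \<open>Order one: near z, \<open>D0\<close> is \<open>w - z\<close> times a function
      without zeros, whose value at z is the derivative.\<close>
    from zorder_exist_zero[OF D0_holomorphic open_UNIV connected_UNIV UNIV_I this, of z, unfolded n1]
    obtain r where r: "r > 0" "zor_poly D0 z holomorphic_on cball z r"
      "\<And>w. w \<in> cball z r \<Longrightarrow> D0 w = zor_poly D0 z w * (w - z) ^ 1 \<and> zor_poly D0 z w \<noteq> 0"
      by blast
    have "zor_poly D0 z holomorphic_on ball z r" using r(2) holomorphic_on_subset by fastforce
    then have "zor_poly D0 z field_differentiable (at z)"
      using r(1) by (intro holomorphic_on_imp_differentiable_at) auto
    then obtain d where d: "(zor_poly D0 z has_field_derivative d) (at z)" by (auto simp: field_differentiable_def)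
    have "((\<lambda>w. zor_poly D0 z w * (w - z)) has_field_derivative zor_poly D0 z z) (at z)"
      by (rule derivative_eq_intros d refl | simp)+
    then have "(D0 has_field_derivative zor_poly D0 z z) (at z)"
      by (rule has_field_derivative_transform_within_open[of _ _ _ "ball z r"]) (use r in auto)
    then show "deriv D0 z \<noteq> 0" using r(1,3) DERIV_imp_deriv by (metis centre_in_cball less_imp_le)
  qed
qed

end

section \<open>Analyticity of the resolvent\<close>

text \<open>The bound M plays the role of the length of the path.\<close>
definition contour_bound :: "(real \<Rightarrow> complex) \<Rightarrow> real \<Rightarrow> bool" where
  "contour_bound \<gamma> M \<longleftrightarrow> (\<forall>f I b. (f has_contour_integral I) \<gamma> \<longrightarrow> (\<forall>z\<in>path_image \<gamma>. cmod (f z) \<le> b) \<longrightarrow> cmod I \<le> M * b)"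

lemma contour_bound_circlepath: "0 < r \<Longrightarrow> contour_bound (circlepath z r) (2 * pi * r)"
  unfolding contour_bound_def
proof (intro allI impI)
  fix f I b assume r: "0 < r" and f: "(f has_contour_integral I) (circlepath z r)"
    and b: "\<forall>w\<in>path_image (circlepath z r). cmod (f w) \<le> b"
  have b': "cmod (f w) \<le> b" if "cmod (w - z) = r" for w
    using b that r by (simp add: dist_norm norm_minus_commute)
  have "0 \<le> b" by (rule order_trans[OF norm_ge_zero b'[of "z + of_real r"]]) (use r in simp)
  then have "cmod I \<le> b * (2 * pi * r)" by (rule has_contour_integral_bound_circlepath[OF f _ r b'])
  then show "cmod I \<le> 2 * pi * r * b" by (simp add: mult.commute)
qed

lemma contour_bound_linepath: "contour_bound (linepath a c) (cmod (c - a))"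
  unfolding contour_bound_def
proof (intro allI impI)
  fix f I b assume f: "(f has_contour_integral I) (linepath a c)"
    and b: "\<forall>w\<in>path_image (linepath a c). cmod (f w) \<le> b"
  have "0 \<le> b" using b norm_ge_zero[of "f a"] by (metis ends_in_segment(1) order_trans path_image_linepath)
  then have "cmod I \<le> b * cmod (c - a)"
    using b by (intro has_contour_integral_bound_linepath[OF f]) simp_all
  then show "cmod I \<le> cmod (c - a) * b" by (simp add: mult.commute)
qed

lemma contour_bound_join:
  assumes "contour_bound g1 M1" "contour_bound g2 M2" "valid_path g1" "valid_path g2" "pathfinish g1 = pathstart g2"
  shows "contour_bound (g1 +++ g2) (M1 + M2)"
  unfolding contour_bound_def
proof (intro allI impI)
  fix f I b assume f: "(f has_contour_integral I) (g1 +++ g2)"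
    and b: "\<forall>w\<in>path_image (g1 +++ g2). cmod (f w) \<le> b"
  have "f contour_integrable_on (g1 +++ g2)" using f by (rule has_contour_integral_integrable)
  then have 1: "f contour_integrable_on g1" and 2: "f contour_integrable_on g2"
    using assms(3,4) by simp_all
  have "I = contour_integral g1 f + contour_integral g2 f"
    using contour_integral_unique[OF f] 1 2 assms(3,4) by simp
  moreover have "cmod (contour_integral g1 f) \<le> M1 * b"
    using assms(1)[unfolded contour_bound_def, rule_format, OF has_contour_integral_integral[OF 1], of b]
      b path_image_join[OF assms(5)] by simp
  moreover have "cmod (contour_integral g2 f) \<le> M2 * b"
    using assms(2)[unfolded contour_bound_def, rule_format, OF has_contour_integral_integral[OF 2], of b]
      b path_image_join[OF assms(5)] by simp
  ultimately show "cmod I \<le> (M1 + M2) * b"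
    using norm_triangle_ineq[of "contour_integral g1 f" "contour_integral g2 f"] by (simp add: distrib_right)
qed

lemma contour_bound_rectpath: "\<exists>M. contour_bound (rectpath a b) M"
  unfolding rectpath_def Let_def
  by (rule exI, rule contour_bound_join[OF contour_bound_linepath contour_bound_join[OF contour_bound_linepath
      contour_bound_join[OF contour_bound_linepath contour_bound_linepath]]]) simp_all

text \<open>The remainder is dominated term by term by that of the real series. This gives one bound
  for all w in a disc, which can be used under an integral.\<close>

lemma exp_minus_partial_sum:
  fixes w :: complex
  assumes "cmod w \<le> r"
  shows "cmod (exp w - (\<Sum>n<N. w ^ n /\<^sub>R fact n)) \<le> exp r - (\<Sum>n<N. r ^ n /\<^sub>R fact n)"
proof -
  have r: "0 \<le> r" using assms norm_ge_zero order_trans by blast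
  have sw: "(\<lambda>n. w ^ n /\<^sub>R fact n) sums exp w" by (rule exp_converges)
  have sr: "(\<lambda>n. r ^ n /\<^sub>R fact n) sums exp r" by (rule exp_converges)
  have s2: "summable (\<lambda>n. r ^ (n + N) /\<^sub>R fact (n + N))"
    by (rule summable_ignore_initial_segment[OF sums_summable[OF sr]])
  have le: "cmod (w ^ n /\<^sub>R fact n) \<le> r ^ n /\<^sub>R fact n" for n
    using assms by (simp add: norm_power power_mono divide_right_mono)
  have s1: "summable (\<lambda>n. cmod (w ^ (n + N) /\<^sub>R fact (n + N)))"
  proof (rule summable_comparison_test[OF _ s2], intro exI[of _ 0] allI impI)
    show "norm (cmod (w ^ (n + N) /\<^sub>R fact (n + N))) \<le> r ^ (n + N) /\<^sub>R fact (n + N)" for n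
      unfolding real_norm_def abs_norm_cancel by (rule le)
  qed
  have "exp w - (\<Sum>n<N. w ^ n /\<^sub>R fact n) = (\<Sum>n. w ^ (n + N) /\<^sub>R fact (n + N))"
    using suminf_minus_initial_segment[OF sums_summable[OF sw], of N] sums_unique[OF sw] by simp
  also have "cmod \<dots> \<le> (\<Sum>n. cmod (w ^ (n + N) /\<^sub>R fact (n + N)))" by (rule summable_norm[OF s1])
  also have "\<dots> \<le> (\<Sum>n. r ^ (n + N) /\<^sub>R fact (n + N))" by (rule suminf_le[OF le s1 s2])
  also have "\<dots> = exp r - (\<Sum>n<N. r ^ n /\<^sub>R fact n)"
    using suminf_minus_initial_segment[OF sums_summable[OF sr], of N] sums_unique[OF sr] by simp
  finally show ?thesis .
qed

text \<open>Expanding the exponential gives an everywhere convergent power series in z, whose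
  coefficients c n are moments of the merely integrable function m.\<close>

lemma exp_integral_holomorphic:
  fixes r :: "real \<Rightarrow> real" and m :: "real \<Rightarrow> complex"
  assumes r: "continuous_on {a..b} r" and m: "m absolutely_integrable_on {a..b}"
  shows "(\<lambda>z. integral {a..b} (\<lambda>t. exp (- (\<i> * z * of_real (r t))) * m t)) holomorphic_on UNIV"
proof -
  obtain K where K: "K > 0" "\<And>x. x \<in> {a..b} \<Longrightarrow> norm (r x) \<le> K"
    using bounded_continuous_Icc[OF r] by blast
  have im: "(\<lambda>t. f t * m t) integrable_on {a..b}" if "continuous_on {a..b} f" for f
    using absolutely_integrable_bilinear_continuous[OF bounded_bilinear_mult m that]
    by (simp add: absolutely_integrable_on_def mult.commute)
  have nm: "(\<lambda>t. cmod (m t)) integrable_on {a..b}" using m by (simp add: absolutely_integrable_on_def)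
  define J where "J = integral {a..b} (\<lambda>t. cmod (m t))"
  define c where "c n = integral {a..b} (\<lambda>t. ((- (\<i> * of_real (r t))) ^ n /\<^sub>R fact n) * m t)" for n
  define G where "G z = integral {a..b} (\<lambda>t. exp (- (\<i> * z * of_real (r t))) * m t)" for z
  have "(\<lambda>n. c n * z ^ n) sums G z" for z
  proof -
    define R where "R = cmod z * K"
    have est: "cmod (G z - (\<Sum>n<N. c n * z ^ n)) \<le> (exp R - (\<Sum>n<N. R ^ n /\<^sub>R fact n)) * J" for N
    proof -
      let ?w = "\<lambda>t. - (\<i> * z * of_real (r t))"
      have cz: "continuous_on {a..b} (\<lambda>t. exp (?w t))" by (intro continuous_intros r)
      have trm: "((\<lambda>t. (?w t ^ n /\<^sub>R fact n) * m t) has_integral c n * z ^ n) {a..b}" for n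
      proof -
        have "((\<lambda>t. ((- (\<i> * of_real (r t))) ^ n /\<^sub>R fact n) * m t) has_integral c n) {a..b}"
          unfolding c_def by (intro integrable_integral im continuous_intros r)
        from has_integral_mult_left[OF this, of "z ^ n"]
        show ?thesis by (rule has_integral_eq[rotated]) (simp add: power_mult_distrib[symmetric] mult_ac)
      qed
      have hi: "((\<lambda>t. exp (?w t) * m t - (\<Sum>n<N. (?w t ^ n /\<^sub>R fact n) * m t)) has_integral G z - (\<Sum>n<N. c n * z ^ n)) {a..b}"
        unfolding G_def by (intro has_integral_diff has_integral_sum trm integrable_integral im cz) auto
      have "cmod (G z - (\<Sum>n<N. c n * z ^ n)) \<le> integral {a..b} (\<lambda>t. (exp R - (\<Sum>n<N. R ^ n /\<^sub>R fact n)) * cmod (m t))"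
        unfolding integral_unique[OF hi, symmetric]
      proof (rule integral_norm_bound_integral)
        show "(\<lambda>t. exp (?w t) * m t - (\<Sum>n<N. (?w t ^ n /\<^sub>R fact n) * m t)) integrable_on {a..b}" using hi by blast
        show "(\<lambda>t. (exp R - (\<Sum>n<N. R ^ n /\<^sub>R fact n)) * cmod (m t)) integrable_on {a..b}"
          by (rule integrable_on_mult_right[OF nm])
        fix t assume t: "t \<in> {a..b}"
        have "cmod (?w t) \<le> R" using K(2)[OF t] by (simp add: R_def norm_mult mult_left_mono)
        from exp_minus_partial_sum[OF this, of N]
        have "cmod ((exp (?w t) - (\<Sum>n<N. ?w t ^ n /\<^sub>R fact n)) * m t) \<le> (exp R - (\<Sum>n<N. R ^ n /\<^sub>R fact n)) * cmod (m t)"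
          unfolding norm_mult by (rule mult_right_mono) simp
        then show "cmod (exp (?w t) * m t - (\<Sum>n<N. (?w t ^ n /\<^sub>R fact n) * m t)) \<le> (exp R - (\<Sum>n<N. R ^ n /\<^sub>R fact n)) * cmod (m t)"
          by (simp only: left_diff_distrib sum_distrib_right)
      qed
      then show ?thesis by (simp add: J_def)
    qed
    have "(\<lambda>N. (\<Sum>n<N. R ^ n /\<^sub>R fact n)) \<longlonglongrightarrow> exp R" using exp_converges[of R] by (simp add: sums_def)
    then have "(\<lambda>N. (exp R - (\<Sum>n<N. R ^ n /\<^sub>R fact n)) * J) \<longlonglongrightarrow> (exp R - exp R) * J" by (intro tendsto_intros)
    then have "(\<lambda>N. (exp R - (\<Sum>n<N. R ^ n /\<^sub>R fact n)) * J) \<longlonglongrightarrow> 0" by simp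
    from Lim_null_comparison[OF always_eventually[OF allI[OF est]] this]
    have "(\<lambda>N. - (G z - (\<Sum>n<N. c n * z ^ n)) + G z) \<longlonglongrightarrow> - 0 + G z" by (intro tendsto_intros)
    then show ?thesis by (simp add: sums_def)
  qed
  then have "G holomorphic_on ball 0 R" for R
    by (intro power_series_holomorphic[of 0 R c]) simp
  then have "G field_differentiable (at z)" for z
    using holomorphic_on_imp_differentiable_at[of G "ball 0 (cmod z + 1)" z] by simp
  then show ?thesis
    by (auto simp: holomorphic_on_def G_def[abs_def] intro: field_differentiable_at_within)
qed

lemma smult_telescope:
  fixes u d v :: complex
  assumes "u * d = v"
  shows "(- u) *s (a - d *s b) = v *s b - u *s a"
  unfolding assms[symmetric] by (simp add: vec_eq_iff algebra_simps)

lemma inverse_power_deriv_aux: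
  fixes d P n :: complex
  assumes "d \<noteq> 0" "P \<noteq> 0" "n \<noteq> 0"
  shows "- (1 / n) * - (inverse (d * P) * (n * P * 1) * inverse (d * P)) = 1 / (d * (d * P))"
  using assms by (simp add: field_simps)

section \<open>Holomorphy of the approximate resolvent\<close>

context bvp begin

lemma F_holomorphic:
  assumes g: "continuous_on {0..l} g" and x: "x \<in> {0..l}"
  shows "(\<lambda>z. F z g x $ a) holomorphic_on UNIV"
proof -
  have sub: "{0..x} \<subseteq> {0..l}" using x by auto
  define m where "m k t = V t $ a $ k * (\<i> * of_real (\<beta> k t) * g t $ k)" for k t
  have "(\<lambda>t. of_real (\<beta> k t) * (V t $ a $ k * \<i> * g t $ k)) absolutely_integrable_on {0..l}" for k
    by (intro beta_times_continuous_ai continuous_intros V_continuous g)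
  then have mk: "m k absolutely_integrable_on {0..x}" for k
    by (rule absolutely_integrable_on_subinterval[OF _ sub, THEN absolutely_integrable_spike[OF _ negligible_empty]])
      (simp add: m_def mult_ac)
  have cr: "continuous_on {0..x} (rho \<beta> k)" for k by (rule continuous_on_subset[OF rho_continuous sub])
  have im: "(\<lambda>t. exp (- (\<i> * z * of_real (rho \<beta> k t))) * m k t) integrable_on {0..x}" for k z
    using absolutely_integrable_bilinear_continuous[OF bounded_bilinear_mult mk, of "\<lambda>t. exp (- (\<i> * z * of_real (rho \<beta> k t)))" k]
      cr by (simp add: absolutely_integrable_on_def mult.commute continuous_intros)
  have "F z g x $ a = (\<Sum>k\<in>UNIV. integral {0..x} (\<lambda>t. exp (- (\<i> * z * of_real (rho \<beta> k t))) * m k t))" for z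
  proof -
    have "F z g x $ a = integral {0..x} (\<lambda>t. forcing z g t $ a)"
      unfolding F_def by (rule integral_vec_nth[OF absolutely_integrable_imp_integrable_sub[OF forcing_ai[OF g] sub]])
    also have "\<dots> = integral {0..x} (\<lambda>t. \<Sum>k\<in>UNIV. exp (- (\<i> * z * of_real (rho \<beta> k t))) * m k t)"
      by (simp add: forcing_def matrix_vector_mult_def osc_exp_def m_def mult_ac)
    also have "\<dots> = (\<Sum>k\<in>UNIV. integral {0..x} (\<lambda>t. exp (- (\<i> * z * of_real (rho \<beta> k t))) * m k t))"
      by (intro Henstock_Kurzweil_Integration.integral_sum im) simp
    finally show ?thesis .
  qed
  moreover have "(\<lambda>z. \<Sum>k\<in>UNIV. integral {0..x} (\<lambda>t. exp (- (\<i> * z * of_real (rho \<beta> k t))) * m k t)) holomorphic_on UNIV"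
    by (intro holomorphic_intros exp_integral_holomorphic cr mk)
  ultimately show ?thesis by simp
qed

lemma A0_entry_holomorphic: "(\<lambda>z. A0 z $ i $ j) holomorphic_on S"
  unfolding A0_entry by (intro holomorphic_intros)

lemma boundary_rhs_holomorphic:
  assumes g: "continuous_on {0..l} g"
  shows "(\<lambda>z. boundary_rhs z g $ i) holomorphic_on UNIV"
proof -
  have "boundary_rhs z g $ i = - (\<Sum>k\<in>UNIV. (A0 z $ i $ k - C $ i $ k) * F z g l $ k)" for z
    by (simp add: boundary_rhs_def matrix_vector_mult_def A0_def)
  then show ?thesis
    using l by (simp, intro holomorphic_intros A0_entry_holomorphic F_holomorphic[OF g]) simp_all
qed

definition num :: "complex \<Rightarrow> (real \<Rightarrow> complex^'n) \<Rightarrow> real \<Rightarrow> complex^'n" where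
  "num z g x = Phi0 \<beta> x z *v (W x *v cramer_vec (A0 z) (boundary_rhs z g))"

lemma num_holomorphic:
  assumes g: "continuous_on {0..l} g"
  shows "(\<lambda>z. num z g x $ k) holomorphic_on UNIV"
proof -
  have "(\<lambda>z. cramer_vec (A0 z) (boundary_rhs z g) $ j) holomorphic_on UNIV" for j
  proof -
    have "(\<lambda>z. if c then boundary_rhs z g $ i else A0 z $ i $ j') holomorphic_on UNIV" for c i j'
      by (cases c) (simp_all add: boundary_rhs_holomorphic[OF g] A0_entry_holomorphic)
    then show ?thesis
      unfolding cramer_vec_def det_def by (simp, intro holomorphic_intros) blast
  qed
  then show ?thesis
    unfolding num_def Phi0_mult matrix_vector_mult_def[of "W x"]
    by (simp, intro holomorphic_intros)
qed

text \<open>Only the Cramer coefficient has a denominator. The second summand is entire in z, so the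
  poles of the model come from zeros of \<open>D0\<close>.\<close>

lemma model_eq: "model z g x $ k = num z g x $ k / D0 z + exp (\<i> * z * of_real (rho \<beta> k x)) * (W x *v F z g x) $ k"
proof -
  interpret mv: bounded_bilinear "\<lambda>(A::complex^'n^'n) x. A *v x" by (rule bounded_bilinear_matrix_vector)
  have "W x *v (c *s v) = c *s (W x *v v)" for c v
    by (simp add: vec_eq_iff matrix_vector_mult_def sum_distrib_left mult_ac)
  then show ?thesis
    by (simp add: model_def num_def cramer_coeff_def mv.add_right Phi0_mult distrib_left divide_inverse mult_ac)
qed

text \<open>Near a simple zero of the characteristic determinant the principal part of the approximate
  resolvent vanishes as soon as the Cramer vector does.\<close>
lemma model_contour_integral_0:
  assumes g: "continuous_on {0..l} g" and x: "x \<in> {0..l}" and r: "0 < r"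
    and zero: "D0 \<mu> = 0" "deriv D0 \<mu> \<noteq> 0" "\<And>z. D0 z = 0 \<Longrightarrow> z \<noteq> \<mu> \<Longrightarrow> r < cmod (z - \<mu>)"
    and cr: "cramer_vec (A0 \<mu>) (boundary_rhs \<mu> g) = 0"
  shows "((\<lambda>z. model z g x $ k) has_contour_integral 0) (circlepath \<mu> r)"
proof -
  \<comment> \<open>\<open>D0\<close> with its simple zero at \<mu> divided out. It has no zero in
    the closed disc, so the polar part of the model becomes a holomorphic function over
    \<open>z - \<mu>\<close>.\<close>
  define E where "E z = (if z = \<mu> then deriv D0 \<mu> else D0 z / (z - \<mu>))" for z
  have Eh: "E holomorphic_on UNIV"
    by (rule pole_theorem_0[of D0 _ \<mu>]) (simp_all add: D0_holomorphic E_def zero)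
  have E0: "E z \<noteq> 0" if "z \<in> cball \<mu> r" for z
    using that zero(2) zero(3)[of z] by (auto simp: E_def dist_norm norm_minus_commute)
  have num0: "num \<mu> g x = 0" by (simp add: num_def cr)
  have h: "(\<lambda>z. num z g x $ k / E z) holomorphic_on cball \<mu> r"
    by (intro holomorphic_intros holomorphic_on_subset[OF num_holomorphic[OF g]] holomorphic_on_subset[OF Eh] E0) auto
  from Cauchy_integral_circlepath_simple[OF h, of \<mu>] r
  have "((\<lambda>u. num u g x $ k / E u / (u - \<mu>)) has_contour_integral 2 * of_real pi * \<i> * (num \<mu> g x $ k / E \<mu>)) (circlepath \<mu> r)"
    by simp
  then have 1: "((\<lambda>u. num u g x $ k / E u / (u - \<mu>)) has_contour_integral 0) (circlepath \<mu> r)"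
    by (simp add: num0)
  have 2: "((\<lambda>z. exp (\<i> * z * of_real (rho \<beta> k x)) * (W x *v F z g x) $ k) has_contour_integral 0) (circlepath \<mu> r)"
    unfolding matrix_vector_mult_def
    by (rule Cauchy_theorem_convex_simple[of _ UNIV]) (simp_all, intro holomorphic_intros F_holomorphic[OF g x])
  have "((\<lambda>u. num u g x $ k / E u / (u - \<mu>) + exp (\<i> * u * of_real (rho \<beta> k x)) * (W x *v F u g x) $ k) has_contour_integral 0 + 0) (circlepath \<mu> r)"
    by (rule has_contour_integral_add[OF 1 2])
  then have "((\<lambda>z. model z g x $ k) has_contour_integral 0 + 0) (circlepath \<mu> r)"
  proof (rule has_contour_integral_eq)
    fix u assume "u \<in> path_image (circlepath \<mu> r)"
    then have "u \<noteq> \<mu>" using r by (auto simp: dist_norm)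
    then show "num u g x $ k / E u / (u - \<mu>) + exp (\<i> * u * of_real (rho \<beta> k x)) * (W x *v F u g x) $ k = model u g x $ k"
      by (simp add: model_eq E_def)
  qed
  then show ?thesis by simp
qed

section \<open>Linear structure of the equation and root functions\<close>

lemma solves_shift:
  assumes "solves lam y g"
  shows "solves z y (\<lambda>x. g x - (z - lam) *s y x)"
proof -
  have "(\<lambda>x. (\<chi> k. \<i> * of_real (\<beta> k x) * (lam * y x $ k + g x $ k)) - Q x *v y x)
     = (\<lambda>x. (\<chi> k. \<i> * of_real (\<beta> k x) * (z * y x $ k + (g x - (z - lam) *s y x) $ k)) - Q x *v y x)"
    by (simp add: fun_eq_iff vec_eq_iff algebra_simps)
  then show ?thesis using assms unfolding solves_def by simp
qed

lemma solves_zero: "solves z (\<lambda>_. 0) (\<lambda>_. 0)"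
proof -
  have "(\<lambda>x. (\<chi> k. \<i> * of_real (\<beta> k x) * (z * (0::complex^'n) $ k + (0::complex^'n) $ k)) - Q x *v 0) = (\<lambda>_. 0)"
    by (simp add: fun_eq_iff vec_eq_iff)
  then show ?thesis unfolding solves_def using AC_with_deriv_const[of l "0::complex^'n"] by simp
qed

lemma solves_add:
  assumes "solves z y g" "solves z y' g'"
  shows "solves z (\<lambda>x. y x + y' x) (\<lambda>x. g x + g' x)"
proof -
  interpret mv: bounded_bilinear "\<lambda>(A::complex^'n^'n) x. A *v x" by (rule bounded_bilinear_matrix_vector)
  have a: "AC_with_deriv l (\<lambda>x. y x + y' x) (\<lambda>x. ((\<chi> k. \<i> * of_real (\<beta> k x) * (z * y x $ k + g x $ k)) - Q x *v y x)
    + ((\<chi> k. \<i> * of_real (\<beta> k x) * (z * y' x $ k + g' x $ k)) - Q x *v y' x))"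
    using assms unfolding solves_def by (intro AC_with_deriv_add) blast+
  have "(\<lambda>x. ((\<chi> k. \<i> * of_real (\<beta> k x) * (z * y x $ k + g x $ k)) - Q x *v y x)
    + ((\<chi> k. \<i> * of_real (\<beta> k x) * (z * y' x $ k + g' x $ k)) - Q x *v y' x))
    = (\<lambda>x. (\<chi> k. \<i> * of_real (\<beta> k x) * (z * (y x + y' x) $ k + (g x + g' x) $ k)) - Q x *v (y x + y' x))"
    by (simp add: fun_eq_iff vec_eq_iff mv.add_right algebra_simps)
  then have "AC_with_deriv l (\<lambda>x. y x + y' x) (\<lambda>x. (\<chi> k. \<i> * of_real (\<beta> k x) * (z * (y x + y' x) $ k + (g x + g' x) $ k)) - Q x *v (y x + y' x))"
    using a by simp
  moreover have "C *v (y 0 + y' 0) + D *v (y l + y' l) = (C *v y 0 + D *v y l) + (C *v y' 0 + D *v y' l)"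
    by (simp add: mv.add_right)
  moreover have "C *v y 0 + D *v y l = 0" "C *v y' 0 + D *v y' l = 0" using assms unfolding solves_def by blast+
  ultimately show ?thesis unfolding solves_def by simp
qed

lemma matrix_vector_smult: "(A::complex^'n^'n) *v (c *s v) = c *s (A *v v)"
  by (simp add: vec_eq_iff matrix_vector_mult_def sum_distrib_left mult_ac)

lemma solves_smult:
  assumes "solves z y g"
  shows "solves z (\<lambda>x. c *s y x) (\<lambda>x. c *s g x)"
proof -
  have lin: "bounded_linear (\<lambda>v::complex^'n. c *s v)"
    by (intro linear_conv_bounded_linear[THEN iffD1] linearI) (simp_all add: vec_eq_iff algebra_simps)
  have a: "AC_with_deriv l (\<lambda>x. c *s y x) (\<lambda>x. c *s ((\<chi> k. \<i> * of_real (\<beta> k x) * (z * y x $ k + g x $ k)) - Q x *v y x))"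
    using assms unfolding solves_def by (intro AC_with_deriv_linear[OF _ lin]) blast
  have "(\<lambda>x. c *s ((\<chi> k. \<i> * of_real (\<beta> k x) * (z * y x $ k + g x $ k)) - Q x *v y x))
    = (\<lambda>x. (\<chi> k. \<i> * of_real (\<beta> k x) * (z * (c *s y x) $ k + (c *s g x) $ k)) - Q x *v (c *s y x))"
    by (simp add: fun_eq_iff vec_eq_iff matrix_vector_smult algebra_simps)
  then have "AC_with_deriv l (\<lambda>x. c *s y x) (\<lambda>x. (\<chi> k. \<i> * of_real (\<beta> k x) * (z * (c *s y x) $ k + (c *s g x) $ k)) - Q x *v (c *s y x))"
    using a by simp
  moreover have "C *v (c *s y 0) + D *v (c *s y l) = c *s (C *v y 0 + D *v y l)"
    by (simp add: matrix_vector_smult vec_eq_iff algebra_simps)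
  moreover have "C *v y 0 + D *v y l = 0" using assms unfolding solves_def by blast
  ultimately show ?thesis unfolding solves_def by simp
qed

lemma solves_sum:
  assumes "finite I" "\<And>i. i \<in> I \<Longrightarrow> solves z (y i) (g i)"
  shows "solves z (\<lambda>x. \<Sum>i\<in>I. c i *s y i x) (\<lambda>x. \<Sum>i\<in>I. c i *s g i x)"
  using assms
proof (induction I rule: finite_induct)
  case empty
  show ?case by (simp add: solves_zero)
next
  case (insert a I)
  have "solves z (\<lambda>x. c a *s y a x + (\<Sum>i\<in>I. c i *s y i x)) (\<lambda>x. c a *s g a x + (\<Sum>i\<in>I. c i *s g i x))"
    using insert by (intro solves_add solves_smult) auto
  then show ?case using insert.hyps by simp
qed

text \<open>A Jordan chain: \<open>\<psi> j\<close> is the j-th power of \<open>L - lam\<close>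
  applied to f. Recording it by functions rather than by classes modulo null sets keeps null sets
  out of the analysis.\<close>

definition root_function :: "complex \<Rightarrow> (real \<Rightarrow> complex^'n) \<Rightarrow> bool" where
  "root_function lam f \<longleftrightarrow> (\<exists>p \<psi>. (\<forall>j<p. solves lam (\<psi> j) (\<psi> (Suc j))) \<and> \<psi> p = (\<lambda>_. 0) \<and> f = \<psi> 0)"

lemma root_function_continuous: "root_function lam f \<Longrightarrow> continuous_on {0..l} f"
proof -
  assume "root_function lam f"
  then obtain p \<psi> where p: "\<And>j. j < p \<Longrightarrow> solves lam (\<psi> j) (\<psi> (Suc j))" "\<psi> p = (\<lambda>_. 0)" "f = \<psi> 0"
    unfolding root_function_def by blast
  show ?thesis
  proof (cases "p = 0")
    case True
    then show ?thesis using p by simp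
  next
    case False
    then show ?thesis using solves_continuous[OF p(1)[of 0]] p(3) by simp
  qed
qed

text \<open>For a root vector the resolvent is an explicit rational function of the spectral parameter.\<close>
lemma root_function_resolvent:
  assumes "root_function lam f"
  obtains Y where "\<And>z. z \<noteq> lam \<Longrightarrow> solves z (Y z) f"
    "\<And>x k. (\<lambda>z. Y z x $ k) holomorphic_on - {lam}"
    "\<And>\<gamma> x k. \<lbrakk>valid_path \<gamma>; pathfinish \<gamma> = pathstart \<gamma>; lam \<notin> path_image \<gamma>\<rbrakk> \<Longrightarrow>
       ((\<lambda>z. Y z x $ k) has_contour_integral - (2 * pi * \<i> * winding_number \<gamma> lam) * f x $ k) \<gamma>"
proof -
  obtain p \<psi> where p: "\<And>j. j < p \<Longrightarrow> solves lam (\<psi> j) (\<psi> (Suc j))" "\<psi> p = (\<lambda>_. 0)" "f = \<psi> 0"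
    using assms unfolding root_function_def by blast
  \<comment> \<open>A finite Neumann series: \<open>L - lam\<close> is nilpotent on the chain, so
    the inverse of \<open>(L - lam) - (z - lam)\<close> is minus the sum of
    \<open>(L - lam) ^ j / (z - lam) ^ (j + 1)\<close>.\<close>
  define Y where "Y z x = (\<Sum>j<p. (- (1 / (z - lam) ^ Suc j)) *s \<psi> j x)" for z x
  show ?thesis
  proof (rule that)
    fix z assume z: "z \<noteq> lam"
    have "solves z (\<lambda>x. \<Sum>j<p. (- (1 / (z - lam) ^ Suc j)) *s \<psi> j x)
       (\<lambda>x. \<Sum>j<p. (- (1 / (z - lam) ^ Suc j)) *s (\<psi> (Suc j) x - (z - lam) *s \<psi> j x))"
      by (intro solves_sum solves_shift p(1)) auto
    moreover have "(\<Sum>j<p. (- (1 / (z - lam) ^ Suc j)) *s (\<psi> (Suc j) x - (z - lam) *s \<psi> j x)) = f x" for x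
    proof -
      \<comment> \<open>Generalised to all partial sums, so that the telescoping is an induction;
        the end term disappears at \<open>q = p\<close>.\<close>
      have "(\<Sum>j<q. (- (1 / (z - lam) ^ Suc j)) *s (\<psi> (Suc j) x - (z - lam) *s \<psi> j x))
          = \<psi> 0 x - (1 / (z - lam) ^ q) *s \<psi> q x" for q
      proof (induction q)
        case 0
        show ?case by simp
      next
        case (Suc q)
        have "1 / (z - lam) ^ Suc q * (z - lam) = 1 / (z - lam) ^ q" using z by simp
        then have "(- (1 / (z - lam) ^ Suc q)) *s (\<psi> (Suc q) x - (z - lam) *s \<psi> q x)
            = (1 / (z - lam) ^ q) *s \<psi> q x - (1 / (z - lam) ^ Suc q) *s \<psi> (Suc q) x"
          by (rule smult_telescope)
        then show ?case unfolding sum.lessThan_Suc Suc by simp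
      qed
      from this[of p] show ?thesis using p(2,3) by simp
    qed
    ultimately show "solves z (Y z) f" by (simp add: Y_def[abs_def])
  next
    fix x k
    show "(\<lambda>z. Y z x $ k) holomorphic_on - {lam}"
      unfolding Y_def by (simp del: power_Suc, intro holomorphic_intros) auto
  next
    fix \<gamma> x k assume g: "valid_path \<gamma>" "pathfinish \<gamma> = pathstart \<gamma>" "lam \<notin> path_image \<gamma>"
    \<comment> \<open>Only the simple pole contributes; the higher negative powers have a primitive
      along the path.\<close>
    define w where "w j = (if j = 0 then 2 * pi * \<i> * winding_number \<gamma> lam else 0)" for j :: nat
    have "((\<lambda>z. 1 / (z - lam) ^ Suc j) has_contour_integral w j) \<gamma>" for j
    proof (cases j)
      case 0
      then show ?thesis using has_contour_integral_winding_number[OF g(1,3)] by (simp add: w_def)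
    next
      case (Suc i)
      have der: "((\<lambda>z. - (1 / of_nat (Suc i)) * (1 / (z - lam) ^ Suc i)) has_field_derivative 1 / (z - lam) ^ Suc (Suc i)) (at z within path_image \<gamma>)"
        if "z \<in> path_image \<gamma>" for z
      proof -
        have nz: "z - lam \<noteq> 0" using that g(3) by auto
        have n0: "(of_nat (Suc i) :: complex) \<noteq> 0" by (simp only: of_nat_eq_0_iff)
        have "((\<lambda>z. (z - lam) ^ Suc i) has_field_derivative of_nat (Suc i) * (z - lam) ^ i * 1) (at z within path_image \<gamma>)"
          by (rule derivative_eq_intros refl | simp)+
        from DERIV_inverse'[OF this] nz
        have "((\<lambda>z. inverse ((z - lam) ^ Suc i)) has_field_derivative
            - (inverse ((z - lam) ^ Suc i) * (of_nat (Suc i) * (z - lam) ^ i * 1) * inverse ((z - lam) ^ Suc i))) (at z within path_image \<gamma>)"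
          by simp
        from DERIV_cmult[OF this, of "- (1 / of_nat (Suc i))"]
        have "((\<lambda>z. - (1 / of_nat (Suc i)) * (1 / (z - lam) ^ Suc i)) has_field_derivative
            - (1 / of_nat (Suc i)) * - (inverse ((z - lam) ^ Suc i) * (of_nat (Suc i) * (z - lam) ^ i * 1) * inverse ((z - lam) ^ Suc i))) (at z within path_image \<gamma>)"
          by (simp only: divide_inverse mult_1_left)
        moreover have "- (1 / of_nat (Suc i)) * - (inverse ((z - lam) ^ Suc i) * (of_nat (Suc i) * (z - lam) ^ i * 1) * inverse ((z - lam) ^ Suc i))
            = 1 / (z - lam) ^ Suc (Suc i)"
          unfolding power_Suc by (rule inverse_power_deriv_aux) (use nz n0 in simp_all)
        ultimately show ?thesis by simp
      qed
      from Cauchy_theorem_primitive[OF der g(1) subset_refl g(2)] show ?thesis by (simp add: Suc w_def)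
    qed
    then have "((\<lambda>z. \<Sum>j<p. (- (\<psi> j x $ k)) * (1 / (z - lam) ^ Suc j)) has_contour_integral (\<Sum>j<p. (- (\<psi> j x $ k)) * w j)) \<gamma>"
      by (intro has_contour_integral_sum has_contour_integral_lmul) auto
    moreover have "(\<Sum>j<p. (- (\<psi> j x $ k)) * w j) = - (2 * pi * \<i> * winding_number \<gamma> lam) * f x $ k"
    proof (cases "p = 0")
      case True
      then show ?thesis using p(2,3) by simp
    next
      case False
      then have "(\<Sum>j<p. (- (\<psi> j x $ k)) * w j) = (- (\<psi> 0 x $ k)) * w 0"
        by (subst sum.remove[of _ 0]) (auto simp: w_def intro!: sum.neutral)
      then show ?thesis using p(3) by (simp add: w_def)
    qed
    moreover have "Y z x $ k = (\<Sum>j<p. (- (\<psi> j x $ k)) * (1 / (z - lam) ^ Suc j))" for z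
      by (simp add: Y_def sum_component mult.commute del: power_Suc)
    ultimately show "((\<lambda>z. Y z x $ k) has_contour_integral - (2 * pi * \<i> * winding_number \<gamma> lam) * f x $ k) \<gamma>"
      by simp
  qed
qed

end

section \<open>The weighted inner product\<close>

definition fspan :: "'i set \<Rightarrow> ('i \<Rightarrow> real \<Rightarrow> complex^'n) \<Rightarrow> (real \<Rightarrow> complex^'n) set" where
  "fspan I f = {h. \<exists>d. h = (\<lambda>x. \<Sum>i\<in>I. d i *s f i x)}"

lemma fspanI: "h = (\<lambda>x. \<Sum>i\<in>I. d i *s f i x) \<Longrightarrow> h \<in> fspan I f"
  unfolding fspan_def mem_Collect_eq by (rule exI)

lemma fspanE:
  assumes "h \<in> fspan I f"
  obtains d where "h = (\<lambda>x. \<Sum>i\<in>I. d i *s f i x)"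
  using assms unfolding fspan_def mem_Collect_eq by (rule exE)

lemma fspan_base: "finite I \<Longrightarrow> i \<in> I \<Longrightarrow> f i \<in> fspan I f"
  unfolding fspan_def
  by (auto intro!: exI[of _ "\<lambda>j. if j = i then 1 else 0"] simp: fun_eq_iff if_distrib[of "\<lambda>c. c *s _"] sum.delta' cong: if_cong)

lemma fspan_add: "g \<in> fspan I f \<Longrightarrow> h \<in> fspan I f \<Longrightarrow> (\<lambda>x. g x + h x) \<in> fspan I f"
proof -
  assume g: "g \<in> fspan I f" and h: "h \<in> fspan I f"
  obtain d where "g = (\<lambda>x. \<Sum>i\<in>I. d i *s f i x)" by (rule fspanE[OF g])
  moreover obtain e where "h = (\<lambda>x. \<Sum>i\<in>I. e i *s f i x)" by (rule fspanE[OF h])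
  ultimately have "(\<lambda>x. g x + h x) = (\<lambda>x. \<Sum>i\<in>I. (d i + e i) *s f i x)"
    by (simp add: fun_eq_iff sum.distrib[symmetric] vector_sadd_rdistrib)
  then show ?thesis by (rule fspanI)
qed

lemma fspan_smult: "g \<in> fspan I f \<Longrightarrow> (\<lambda>x. c *s g x) \<in> fspan I f"
proof -
  assume "g \<in> fspan I f"
  then obtain d where "g = (\<lambda>x. \<Sum>i\<in>I. d i *s f i x)" by (rule fspanE)
  then have "(\<lambda>x. c *s g x) = (\<lambda>x. \<Sum>i\<in>I. (c * d i) *s f i x)"
    by (simp add: fun_eq_iff vec_eq_iff sum_component sum_distrib_left mult.assoc)
  then show ?thesis by (rule fspanI)
qed

lemma fspan_0: "(\<lambda>x. 0) \<in> fspan I f"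
  unfolding fspan_def by (auto intro!: exI[of _ "\<lambda>_. 0"])

lemma fspan_sum:
  assumes "finite J" "\<And>j. j \<in> J \<Longrightarrow> g j \<in> fspan I f"
  shows "(\<lambda>x. \<Sum>j\<in>J. c j *s g j x) \<in> fspan I f"
  using assms
proof (induction J rule: finite_induct)
  case empty
  then show ?case by (simp add: fspan_0)
next
  case (insert j J)
  have "(\<lambda>x. c j *s g j x + (\<Sum>j\<in>J. c j *s g j x)) \<in> fspan I f"
    using insert by (intro fspan_add fspan_smult) auto
  then show ?case using insert.hyps by simp
qed

lemma fspan_trans:
  assumes "finite J" "h \<in> fspan J g" "\<And>j. j \<in> J \<Longrightarrow> g j \<in> fspan I f"
  shows "h \<in> fspan I f"
proof -
  obtain d where "h = (\<lambda>x. \<Sum>j\<in>J. d j *s g j x)" by (rule fspanE[OF assms(2)])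
  then show ?thesis using fspan_sum[OF assms(1,3)] by simp
qed

lemma fspan_mono:
  assumes "finite I" "J \<subseteq> I" "h \<in> fspan J f"
  shows "h \<in> fspan I f"
  using assms by (intro fspan_trans[OF _ assms(3)]) (auto intro: fspan_base finite_subset)

lemma cnj_mult_self: "cnj z * z = of_real ((cmod z)\<^sup>2)"
  by (simp only: complex_norm_square mult.commute)

lemma bounded_linear_vsmult: "bounded_linear (\<lambda>v::complex^'n. c *s v)"
  by (intro linear_conv_bounded_linear[THEN iffD1] linearI) (simp_all add: vec_eq_iff algebra_simps)

context bvp begin

abbreviation cont :: "(real \<Rightarrow> complex^'n) \<Rightarrow> bool" where "cont f \<equiv> continuous_on {0..l} f"

definition inner_H :: "(real \<Rightarrow> complex^'n) \<Rightarrow> (real \<Rightarrow> complex^'n) \<Rightarrow> complex" where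
  "inner_H f g = (\<Sum>k\<in>UNIV. integral {0..l} (\<lambda>x. of_real \<bar>\<beta> k x\<bar> * (f x $ k * cnj (g x $ k))))"

definition norm_H_sq :: "(real \<Rightarrow> complex^'n) \<Rightarrow> real" where
  "norm_H_sq f = (\<Sum>k\<in>UNIV. integral {0..l} (\<lambda>x. \<bar>\<beta> k x\<bar> * (cmod (f x $ k))\<^sup>2))"

definition norm_H :: "(real \<Rightarrow> complex^'n) \<Rightarrow> real" where "norm_H f = sqrt (norm_H_sq f)"

lemma abs_beta_ai: "(\<lambda>x. \<bar>\<beta> k x\<bar>) absolutely_integrable_on {0..l}"
  using absolutely_integrable_norm[OF beta_ai[of k]] by (simp add: o_def)

lemma weight_integrable:
  assumes "continuous_on {0..l} (f :: real \<Rightarrow> complex)"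
  shows "(\<lambda>x. of_real \<bar>\<beta> k x\<bar> * f x) integrable_on {0..l}"
proof -
  have "(\<lambda>x. complex_of_real \<bar>\<beta> k x\<bar>) absolutely_integrable_on {0..l}"
    using absolutely_integrable_linear[OF abs_beta_ai[of k] bounded_linear_of_real[where 'a=complex]] by (simp add: o_def)
  from absolutely_integrable_bilinear_continuous[OF bounded_bilinear_mult this assms]
  show ?thesis by (simp only: absolutely_integrable_on_def)
qed

lemma weight_integrable_real:
  assumes "continuous_on {0..l} (f :: real \<Rightarrow> real)"
  shows "(\<lambda>x. \<bar>\<beta> k x\<bar> * f x) integrable_on {0..l}"
  using absolutely_integrable_bilinear_continuous[OF bounded_bilinear_mult abs_beta_ai assms, of k]
  by (simp add: absolutely_integrable_on_def)

lemma continuous_smult_fun: "cont f \<Longrightarrow> cont (\<lambda>x. c *s f x)"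
  by (rule bounded_linear.continuous_on[OF bounded_linear_vsmult])

lemma cont_fspan: "(\<And>i. i \<in> I \<Longrightarrow> cont (f i)) \<Longrightarrow> h \<in> fspan I f \<Longrightarrow> cont h"
  unfolding fspan_def by (auto intro!: continuous_on_sum continuous_smult_fun)

lemma inner_H_add_left:
  assumes "cont f" "cont f'" "cont g"
  shows "inner_H (\<lambda>x. f x + f' x) g = inner_H f g + inner_H f' g"
proof -
  have "integral {0..l} (\<lambda>x. of_real \<bar>\<beta> k x\<bar> * ((f x + f' x) $ k * cnj (g x $ k)))
      = integral {0..l} (\<lambda>x. of_real \<bar>\<beta> k x\<bar> * (f x $ k * cnj (g x $ k))) + integral {0..l} (\<lambda>x. of_real \<bar>\<beta> k x\<bar> * (f' x $ k * cnj (g x $ k)))" for k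
  proof -
    have "((\<lambda>x. of_real \<bar>\<beta> k x\<bar> * (f x $ k * cnj (g x $ k)) + of_real \<bar>\<beta> k x\<bar> * (f' x $ k * cnj (g x $ k))) has_integral
       integral {0..l} (\<lambda>x. of_real \<bar>\<beta> k x\<bar> * (f x $ k * cnj (g x $ k))) + integral {0..l} (\<lambda>x. of_real \<bar>\<beta> k x\<bar> * (f' x $ k * cnj (g x $ k)))) {0..l}"
      by (intro has_integral_add integrable_integral weight_integrable continuous_intros assms)
    then show ?thesis by (simp add: distrib_left distrib_right integral_unique)
  qed
  then show ?thesis by (simp add: inner_H_def sum.distrib)
qed

lemma inner_H_smult_left:
  shows "inner_H (\<lambda>x. c *s f x) g = c * inner_H f g"
proof -
  have "integral {0..l} (\<lambda>x. of_real \<bar>\<beta> k x\<bar> * ((c *s f x) $ k * cnj (g x $ k)))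
      = c * integral {0..l} (\<lambda>x. of_real \<bar>\<beta> k x\<bar> * (f x $ k * cnj (g x $ k)))" for k
    unfolding integral_mult_right[symmetric] by (simp add: mult_ac)
  then show ?thesis by (simp add: inner_H_def sum_distrib_left)
qed

lemma inner_H_commute: "inner_H g f = cnj (inner_H f g)"
proof -
  have "integral {0..l} (\<lambda>x. of_real \<bar>\<beta> k x\<bar> * (g x $ k * cnj (f x $ k)))
      = cnj (integral {0..l} (\<lambda>x. of_real \<bar>\<beta> k x\<bar> * (f x $ k * cnj (g x $ k))))" for k
    unfolding integral_cnj by (simp add: mult.commute)
  then show ?thesis by (simp add: inner_H_def)
qed

lemma inner_H_sum_left:
  assumes "finite I" "\<And>i. i \<in> I \<Longrightarrow> cont (f i)" "cont g"
  shows "inner_H (\<lambda>x. \<Sum>i\<in>I. c i *s f i x) g = (\<Sum>i\<in>I. c i * inner_H (f i) g)"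
  using assms
proof (induction I rule: finite_induct)
  case empty
  then show ?case by (simp add: inner_H_def)
next
  case (insert a I)
  have "inner_H (\<lambda>x. c a *s f a x + (\<Sum>i\<in>I. c i *s f i x)) g = inner_H (\<lambda>x. c a *s f a x) g + inner_H (\<lambda>x. \<Sum>i\<in>I. c i *s f i x) g"
    using insert.prems by (intro inner_H_add_left continuous_on_sum continuous_smult_fun) auto
  then show ?case using insert by (simp add: inner_H_smult_left)
qed

lemma inner_H_sum_right:
  assumes "finite I" "\<And>i. i \<in> I \<Longrightarrow> cont (f i)" "cont g"
  shows "inner_H g (\<lambda>x. \<Sum>i\<in>I. c i *s f i x) = (\<Sum>i\<in>I. cnj (c i) * inner_H g (f i))"
proof -
  have "inner_H g (\<lambda>x. \<Sum>i\<in>I. c i *s f i x) = cnj (inner_H (\<lambda>x. \<Sum>i\<in>I. c i *s f i x) g)" by (rule inner_H_commute)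
  also have "inner_H (\<lambda>x. \<Sum>i\<in>I. c i *s f i x) g = (\<Sum>i\<in>I. c i * inner_H (f i) g)" by (rule inner_H_sum_left[OF assms])
  also have "cnj \<dots> = (\<Sum>i\<in>I. cnj (c i) * inner_H g (f i))"
    unfolding cnj_sum complex_cnj_mult inner_H_commute[of _ g] complex_cnj_cnj ..
  finally show ?thesis .
qed

lemma sq_integrable: "cont f \<Longrightarrow> (\<lambda>x. \<bar>\<beta> k x\<bar> * (cmod (f x $ k))\<^sup>2) integrable_on {0..l}"
  by (intro weight_integrable_real continuous_intros)

lemma inner_H_self:
  assumes f: "cont f"
  shows "inner_H f f = of_real (norm_H_sq f)"
proof -
  have "integral {0..l} (\<lambda>x. of_real \<bar>\<beta> k x\<bar> * (f x $ k * cnj (f x $ k)))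
      = of_real (integral {0..l} (\<lambda>x. \<bar>\<beta> k x\<bar> * (cmod (f x $ k))\<^sup>2))" for k
  proof -
    have "of_real (integral {0..l} (\<lambda>x. \<bar>\<beta> k x\<bar> * (cmod (f x $ k))\<^sup>2))
        = integral {0..l} (\<lambda>x. complex_of_real (\<bar>\<beta> k x\<bar> * (cmod (f x $ k))\<^sup>2))"
      using integral_linear[OF sq_integrable[OF f] bounded_linear_of_real[where 'a=complex], of k] by (simp add: o_def)
    then show ?thesis by (simp add: complex_norm_square[symmetric])
  qed
  then show ?thesis by (simp add: inner_H_def norm_H_sq_def)
qed

lemma norm_H_sq_nonneg: "cont f \<Longrightarrow> 0 \<le> norm_H_sq f"
  unfolding norm_H_sq_def by (intro sum_nonneg Henstock_Kurzweil_Integration.integral_nonneg sq_integrable) auto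

lemma norm_H_le_sup:
  assumes f: "cont f" and K: "0 \<le> K" "\<And>x. x \<in> {0..l} \<Longrightarrow> norm (f x) \<le> K"
  shows "norm_H f \<le> sqrt (real CARD('n) * (l * B)) * K"
proof -
  have "integral {0..l} (\<lambda>x. \<bar>\<beta> k x\<bar> * (cmod (f x $ k))\<^sup>2) \<le> l * B * K\<^sup>2" for k
  proof -
    have "integral {0..l} (\<lambda>x. \<bar>\<beta> k x\<bar> * (cmod (f x $ k))\<^sup>2) \<le> integral {0..l} (\<lambda>x. B * K\<^sup>2)"
    proof (rule integral_le[OF sq_integrable[OF f]])
      fix x assume x: "x \<in> {0..l}"
      have "cmod (f x $ k) \<le> K" using Finite_Cartesian_Product.norm_nth_le[of "f x" k] K(2)[OF x] by linarith
      then show "\<bar>\<beta> k x\<bar> * (cmod (f x $ k))\<^sup>2 \<le> B * K\<^sup>2"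
        using beta_hi[OF x, of k] B0 by (intro mult_mono power_mono) auto
    qed auto
    then show ?thesis using l by (simp add: mult_ac)
  qed
  then have "norm_H_sq f \<le> of_nat (card (UNIV :: 'n set)) * (l * B * K\<^sup>2)"
    unfolding norm_H_sq_def by (intro sum_bounded_above) auto
  then have "norm_H f \<le> sqrt ((real CARD('n) * (l * B)) * K\<^sup>2)" unfolding norm_H_def by (simp add: mult.assoc)
  also have "\<dots> = sqrt (real CARD('n) * (l * B)) * K" using K(1) by (simp add: real_sqrt_mult)
  finally show ?thesis .
qed

lemma norm_H_sq_lower:
  assumes f: "cont f"
  shows "(\<lambda>x. (norm (f x))\<^sup>2) integrable_on {0..l}" "b0 * integral {0..l} (\<lambda>x. (norm (f x))\<^sup>2) \<le> norm_H_sq f"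
proof -
  show i: "(\<lambda>x. (norm (f x))\<^sup>2) integrable_on {0..l}"
    by (intro integrable_continuous_real continuous_intros f)
  have "b0 * integral {0..l} (\<lambda>x. (norm (f x))\<^sup>2) = integral {0..l} (\<lambda>x. b0 * (norm (f x))\<^sup>2)" by simp
  also have "\<dots> \<le> integral {0..l} (\<lambda>x. \<Sum>k\<in>UNIV. \<bar>\<beta> k x\<bar> * (cmod (f x $ k))\<^sup>2)"
  proof (rule integral_le)
    show "(\<lambda>x. b0 * (norm (f x))\<^sup>2) integrable_on {0..l}" by (rule integrable_on_mult_right[OF i])
    show "(\<lambda>x. \<Sum>k\<in>UNIV. \<bar>\<beta> k x\<bar> * (cmod (f x $ k))\<^sup>2) integrable_on {0..l}"
      by (intro integrable_sum sq_integrable f) simp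
    fix x assume x: "x \<in> {0..l}"
    have "(norm (f x))\<^sup>2 = (\<Sum>k\<in>UNIV. (cmod (f x $ k))\<^sup>2)"
      by (simp add: norm_vec_def L2_set_def sum_nonneg)
    then show "b0 * (norm (f x))\<^sup>2 \<le> (\<Sum>k\<in>UNIV. \<bar>\<beta> k x\<bar> * (cmod (f x $ k))\<^sup>2)"
      using beta_lo[OF x] by (simp add: sum_distrib_left sum_mono mult_right_mono)
  qed
  also have "\<dots> = norm_H_sq f" unfolding norm_H_sq_def
    by (intro Henstock_Kurzweil_Integration.integral_sum sq_integrable f) simp
  finally show "b0 * integral {0..l} (\<lambda>x. (norm (f x))\<^sup>2) \<le> norm_H_sq f" .
qed

text \<open>The pointwise inequality \<open>norm f \<le> t / 2 + (norm f)^2 / (2 * t)\<close> is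
  integrated, with t equal to the Hilbert norm of f.\<close>

lemma L1_le_norm_H:
  assumes f: "cont f"
  shows "L1 f \<le> (l / 2 + 1 / (2 * b0)) * norm_H f"
proof -
  have N: "0 \<le> norm_H_sq f" by (rule norm_H_sq_nonneg[OF f])
  have est: "L1 f \<le> t * l / 2 + norm_H_sq f / (2 * t * b0)" if t: "t > 0" for t
  proof -
    have "L1 f \<le> integral {0..l} (\<lambda>x. t / 2 + 1 / (2 * t) * (norm (f x))\<^sup>2)"
      unfolding L1_def
    proof (rule integral_le[OF cnorm_integrable[OF f]])
      show "(\<lambda>x. t / 2 + 1 / (2 * t) * (norm (f x))\<^sup>2) integrable_on {0..l}"
        by (intro integrable_add integrable_on_mult_right norm_H_sq_lower(1) f) auto
      fix x
      have "0 \<le> (t - norm (f x))\<^sup>2" by simp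
      then have "2 * t * norm (f x) \<le> t\<^sup>2 + (norm (f x))\<^sup>2" by (simp add: power2_diff)
      then show "norm (f x) \<le> t / 2 + 1 / (2 * t) * (norm (f x))\<^sup>2"
        using t by (simp add: field_simps power2_eq_square)
    qed
    also have "\<dots> = t / 2 * l + 1 / (2 * t) * integral {0..l} (\<lambda>x. (norm (f x))\<^sup>2)"
    proof (intro integral_unique has_integral_add has_integral_mult_right integrable_integral norm_H_sq_lower(1) f)
      show "((\<lambda>x. t / 2) has_integral t / 2 * l) {0..l}"
        using has_integral_const_real[of "t / 2" 0 l] l by (simp add: mult.commute)
    qed
    also have "integral {0..l} (\<lambda>x. (norm (f x))\<^sup>2) \<le> norm_H_sq f / b0"
      using norm_H_sq_lower(2)[OF f] b0 by (simp add: field_simps)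
    finally show ?thesis using t by (simp add: mult.commute mult_left_mono divide_simps)
  qed
  show ?thesis
  proof (cases "norm_H_sq f = 0")
    case True
    \<comment> \<open>The value t = 0 is not admissible, so t is sent to zero instead.\<close>
    have "L1 f \<le> 0 + e" if "e > 0" for e
      using est[of "2 * e / l"] that l True by simp
    then have "L1 f \<le> 0" by (rule field_le_epsilon)
    then show ?thesis using True by (simp add: norm_H_def)
  next
    case False
    then have p: "norm_H f > 0" using N by (simp add: norm_H_def)
    have "norm_H_sq f = norm_H f * norm_H f" using N by (simp add: norm_H_def)
    then have "norm_H_sq f / (2 * norm_H f * b0) = norm_H f / (2 * b0)" using p by simp
    then show ?thesis using est[OF p] by (simp add: algebra_simps)
  qed
qed

lemma L1_zero:
  assumes f: "cont f" and L: "L1 f = 0" and x: "x \<in> {0..l}"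
  shows "f x = 0"
proof -
  have "(\<lambda>x. norm (f x)) x = 0"
  proof (rule integral_cbox_eq_0_iff[THEN iffD1, rule_format, of 0 l "\<lambda>x. norm (f x)"])
    show "continuous_on (cbox 0 l) (\<lambda>x. norm (f x))" using f by (simp add: continuous_on_norm)
    show "box 0 l \<noteq> {}" using l by (simp add: box_real)
    show "integral (cbox 0 l) (\<lambda>x. norm (f x)) = 0" using L by (simp add: L1_def)
  qed (use x in auto)
  then show ?thesis by simp
qed

section \<open>Linear independence, orthonormalisation and distances\<close>

definition indep :: "'i set \<Rightarrow> ('i \<Rightarrow> real \<Rightarrow> complex^'n) \<Rightarrow> bool" where
  "indep I f \<longleftrightarrow> (\<forall>c. (\<forall>x\<in>{0..l}. (\<Sum>i\<in>I. c i *s f i x) = 0) \<longrightarrow> (\<forall>i\<in>I. c i = 0))"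

lemma indep_mono:
  assumes "finite I" "J \<subseteq> I" "indep I f"
  shows "indep J f"
  unfolding indep_def
proof (intro allI impI)
  fix c assume c: "\<forall>x\<in>{0..l}. (\<Sum>i\<in>J. c i *s f i x) = 0"
  define c' where "c' i = (if i \<in> J then c i else 0)" for i
  have "(\<Sum>i\<in>I. c' i *s f i x) = (\<Sum>i\<in>J. c i *s f i x)" for x
    using assms(1,2) by (intro sum.mono_neutral_cong_right) (auto simp: c'_def)
  then have "\<forall>x\<in>{0..l}. (\<Sum>i\<in>I. c' i *s f i x) = 0" using c by simp
  then have "\<forall>i\<in>I. c' i = 0" using assms(3) unfolding indep_def by blast
  then have "c' i = 0" if "i \<in> J" for i using assms(2) that by blast
  then show "\<forall>i\<in>J. c i = 0" by (simp add: c'_def)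
qed

text \<open>One step of orthogonalisation, shared by the Gram-Schmidt process and the distance
  estimate. The residual has positive norm, since a vanishing residual would be a linear dependence
  in which \<open>f a\<close> has coefficient one.\<close>

lemma orthogonal_residual:
  assumes I: "finite I" and a: "a \<notin> I" and ct: "\<And>i. i \<in> insert a I \<Longrightarrow> cont (f i)"
    and ind: "indep (insert a I) f"
    and e: "\<And>i. i \<in> I \<Longrightarrow> e i \<in> fspan I f" "\<And>i j. i \<in> I \<Longrightarrow> j \<in> I \<Longrightarrow> inner_H (e i) (e j) = (if i = j then 1 else 0)"
  obtains r p where "p \<in> fspan I e" "p \<in> fspan I f" "r = (\<lambda>x. f a x - p x)" "cont r"
    "\<And>j. j \<in> I \<Longrightarrow> inner_H r (e j) = 0" "0 < norm_H_sq r"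
proof -
  have ce: "cont (e i)" if "i \<in> I" for i using cont_fspan[OF _ e(1)[OF that]] ct by blast
  define p where "p = (\<lambda>x. \<Sum>i\<in>I. inner_H (f a) (e i) *s e i x)"
  define r where "r = (\<lambda>x. f a x - p x)"
  have pe: "p \<in> fspan I e" unfolding p_def by (rule fspanI[OF refl])
  have pf: "p \<in> fspan I f" by (rule fspan_trans[OF I pe e(1)])
  have cp: "cont p" using cont_fspan[OF ce pe] .
  have cr: "cont r" unfolding r_def using cp ct by (intro continuous_intros) auto
  have req: "r = (\<lambda>x. f a x + (-1) *s p x)" by (simp add: r_def fun_eq_iff vec_eq_iff)
  have orth: "inner_H r (e j) = 0" if j: "j \<in> I" for j
  proof -
    have "inner_H p (e j) = (\<Sum>i\<in>I. inner_H (f a) (e i) * inner_H (e i) (e j))"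
      unfolding p_def by (intro inner_H_sum_left I ce j)
    also have "\<dots> = (\<Sum>i\<in>I. if i = j then inner_H (f a) (e j) else 0)"
      by (rule sum.cong) (auto simp: e(2) j)
    also have "\<dots> = inner_H (f a) (e j)" using I j by simp
    finally have "inner_H p (e j) = inner_H (f a) (e j)" .
    moreover have "inner_H r (e j) = inner_H (f a) (e j) + inner_H (\<lambda>x. (-1) *s p x) (e j)"
      unfolding req using ct cp ce j by (intro inner_H_add_left continuous_smult_fun) auto
    ultimately show ?thesis unfolding inner_H_smult_left by simp
  qed
  have "norm_H_sq r \<noteq> 0"
  proof
    assume "norm_H_sq r = 0"
    then have "L1 r \<le> 0" using L1_le_norm_H[OF cr] by (simp add: norm_H_def)
    then have "L1 r = 0" using L1_nonneg[OF cr] by simp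
    then have r0: "r x = 0" if "x \<in> {0..l}" for x by (rule L1_zero[OF cr _ that])
    obtain d where d: "p = (\<lambda>x. \<Sum>i\<in>I. d i *s f i x)" by (rule fspanE[OF pf])
    define c where "c i = (if i = a then 1 else - d i)" for i
    have "(\<Sum>i\<in>insert a I. c i *s f i x) = r x" for x
    proof -
      have "(\<Sum>i\<in>I. c i *s f i x) = (\<Sum>i\<in>I. - (d i *s f i x))"
        using a by (intro sum.cong) (auto simp: c_def vec_eq_iff)
      then show ?thesis using I a by (simp add: c_def r_def d sum_negf)
    qed
    then have "\<forall>x\<in>{0..l}. (\<Sum>i\<in>insert a I. c i *s f i x) = 0" using r0 by simp
    then have "\<forall>i\<in>insert a I. c i = 0" using ind unfolding indep_def by blast
    then show False by (simp add: c_def)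
  qed
  then have "0 < norm_H_sq r" using norm_H_sq_nonneg[OF cr] by simp
  then show ?thesis using that pe pf r_def cr orth by blast
qed

lemma gram_schmidt:
  assumes "finite I" "\<And>i. i \<in> I \<Longrightarrow> cont (f i)" "indep I f"
  shows "\<exists>e. (\<forall>i\<in>I. e i \<in> fspan I f \<and> f i \<in> fspan I e) \<and> (\<forall>i\<in>I. \<forall>j\<in>I. inner_H (e i) (e j) = (if i = j then 1 else 0))"
  using assms
proof (induction I rule: finite_induct)
  case empty
  then show ?case by simp
next
  case (insert a I)
  have indI: "indep I f" using indep_mono[OF _ _ insert.prems(2)] insert.hyps by blast
  obtain e where e1: "\<And>i. i \<in> I \<Longrightarrow> e i \<in> fspan I f" "\<And>i. i \<in> I \<Longrightarrow> f i \<in> fspan I e"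
    and e2: "\<And>i j. i \<in> I \<Longrightarrow> j \<in> I \<Longrightarrow> inner_H (e i) (e j) = (if i = j then 1 else 0)"
    using insert.IH[OF insert.prems(1) indI] by blast
  obtain r p where r: "p \<in> fspan I e" "p \<in> fspan I f" "r = (\<lambda>x. f a x - p x)" "cont r"
    "\<And>j. j \<in> I \<Longrightarrow> inner_H r (e j) = 0" "0 < norm_H_sq r"
    using orthogonal_residual[OF insert.hyps insert.prems e1(1) e2] by blast
  define s where "s = norm_H r"
  have s: "s > 0" "s * s = norm_H_sq r" using r(6) by (simp_all add: s_def norm_H_def)
  define e' where "e' = e(a := (\<lambda>x. of_real (1 / s) *s r x))"
  have e'I: "e' i = e i" if "i \<in> I" for i using that insert.hyps by (auto simp: e'_def)
  have fin: "finite (insert a I)" using insert.hyps by simp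
  have spe: "fspan I e \<subseteq> fspan (insert a I) e'"
  proof
    fix h assume "h \<in> fspan I e"
    then have "h \<in> fspan I e'" using e'I by (auto simp: fspan_def)
    then show "h \<in> fspan (insert a I) e'" by (rule fspan_mono[OF fin subset_insertI])
  qed
  have sub: "fspan I f \<subseteq> fspan (insert a I) f" using fspan_mono[OF fin subset_insertI] by blast
  have e'a: "e' a \<in> fspan (insert a I) f"
  proof -
    have "(\<lambda>x. f a x + (-1) *s p x) \<in> fspan (insert a I) f"
      using r(2) sub fin by (intro fspan_add fspan_smult fspan_base) auto
    moreover have "r = (\<lambda>x. f a x + (-1) *s p x)" by (simp add: r(3) fun_eq_iff vec_eq_iff)
    ultimately have "r \<in> fspan (insert a I) f" by (simp only:)
    then show ?thesis unfolding e'_def fun_upd_same by (rule fspan_smult)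
  qed
  have fa: "f a \<in> fspan (insert a I) e'"
  proof -
    have "(\<lambda>x. of_real s *s e' a x + p x) \<in> fspan (insert a I) e'"
      using r(1) spe fin by (intro fspan_add fspan_smult fspan_base) auto
    moreover have "(\<lambda>x. of_real s *s e' a x + p x) = f a"
      using s(1) by (simp add: e'_def r(3) fun_eq_iff vec_eq_iff)
    ultimately show ?thesis by simp
  qed
  have ce: "cont (e i)" if "i \<in> I" for i
    using cont_fspan[OF _ e1(1)[OF that]] insert.prems(1) by blast
  have ra: "inner_H (e' a) (e i) = 0" if "i \<in> I" for i
    unfolding e'_def fun_upd_same inner_H_smult_left using r(5)[OF that] by simp
  have raa: "inner_H (e' a) (e' a) = 1"
  proof -
    have "inner_H (e' a) (e' a) = of_real (1 / s) * cnj (of_real (1 / s) * inner_H r r)"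
      unfolding e'_def fun_upd_same inner_H_smult_left inner_H_commute[of r "\<lambda>x. of_real (1 / s) *s r x"] by simp
    also have "\<dots> = of_real (1 / s * (1 / s * norm_H_sq r))" by (simp add: inner_H_self[OF r(4)])
    also have "norm_H_sq r = s * s" by (rule s(2)[symmetric])
    also have "1 / s * (1 / s * (s * s)) = 1" using s(1) by simp
    finally show ?thesis by simp
  qed
  show ?case
  proof (intro exI[of _ e'] conjI ballI)
    fix i assume i: "i \<in> insert a I"
    show "e' i \<in> fspan (insert a I) f"
      using i e'a e1(1) sub e'I by (cases "i = a") auto
    show "f i \<in> fspan (insert a I) e'"
      using i fa e1(2) spe by (cases "i = a") auto
    fix j assume j: "j \<in> insert a I"
    show "inner_H (e' i) (e' j) = (if i = j then 1 else 0)"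
    proof (cases "i = a")
      case True
      then show ?thesis using j raa ra[of j] e'I[of j] by (cases "j = a") auto
    next
      case False
      then show ?thesis using i j ra[of i] e'I e2 inner_H_commute[of "e i" "e' a"] by (cases "j = a") auto
    qed
  qed
qed

text \<open>A family whose span satisfies a sup-norm by L2-norm estimate is finite: evaluating the estimate
  at the reproducing kernel bounds the pointwise sum of squares of an orthonormal basis.\<close>
lemma card_bound:
  assumes I: "finite I" and ct: "\<And>i. i \<in> I \<Longrightarrow> cont (f i)" and ind: "indep I f" and K: "0 \<le> K"
    and sup: "\<And>h x. h \<in> fspan I f \<Longrightarrow> x \<in> {0..l} \<Longrightarrow> norm (h x) \<le> K * norm_H h"
  shows "real (card I) \<le> real CARD('n) * (l * (B * K\<^sup>2))"
proof -
  obtain e where e1: "\<And>i. i \<in> I \<Longrightarrow> e i \<in> fspan I f"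
    and e2: "\<And>i j. i \<in> I \<Longrightarrow> j \<in> I \<Longrightarrow> inner_H (e i) (e j) = (if i = j then 1 else 0)"
    using gram_schmidt[OF I ct ind] by blast
  have ce: "cont (e i)" if "i \<in> I" for i using cont_fspan[OF ct e1[OF that]] .
  have pt: "(\<Sum>i\<in>I. (cmod (e i x $ k))\<^sup>2) \<le> K\<^sup>2" if x: "x \<in> {0..l}" for x k
  proof -
    define s where "s = (\<Sum>i\<in>I. (cmod (e i x $ k))\<^sup>2)"
    have s0: "0 \<le> s" unfolding s_def by (intro sum_nonneg) auto
    \<comment> \<open>The reproducing kernel of the span for the k-th coordinate at x: both
      \<open>h x $ k\<close> and the squared norm of h equal s, so the hypothesis gives
      \<open>s \<le> K * sqrt s\<close>.\<close>
    define h where "h = (\<lambda>t. \<Sum>i\<in>I. cnj (e i x $ k) *s e i t)"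
    have hs: "h \<in> fspan I f" unfolding h_def by (rule fspan_sum[OF I e1])
    have ch: "cont h" by (rule cont_fspan[OF ct hs])
    have "h x $ k = of_real s"
      by (simp only: h_def s_def sum_component vector_smult_component cnj_mult_self of_real_sum)
    then have hx: "s \<le> norm (h x)" using Finite_Cartesian_Product.norm_nth_le[of "h x" k] s0 by simp
    have he: "inner_H (e j) h = e j x $ k" if j: "j \<in> I" for j
    proof -
      have "inner_H (e j) h = (\<Sum>i\<in>I. cnj (cnj (e i x $ k)) * inner_H (e j) (e i))"
        unfolding h_def by (intro inner_H_sum_right I ce j)
      also have "\<dots> = (\<Sum>i\<in>I. if i = j then e j x $ k else 0)"
        by (rule sum.cong) (auto simp: e2 j)
      finally show ?thesis using I j by simp
    qed
    have "inner_H h h = (\<Sum>i\<in>I. cnj (e i x $ k) * inner_H (e i) h)"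
      unfolding h_def by (rule inner_H_sum_left[OF I ce]) (simp_all only: h_def[symmetric] ch)
    also have "\<dots> = of_real s"
      by (simp add: he s_def cnj_mult_self)
    finally have "norm_H_sq h = s" unfolding inner_H_self[OF ch] by (simp only: of_real_eq_iff)
    then have "s \<le> K * sqrt s" using sup[OF hs x] hx by (simp add: norm_H_def)
    then have sK: "sqrt s * sqrt s \<le> K * sqrt s" using s0 by simp
    have "sqrt s \<le> K"
    proof (cases "s = 0")
      case False
      then have "0 < sqrt s" using s0 by simp
      then show ?thesis using sK by (rule mult_right_le_imp_le[rotated])
    qed (simp add: K)
    then have "(sqrt s)\<^sup>2 \<le> K\<^sup>2" using s0 by (intro power_mono) auto
    then show ?thesis using s0 by (simp add: s_def)
  qed
  have "complex_of_real (norm_H_sq (e i)) = 1" if "i \<in> I" for i using e2[OF that that] by (simp add: inner_H_self[OF ce[OF that], symmetric])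
  then have "norm_H_sq (e i) = 1" if "i \<in> I" for i using that by (simp only: of_real_eq_1_iff)
  \<comment> \<open>The basis vectors have norm one, so integrating the pointwise bound counts
    them.\<close>
  then have "real (card I) = (\<Sum>i\<in>I. norm_H_sq (e i))" by simp
  also have "\<dots> = (\<Sum>k\<in>UNIV. \<Sum>i\<in>I. integral {0..l} (\<lambda>x. \<bar>\<beta> k x\<bar> * (cmod (e i x $ k))\<^sup>2))"
    unfolding norm_H_sq_def by (rule sum.swap)
  also have "\<dots> \<le> of_nat (card (UNIV :: 'n set)) * (l * (B * K\<^sup>2))"
  proof (rule sum_bounded_above)
    fix k :: 'n
    have "(\<Sum>i\<in>I. integral {0..l} (\<lambda>x. \<bar>\<beta> k x\<bar> * (cmod (e i x $ k))\<^sup>2))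
        = integral {0..l} (\<lambda>x. \<Sum>i\<in>I. \<bar>\<beta> k x\<bar> * (cmod (e i x $ k))\<^sup>2)"
      by (rule Henstock_Kurzweil_Integration.integral_sum[symmetric, OF I]) (intro sq_integrable ce)
    also have "\<dots> \<le> integral {0..l} (\<lambda>x. B * K\<^sup>2)"
    proof (rule integral_le)
      show "(\<lambda>x. \<Sum>i\<in>I. \<bar>\<beta> k x\<bar> * (cmod (e i x $ k))\<^sup>2) integrable_on {0..l}"
        by (intro integrable_sum I sq_integrable ce)
      fix x assume x: "x \<in> {0..l}"
      show "(\<Sum>i\<in>I. \<bar>\<beta> k x\<bar> * (cmod (e i x $ k))\<^sup>2) \<le> B * K\<^sup>2"
        unfolding sum_distrib_left[symmetric] using beta_hi[OF x, of k] B0 pt[OF x, of k]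
        by (intro mult_mono) (auto intro: sum_nonneg)
    qed auto
    also have "\<dots> = l * (B * K\<^sup>2)" using l by simp
    finally show "(\<Sum>i\<in>I. integral {0..l} (\<lambda>x. \<bar>\<beta> k x\<bar> * (cmod (e i x $ k))\<^sup>2)) \<le> l * (B * K\<^sup>2)" .
  qed
  finally show ?thesis by simp
qed

text \<open>Pythagoras: every difference is the residual r plus an element s of the span, which is
  orthogonal to r, so its norm is at least that of r.\<close>

lemma distance_positive:
  assumes I: "finite I" and m: "m \<notin> I" and ct: "\<And>i. i \<in> insert m I \<Longrightarrow> cont (f i)" and ind: "indep (insert m I) f"
  shows "\<exists>\<delta>>0. \<forall>c. \<delta> \<le> norm_H (\<lambda>x. f m x - (\<Sum>i\<in>I. c i *s f i x))"
proof -
  have indI: "indep I f" using indep_mono[OF _ _ ind] I by blast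
  obtain e where e1: "\<And>i. i \<in> I \<Longrightarrow> e i \<in> fspan I f" "\<And>i. i \<in> I \<Longrightarrow> f i \<in> fspan I e"
    and e2: "\<And>i j. i \<in> I \<Longrightarrow> j \<in> I \<Longrightarrow> inner_H (e i) (e j) = (if i = j then 1 else 0)"
    using gram_schmidt[OF I _ indI] ct by blast
  obtain r p where r: "p \<in> fspan I e" "p \<in> fspan I f" "r = (\<lambda>x. f m x - p x)" "cont r"
    "\<And>j. j \<in> I \<Longrightarrow> inner_H r (e j) = 0" "0 < norm_H_sq r"
    using orthogonal_residual[OF I m ct ind e1(1) e2] by blast
  have ce: "cont (e i)" if "i \<in> I" for i
    using cont_fspan[OF _ e1(1)[OF that]] ct by blast
  have "norm_H r \<le> norm_H (\<lambda>x. f m x - (\<Sum>i\<in>I. c i *s f i x))" for c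
  proof -
    define s where "s = (\<lambda>x. p x + (-1) *s (\<Sum>i\<in>I. c i *s f i x))"
    have "s \<in> fspan I e"
      unfolding s_def by (intro fspan_add fspan_smult r(1) fspan_sum[OF I e1(2)])
    then obtain d where d: "s = (\<lambda>x. \<Sum>i\<in>I. d i *s e i x)" by (rule fspanE)
    have cs: "cont s" unfolding d using ce by (intro continuous_on_sum continuous_smult_fun)
    have rs: "inner_H r s = 0" unfolding d using r(5) by (simp add: inner_H_sum_right[OF I ce r(4)])
    have eq: "(\<lambda>x. f m x - (\<Sum>i\<in>I. c i *s f i x)) = (\<lambda>x. r x + s x)"
      by (simp add: r(3) s_def fun_eq_iff vec_eq_iff)
    have crs: "cont (\<lambda>x. r x + s x)" using r(4) cs by (rule continuous_on_add)
    have "inner_H (\<lambda>x. r x + s x) (\<lambda>x. r x + s x) = cnj (inner_H (\<lambda>x. r x + s x) r) + cnj (inner_H (\<lambda>x. r x + s x) s)"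
      unfolding inner_H_add_left[OF r(4) cs crs] inner_H_commute[of r "\<lambda>x. r x + s x"] inner_H_commute[of s "\<lambda>x. r x + s x"] ..
    also have "\<dots> = of_real (norm_H_sq r + norm_H_sq s)"
      unfolding inner_H_add_left[OF r(4) cs r(4)] inner_H_add_left[OF r(4) cs cs] rs inner_H_commute[of s r]
      by (simp add: inner_H_self[OF r(4)] inner_H_self[OF cs])
    finally have "norm_H_sq (\<lambda>x. r x + s x) = norm_H_sq r + norm_H_sq s" unfolding inner_H_self[OF crs] by (simp only: of_real_eq_iff)
    then show ?thesis unfolding eq norm_H_def using norm_H_sq_nonneg[OF cs] by simp
  qed
  moreover have "0 < norm_H r" using r(6) by (simp add: norm_H_def)
  ultimately show ?thesis by blast
qed

end

section \<open>Riesz projections\<close>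

lemma winding_number_circlepath_outside:
  assumes "0 < r" "r < cmod (w - z)"
  shows "winding_number (circlepath z r) w = 0"
proof (rule winding_number_zero_outside)
  show "w \<notin> cball z r" using assms by (simp add: dist_norm norm_minus_commute)
  show "path_image (circlepath z r) \<subseteq> cball z r" using assms by auto
qed simp_all

lemma path_image_circlepath_iff: "0 < r \<Longrightarrow> w \<in> path_image (circlepath z r) \<longleftrightarrow> cmod (w - z) = r"
  by (simp add: dist_norm norm_minus_commute)

context bvp begin

text \<open>Downwards along the chain: each member solves the equation whose right-hand side is the
  next member, already known to vanish, so uniqueness applies.\<close>

lemma root_function_zero:
  assumes f: "root_function lam f" and uniq: "\<And>y x. solves lam y (\<lambda>_. 0) \<Longrightarrow> x \<in> {0..l} \<Longrightarrow> y x = 0"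
    and x: "x \<in> {0..l}"
  shows "f x = 0"
proof -
  obtain p \<psi> where p: "\<And>j. j < p \<Longrightarrow> solves lam (\<psi> j) (\<psi> (Suc j))" "\<psi> p = (\<lambda>_. 0)" "f = \<psi> 0"
    using f unfolding root_function_def by blast
  have "\<forall>x\<in>{0..l}. \<psi> (p - q) x = 0" if "q \<le> p" for q
    using that
  proof (induction q)
    case 0
    show ?case using p(2) by simp
  next
    case (Suc q)
    let ?j = "p - Suc q"
    have j: "?j < p" "Suc ?j = p - q" using Suc.prems by auto
    have z: "\<psi> (Suc ?j) x = 0" if "x \<in> {0..l}" for x using Suc that unfolding j(2) by simp
    have s: "solves lam (\<psi> ?j) (\<psi> (Suc ?j))" by (rule p(1)[OF j(1)])
    \<comment> \<open>The next member is known to vanish on \<open>{0..l}\<close> only, so it is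
      replaced by the zero function before uniqueness is invoked.\<close>
    have "AC_with_deriv l (\<psi> ?j) (\<lambda>x. (\<chi> k. \<i> * of_real (\<beta> k x) * (lam * \<psi> ?j x $ k + (0::complex^'n) $ k)) - Q x *v \<psi> ?j x)"
    proof (rule AC_with_deriv_cong[OF conjunct1[OF s[unfolded solves_def]] l0])
      fix x assume "x \<in> {0..l}"
      then show "(\<chi> k. \<i> * of_real (\<beta> k x) * (lam * \<psi> ?j x $ k + \<psi> (Suc ?j) x $ k)) - Q x *v \<psi> ?j x
          = (\<chi> k. \<i> * of_real (\<beta> k x) * (lam * \<psi> ?j x $ k + (0::complex^'n) $ k)) - Q x *v \<psi> ?j x"
        using z by simp
    qed simp
    then have "solves lam (\<psi> ?j) (\<lambda>_. 0)" using s unfolding solves_def by simp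
    then show ?case using uniq by simp
  qed
  from this[of p] show ?thesis using p(3) x by simp
qed

definition is_resolvent :: "'i set \<Rightarrow> ('i \<Rightarrow> complex) \<Rightarrow> ('i \<Rightarrow> real \<Rightarrow> complex^'n) \<Rightarrow> ('i \<Rightarrow> complex)
    \<Rightarrow> (complex \<Rightarrow> real \<Rightarrow> complex^'n) \<Rightarrow> bool" where
  "is_resolvent I ev f c Y \<longleftrightarrow>
    (\<forall>z. z \<notin> ev ` I \<longrightarrow> solves z (Y z) (\<lambda>x. \<Sum>i\<in>I. c i *s f i x)) \<and>
    (\<forall>x k. (\<lambda>z. Y z x $ k) holomorphic_on - ev ` I) \<and>
    (\<forall>\<gamma> x k. valid_path \<gamma> \<and> pathfinish \<gamma> = pathstart \<gamma> \<and> ev ` I \<inter> path_image \<gamma> = {} \<longrightarrow>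
       ((\<lambda>z. Y z x $ k) has_contour_integral (\<Sum>i\<in>I. c i * (- (2 * pi * \<i> * winding_number \<gamma> (ev i)) * f i x $ k))) \<gamma>)"

lemma is_resolventD:
  assumes "is_resolvent I ev f c Y"
  shows "z \<notin> ev ` I \<Longrightarrow> solves z (Y z) (\<lambda>x. \<Sum>i\<in>I. c i *s f i x)"
    "(\<lambda>z. Y z x $ k) holomorphic_on - ev ` I"
    "\<lbrakk>valid_path \<gamma>; pathfinish \<gamma> = pathstart \<gamma>; ev ` I \<inter> path_image \<gamma> = {}\<rbrakk> \<Longrightarrow>
       ((\<lambda>z. Y z x $ k) has_contour_integral (\<Sum>i\<in>I. c i * (- (2 * pi * \<i> * winding_number \<gamma> (ev i)) * f i x $ k))) \<gamma>"
  using assms unfolding is_resolvent_def by simp_all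

lemma resolvent_comb:
  fixes f :: "'i \<Rightarrow> real \<Rightarrow> complex^'n"
  assumes I: "finite I" and f: "\<And>i. i \<in> I \<Longrightarrow> root_function (ev i) (f i)"
  shows "\<exists>Y. is_resolvent I ev f c Y"
proof -
  have "\<forall>i\<in>I. \<exists>Y. (\<forall>z. z \<noteq> ev i \<longrightarrow> solves z (Y z) (f i)) \<and> (\<forall>x k. (\<lambda>z. Y z x $ k) holomorphic_on - {ev i}) \<and>
    (\<forall>\<gamma> x k. valid_path \<gamma> \<and> pathfinish \<gamma> = pathstart \<gamma> \<and> ev i \<notin> path_image \<gamma> \<longrightarrow>
       ((\<lambda>z. Y z x $ k) has_contour_integral - (2 * pi * \<i> * winding_number \<gamma> (ev i)) * f i x $ k) \<gamma>)"
  proof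
    fix i assume i: "i \<in> I"
    show "\<exists>Y. (\<forall>z. z \<noteq> ev i \<longrightarrow> solves z (Y z) (f i)) \<and> (\<forall>x k. (\<lambda>z. Y z x $ k) holomorphic_on - {ev i}) \<and>
      (\<forall>\<gamma> x k. valid_path \<gamma> \<and> pathfinish \<gamma> = pathstart \<gamma> \<and> ev i \<notin> path_image \<gamma> \<longrightarrow>
       ((\<lambda>z. Y z x $ k) has_contour_integral - (2 * pi * \<i> * winding_number \<gamma> (ev i)) * f i x $ k) \<gamma>)"
      by (rule root_function_resolvent[OF f[OF i]], rule exI, intro conjI allI impI) (assumption | elim conjE | simp)+
  qed
  from bchoice[OF this] obtain YY where YY: "\<forall>i\<in>I. (\<forall>z. z \<noteq> ev i \<longrightarrow> solves z (YY i z) (f i)) \<and> (\<forall>x k. (\<lambda>z. YY i z x $ k) holomorphic_on - {ev i}) \<and>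
    (\<forall>\<gamma> x k. valid_path \<gamma> \<and> pathfinish \<gamma> = pathstart \<gamma> \<and> ev i \<notin> path_image \<gamma> \<longrightarrow>
       ((\<lambda>z. YY i z x $ k) has_contour_integral - (2 * pi * \<i> * winding_number \<gamma> (ev i)) * f i x $ k) \<gamma>)"
    by (rule exE)
  have Y1: "solves z (YY i z) (f i)" if "i \<in> I" "z \<noteq> ev i" for i z using YY that by simp
  have Y2: "(\<lambda>z. YY i z x $ k) holomorphic_on - {ev i}" if "i \<in> I" for i x k using YY that by simp
  have Y3: "((\<lambda>z. YY i z x $ k) has_contour_integral - (2 * pi * \<i> * winding_number \<gamma> (ev i)) * f i x $ k) \<gamma>"
    if "i \<in> I" "valid_path \<gamma>" "pathfinish \<gamma> = pathstart \<gamma>" "ev i \<notin> path_image \<gamma>" for i \<gamma> x k using YY that by simp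
  define Y where "Y = (\<lambda>z x. \<Sum>i\<in>I. c i *s YY i z x)"
  have comp: "(\<lambda>z. Y z x $ k) = (\<lambda>z. \<Sum>i\<in>I. c i * YY i z x $ k)" for x k
    by (simp add: Y_def sum_component)
  show ?thesis
    unfolding is_resolvent_def
  proof (intro exI[of _ Y] conjI allI impI)
    fix z assume "z \<notin> ev ` I"
    then show "solves z (Y z) (\<lambda>x. \<Sum>i\<in>I. c i *s f i x)"
      unfolding Y_def by (intro solves_sum I Y1) auto
  next
    fix x k
    show "(\<lambda>z. Y z x $ k) holomorphic_on - ev ` I"
      unfolding comp by (intro holomorphic_intros holomorphic_on_subset[OF Y2]) auto
  next
    fix \<gamma> x k assume g: "valid_path \<gamma> \<and> pathfinish \<gamma> = pathstart \<gamma> \<and> ev ` I \<inter> path_image \<gamma> = {}"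
    show "((\<lambda>z. Y z x $ k) has_contour_integral (\<Sum>i\<in>I. c i * (- (2 * pi * \<i> * winding_number \<gamma> (ev i)) * f i x $ k))) \<gamma>"
      unfolding comp using g by (intro has_contour_integral_sum I has_contour_integral_lmul Y3) auto
  qed
qed

text \<open>The contour integral of the resolvent of the combination is
  \<open>- (2 * pi * \<i>)\<close> times the part belonging to S. Subtracting a function a with
  vanishing integral leaves only the distance of the resolvent from a to be bounded. Both a = 0 and
  a equal to the model, when its integral is known to vanish, are used.\<close>

lemma riesz_bound:
  fixes f :: "'i \<Rightarrow> real \<Rightarrow> complex^'n"
  assumes I: "finite I" and f: "\<And>i. i \<in> I \<Longrightarrow> root_function (ev i) (f i)"
    and \<gamma>: "valid_path \<gamma>" "pathfinish \<gamma> = pathstart \<gamma>" "\<And>i. i \<in> I \<Longrightarrow> ev i \<notin> path_image \<gamma>"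
    and wn: "\<And>i. i \<in> I \<Longrightarrow> winding_number \<gamma> (ev i) = (if i \<in> S then 1 else 0)"
    and M: "contour_bound \<gamma> M" and x: "x \<in> {0..l}"
    and apr: "\<And>z y. z \<in> path_image \<gamma> \<Longrightarrow> solves z y (\<lambda>x. \<Sum>i\<in>I. c i *s f i x) \<Longrightarrow> norm (y x - a z) \<le> b"
    and a: "\<And>k. ((\<lambda>z. a z $ k) has_contour_integral 0) \<gamma>"
  shows "norm (\<Sum>i\<in>I \<inter> S. c i *s f i x) \<le> real CARD('n) * (M * b)"
proof -
  define h where "h = (\<lambda>x. \<Sum>i\<in>I. c i *s f i x)"
  obtain Y where Y: "is_resolvent I ev f c Y" using resolvent_comb[OF I f, where c=c] by (rule exE)
  note Y = is_resolventD[OF Y, folded h_def]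
  have disj: "ev ` I \<inter> path_image \<gamma> = {}" using \<gamma>(3) by auto
  have "cmod ((\<Sum>i\<in>I \<inter> S. c i *s f i x) $ k) \<le> M * b" for k
  proof -
    define v where "v = (\<Sum>i\<in>I \<inter> S. c i *s f i x) $ k"
    have "(\<Sum>i\<in>I. c i * (- (2 * pi * \<i> * winding_number \<gamma> (ev i)) * f i x $ k)) = (\<Sum>i\<in>I \<inter> S. - (2 * pi * \<i>) * (c i * f i x $ k))"
      using I wn by (intro sum.mono_neutral_cong_right) auto
    also have "\<dots> = - (2 * pi * \<i>) * v" by (simp only: v_def sum_distrib_left sum_component vector_smult_component)
    finally have "((\<lambda>z. Y z x $ k) has_contour_integral - (2 * pi * \<i>) * v) \<gamma>"
      using Y(3)[OF \<gamma>(1,2) disj, of x k] by simp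
    from has_contour_integral_diff[OF this a[of k]]
    have hi: "((\<lambda>z. Y z x $ k - a z $ k) has_contour_integral - (2 * pi * \<i>) * v) \<gamma>" by simp
    have "cmod (Y z x $ k - a z $ k) \<le> b" if z: "z \<in> path_image \<gamma>" for z
    proof -
      have "z \<notin> ev ` I" using disj z by blast
      then have "norm (Y z x - a z) \<le> b" by (intro apr[OF z] Y(1)[unfolded h_def])
      then show ?thesis using Finite_Cartesian_Product.norm_nth_le[of "Y z x - a z" k] by simp
    qed
    then have "cmod (- (2 * pi * \<i>) * v) \<le> M * b"
      using M[unfolded contour_bound_def, rule_format, OF hi, of b] by simp
    then have "2 * pi * cmod v \<le> M * b" by (simp add: norm_mult)
    \<comment> \<open>The factor \<open>2 * pi\<close> exceeds one and is given away.\<close>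
    moreover have "1 * cmod v \<le> (2 * pi) * cmod v"
      using pi_gt3 by (intro mult_right_mono) auto
    ultimately show ?thesis by (simp add: v_def)
  qed
  then show ?thesis by (rule norm_vec_le_const)
qed

text \<open>For a vanishing combination the a priori estimate has right-hand side of L1 norm zero,
  so the resolvent of the combination vanishes far from the real axis, hence everywhere off the
  eigenvalues by continuation. Contours around single eigenvalues then isolate the parts, which are
  independent by hypothesis.\<close>

lemma indep_of_distinct_eigenvalues:
  fixes f :: "'i \<Rightarrow> real \<Rightarrow> complex^'n"
  assumes I: "finite I" and f: "\<And>i. i \<in> I \<Longrightarrow> root_function (ev i) (f i)"
    and ind: "\<And>lam. indep {i \<in> I. ev i = lam} f"
    and apr: "\<And>lam y g x. \<lbrakk>T \<le> \<bar>Im lam\<bar>; continuous_on {0..l} g; solves lam y g; x \<in> {0..l}\<rbrakk> \<Longrightarrow> norm (y x) \<le> K * L1 g"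
  shows "indep I f"
  unfolding indep_def
proof (intro allI impI)
  fix c assume c0: "\<forall>x\<in>{0..l}. (\<Sum>i\<in>I. c i *s f i x) = 0"
  define h where "h = (\<lambda>x. \<Sum>i\<in>I. c i *s f i x)"
  have ch: "cont h" unfolding h_def by (intro continuous_on_sum continuous_smult_fun root_function_continuous[OF f])
  have "L1 h = integral {0..l} (\<lambda>t. 0)" unfolding L1_def
    by (rule Henstock_Kurzweil_Integration.integral_cong) (simp add: h_def c0)
  then have L: "L1 h = 0" by simp
  obtain Y where Y: "is_resolvent I ev f c Y" using resolvent_comb[OF I f, where c=c] by (rule exE)
  note Y = is_resolventD[OF Y, folded h_def]
  \<comment> \<open>No eigenvalue of the family lies above height T1, so a whole half plane is
    available as a starting set for the continuation.\<close>
  define T1 where "T1 = Max (insert \<bar>T\<bar> ((\<lambda>i. \<bar>Im (ev i)\<bar>) ` I))"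
  have T1: "\<bar>T\<bar> \<le> T1" "\<And>i. i \<in> I \<Longrightarrow> \<bar>Im (ev i)\<bar> \<le> T1"
    unfolding T1_def using I by (auto intro!: Max_ge)
  have U0: "Y z x $ k = 0" if x: "x \<in> {0..l}" and z: "T1 < Im z" for z x k
  proof -
    have "z \<notin> ev ` I" using T1(2) z by force
    then have "norm (Y z x) \<le> K * L1 h" using T1(1) z by (intro apr[OF _ ch Y(1) x]) auto
    then show ?thesis using L by simp
  qed
  have Y0: "Y z x $ k = 0" if x: "x \<in> {0..l}" and z: "z \<notin> ev ` I" for z x k
  proof (rule analytic_continuation_open[of "{z. T1 < Im z}" "- ev ` I" "\<lambda>z. Y z x $ k" "\<lambda>_. 0"])
    show "open {z. T1 < Im z}" by (rule open_halfspace_Im_gt)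
    show "open (- ev ` I)" using I by (intro open_Compl finite_imp_closed finite_imageI)
    have "Complex 0 (T1 + 1) \<in> {z. T1 < Im z}" by simp
    then show "{z. T1 < Im z} \<noteq> {}" by blast
    show "connected (- ev ` I)"
      using connected_open_delete_finite[OF open_UNIV connected_UNIV _ finite_imageI[OF I], of ev]
      by (simp add: Compl_eq_Diff_UNIV)
    show "{z. T1 < Im z} \<subseteq> - ev ` I" using T1(2) by force
    show "z \<in> - ev ` I" using z by simp
  qed (use U0[OF x] Y(2) in simp_all)
  show "\<forall>i\<in>I. c i = 0"
  proof
    fix j assume j: "j \<in> I"
    obtain d where d: "d > 0" "\<And>w. w \<in> ev ` I \<Longrightarrow> w \<noteq> ev j \<Longrightarrow> d \<le> dist (ev j) w"
      using finite_set_avoid[of "ev ` I" "ev j"] I by auto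
    define \<gamma> where "\<gamma> = circlepath (ev j) (d / 2)"
    have vg: "valid_path \<gamma>" "pathfinish \<gamma> = pathstart \<gamma>" by (simp_all add: \<gamma>_def)
    have off: "d \<le> cmod (ev i - ev j)" if "i \<in> I" "ev i \<noteq> ev j" for i
      using d(2)[of "ev i"] that by (simp add: dist_norm norm_minus_commute)
    have disj: "ev ` I \<inter> path_image \<gamma> = {}"
    proof -
      have "ev i \<notin> path_image \<gamma>" if "i \<in> I" for i
      proof -
        have "cmod (ev i - ev j) \<noteq> d / 2" using off[OF that] d(1) by (cases "ev i = ev j") auto
        then show ?thesis using path_image_circlepath_iff[of "d / 2" "ev i" "ev j"] d(1) by (simp add: \<gamma>_def)
      qed
      then show ?thesis by auto
    qed
    define w where "w = (\<lambda>i. winding_number \<gamma> (ev i))"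
    have wn: "w i = (if ev i = ev j then 1 else 0)" if "i \<in> I" for i
    proof (cases "ev i = ev j")
      case True
      then show ?thesis using d(1) by (simp add: w_def \<gamma>_def winding_number_circlepath_centre)
    next
      case False
      then show ?thesis using off[OF that] d(1) by (simp add: w_def \<gamma>_def winding_number_circlepath_outside)
    qed
    have "(\<Sum>i\<in>{i \<in> I. ev i = ev j}. c i *s f i x) = 0" if x: "x \<in> {0..l}" for x
    proof -
      have "(\<Sum>i\<in>{i \<in> I. ev i = ev j}. c i *s f i x) $ k = 0" for k
      proof -
        have "((\<lambda>z. Y z x $ k) has_contour_integral 0) \<gamma>"
          by (rule has_contour_integral_is_0) (use Y0[OF x] disj in auto)
        then have "(\<Sum>i\<in>I. c i * (- (2 * pi * \<i> * w i) * f i x $ k)) = 0"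
          unfolding w_def by (rule has_contour_integral_unique[OF Y(3)[OF vg disj, of x k]])
        moreover have "(\<Sum>i\<in>I. c i * (- (2 * pi * \<i> * w i) * f i x $ k))
            = (\<Sum>i\<in>{i \<in> I. ev i = ev j}. - (2 * pi * \<i>) * (c i * f i x $ k))"
          using I wn by (intro sum.mono_neutral_cong_right) auto
        moreover have "\<dots> = - (2 * pi * \<i>) * (\<Sum>i\<in>{i \<in> I. ev i = ev j}. c i * f i x $ k)"
          by (rule sum_distrib_left[symmetric])
        ultimately have "- (2 * pi * \<i>) * (\<Sum>i\<in>{i \<in> I. ev i = ev j}. c i * f i x $ k) = 0" by (simp only:)
        then have "(\<Sum>i\<in>{i \<in> I. ev i = ev j}. c i * f i x $ k) = 0" by simp
        then show ?thesis by (simp only: sum_component vector_smult_component)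
      qed
      then show ?thesis by (simp add: vec_eq_iff)
    qed
    then show "c j = 0" using ind[of "ev j", unfolded indep_def, rule_format, of c j] j by simp
  qed
qed

lemma boundary_rhs_comb:
  assumes "cont f1" "cont f2"
  shows "boundary_rhs lam (\<lambda>x. c1 *s f1 x + c2 *s f2 x) = c1 *s boundary_rhs lam f1 + c2 *s boundary_rhs lam f2"
proof -
  interpret mv: bounded_bilinear "\<lambda>(A::complex^'n^'n) x. A *v x" by (rule bounded_bilinear_matrix_vector)
  have ll: "l \<in> {0..l}" using l by simp
  have hi: "(forcing lam f has_integral F lam f l) {0..l}" if "cont f" for f
    unfolding F_def by (intro integrable_integral AC_with_derivD(2)[OF F_AC[OF that]])
  have hs: "((\<lambda>x. c *s forcing lam f x) has_integral c *s F lam f l) {0..l}" if "cont f" for c f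
    using has_integral_linear[OF hi[OF that] bounded_linear_vsmult, of c] by (simp add: o_def)
  have "forcing lam (\<lambda>x. c1 *s f1 x + c2 *s f2 x) = (\<lambda>x. c1 *s forcing lam f1 x + c2 *s forcing lam f2 x)"
    unfolding forcing_def by (simp add: fun_eq_iff vec_eq_iff matrix_vector_mult_def sum_distrib_left sum.distrib[symmetric] algebra_simps)
  then have "F lam (\<lambda>x. c1 *s f1 x + c2 *s f2 x) l = c1 *s F lam f1 l + c2 *s F lam f2 l"
    unfolding F_def[of lam "\<lambda>x. c1 *s f1 x + c2 *s f2 x"]
    using integral_unique[OF has_integral_add[OF hs[OF assms(1), of c1] hs[OF assms(2), of c2]]] by simp
  then show ?thesis
    unfolding boundary_rhs_def by (simp only: mv.add_right matrix_vector_smult minus_add_distrib) (simp add: vec_eq_iff)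
qed

lemma L1_le_sup:
  assumes "cont h" "\<And>x. x \<in> {0..l} \<Longrightarrow> norm (h x) \<le> K"
  shows "L1 h \<le> l * K"
proof -
  have "L1 h \<le> integral {0..l} (\<lambda>x. K)"
    unfolding L1_def by (rule integral_le[OF cnorm_integrable[OF assms(1)]]) (use assms(2) in auto)
  then show ?thesis using l by simp
qed

end

section \<open>Uniform minimality for continuous root functions\<close>

lemma finite_positive_lower_bound:
  fixes g :: "'a \<Rightarrow> real"
  assumes "finite A" "\<And>a. a \<in> A \<Longrightarrow> 0 < g a"
  shows "\<exists>d>0. \<forall>a\<in>A. d \<le> g a"
proof (intro exI conjI ballI)
  show "0 < Min (insert 1 (g ` A))" using assms by simp
  fix a assume "a \<in> A"
  then show "Min (insert 1 (g ` A)) \<le> g a" using assms(1) by (intro Min_le) auto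
qed

context bvp begin

text \<open>Two root vectors cannot belong to the same small disc around a simple zero: a nontrivial
  combination of them would be annihilated by the rank one principal part of the resolvent.\<close>
lemma two_root_vectors_in_disc:
  fixes f :: "'i \<Rightarrow> real \<Rightarrow> complex^'n"
  assumes mi: "m \<noteq> i" and root: "root_function (ev m) (f m)" "root_function (ev i) (f i)" and ind: "indep {m, i} f"
    and d: "0 < \<delta>" and zero: "D0 \<mu> = 0" "deriv D0 \<mu> \<noteq> 0" "\<And>z. D0 z = 0 \<Longrightarrow> z \<noteq> \<mu> \<Longrightarrow> \<delta> < cmod (z - \<mu>)"
    and disc: "cmod (ev m - \<mu>) < \<delta>" "cmod (ev i - \<mu>) < \<delta>"
    and apr: "\<And>z y g x. \<lbrakk>cmod (z - \<mu>) = \<delta>; cont g; solves z y g; x \<in> {0..l}\<rbrakk> \<Longrightarrow> norm (y x - model z g x) \<le> \<eta> * L1 g"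
    and small: "l * (real CARD('n) * (2 * pi * \<delta> * \<eta>)) < 1"
  shows False
proof -
  have "det (transpose (A0 \<mu>)) = 0" using zero(1) by (simp add: D0_eq)
  then obtain p where p: "p \<noteq> 0" "transpose (A0 \<mu>) *v p = 0" using det_eq_0_iff_kernel by blast
  \<comment> \<open>By \<open>cramer_vec_eq_0\<close> the Cramer vector at \<mu> vanishes for every
    right-hand side in the kernel of L.\<close>
  define L where "L g = (\<Sum>j\<in>UNIV. boundary_rhs \<mu> g $ j * p $ j)" for g
  \<comment> \<open>On the plane of combinations of the two vectors L has a kernel; the case
    distinction keeps the coefficients nontrivial when L vanishes on both.\<close>
  define c where "c = (\<lambda>j. if L (f m) = 0 \<and> L (f i) = 0 then if j = m then 1 else 0 else if j = m then L (f i) else - L (f m))"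
  have cnz: "c m \<noteq> 0 \<or> c i \<noteq> 0" using mi by (simp add: c_def)
  have cm: "cont (f m)" and ci: "cont (f i)" using root by (auto intro: root_function_continuous)
  define h where "h = (\<lambda>x. c m *s f m x + c i *s f i x)"
  have hsum: "h = (\<lambda>x. \<Sum>j\<in>{m, i}. c j *s f j x)" using mi by (simp add: h_def)
  have ch: "cont h" unfolding h_def using cm ci by (intro continuous_on_add continuous_smult_fun)
  have "L h = c m * L (f m) + c i * L (f i)"
    unfolding L_def h_def boundary_rhs_comb[OF cm ci]
    by (simp add: distrib_right sum.distrib sum_distrib_left mult.assoc)
  then have "L h = 0" using mi by (simp add: c_def)
  then have cr: "cramer_vec (A0 \<mu>) (boundary_rhs \<mu> h) = 0" unfolding L_def by (rule cramer_vec_eq_0[OF p])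
  have hx: "norm (h x) \<le> real CARD('n) * (2 * pi * \<delta> * (\<eta> * L1 h))" if x: "x \<in> {0..l}" for x
  proof -
    have "norm (\<Sum>j\<in>{m, i} \<inter> UNIV. c j *s f j x) \<le> real CARD('n) * ((2 * pi * \<delta>) * (\<eta> * L1 h))"
    proof (rule riesz_bound[where \<gamma>="circlepath \<mu> \<delta>" and a="\<lambda>z. model z h x" and ev=ev])
      show "contour_bound (circlepath \<mu> \<delta>) (2 * pi * \<delta>)" by (rule contour_bound_circlepath[OF d])
      show "((\<lambda>z. model z h x $ k) has_contour_integral 0) (circlepath \<mu> \<delta>)" for k
        by (rule model_contour_integral_0[OF ch x d zero cr])
    next
      fix j assume j: "j \<in> {m, i}"
      then have dj: "cmod (ev j - \<mu>) < \<delta>" using disc by auto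
      show "root_function (ev j) (f j)" using j root by auto
      show "ev j \<notin> path_image (circlepath \<mu> \<delta>)" using dj d path_image_circlepath_iff[of \<delta> "ev j" \<mu>] by simp
      show "winding_number (circlepath \<mu> \<delta>) (ev j) = (if j \<in> UNIV then 1 else 0)"
        using winding_number_circlepath[OF dj] by simp
    next
      fix z y assume z: "z \<in> path_image (circlepath \<mu> \<delta>)" and y: "solves z y (\<lambda>x. \<Sum>j\<in>{m, i}. c j *s f j x)"
      have "cmod (z - \<mu>) = \<delta>" using z d path_image_circlepath_iff[of \<delta> z \<mu>] by simp
      then show "norm (y x - model z h x) \<le> \<eta> * L1 h" using y unfolding hsum[symmetric] by (intro apr ch x)
    qed (use x in simp_all)
    then show ?thesis using mi by (simp add: h_def)
  qed
  have "L1 h \<le> l * (real CARD('n) * (2 * pi * \<delta> * (\<eta> * L1 h)))" by (rule L1_le_sup[OF ch hx])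
  also have "\<dots> = (l * (real CARD('n) * (2 * pi * \<delta> * \<eta>))) * L1 h" by (simp only: mult_ac)
  finally have le: "L1 h \<le> (l * (real CARD('n) * (2 * pi * \<delta> * \<eta>))) * L1 h" .
  have "L1 h = 0"
  proof (rule ccontr)
    assume "L1 h \<noteq> 0"
    then have "0 < L1 h" using L1_nonneg[OF ch] by simp
    then have "(l * (real CARD('n) * (2 * pi * \<delta> * \<eta>))) * L1 h < 1 * L1 h" using small by (intro mult_strict_right_mono)
    then show False using le by simp
  qed
  then have "\<forall>x\<in>{0..l}. (\<Sum>j\<in>{m, i}. c j *s f j x) = 0"
    using L1_zero[OF ch] unfolding hsum by simp
  then have "\<forall>j\<in>{m, i}. c j = 0" using ind unfolding indep_def by simp
  then show False using cnz by simp
qed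

lemma norm_H_smult: "norm_H (\<lambda>x. c *s f x) = cmod c * norm_H f"
proof -
  have "norm_H_sq (\<lambda>x. c *s f x) = (cmod c)\<^sup>2 * norm_H_sq f"
    unfolding norm_H_sq_def sum_distrib_left integral_mult_right[symmetric]
    by (simp add: norm_mult power_mult_distrib mult_ac)
  then show ?thesis by (simp add: norm_H_def real_sqrt_mult)
qed

lemma insert_comb:
  fixes f :: "'i \<Rightarrow> real \<Rightarrow> complex^'n"
  assumes "finite I" "m \<notin> I"
  shows "(\<Sum>i\<in>insert m I. (if i = m then 1 else - c i) *s f i x) = f m x - (\<Sum>i\<in>I. c i *s f i x)"
proof -
  have "(\<Sum>i\<in>I. (if i = m then 1 else - c i) *s f i x) = (\<Sum>i\<in>I. - (c i *s f i x))"
    using assms(2) by (intro sum.cong refl) (auto simp: vec_eq_iff)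
  then show ?thesis using assms by (simp add: sum_negf)
qed

text \<open>Each root vector is estimated through a contour made of points called good, where the a
  priori bound holds. At such points the homogeneous problem has only the zero solution, so no
  eigenvalue is good. Hence every eigenvalue lies either in the central rectangle or within \<delta>
  of a distant zero of \<open>D0\<close>.\<close>

theorem core_uniform_minimality:
  fixes f :: "'i \<Rightarrow> real \<Rightarrow> complex^'n"
  assumes det: "det (C ** proj_on pos_idx + D ** W l ** proj_on (- pos_idx)) \<noteq> 0" "det (C ** proj_on (- pos_idx) + D ** W l ** proj_on pos_idx) \<noteq> 0"
    and sep: "zeros_asympt_separated D0"
    and root: "\<And>i. root_function (ev i) (f i)"
    and ind: "\<And>I lam. finite I \<Longrightarrow> I \<subseteq> {i. ev i = lam} \<Longrightarrow> indep I f"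
  shows "\<exists>\<delta>>0. \<forall>m I c. finite I \<and> m \<notin> I \<longrightarrow> \<delta> * norm_H (f m) \<le> norm_H (\<lambda>x. f m x - (\<Sum>i\<in>I. c i *s f i x))"
proof -
  define n where "n = real CARD('n)"
  have n: "0 < n" by (simp add: n_def)
  obtain T K1 where T: "T > 0" and K1: "K1 > 0"
    "\<And>lam y g x. \<lbrakk>T \<le> \<bar>Im lam\<bar>; continuous_on {0..l} g; solves lam y g; x \<in> {0..l}\<rbrakk> \<Longrightarrow> norm (y x) \<le> K1 * L1 g"
    using large_Im[OF det] by blast
  obtain \<delta> R0 where d: "\<delta> > 0"
    and zsep: "\<And>z w. \<lbrakk>D0 z = 0; D0 w = 0; z \<noteq> w; R0 \<le> \<bar>Re z\<bar>\<rbrakk> \<Longrightarrow> 2 * \<delta> \<le> cmod (z - w)"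
    and simple: "\<And>z. \<lbrakk>D0 z = 0; R0 \<le> \<bar>Re z\<bar>\<rbrakk> \<Longrightarrow> deriv D0 z \<noteq> 0"
  proof (rule D0_zeros_separated[OF det(1) sep])
    fix R \<delta>
    assume a: "0 < \<delta>" "\<And>z w. \<lbrakk>D0 z = 0; D0 w = 0; z \<noteq> w; R \<le> \<bar>Re z\<bar>\<rbrakk> \<Longrightarrow> 2 * \<delta> \<le> cmod (z - w)"
      "\<And>z. \<lbrakk>D0 z = 0; R \<le> \<bar>Re z\<bar>\<rbrakk> \<Longrightarrow> deriv D0 z \<noteq> 0"
    show thesis using a by (rule that)
  qed
  \<comment> \<open>A circle of radius \<delta> about a zero that is within \<delta> of an
    eigenvalue, itself at height below T, stays in the strip of height H.\<close>
  define H where "H = T + 2 * \<delta>"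
  have H: "0 \<le> H" "T \<le> H" "T + \<delta> \<le> H" using T d by (simp_all add: H_def)
  obtain ca where ca: "ca > 0" "\<And>lam. \<lbrakk>\<bar>Im lam\<bar> \<le> H; \<And>z. D0 z = 0 \<Longrightarrow> \<delta> \<le> cmod (lam - z)\<rbrakk> \<Longrightarrow> ca \<le> cmod (D0 lam)"
    using D0_lower_bound_off_zeros[OF det(1) d, of H] by blast
  obtain cb where cb: "cb > 0" "\<And>R. \<exists>x\<in>{R..R+1}. \<forall>\<tau>. \<bar>\<tau>\<bar> \<le> H \<longrightarrow> cb \<le> cmod (D0 (Complex x \<tau>))"
    using D0_lower_bound_segments[OF det(1) H(1)] by blast
  define c0 where "c0 = min ca cb"
  have c0: "c0 > 0" "c0 \<le> ca" "c0 \<le> cb" using ca cb by (simp_all add: c0_def)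
  obtain K2 where K2: "K2 > 0" "\<And>lam g x. \<lbrakk>\<bar>Im lam\<bar> \<le> H; continuous_on {0..l} g; c0 \<le> cmod (D0 lam); x \<in> {0..l}\<rbrakk>
     \<Longrightarrow> norm (model lam g x) \<le> K2 * L1 g"
    using model_bound[OF c0(1), of H] by blast
  \<comment> \<open>Makes the model error, integrated around a circle of radius \<delta>, return at
    most half of the L1 norm of the combination; this excludes two root vectors in one disc.\<close>
  define \<eta> where "\<eta> = 1 / (2 * (l * (n * (2 * pi * \<delta>))))"
  have eta: "\<eta> > 0" unfolding \<eta>_def using l n d by simp
  have "l * (n * (2 * pi * \<delta> * \<eta>)) = (l * (n * (2 * pi * \<delta>))) * \<eta>" by (simp only: mult_ac)
  also have "\<dots> = 1 / 2" unfolding \<eta>_def using l n d by simp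
  finally have small: "l * (n * (2 * pi * \<delta> * \<eta>)) < 1" by simp
  obtain R1 where R1: "\<And>lam y g x. \<lbrakk>\<bar>Im lam\<bar> \<le> H; R1 \<le> cmod lam; continuous_on {0..l} g; solves lam y g;
      c0 \<le> cmod (D0 lam); x \<in> {0..l}\<rbrakk> \<Longrightarrow> norm (y x - model lam g x) \<le> \<eta> * L1 g"
    using strip_good_set[OF c0(1) eta, of H] by blast
  define K where "K = K1 + K2 + \<eta>"
  have K: "K > 0" using K1(1) K2(1) eta by (simp add: K_def)
  define good where "good z \<longleftrightarrow> T \<le> \<bar>Im z\<bar> \<or> \<bar>Im z\<bar> \<le> H \<and> R1 \<le> cmod z \<and> c0 \<le> cmod (D0 z)" for z
  have apr: "norm (y x) \<le> K * L1 g" if z: "good z" and g: "cont g" and y: "solves z y g" and x: "x \<in> {0..l}" for z y g x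
  proof -
    have L: "0 \<le> L1 g" by (rule L1_nonneg[OF g])
    have "norm (y x) \<le> K1 * L1 g \<or> norm (y x) \<le> (K2 + \<eta>) * L1 g"
      using z unfolding good_def
    proof
      assume "T \<le> \<bar>Im z\<bar>"
      then show ?thesis using K1(2)[OF _ g y x] by blast
    next
      assume a: "\<bar>Im z\<bar> \<le> H \<and> R1 \<le> cmod z \<and> c0 \<le> cmod (D0 z)"
      have "norm (y x - model z g x) \<le> \<eta> * L1 g" using a by (intro R1[OF _ _ g y _ x]) auto
      moreover have "norm (model z g x) \<le> K2 * L1 g" using a by (intro K2(2)[OF _ g _ x]) auto
      ultimately have "norm (y x) \<le> K2 * L1 g + \<eta> * L1 g"
        using norm_triangle_ineq[of "y x - model z g x" "model z g x"] by simp
      then show ?thesis by (simp add: distrib_right)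
    qed
    moreover have "K1 * L1 g \<le> K * L1 g" "(K2 + \<eta>) * L1 g \<le> K * L1 g"
      using L K1(1) K2(1) eta by (intro mult_right_mono; simp add: K_def)+
    ultimately show ?thesis by linarith
  qed
  have fc: "cont (f i)" for i by (rule root_function_continuous[OF root[of i]])
  have ind_all: "indep I f" if "finite I" for I
  proof -
    have a: "indep {i \<in> I. ev i = lam} f" for lam
    proof (rule ind[of _ lam])
      show "finite {i \<in> I. ev i = lam}" by (rule rev_finite_subset[OF that Collect_restrict])
      show "{i \<in> I. ev i = lam} \<subseteq> {i. ev i = lam}" by auto
    qed
    show ?thesis
    proof (rule indep_of_distinct_eigenvalues[where ev=ev and T=T and K=K1 and f=f and I=I])
    qed (rule that, rule root, rule a, (rule K1(2); assumption))
  qed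
  have not_good: "\<not> good (ev i)" for i
  proof
    assume g: "good (ev i)"
    have "f i x = 0" if x: "x \<in> {0..l}" for x
    proof (rule root_function_zero[OF root _ x])
      fix y x assume y: "solves (ev i) y (\<lambda>_. 0)" and x: "x \<in> {0..l}"
      have "norm (y x) \<le> K * L1 (\<lambda>_. 0)" by (rule apr[OF g _ y x]) simp
      then show "y x = 0" by (simp add: L1_def)
    qed
    then have "\<forall>x\<in>{0..l}. (\<Sum>j\<in>{i}. 1 *s f j x) = 0" by simp
    then have "\<forall>j\<in>{i}. (1::complex) = 0"
      using ind_all[of "{i}", unfolded indep_def, THEN spec, of "\<lambda>_. 1"] by simp
    then show False by simp
  qed
  \<comment> \<open>For an eigenvalue beyond Rr, the nearby zero has real part at least R0 in
    modulus, and the whole circle around that zero has modulus at least R1.\<close>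
  define Rr where "Rr = max (\<bar>R0\<bar> + \<delta>) (\<bar>R1\<bar> + 2 * \<delta>)"
  have Rr: "R0 + \<delta> \<le> Rr" "R1 + 2 * \<delta> \<le> Rr" "0 < Rr" using d by (auto simp: Rr_def)
  obtain xp where xp: "Rr \<le> xp" "\<And>\<tau>. \<bar>\<tau>\<bar> \<le> H \<Longrightarrow> cb \<le> cmod (D0 (Complex xp \<tau>))"
    using cb(2)[of Rr] by auto
  obtain xm where xm: "xm \<le> - Rr" "\<And>\<tau>. \<bar>\<tau>\<bar> \<le> H \<Longrightarrow> cb \<le> cmod (D0 (Complex xm \<tau>))"
    using cb(2)[of "- Rr - 1"] by auto
  define a1 where "a1 = Complex xm (- H)"
  define a3 where "a3 = Complex xp H"
  \<comment> \<open>The horizontal sides lie at height H, which is at least T, where the imaginary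
    part gives the estimate; on the vertical sides at xm and xp it comes from the lower bound for
    \<open>D0\<close>.\<close>
  define \<Gamma> where "\<Gamma> = rectpath a1 a3"
  have ord: "Re a1 \<le> Re a3" "Im a1 \<le> Im a3" using xp(1) xm(1) Rr(3) H(1) by (simp_all add: a1_def a3_def)
  have vert: "good (Complex x \<tau>)" if "\<bar>\<tau>\<bar> \<le> H" "x = xm \<or> x = xp" for x \<tau>
  proof -
    have "c0 \<le> cmod (D0 (Complex x \<tau>))" using that xp(2) xm(2) c0(3) by (auto intro: order_trans)
    moreover have "R1 \<le> cmod (Complex x \<tau>)"
    proof -
      have "R1 \<le> \<bar>x\<bar>" using that(2) xp(1) xm(1) Rr d by auto
      also have "\<dots> \<le> cmod (Complex x \<tau>)" using abs_Re_le_cmod[of "Complex x \<tau>"] by simp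
      finally show ?thesis .
    qed
    ultimately show ?thesis using that(1) by (simp add: good_def)
  qed
  have Gamma_good: "good z" if z: "z \<in> path_image \<Gamma>" for z
  proof -
    have "Re z \<in> {Re a1, Re a3} \<and> Im z \<in> {Im a1..Im a3} \<or> Im z \<in> {Im a1, Im a3}"
      using z path_image_rectpath[OF ord] unfolding \<Gamma>_def by auto
    then show ?thesis
    proof
      assume a: "Re z \<in> {Re a1, Re a3} \<and> Im z \<in> {Im a1..Im a3}"
      then have "\<bar>Im z\<bar> \<le> H" "Re z = xm \<or> Re z = xp" by (auto simp: a1_def a3_def)
      then show ?thesis using vert[of "Im z" "Re z"] by simp
    next
      assume "Im z \<in> {Im a1, Im a3}"
      then have "\<bar>Im z\<bar> = H" using H(1) by (auto simp: a1_def a3_def)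
      then show ?thesis using H(2) by (simp add: good_def)
    qed
  qed
  have off_Gamma: "ev i \<notin> path_image \<Gamma>" for i using Gamma_good not_good by blast
  obtain MG where MG: "contour_bound \<Gamma> MG" using contour_bound_rectpath unfolding \<Gamma>_def by blast
  define Ic where "Ic = {i. ev i \<in> box a1 a3}"
  have wnG: "winding_number \<Gamma> (ev i) = (if i \<in> Ic then 1 else 0)" for i
  proof (cases "i \<in> Ic")
    case True
    then show ?thesis by (simp add: \<Gamma>_def Ic_def winding_number_rectpath)
  next
    case False
    then have "ev i \<notin> cbox a1 a3"
      using off_Gamma[of i] path_image_rectpath_cbox_minus_box[OF ord] by (simp add: \<Gamma>_def Ic_def)
    then show ?thesis using False by (simp add: \<Gamma>_def winding_number_rectpath_outside[OF ord])
  qed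
  define KL where "KL = l / 2 + 1 / (2 * b0)"
  have KL: "KL > 0" using l b0 by (simp add: KL_def add_pos_pos)
  define Ks where "Ks = sqrt (n * (l * B))"
  have Ks: "Ks > 0" using n l B0 by (simp add: Ks_def)
  have L1n: "L1 h \<le> KL * norm_H h" if "cont h" for h unfolding KL_def by (rule L1_le_norm_H[OF that])
  have nHs: "norm_H h \<le> Ks * k" if "cont h" "0 \<le> k" "\<And>x. x \<in> {0..l} \<Longrightarrow> norm (h x) \<le> k" for h k
    unfolding Ks_def n_def by (rule norm_H_le_sup[OF that])
  have nH0: "0 \<le> norm_H h" if "cont h" for h using norm_H_sq_nonneg[OF that] by (simp add: norm_H_def)
  have contS: "cont (\<lambda>x. \<Sum>i\<in>I. c i *s f i x)" for I c
    by (intro continuous_on_sum continuous_smult_fun fc)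
  \<comment> \<open>n passes from coordinates to the norm, MG comes from the contour, K from the
    estimate and KL from the L1 norm to the Hilbert norm. MG enters in modulus since
    \<open>contour_bound\<close> leaves its sign open.\<close>
  define Cc where "Cc = n * (\<bar>MG\<bar> * K) * KL"
  have Cc: "0 \<le> Cc" using n K KL by (simp add: Cc_def)
  have central: "norm (\<Sum>i\<in>I \<inter> Ic. c i *s f i x) \<le> Cc * norm_H (\<lambda>x. \<Sum>i\<in>I. c i *s f i x)"
    if I: "finite I" and x: "x \<in> {0..l}" for I c x
  proof -
    define h where "h = (\<lambda>x. \<Sum>i\<in>I. c i *s f i x)"
    have ch: "cont h" unfolding h_def by (rule contS)
    have "norm (\<Sum>i\<in>I \<inter> Ic. c i *s f i x) \<le> real CARD('n) * (MG * (K * L1 h))"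
    proof (rule riesz_bound[where \<gamma>=\<Gamma> and a="\<lambda>_. 0" and ev=ev, OF I root _ _ off_Gamma wnG MG x])
      show "valid_path \<Gamma>" "pathfinish \<Gamma> = pathstart \<Gamma>" by (simp_all add: \<Gamma>_def)
      fix z y assume "z \<in> path_image \<Gamma>" "solves z y (\<lambda>x. \<Sum>i\<in>I. c i *s f i x)"
      then show "norm (y x - 0) \<le> K * L1 h"
        unfolding diff_zero h_def[symmetric] by (intro apr Gamma_good ch x)
    qed (simp add: has_contour_integral_0)
    also have "\<dots> \<le> n * (\<bar>MG\<bar> * (K * (KL * norm_H h)))"
    proof -
      have "MG * (K * L1 h) \<le> \<bar>MG\<bar> * (K * L1 h)" using K L1_nonneg[OF ch] by (intro mult_right_mono) auto
      also have "\<dots> \<le> \<bar>MG\<bar> * (K * (KL * norm_H h))" using K L1n[OF ch] by (intro mult_left_mono) auto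
      finally show ?thesis unfolding n_def by (rule mult_left_mono) simp
    qed
    finally show ?thesis by (simp add: Cc_def h_def mult_ac)
  qed
  have finIc: "finite Ic"
  \<comment> \<open>On spans of central root vectors the projection is the identity, so
    \<open>central\<close> becomes the sup-norm estimate required by \<open>card_bound\<close>, with
    a constant independent of the subset.\<close>
  proof (rule finite_if_finite_subsets_card_bdd[of _ "nat \<lfloor>real CARD('n) * (l * (B * Cc\<^sup>2))\<rfloor>", THEN conjunct1])
    fix I assume I: "I \<subseteq> Ic" "finite I"
    have "real (card I) \<le> real CARD('n) * (l * (B * Cc\<^sup>2))"
    proof (rule card_bound[OF I(2) fc ind_all[OF I(2)] Cc])
      fix h x assume h: "h \<in> fspan I f" and x: "x \<in> {0..l}"
      obtain c where c: "h = (\<lambda>x. \<Sum>i\<in>I. c i *s f i x)" by (rule fspanE[OF h])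
      have "I \<inter> Ic = I" using I(1) by blast
      then show "norm (h x) \<le> Cc * norm_H h" using central[OF I(2) x, of c] unfolding c by simp
    qed
    then show "card I \<le> nat \<lfloor>real CARD('n) * (l * (B * Cc\<^sup>2))\<rfloor>" by (simp add: le_nat_floor)
  qed
  have fpos: "0 < norm_H (f m)" for m
  proof -
    \<comment> \<open>The distance to the span of the empty family is the norm itself.\<close>
    have "\<exists>\<delta>>0. \<forall>c. \<delta> \<le> norm_H (\<lambda>x. f m x - (\<Sum>i\<in>{}. c i *s f i x))"
      by (rule distance_positive) (use fc ind_all in auto)
    then show ?thesis by auto
  qed
  \<comment> \<open>Each m has some positive distance; \<open>SOME\<close> makes it a function of m,
    so that a minimum over the finite set \<open>Ic\<close> can be taken.\<close>
  have "\<exists>d>0. \<forall>m\<in>Ic. d \<le> (SOME e. e > 0 \<and> (\<forall>c. e \<le> norm_H (\<lambda>x. f m x - (\<Sum>i\<in>Ic - {m}. c i *s f i x)))) / norm_H (f m)"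
  proof (rule finite_positive_lower_bound[OF finIc])
    fix m assume m: "m \<in> Ic"
    have "\<exists>\<delta>>0. \<forall>c. \<delta> \<le> norm_H (\<lambda>x. f m x - (\<Sum>i\<in>Ic - {m}. c i *s f i x))"
      by (rule distance_positive) (use finIc fc ind_all in auto)
    from someI_ex[OF this] show "0 < (SOME e. e > 0 \<and> (\<forall>c. e \<le> norm_H (\<lambda>x. f m x - (\<Sum>i\<in>Ic - {m}. c i *s f i x)))) / norm_H (f m)"
      using fpos by simp
  qed
  then obtain d1 where d1: "d1 > 0" "\<And>m. m \<in> Ic \<Longrightarrow> d1 \<le> (SOME e. e > 0 \<and> (\<forall>c. e \<le> norm_H (\<lambda>x. f m x - (\<Sum>i\<in>Ic - {m}. c i *s f i x)))) / norm_H (f m)"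
    by blast
  have d1': "d1 * norm_H (f m) \<le> norm_H (\<lambda>x. f m x - (\<Sum>i\<in>Ic - {m}. c i *s f i x))" if m: "m \<in> Ic" for m c
  proof -
    have "\<exists>\<delta>>0. \<forall>c. \<delta> \<le> norm_H (\<lambda>x. f m x - (\<Sum>i\<in>Ic - {m}. c i *s f i x))"
      by (rule distance_positive) (use finIc fc ind_all in auto)
    from someI_ex[OF this] have "(SOME e. e > 0 \<and> (\<forall>c. e \<le> norm_H (\<lambda>x. f m x - (\<Sum>i\<in>Ic - {m}. c i *s f i x)))) \<le> norm_H (\<lambda>x. f m x - (\<Sum>i\<in>Ic - {m}. c i *s f i x))"
      by blast
    moreover have "d1 * norm_H (f m) \<le> (SOME e. e > 0 \<and> (\<forall>c. e \<le> norm_H (\<lambda>x. f m x - (\<Sum>i\<in>Ic - {m}. c i *s f i x))))"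
      using d1(2)[OF m] by (simp only: pos_le_divide_eq[OF fpos])
    ultimately show ?thesis by linarith
  qed
  \<comment> \<open>The central part of a combination has norm at most \<open>Ks * Cc\<close> times
    the whole; the added 1 keeps the denominator positive.\<close>
  define d2 where "d2 = d1 / (Ks * Cc + 1)"
  have KsCc: "0 < Ks * Cc + 1" using Ks Cc by (simp add: add_nonneg_pos)
  have d2: "d2 > 0" using d1(1) KsCc by (simp add: d2_def)
  have central_est: "d2 * norm_H (f m) \<le> norm_H (\<lambda>x. f m x - (\<Sum>i\<in>I. c i *s f i x))"
    if m: "m \<in> Ic" and I: "finite I" "m \<notin> I" for m I c
  proof -
    define h where "h = (\<lambda>x. f m x - (\<Sum>i\<in>I. c i *s f i x))"
    define c' where "c' = (\<lambda>i. if i = m then 1 else - c i)"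
    have heq: "(\<lambda>x. \<Sum>i\<in>insert m I. c' i *s f i x) = h"
      unfolding h_def c'_def by (rule ext) (rule insert_comb[OF I])
    have ch: "cont h" unfolding heq[symmetric] by (rule contS)
    \<comment> \<open>The central part of h, written over all of \<open>Ic - {m}\<close> with zero
      coefficients outside I, to match the fixed finite family in \<open>d1'\<close>.\<close>
    define k where "k = (\<lambda>x. f m x - (\<Sum>i\<in>Ic - {m}. (if i \<in> I then c i else 0) *s f i x))"
    have ck: "cont k" unfolding k_def by (intro continuous_on_diff fc contS)
    have keq: "(\<Sum>i\<in>insert m I \<inter> Ic. c' i *s f i x) = k x" for x
    proof -
      have "insert m I \<inter> Ic = insert m (I \<inter> Ic)" using m by auto
      then have "(\<Sum>i\<in>insert m I \<inter> Ic. c' i *s f i x) = f m x - (\<Sum>i\<in>I \<inter> Ic. c i *s f i x)"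
        unfolding c'_def using insert_comb[of "I \<inter> Ic" m c f x] I by simp
      also have "(\<Sum>i\<in>I \<inter> Ic. c i *s f i x) = (\<Sum>i\<in>Ic - {m}. (if i \<in> I then c i else 0) *s f i x)"
        using finIc I(2) by (intro sum.mono_neutral_cong_left) auto
      finally show ?thesis by (simp add: k_def)
    qed
    have "norm (k x) \<le> Cc * norm_H h" if x: "x \<in> {0..l}" for x
      using central[of "insert m I" x c'] I(1) x unfolding keq heq by simp
    then have "norm_H k \<le> Ks * (Cc * norm_H h)" using Cc nH0[OF ch] by (intro nHs[OF ck]) auto
    moreover have "d1 * norm_H (f m) \<le> norm_H k" unfolding k_def by (rule d1'[OF m])
    ultimately have "d1 * norm_H (f m) \<le> (Ks * Cc + 1) * norm_H h"
      using nH0[OF ch] by (simp add: algebra_simps)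
    then show ?thesis using KsCc unfolding d2_def h_def[symmetric] by (simp add: pos_divide_le_eq mult.commute)
  qed
  define Cf where "Cf = Ks * (n * (2 * pi * \<delta> * (K * KL)))"
  have Cf: "Cf > 0" unfolding Cf_def using Ks n d K KL by simp
  have far_est: "norm_H (f m) \<le> Cf * norm_H (\<lambda>x. f m x - (\<Sum>i\<in>I. c i *s f i x))"
    if m: "m \<notin> Ic" and I: "finite I" "m \<notin> I" for m I c
  proof -
    have im: "\<bar>Im (ev m)\<bar> < T" using not_good[of m] by (auto simp: good_def)
    have re: "Rr \<le> \<bar>Re (ev m)\<bar>"
    proof (rule ccontr)
      assume "\<not> Rr \<le> \<bar>Re (ev m)\<bar>"
      then have "ev m \<in> box a1 a3" using im H xp(1) xm(1) by (auto simp: in_box_complex_iff a1_def a3_def)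
      then show False using m by (simp add: Ic_def)
    qed
    have "R1 \<le> cmod (ev m)" using re Rr d abs_Re_le_cmod[of "ev m"] by linarith
    then have "cmod (D0 (ev m)) < c0" using not_good[of m] im H by (auto simp: good_def)
    then have "\<not> (\<forall>z. D0 z = 0 \<longrightarrow> \<delta> \<le> cmod (ev m - z))"
      using ca(2)[of "ev m"] im H c0(2) by force
    then obtain \<mu> where mu: "D0 \<mu> = 0" "cmod (ev m - \<mu>) < \<delta>" by force
    have Re_mu: "R0 \<le> \<bar>Re \<mu>\<bar>"
      using re Rr mu(2) abs_Re_le_cmod[of "ev m - \<mu>"] by simp
    have zsep': "\<delta> < cmod (z - \<mu>)" if "D0 z = 0" "z \<noteq> \<mu>" for z
      using zsep[OF mu(1) that(1) that(2)[symmetric] Re_mu] d by (simp add: norm_minus_commute)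
    \<comment> \<open>Distinct zeros are \<open>2 * \<delta>\<close> apart from \<mu>, so a point of
      the circle keeps distance \<delta> from every zero and the lower bound for \<open>D0\<close>
      applies.\<close>
    have circle: "\<bar>Im z\<bar> \<le> H \<and> R1 \<le> cmod z \<and> c0 \<le> cmod (D0 z)" if z: "cmod (z - \<mu>) = \<delta>" for z
    proof -
      have dist: "cmod (z - ev m) < 2 * \<delta>"
        using norm_triangle_ineq[of "z - \<mu>" "\<mu> - ev m"] z mu(2) by (simp add: norm_minus_commute)
      have i: "\<bar>Im z\<bar> \<le> H"
        using abs_Im_le_cmod[of "z - ev m"] dist im by (simp add: H_def)
      have r: "R1 \<le> cmod z"
        using abs_Re_le_cmod[of "z - ev m"] dist re Rr(2) abs_Re_le_cmod[of z] by simp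
      have "ca \<le> cmod (D0 z)"
      proof (rule ca(2)[OF i])
        fix w assume w: "D0 w = 0"
        show "\<delta> \<le> cmod (z - w)"
        proof (cases "w = \<mu>")
          case False
          have "2 * \<delta> \<le> cmod (\<mu> - w)" using zsep[OF mu(1) w _ Re_mu] False by simp
          also have "\<dots> \<le> cmod (\<mu> - z) + cmod (z - w)" using norm_triangle_ineq[of "\<mu> - z" "z - w"] by simp
          finally show ?thesis using z by (simp add: norm_minus_commute)
        qed (use z in simp)
      qed
      then show ?thesis using i r c0(2) by simp
    qed
    then have cgood: "good z" if "cmod (z - \<mu>) = \<delta>" for z using that by (simp add: good_def)
    \<comment> \<open>Once a second root vector in the disc is excluded, the projection around \<mu>
      of a combination reduces to its m-th term.\<close>
    have only: "i = m" if i: "cmod (ev i - \<mu>) < \<delta>" for i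
    proof (rule ccontr)
      assume "i \<noteq> m"
      then have mi: "m \<noteq> i" by simp
      show False
      proof (rule two_root_vectors_in_disc[OF mi root root _ d mu(1) simple[OF mu(1) Re_mu] zsep' mu(2) i])
        show "indep {m, i} f" by (rule ind_all) simp
        show "l * (real CARD('n) * (2 * pi * \<delta> * \<eta>)) < 1" using small by (simp add: n_def)
        fix z y g x assume "cmod (z - \<mu>) = \<delta>" "cont g" "solves z y g" "x \<in> {0..l}"
        then show "norm (y x - model z g x) \<le> \<eta> * L1 g" using circle[of z] by (intro R1) auto
      qed
    qed
    define h where "h = (\<lambda>x. f m x - (\<Sum>i\<in>I. c i *s f i x))"
    define c' where "c' = (\<lambda>i. if i = m then 1 else - c i)"
    have heq: "(\<lambda>x. \<Sum>i\<in>insert m I. c' i *s f i x) = h"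
      unfolding h_def c'_def by (rule ext) (rule insert_comb[OF I])
    have ch: "cont h" unfolding heq[symmetric] by (rule contS)
    have "norm (f m x) \<le> n * (2 * pi * \<delta> * (K * KL)) * norm_H h" if x: "x \<in> {0..l}" for x
    proof -
      have "norm (\<Sum>i\<in>insert m I \<inter> {m}. c' i *s f i x) \<le> real CARD('n) * ((2 * pi * \<delta>) * (K * L1 h))"
      proof (rule riesz_bound[where \<gamma>="circlepath \<mu> \<delta>" and a="\<lambda>_. 0" and ev=ev, OF _ root])
        show "contour_bound (circlepath \<mu> \<delta>) (2 * pi * \<delta>)" by (rule contour_bound_circlepath[OF d])
      next
        fix i
        have ne: "cmod (ev i - \<mu>) \<noteq> \<delta>" using cgood[of "ev i"] not_good[of i] by blast
        then show "ev i \<notin> path_image (circlepath \<mu> \<delta>)" using d path_image_circlepath_iff[of \<delta> "ev i" \<mu>] by simp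
        show "winding_number (circlepath \<mu> \<delta>) (ev i) = (if i \<in> {m} then 1 else 0)"
        proof (cases "i = m")
          case True
          then show ?thesis using winding_number_circlepath[OF mu(2)] by simp
        next
          case False
          then have "\<delta> < cmod (ev i - \<mu>)" using only[of i] ne by fastforce
          then show ?thesis using False winding_number_circlepath_outside[OF d] by simp
        qed
      next
        fix z y assume z: "z \<in> path_image (circlepath \<mu> \<delta>)" and y: "solves z y (\<lambda>x. \<Sum>i\<in>insert m I. c' i *s f i x)"
        have "cmod (z - \<mu>) = \<delta>" using z d path_image_circlepath_iff[of \<delta> z \<mu>] by simp
        then show "norm (y x - 0) \<le> K * L1 h"
          using y unfolding heq diff_zero by (intro apr cgood ch x)
      qed (use x I in \<open>simp_all add: has_contour_integral_0\<close>)
      then have "norm (f m x) \<le> real CARD('n) * ((2 * pi * \<delta>) * (K * L1 h))" by (simp add: c'_def)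
      also have "real CARD('n) * ((2 * pi * \<delta>) * (K * L1 h)) \<le> n * ((2 * pi * \<delta>) * (K * (KL * norm_H h)))"
        unfolding n_def using K d L1n[OF ch] by (intro mult_left_mono) auto
      finally show ?thesis by (simp add: mult_ac)
    qed
    then have "norm_H (f m) \<le> Ks * (n * (2 * pi * \<delta> * (K * KL)) * norm_H h)"
      using n d K KL nH0[OF ch] by (intro nHs fc) auto
    then show ?thesis by (simp add: Cf_def h_def mult.assoc)
  qed
  show ?thesis
  proof (intro exI[of _ "min d2 (1 / Cf)"] conjI allI impI)
    show "0 < min d2 (1 / Cf)" using d2 Cf by simp
    fix m :: 'i and I :: "'i set" and c :: "'i \<Rightarrow> complex" assume a: "finite I \<and> m \<notin> I"
    show "min d2 (1 / Cf) * norm_H (f m) \<le> norm_H (\<lambda>x. f m x - (\<Sum>i\<in>I. c i *s f i x))"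
    proof (cases "m \<in> Ic")
      case True
      have "min d2 (1 / Cf) * norm_H (f m) \<le> d2 * norm_H (f m)" using fpos[of m] by (intro mult_right_mono) auto
      then show ?thesis using central_est[OF True, of I c] a by linarith
    next
      case False
      have "min d2 (1 / Cf) * norm_H (f m) \<le> (1 / Cf) * norm_H (f m)" using fpos[of m] by (intro mult_right_mono) auto
      also have "\<dots> \<le> norm_H (\<lambda>x. f m x - (\<Sum>i\<in>I. c i *s f i x))"
        using far_est[OF False, of I c] a Cf by (simp add: pos_divide_le_eq mult.commute)
      finally show ?thesis .
    qed
  qed
qed

end

section \<open>Almost everywhere defined coefficients\<close>

lemma idx_succ_exists:
  fixes i :: "'n::{finite,linorder}"
  assumes "i < k"
  obtains i' where "idx_succ i i'" "i' \<le> k"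
proof
  let ?A = "{j. i < j}"
  have A: "finite ?A" "?A \<noteq> {}" using assms by auto
  have "\<not> j < Min ?A" if "i < j" for j using Min_le[OF A(1), of j] that by (simp add: not_less)
  then show "idx_succ i (Min ?A)" using Min_in[OF A] unfolding idx_succ_def by blast
  show "Min ?A \<le> k" using Min_le[OF A(1)] assms by simp
qed

lemma ae_on_iff_negligible: "ae_on l P \<longleftrightarrow> (\<exists>Z. negligible Z \<and> (\<forall>x\<in>{0..l} - Z. P x))"
  by (rule AE_lebesgue_on_iff_negligible) simp

lemma ae_on_exists:
  assumes "0 < l" "ae_on l P"
  obtains x where "x \<in> {0..l}" "P x"
proof -
  obtain Z where Z: "negligible Z" "\<forall>x\<in>{0..l} - Z. P x" using assms(2) unfolding ae_on_iff_negligible by blast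
  have "\<not> {0..l} \<subseteq> Z"
  proof
    assume "{0..l} \<subseteq> Z"
    from negligible_subset[OF Z(1) this] show False using assms(1) negligible_interval(1)[of 0 l] by simp
  qed
  then show ?thesis using Z(2) that by blast
qed

text \<open>The gap is assumed between neighbouring indices only. For the largest i up to k whose
  weight equals that of j, the jump by \<theta> occurs at the successor of i, and monotonicity in
  the index carries it to k.\<close>

lemma admissible_B_gap:
  fixes \<beta> :: "'n::{finite,linorder} \<Rightarrow> real \<Rightarrow> real"
  assumes mono: "\<And>j k. j \<le> k \<Longrightarrow> ae_on l (\<lambda>x. \<beta> j x \<le> \<beta> k x)"
    and succ: "\<And>j k. idx_succ j k \<Longrightarrow> beta_eq l \<beta> j k \<or> ae_on l (\<lambda>x. \<beta> j x + \<theta> < \<beta> k x)"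
  shows "beta_eq l \<beta> j k \<or> ae_on l (\<lambda>x. \<theta> \<le> \<bar>\<beta> j x - \<beta> k x\<bar>)"
proof -
  have less: "beta_eq l \<beta> j k \<or> ae_on l (\<lambda>x. \<beta> j x + \<theta> \<le> \<beta> k x)" if jk: "j < k" for j k
  proof -
    define A where "A = {i. j \<le> i \<and> i \<le> k \<and> beta_eq l \<beta> j i}"
    have A: "finite A" "A \<noteq> {}" using jk by (auto simp: A_def beta_eq_def intro!: exI[of _ j])
    define i where "i = Max A"
    have iA: "i \<in> A" unfolding i_def using A by (rule Max_in)
    show ?thesis
    proof (cases "i = k")
      case True
      then show ?thesis using iA by (simp add: A_def)
    next
      case False
      then have "i < k" using iA by (simp add: A_def order_less_le)
      then obtain i' where i': "idx_succ i i'" "i' \<le> k" by (rule idx_succ_exists)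
      have ii: "i < i'" using i'(1) by (simp add: idx_succ_def)
      have "i' \<notin> A"
      proof
        assume "i' \<in> A"
        then have "i' \<le> i" unfolding i_def by (rule Max_ge[OF A(1)])
        then show False using ii by simp
      qed
      then have n: "\<not> beta_eq l \<beta> j i'" using iA ii i'(2) by (auto simp: A_def)
      have ji: "ae_on l (\<lambda>x. \<beta> j x = \<beta> i x)" using iA by (simp add: A_def beta_eq_def)
      have "\<not> beta_eq l \<beta> i i'"
      proof
        assume "beta_eq l \<beta> i i'"
        then have "ae_on l (\<lambda>x. \<beta> i x = \<beta> i' x)" by (simp add: beta_eq_def)
        with ji have "ae_on l (\<lambda>x. \<beta> j x = \<beta> i' x)" by eventually_elim simp
        then show False using n by (simp add: beta_eq_def)
      qed
      then have "ae_on l (\<lambda>x. \<beta> i x + \<theta> < \<beta> i' x)" using succ[OF i'(1)] by blast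
      with ji mono[OF i'(2)] have "ae_on l (\<lambda>x. \<beta> j x + \<theta> \<le> \<beta> k x)" by eventually_elim simp
      then show ?thesis ..
    qed
  qed
  consider "j = k" | "j < k" | "k < j" by (rule linorder_cases)
  then show ?thesis
  proof cases
    case 1
    then show ?thesis by (simp add: beta_eq_def)
  next
    case 2
    from less[OF this] show ?thesis
    proof
      assume "ae_on l (\<lambda>x. \<beta> j x + \<theta> \<le> \<beta> k x)"
      then have "ae_on l (\<lambda>x. \<theta> \<le> \<bar>\<beta> j x - \<beta> k x\<bar>)" by eventually_elim simp
      then show ?thesis ..
    qed simp
  next
    case 3
    from less[OF this] show ?thesis
    proof
      assume "beta_eq l \<beta> k j"
      then have "ae_on l (\<lambda>x. \<beta> k x = \<beta> j x)" by (simp add: beta_eq_def)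
      then have "ae_on l (\<lambda>x. \<beta> j x = \<beta> k x)" by eventually_elim simp
      then show ?thesis by (simp add: beta_eq_def)
    next
      assume "ae_on l (\<lambda>x. \<beta> k x + \<theta> \<le> \<beta> j x)"
      then have "ae_on l (\<lambda>x. \<theta> \<le> \<bar>\<beta> j x - \<beta> k x\<bar>)" by eventually_elim simp
      then show ?thesis ..
    qed
  qed
qed

text \<open>All conditions hold simultaneously off one null set Z, and on Z every weight takes its
  value at a single good point x0. Using the same point for all indices preserves equalities and
  gaps between the weights.\<close>

lemma admissible_B_normalize:
  fixes \<beta> :: "'n::{finite,linorder} \<Rightarrow> real \<Rightarrow> real"
  assumes l: "0 < l" and adm: "admissible_B l \<beta>"
  obtains \<gamma> b0 B \<theta> where "\<And>k. \<gamma> k \<in> borel_measurable (lebesgue_on {0..l})" "0 < b0"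
    "\<And>k x. x \<in> {0..l} \<Longrightarrow> b0 \<le> \<bar>\<gamma> k x\<bar>" "\<And>k x. x \<in> {0..l} \<Longrightarrow> \<bar>\<gamma> k x\<bar> \<le> B"
    "\<And>k. (\<forall>x\<in>{0..l}. 0 < \<gamma> k x) \<or> (\<forall>x\<in>{0..l}. \<gamma> k x < 0)" "0 < \<theta>"
    "\<And>j k. (\<forall>x\<in>{0..l}. \<gamma> j x = \<gamma> k x) \<or> (\<forall>x\<in>{0..l}. \<theta> \<le> \<bar>\<gamma> j x - \<gamma> k x\<bar>)"
    "ae_on l (\<lambda>x. \<forall>k. \<beta> k x = \<gamma> k x)"
proof -
  note d = adm[unfolded admissible_B_def Linf_on_def]
  from d obtain \<theta> where th: "0 < \<theta>" and succ: "\<And>j k. idx_succ j k \<Longrightarrow> beta_eq l \<beta> j k \<or> ae_on l (\<lambda>x. \<beta> j x + \<theta> < \<beta> k x)"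
    by (elim conjE exE) simp
  have meas: "\<beta> k \<in> borel_measurable (lebesgue_on {0..l})" for k using d by simp
  have mono: "ae_on l (\<lambda>x. \<beta> j x \<le> \<beta> k x)" if "j \<le> k" for j k using d that by simp
  have sgn: "ae_on l (\<lambda>x. \<beta> k x < 0) \<or> ae_on l (\<lambda>x. 0 < \<beta> k x)" for k using d by simp
  have "\<exists>M. \<forall>k. ae_on l (\<lambda>x. \<bar>\<beta> k x\<bar> \<le> M k)" by (rule choice) (use d in simp)
  then obtain M where M: "\<And>k. ae_on l (\<lambda>x. \<bar>\<beta> k x\<bar> \<le> M k)" by (elim exE) (rule that, rule spec)
  have "\<exists>M. \<forall>k. ae_on l (\<lambda>x. \<bar>1 / \<beta> k x\<bar> \<le> M k)" by (rule choice) (use d in simp)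
  then obtain M' where M': "\<And>k. ae_on l (\<lambda>x. \<bar>1 / \<beta> k x\<bar> \<le> M' k)" by (elim exE) (rule that, rule spec)
  define G where "G x \<longleftrightarrow> (\<forall>k. \<bar>\<beta> k x\<bar> \<le> M k \<and> \<bar>1 / \<beta> k x\<bar> \<le> M' k
      \<and> (if ae_on l (\<lambda>x. \<beta> k x < 0) then \<beta> k x < 0 else 0 < \<beta> k x)
      \<and> (\<forall>j. if beta_eq l \<beta> j k then \<beta> j x = \<beta> k x else \<theta> \<le> \<bar>\<beta> j x - \<beta> k x\<bar>))" for x
  have "ae_on l G"
    unfolding G_def
  proof (intro eventually_all_finite eventually_conj M M')
    fix j k
    show "ae_on l (\<lambda>x. if ae_on l (\<lambda>x. \<beta> k x < 0) then \<beta> k x < 0 else 0 < \<beta> k x)"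
      using sgn[of k] by (cases "ae_on l (\<lambda>x. \<beta> k x < 0)") simp_all
    show "ae_on l (\<lambda>x. if beta_eq l \<beta> j k then \<beta> j x = \<beta> k x else \<theta> \<le> \<bar>\<beta> j x - \<beta> k x\<bar>)"
      using admissible_B_gap[OF mono succ, of j k] by (cases "beta_eq l \<beta> j k") (simp_all add: beta_eq_def)
  qed
  then obtain Z where Z: "negligible Z" "\<And>x. x \<in> {0..l} - Z \<Longrightarrow> G x" unfolding ae_on_iff_negligible by blast
  obtain x0 where x0: "G x0" using ae_on_exists[OF l \<open>ae_on l G\<close>] by blast
  define \<gamma> where "\<gamma> k x = \<beta> k (if x \<in> Z then x0 else x)" for k x
  have G: "G (if x \<in> Z then x0 else x)" if "x \<in> {0..l}" for x using x0 Z(2) that by auto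
  show ?thesis
  proof (rule that[of \<gamma>])
    show "\<gamma> k \<in> borel_measurable (lebesgue_on {0..l})" for k
    proof -
      have "Z \<in> sets lebesgue" using Z(1) by (rule negligible_imp_sets)
      then have "{x \<in> space (lebesgue_on {0..l}). x \<in> Z} \<in> sets (lebesgue_on {0..l})"
        by (auto simp: sets_restrict_space space_restrict_space)
      then have "(\<lambda>x. if x \<in> Z then \<beta> k x0 else \<beta> k x) \<in> borel_measurable (lebesgue_on {0..l})"
        by (intro measurable_If meas) auto
      then show ?thesis unfolding \<gamma>_def by (simp add: if_distrib cong: if_cong)
    qed
    \<comment> \<open>The lower bound comes from the bounds on the reciprocals; the 1 and the moduli
      keep it positive.\<close>
    show "0 < 1 / (1 + (\<Sum>k\<in>UNIV. \<bar>M' k\<bar>))" by (simp add: add_pos_nonneg sum_nonneg)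
    show "0 < \<theta>" by (rule th)
    fix x k assume x: "x \<in> {0..l}"
    define y where "y = (if x \<in> Z then x0 else x)"
    have y: "\<bar>\<beta> k y\<bar> \<le> M k" "\<bar>1 / \<beta> k y\<bar> \<le> M' k" "\<beta> k y \<noteq> 0"
      using G[OF x] unfolding y_def[symmetric] G_def by (metis order_less_irrefl)+
    define S where "S = (\<Sum>k\<in>UNIV. \<bar>M' k\<bar>)"
    have "\<bar>M k\<bar> \<le> (\<Sum>k\<in>UNIV. \<bar>M k\<bar>)" and S: "\<bar>M' k\<bar> \<le> S" "0 \<le> S"
      by (auto simp: S_def intro: member_le_sum sum_nonneg)
    moreover have "1 \<le> (1 + S) * \<bar>\<beta> k y\<bar>"
    proof -
      have "1 = \<bar>1 / \<beta> k y\<bar> * \<bar>\<beta> k y\<bar>" using y(3) by simp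
      also have "\<dots> \<le> (1 + S) * \<bar>\<beta> k y\<bar>" using y(2) S by (intro mult_right_mono) auto
      finally show ?thesis .
    qed
    then have "1 / (1 + S) \<le> \<bar>\<beta> k y\<bar>" using S(2) by (simp add: pos_divide_le_eq mult.commute)
    ultimately show "\<bar>\<gamma> k x\<bar> \<le> (\<Sum>k\<in>UNIV. \<bar>M k\<bar>)" "1 / (1 + (\<Sum>k\<in>UNIV. \<bar>M' k\<bar>)) \<le> \<bar>\<gamma> k x\<bar>"
      using y(1) unfolding \<gamma>_def y_def[symmetric] S_def by auto
  next
    show "(\<forall>x\<in>{0..l}. 0 < \<gamma> k x) \<or> (\<forall>x\<in>{0..l}. \<gamma> k x < 0)" for k
      using G unfolding G_def \<gamma>_def by (cases "ae_on l (\<lambda>x. \<beta> k x < 0)") simp_all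
    show "(\<forall>x\<in>{0..l}. \<gamma> j x = \<gamma> k x) \<or> (\<forall>x\<in>{0..l}. \<theta> \<le> \<bar>\<gamma> j x - \<gamma> k x\<bar>)" for j k
      using G unfolding G_def \<gamma>_def by (cases "beta_eq l \<beta> j k") simp_all
    show "ae_on l (\<lambda>x. \<forall>k. \<beta> k x = \<gamma> k x)"
      unfolding ae_on_iff_negligible using Z(1) by (intro exI[of _ Z]) (simp add: \<gamma>_def)
  qed
qed

text \<open>Equality almost everywhere holds at some point of the interval, where it excludes the
  gap. So the original weights, compared almost everywhere, and the normalised ones, compared
  everywhere, define the same blocks.\<close>

lemma beta_eq_iff:
  assumes l: "0 < l" and theta: "0 < \<theta>"
    and gap: "\<And>j k. (\<forall>x\<in>{0..l}. \<beta> j x = \<beta> k x) \<or> (\<forall>x\<in>{0..l}. \<theta> \<le> \<bar>\<beta> j x - \<beta> k x\<bar>)"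
    and ae: "ae_on l (\<lambda>x. \<forall>k. \<gamma> k x = \<beta> k x)"
  shows "beta_eq l \<gamma> j k \<longleftrightarrow> (\<forall>x\<in>{0..l}. \<beta> j x = \<beta> k x)"
proof
  assume "beta_eq l \<gamma> j k"
  then have "ae_on l (\<lambda>x. \<gamma> j x = \<gamma> k x)" by (simp add: beta_eq_def)
  with ae have "ae_on l (\<lambda>x. \<beta> j x = \<beta> k x)" by eventually_elim simp
  then obtain x where "x \<in> {0..l}" "\<beta> j x = \<beta> k x" by (rule ae_on_exists[OF l])
  then have "\<not> (\<forall>x\<in>{0..l}. \<theta> \<le> \<bar>\<beta> j x - \<beta> k x\<bar>)" using theta by (auto intro!: bexI[of _ x])
  then show "\<forall>x\<in>{0..l}. \<beta> j x = \<beta> k x" using gap[of j k] by blast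
next
  assume "\<forall>x\<in>{0..l}. \<beta> j x = \<beta> k x"
  then have "ae_on l (\<lambda>x. \<beta> j x = \<beta> k x)" by (intro AE_I2) simp
  with ae have "ae_on l (\<lambda>x. \<gamma> j x = \<gamma> k x)" by eventually_elim simp
  then show "beta_eq l \<gamma> j k" by (simp add: beta_eq_def)
qed

section \<open>From operator graphs modulo null sets to continuous root functions\<close>

context bvp begin

lemma rho_cong_ae:
  assumes ae: "ae_on l (\<lambda>x. \<forall>k. \<gamma> k x = \<beta> k x)"
  shows "rho \<gamma> k l = rho \<beta> k l"
proof -
  obtain Z where Z: "negligible Z" "\<forall>x\<in>{0..l} - Z. \<forall>k. \<gamma> k x = \<beta> k x" using ae unfolding ae_on_iff_negligible by blast
  then show ?thesis unfolding rho_def by (intro integral_spike[of Z]) auto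
qed

text \<open>The graph and the right-hand side are given modulo null sets, but an absolutely
  continuous function does not notice a change of its derivative on a null set. The representative
  yt therefore satisfies the equation with \<psi> itself.\<close>

lemma LU_solves:
  assumes ae: "ae_on l (\<lambda>x. \<forall>k. \<gamma> k x = \<beta> k x)"
    and LU: "LU l \<gamma> Q C D y f" and psi: "ae_on l (\<lambda>x. f x - lam *s y x = \<psi> x)"
  shows "\<exists>yt. solves lam yt \<psi> \<and> ae_on l (\<lambda>x. y x = yt x)"
proof -
  obtain yt g where yt: "AC_with_deriv l yt g" and y: "ae_on l (\<lambda>x. y x = yt x)" and bc: "C *v yt 0 + D *v yt l = 0"
    and f: "ae_on l (\<lambda>x. f x = (\<chi> k. - \<i> * ((g x + Q x *v yt x) $ k) / complex_of_real (\<gamma> k x)))"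
    using LU unfolding LU_def by blast
  have "ae_on l (\<lambda>x. x \<in> {0..l})" by (rule AE_I2) simp
  with ae y f psi have "ae_on l (\<lambda>x. (\<chi> k. \<i> * of_real (\<beta> k x) * (lam * yt x $ k + \<psi> x $ k)) - Q x *v yt x = g x)"
  proof eventually_elim
    case (elim x)
    have "\<i> * of_real (\<beta> k x) * (lam * yt x $ k + \<psi> x $ k) = (g x + Q x *v yt x) $ k" for k
    proof -
      have "\<beta> k x \<noteq> 0" using beta_lo[OF elim(5), of k] b0 by auto
      moreover have "lam * yt x $ k + \<psi> x $ k = - \<i> * ((g x + Q x *v yt x) $ k) / complex_of_real (\<beta> k x)"
        using elim(1,2) arg_cong[OF elim(3), of "\<lambda>v. v $ k"] arg_cong[OF elim(4), of "\<lambda>v. v $ k"]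
        by (auto simp: algebra_simps)
      ultimately show ?thesis by simp
    qed
    then show ?case by (simp add: vec_eq_iff)
  qed
  then obtain Z where "negligible Z" "\<forall>x\<in>{0..l} - Z. (\<chi> k. \<i> * of_real (\<beta> k x) * (lam * yt x $ k + \<psi> x $ k)) - Q x *v yt x = g x"
    unfolding ae_on_iff_negligible by blast
  then have "AC_with_deriv l yt (\<lambda>x. (\<chi> k. \<i> * of_real (\<beta> k x) * (lam * yt x $ k + \<psi> x $ k)) - Q x *v yt x)"
    by (intro AC_with_deriv_spike[OF yt]) auto
  then show ?thesis using bc y unfolding solves_def by (intro exI[of _ yt] conjI)
qed

text \<open>Induction from the end of the chain: the image under \<open>L - lam\<close> already has
  a chain, and the continuous representative of y is put in front by
  \<open>case_nat\<close>.\<close>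

lemma ker_pow_root_function:
  assumes ae: "ae_on l (\<lambda>x. \<forall>k. \<gamma> k x = \<beta> k x)"
  shows "ker_pow l \<gamma> Q C D lam k y \<Longrightarrow> \<exists>f. root_function lam f \<and> ae_on l (\<lambda>x. y x = f x)"
proof -
  have "\<exists>\<psi>. (\<forall>j<k. solves lam (\<psi> j) (\<psi> (Suc j))) \<and> \<psi> k = (\<lambda>_. 0) \<and> ae_on l (\<lambda>x. y x = \<psi> 0 x)"
    if "ker_pow l \<gamma> Q C D lam k y"
    using that
  proof (induction k arbitrary: y)
    case 0
    then show ?case by (intro exI[of _ "\<lambda>_ _. 0"]) (simp add: H_zero_def)
  next
    case (Suc k)
    obtain f where f: "LU l \<gamma> Q C D y f" "ker_pow l \<gamma> Q C D lam k (\<lambda>x. f x - lam *s y x)" using Suc.prems by auto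
    from Suc.IH[OF f(2)] obtain \<psi> where psi: "\<forall>j<k. solves lam (\<psi> j) (\<psi> (Suc j))" "\<psi> k = (\<lambda>_. 0)"
      "ae_on l (\<lambda>x. f x - lam *s y x = \<psi> 0 x)" by (elim exE conjE)
    from LU_solves[OF ae f(1) psi(3)] obtain yt where yt: "solves lam yt (\<psi> 0)" "ae_on l (\<lambda>x. y x = yt x)" by (elim exE conjE)
    show ?case
    proof (intro exI[of _ "case_nat yt \<psi>"] conjI allI impI)
      fix j assume j: "j < Suc k"
      show "solves lam (case_nat yt \<psi> j) (case_nat yt \<psi> (Suc j))"
        using j psi(1) yt(1) by (cases j) simp_all
    qed (simp_all add: psi(2) yt(2))
  qed
  then show "ker_pow l \<gamma> Q C D lam k y \<Longrightarrow> \<exists>f. root_function lam f \<and> ae_on l (\<lambda>x. y x = f x)"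
    unfolding root_function_def by metis
qed

lemma H_norm_eq_norm_H:
  assumes ae: "ae_on l (\<lambda>x. \<forall>k. \<gamma> k x = \<beta> k x)" and gh: "ae_on l (\<lambda>x. g x = h x)" and h: "cont h"
  shows "H_norm l \<gamma> g = norm_H h"
proof -
  have "ae_on l (\<lambda>x. (\<forall>k. \<gamma> k x = \<beta> k x) \<and> g x = h x)" using ae gh by (rule eventually_conj)
  then obtain Z where Z: "negligible Z" "\<And>x. x \<in> {0..l} - Z \<Longrightarrow> (\<forall>k. \<gamma> k x = \<beta> k x) \<and> g x = h x"
    unfolding ae_on_iff_negligible by blast
  have "(LINT x|lebesgue_on {0..l}. \<bar>\<gamma> k x\<bar> * (cmod (g x $ k))\<^sup>2) = integral {0..l} (\<lambda>x. \<bar>\<beta> k x\<bar> * (cmod (h x $ k))\<^sup>2)" for k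
  proof -
    have eq: "\<bar>\<gamma> k x\<bar> * (cmod (g x $ k))\<^sup>2 = \<bar>\<beta> k x\<bar> * (cmod (h x $ k))\<^sup>2" if "x \<in> {0..l} - Z" for x
      using Z(2)[OF that] by simp
    have "(\<lambda>x. \<bar>\<beta> k x\<bar> * (cmod (h x $ k))\<^sup>2) absolutely_integrable_on {0..l}"
      by (rule nonnegative_absolutely_integrable_1[OF sq_integrable[OF h]]) simp
    then have "(\<lambda>x. \<bar>\<gamma> k x\<bar> * (cmod (g x $ k))\<^sup>2) absolutely_integrable_on {0..l}"
      using Z(1) eq by (rule absolutely_integrable_spike)
    then have "integrable (lebesgue_on {0..l}) (\<lambda>x. \<bar>\<gamma> k x\<bar> * (cmod (g x $ k))\<^sup>2)"
      by (simp only: absolutely_integrable_Icc_iff_integrable)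
    then have "(LINT x|lebesgue_on {0..l}. \<bar>\<gamma> k x\<bar> * (cmod (g x $ k))\<^sup>2) = integral {0..l} (\<lambda>x. \<bar>\<gamma> k x\<bar> * (cmod (g x $ k))\<^sup>2)"
      by (intro lebesgue_integral_eq_integral) simp_all
    also have "\<dots> = integral {0..l} (\<lambda>x. \<bar>\<beta> k x\<bar> * (cmod (h x $ k))\<^sup>2)"
      using Z(1) by (rule integral_spike) (simp add: eq)
    finally show ?thesis .
  qed
  then show ?thesis by (simp add: H_norm_def norm_H_def norm_H_sq_def)
qed

text \<open>A weight of constant sign has an integral of the same sign, so the sign of
  \<open>bvec\<close> selects the indices of positive weights.\<close>

lemma Pplus_cong_ae:
  assumes ae: "ae_on l (\<lambda>x. \<forall>k. \<gamma> k x = \<beta> k x)"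
  shows "Pplus l \<gamma> = proj_on pos_idx" "Pminus l \<gamma> = proj_on (- pos_idx)"
proof -
  have "bvec l \<gamma> k > 0 \<longleftrightarrow> k \<in> pos_idx" for k
    using bb_sgn[of k] by (cases "k \<in> pos_idx") (simp_all add: bvec_def rho_cong_ae[OF ae] bb_def)
  then show P: "Pplus l \<gamma> = proj_on pos_idx" by (simp add: Pplus_def proj_on_def)
  show "Pminus l \<gamma> = proj_on (- pos_idx)"
    unfolding Pminus_def P by (simp add: proj_on_def diag_mat_def mat_def vec_eq_iff)
qed

end

lemma ae_on_finite_sum_cong:
  assumes "\<And>i. ae_on l (\<lambda>x. \<phi> i x = f i x)" "finite F"
  shows "ae_on l (\<lambda>x. (\<Sum>i\<in>F. c i *s \<phi> i x) = (\<Sum>i\<in>F. c i *s f i x))"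
proof -
  have "ae_on l (\<lambda>x. \<forall>i\<in>F. \<phi> i x = f i x)" using assms by (intro eventually_ball_finite) auto
  then show ?thesis by eventually_elim (intro sum.cong, auto)
qed

theorem theorem9p4:
  fixes l :: real
    and \<beta> :: "'n::{finite,linorder} \<Rightarrow> real \<Rightarrow> real"
    and Q :: "real \<Rightarrow> ((complex, 'n) vec, 'n) vec"
    and C D :: "((complex, 'n) vec, 'n) vec"
    and ev :: "'i \<Rightarrow> complex"
    and \<phi> :: "'i \<Rightarrow> real \<Rightarrow> (complex, 'n) vec"
  assumes "l > 0"
    and "admissible_B l \<beta>"
    and "Q absolutely_integrable_on {0..l}"
    and "rank (block_CD C D) = card (UNIV :: 'n set)"
    and "strictly_regular l \<beta> Q C D"
    and "root_vector_system l \<beta> Q C D ev \<phi>"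
  shows "uniformly_minimal l \<beta> \<phi>"
proof -
  obtain \<gamma> b0 B \<theta> where meas: "\<And>k. \<gamma> k \<in> borel_measurable (lebesgue_on {0..l})" and b0: "0 < b0"
    and lo: "\<And>k x. x \<in> {0..l} \<Longrightarrow> b0 \<le> \<bar>\<gamma> k x\<bar>" and hi: "\<And>k x. x \<in> {0..l} \<Longrightarrow> \<bar>\<gamma> k x\<bar> \<le> B"
    and sgn: "\<And>k. (\<forall>x\<in>{0..l}. 0 < \<gamma> k x) \<or> (\<forall>x\<in>{0..l}. \<gamma> k x < 0)" and theta: "0 < \<theta>"
    and gap: "\<And>j k. (\<forall>x\<in>{0..l}. \<gamma> j x = \<gamma> k x) \<or> (\<forall>x\<in>{0..l}. \<theta> \<le> \<bar>\<gamma> j x - \<gamma> k x\<bar>)"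
    and ae: "ae_on l (\<lambda>x. \<forall>k. \<beta> k x = \<gamma> k x)"
  proof (rule admissible_B_normalize[OF assms(1,2)])
    fix \<gamma> b0 B \<theta>
    assume a: "\<And>k. \<gamma> k \<in> borel_measurable (lebesgue_on {0..l})" "0 < b0"
      "\<And>k x. x \<in> {0..l} \<Longrightarrow> b0 \<le> \<bar>\<gamma> k x\<bar>" "\<And>k x. x \<in> {0..l} \<Longrightarrow> \<bar>\<gamma> k x\<bar> \<le> B"
      "\<And>k. (\<forall>x\<in>{0..l}. 0 < \<gamma> k x) \<or> (\<forall>x\<in>{0..l}. \<gamma> k x < 0)" "0 < \<theta>"
      "\<And>j k. (\<forall>x\<in>{0..l}. \<gamma> j x = \<gamma> k x) \<or> (\<forall>x\<in>{0..l}. \<theta> \<le> \<bar>\<gamma> j x - \<gamma> k x\<bar>)"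
      "ae_on l (\<lambda>x. \<forall>k. \<beta> k x = \<gamma> k x)"
    show thesis using a by (rule that)
  qed
  obtain W where W: "W 0 = mat 1" "AC_with_deriv l W (\<lambda>x. - (Qdiag l \<beta> Q x ** W x))"
    and det: "det (C ** Pminus l \<beta> + D ** W l ** Pplus l \<beta>) \<noteq> 0" "det (C ** Pplus l \<beta> + D ** W l ** Pminus l \<beta>) \<noteq> 0"
    and sep: "zeros_asympt_separated (Delta0 l \<beta> C D (W l))"
    using assms(5) unfolding strictly_regular_def is_W_def by (elim exE conjE)
  have beta_eq: "beta_eq l \<beta> j k \<longleftrightarrow> (\<forall>x\<in>{0..l}. \<gamma> j x = \<gamma> k x)" for j k
    by (rule beta_eq_iff[OF assms(1) theta gap ae])
  \<comment> \<open>The analysis runs with the normalised weights \<gamma>; W serves for both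
    because the blocks are the same.\<close>
  interpret bvp l \<gamma> Q C D W b0 B \<theta>
    by (rule bvp.intro[OF assms(1) meas b0 lo hi sgn theta gap assms(3) W(1) W(2)[unfolded Qdiag_def beta_eq]])
  have "\<forall>i. \<exists>f. root_function (ev i) f \<and> ae_on l (\<lambda>x. \<phi> i x = f x)"
  proof
    fix i
    have "\<phi> i \<in> root_space l \<beta> Q C D (ev i)" using assms(6) by (simp add: root_vector_system_def)
    then obtain k where "ker_pow l \<beta> Q C D (ev i) k (\<phi> i)" by (auto simp: root_space_def)
    then show "\<exists>f. root_function (ev i) f \<and> ae_on l (\<lambda>x. \<phi> i x = f x)" by (rule ker_pow_root_function[OF ae])
  qed
  from choice[OF this] obtain f where f: "\<forall>i. root_function (ev i) (f i) \<and> ae_on l (\<lambda>x. \<phi> i x = f i x)" ..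
  have root: "root_function (ev i) (f i)" and phi: "ae_on l (\<lambda>x. \<phi> i x = f i x)" for i using f by simp_all
  have fc: "cont (f i)" for i by (rule root_function_continuous[OF root])
  have ind: "indep I f" if I: "finite I" "I \<subseteq> {i. ev i = lam}" for I lam
    unfolding indep_def
  proof (intro allI impI)
    fix c assume 0: "\<forall>x\<in>{0..l}. (\<Sum>i\<in>I. c i *s f i x) = 0"
    have "ae_on l (\<lambda>x. x \<in> {0..l})" by (rule AE_I2) simp
    with ae_on_finite_sum_cong[of \<phi> f, OF phi I(1), of c]
    have z: "H_zero l (\<lambda>x. \<Sum>i\<in>I. c i *s \<phi> i x)" unfolding H_zero_def by eventually_elim (simp add: 0)
    show "\<forall>i\<in>I. c i = 0"
    \<comment> \<open>Independence is assumed at eigenvalues only, and a member of I shows that lam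
      is one.\<close>
    proof (cases "I = {}")
      case False
      then obtain i where "i \<in> I" by blast
      then have "lam = ev i" using I(2) by auto
      then have "is_eigenvalue l \<beta> Q C D lam" using assms(6) by (simp add: root_vector_system_def)
      then show ?thesis using assms(6) I z unfolding root_vector_system_def by simp
    qed simp
  qed
  have pos: "0 < norm_H (f m)" for m
  proof -
    have "\<exists>\<delta>>0. \<forall>c. \<delta> \<le> norm_H (\<lambda>x. f m x - (\<Sum>i\<in>{}. c i *s f i x))"
      by (rule distance_positive) (simp_all add: fc ind[of "{m}" "ev m"])
    then show ?thesis by auto
  qed
  note P = Pplus_cong_ae[OF ae]
  \<comment> \<open>The determinant depends on the weights only through \<open>rho\<close> at l,
    which ignores null sets.\<close>
  have "Delta0 l \<beta> C D (W l) = D0" by (rule ext) (simp add: Delta0_def Phi0_def rho_cong_ae[OF ae])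
  then have sep': "zeros_asympt_separated D0" using sep by simp
  have "\<exists>\<delta>>0. \<forall>m I c. finite I \<and> m \<notin> I \<longrightarrow> \<delta> * norm_H (f m) \<le> norm_H (\<lambda>x. f m x - (\<Sum>i\<in>I. c i *s f i x))"
  proof (rule core_uniform_minimality[where ev=ev])
    show "root_function (ev i) (f i)" for i by (rule root)
    show "indep I f" if "finite I" "I \<subseteq> {i. ev i = lam}" for I lam using that by (rule ind)
  qed (use det sep' in \<open>simp_all add: P\<close>)
  then obtain \<delta> where d: "\<delta> > 0"
    and core: "\<forall>m I c. finite I \<and> m \<notin> I \<longrightarrow> \<delta> * norm_H (f m) \<le> norm_H (\<lambda>x. f m x - (\<Sum>i\<in>I. c i *s f i x))"
    by (elim exE conjE)
  show ?thesis
    unfolding uniformly_minimal_def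
  proof (intro exI[of _ \<delta>] conjI allI impI)
    fix m :: 'i and F and c :: "'i \<Rightarrow> complex" assume F: "finite F \<and> m \<notin> F"
    define r where "r = norm_H (f m)"
    have r: "r > 0" using pos by (simp add: r_def)
    have Hr: "H_norm l \<beta> (\<phi> m) = r" unfolding r_def by (rule H_norm_eq_norm_H[OF ae phi fc])
    \<comment> \<open>Scaling by r undoes the normalisation of \<open>\<phi> m\<close>, so that the
      homogeneous estimate \<open>core\<close> applies to h.\<close>
    define c' where "c' i = of_real r * c i" for i
    define h where "h x = f m x - (\<Sum>i\<in>F. c' i *s f i x)" for x
    have ch: "cont h" unfolding h_def by (intro continuous_on_diff continuous_on_sum continuous_smult_fun fc)
    have "ae_on l (\<lambda>x. complex_of_real (1 / r) *s \<phi> m x - (\<Sum>k\<in>F. c k *s \<phi> k x) = complex_of_real (1 / r) *s h x)"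
      using phi[of m] ae_on_finite_sum_cong[of \<phi> f, OF phi conjunct1[OF F], of c]
    proof eventually_elim
      case (elim x)
      have "complex_of_real (1 / r) *s (\<Sum>i\<in>F. c' i *s f i x) = (\<Sum>i\<in>F. c i *s f i x)"
        using r by (simp add: c'_def vec_eq_iff sum_distrib_left)
      then show ?case using elim by (simp add: h_def vector_ssub_ldistrib)
    qed
    from H_norm_eq_norm_H[OF ae this continuous_smult_fun[OF ch]]
    have "H_norm l \<beta> (\<lambda>x. complex_of_real (1 / r) *s \<phi> m x - (\<Sum>k\<in>F. c k *s \<phi> k x)) = (1 / r) * norm_H h"
      using r by (simp add: norm_H_smult norm_divide)
    moreover have "\<delta> * r \<le> norm_H h" using core F unfolding h_def r_def by blast
    ultimately show "H_norm l \<beta> (\<lambda>x. complex_of_real (1 / H_norm l \<beta> (\<phi> m)) *s \<phi> m x - (\<Sum>k\<in>F. c k *s \<phi> k x)) \<ge> \<delta>"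
      unfolding Hr using r by (simp add: pos_le_divide_eq)
  qed (rule d)
qed

end
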